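(* Let $H$ be a $v$-noetherian weakly Krull monoid with conductor $\emptyset\ne\mathfrak f=(H:\widehat H)\subsetneq H$ such that $H_{\mathfrak p}$ is finitely primary for each $\mathfrak p\in\mathfrak X(H)$. Let $\mathcal P^*=\{\mathfrak p\in\mathfrak X(H)\mid\mathfrak p\supset\mathfrak f\}$, $\mathcal P=\mathfrak X(H)\setminus\mathcal P^*$, and let $\pi\colon\mathfrak X(\widehat H)\to\mathfrak X(H)$ be the natural map defined by $\pi(\mathfrak P)=\mathfrak P\cap H$ for all $\mathfrak P\in\mathfrak X(\widehat H)$. 1. $\mathcal I_v^*(H)$ has finite elasticity if and only if $\pi$ is bijective. 2. If $\pi$ is bijective and $\widehat H_{\mathfrak p}^{\times}/H_{\mathfrak p}^{\times}$ are torsion groups for all $\mathfrak p\in\mathcal P^*$, then $\mathcal I_v^*(H)$ has accepted elasticity. 3. Suppose that $\mathcal I_v^*(H)$ has accepted elasticity, and let $\mathfrak p_1,\ldots,\mathfrak p_s\in\mathcal P^*$ be the minimal prime ideals with $\rho(H_{\mathfrak p_i})=\rho(\mathcal I_v^*(H))$ for all $i\in[1,s]$, and set $d_i=\min\Delta(H_{\mathfrak p_i})$. Then $$\big\{\gcd\{d_i\mid i\in I\}\ \mid\ \emptyset\ne I\subset[1,s]\big\}=\Delta_{\rho}^*\big(\mathcal I_v^*(H)\big)\subset\Delta_{\rho}\big(\mathcal I_v^*(H)\big)\subset\big\{d\in\mathbb N\mid d\text{ divides some }d'\in\Delta_{\rho}^*\big(\mathcal I_v^*(H)\big)\big\}.$$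 4. Let $G_{\mathcal P}\subset\mathcal C_v(H)$ denote the set of classes containing a minimal prime ideal from $\mathcal P$. Suppose that $\pi$ is bijective, and that $\mathcal C_v(H)$ and $\widehat H^{\times}/H^{\times}$ are both finite. Then $H$ has accepted elasticity, and if $\rho(H)=\rho(G_{\mathcal P})$, then $\Delta_{\rho}(G_{\mathcal P})\subset\Delta_{\rho}(H)$.
   Context: All monoids here are commutative and cancellative. $\mathbb N$ = positive integers, $\mathbb N_0=\mathbb N\cup\{0\}$, $[1,s]=\{1,\ldots,s\}$. For a monoid $H$: $H^\times$ is the unit group, $\mathsf q(H)$ the quotient group. Factorizations: an atom is a non-unit $u$ such that $u=ab$ implies $a\in H^\times$ or $b\in H^\times$; $H$ is atomic if every non-unit is a finite product of atoms. For a non-unit $a$, $\mathsf L_H(a)=\mathsf L(a)$ is the set of all $k\in\mathbb N$ such that $a$ is a product of $k$ atoms; $\mathsf L(a)=\{0\}$ for units; $\mathcal L(H)=\{\mathsf L(a)\mid a\in H\}$. $\rho(L)=\sup L/\min L$ for nonempty $L\subset\mathbb N$, $\rho(\{0\})=1$, $\rho(H)=\sup\{\rho(L)\mid L\in\mathcal L(H)\}$ is the elasticity. $H$ has accepted elasticity if it is atomic, $\rho(H)<\infty$ and $\rho(L)=\rho(H)$ for some $L\in\mathcal L(H)$. For a finite $L=\{m_1<\ldots<m_k\}\subset\mathbb Z$, $\Delta(L)=\{m_i-m_{i-1}\mid 2\le i\le k\}$; for $S\subset H$, $\Delta_H(S)=\bigcup_{a\in S}\Delta(\mathsf L_H(a))$,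 and $\Delta(H)=\Delta_H(H)$. With $[a]=\{a^k\mid k\in\mathbb N_0\}$, $\Delta_\rho^*(H)=\{\min\Delta_H([a])\mid a\in H,\ \rho(\mathsf L(a))=\rho(H)\}$ (only $a$ with $\Delta_H([a])\neq\emptyset$ contribute). $L\subset\mathbb Z$ is an AAP with difference $d\in\mathbb N$ and length $\ell$ if $L=y+(L'\cup\{0,d,\ldots,\ell d\}\cup L'')\subset y+d\mathbb Z$ with $y\in\mathbb Z$, $L'\subset[-M,-1]$, $L''\subset\ell d+[1,M]$ for some $M\in\mathbb N_0$. $\Delta_\rho(H)$ is the set of all $d\in\mathbb N$ such that for every $k\in\mathbb N$ there is $L_k\in\mathcal L(H)$ which is an AAP with difference $d$, length at least $k$, and $\rho(L_k)=\rho(H)$. Ideal theory: an $s$-ideal is a subset $I\subset H$ with $IH=I$; it is prime if $H\setminus I$ is a submonoid of $H$. $\mathfrak X(H)$ is the set of minimal nonempty prime $s$-ideals. For $\mathfrak p\in\mathfrak X(H)$, $H_{\mathfrak p}=(H\setminus\mathfrak p)^{-1}H$. $\widehat H=\{x\in\mathsf q(H)\mid\exists c\in H\ \forall n\in\mathbb N\colon cx^n\in H\}$ is the complete integral closure, $\widehat H_{\mathfrak p}=(H\setminus\mathfrak p)^{-1}\widehat H$, and $(H:\widehat H)=\{x\in\mathsf q(H)\mid x\widehat H\subset H\}$. For $X\subset\mathsf q(H)$ let $X^{-1}=\{x\in\mathsf q(H)\mid xX\subset H\}$ and $X_v=(X^{-1})^{-1}$. A fractional $v$-ideal is a nonempty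 $I\subset\mathsf q(H)$ with $I_v=I$ and $cI\subset H$ for some $c\in H$; it is a $v$-ideal if $I\subset H$. The $v$-product is $(I,J)\mapsto(IJ)_v$; $I$ is $v$-invertible if $(II^{-1})_v=H$. $\mathcal I_v^*(H)$ is the monoid of $v$-invertible $v$-ideals (with $v$-product), $\mathcal F_v(H)^\times$ its quotient group (the group of $v$-invertible fractional $v$-ideals), and $\mathcal C_v(H)=\mathcal F_v(H)^\times/\{xH\mid x\in\mathsf q(H)\}$ is the $v$-class group (written additively). $H$ is $v$-noetherian if it satisfies the ascending chain condition on $v$-ideals. $H$ is weakly Krull if $H=\bigcap_{\mathfrak p\in\mathfrak X(H)}H_{\mathfrak p}$ and $\{\mathfrak p\in\mathfrak X(H)\mid a\in\mathfrak p\}$ is finite for all $a\in H$. (Under the hypotheses of the theorem the $\mathfrak p\in\mathcal P$ are $v$-invertible $v$-ideals, so they have a class in $\mathcal C_v(H)$.) $H$ is finitely primary if there are $s,\alpha\in\mathbb N$ and a factorial monoid $F=F^\times\times\mathcal F(\{p_1,\ldots,p_s\})$ (where $\mathcal F(P)$ is the free abelian monoid with basis $P$) with $H\subset F$ a submonoid, $H\setminus H^\times\subset p_1\cdots p_sF$ and $(p_1\cdots p_s)^\alpha F\subset H$. For a subset $G_0$ of an additive abelian group, $\mathcal B(G_0)=\{g_1\cdots g_\ell\in\mathcal F(G_0)\mid g_1+\ldots+g_\ell=0\}$ is the monoid of zero-sum sequences over $G_0$, and $\rho(G_0):=\rho(\mathcal B(G_0))$, $\Delta_\rho(G_0):=\Delta_\rho(\mathcal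 B(G_0))$.
   Formalization: In part 3 the p_i are only those primes in P* with ρ(H_p)=ρ(I_v^*(H)) for which H_p itself has accepted elasticity and Δ(H_p) is nonempty; without this the first equality fails (a local elasticity may be finite but not accepted) or d_i is undefined. *)

theory Defs
  imports
    "HOL-Algebra.Divisibility"
    "HOL-Algebra.Coset"
    "HOL-Algebra.FiniteProduct"
    "HOL-Library.Multiset"
    "HOL-Library.Extended_Nonnegative_Real"
begin

section \<open>Factorizations in a commutative cancellative monoid\<close>

definition atomic_monoid :: "('a, 'b) monoid_scheme \<Rightarrow> bool" where
  "atomic_monoid M \<longleftrightarrow>
     (\<forall>a \<in> carrier M - Units M. \<exists>us. set us \<subseteq> carrier M \<and> factors M us a)"

text \<open>For a non-unit the list of atoms is automatically nonempty, as the empty product is a unit.\<close>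

definition length_set :: "('a, 'b) monoid_scheme \<Rightarrow> 'a \<Rightarrow> nat set" where
  "length_set M a =
     (if a \<in> Units M then {0}
      else {length us | us. set us \<subseteq> carrier M \<and> factors M us a})"

definition system_of_length_sets :: "('a, 'b) monoid_scheme \<Rightarrow> nat set set" where
  "system_of_length_sets M = length_set M ` carrier M"

text \<open>The supremum is taken in the extended reals, so an unbounded set has elasticity \<open>\<infinity>\<close>.\<close>

definition set_elasticity :: "nat set \<Rightarrow> ennreal" where
  "set_elasticity L = (if L = {0} then 1 else (SUP k\<in>L. of_nat k) / of_nat (Inf L))"

definition elasticity :: "('a, 'b) monoid_scheme \<Rightarrow> ennreal" where
  "elasticity M = (SUP L\<in>{L \<in> system_of_length_sets M. L \<noteq> {}}. set_elasticity L)"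

definition accepted_elasticity :: "('a, 'b) monoid_scheme \<Rightarrow> bool" where
  "accepted_elasticity M \<longleftrightarrow>
     atomic_monoid M \<and> elasticity M < \<infinity> \<and>
     (\<exists>L \<in> system_of_length_sets M. set_elasticity L = elasticity M)"

definition distances :: "nat set \<Rightarrow> nat set" where
  "distances L = {n - m | m n. m \<in> L \<and> n \<in> L \<and> m < n \<and> (\<forall>k\<in>L. \<not> (m < k \<and> k < n))}"

definition distances_of :: "('a, 'b) monoid_scheme \<Rightarrow> 'a set \<Rightarrow> nat set" where
  "distances_of M S = (\<Union>a\<in>S. distances (length_set M a))"

definition powers_of :: "('a, 'b) monoid_scheme \<Rightarrow> 'a \<Rightarrow> 'a set" where
  "powers_of M a = range (\<lambda>k::nat. a [^]\<^bsub>M\<^esub> k)"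

definition Delta_rho_star :: "('a, 'b) monoid_scheme \<Rightarrow> nat set" where
  "Delta_rho_star M =
     {Inf (distances_of M (powers_of M a)) | a.
        a \<in> carrier M \<and> set_elasticity (length_set M a) = elasticity M \<and>
        distances_of M (powers_of M a) \<noteq> {}}"

definition is_AAP :: "nat \<Rightarrow> nat \<Rightarrow> int set \<Rightarrow> bool" where
  "is_AAP d l L \<longleftrightarrow> d > 0 \<and>
     (\<exists>(y::int) (M::nat) L' L''.
        L' \<subseteq> {- int M .. -1} \<and>
        L'' \<subseteq> (\<lambda>i. int (l * d) + i) ` {1 .. int M} \<and>
        L = (\<lambda>i. y + i) ` (L' \<union> (\<lambda>j. int (j * d)) ` {0 .. l} \<union> L'') \<and>
        L \<subseteq> range (\<lambda>z. y + int d * z))"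

definition Delta_rho :: "('a, 'b) monoid_scheme \<Rightarrow> nat set" where
  "Delta_rho M =
     {d. d > 0 \<and>
         (\<forall>k>0. \<exists>L \<in> system_of_length_sets M. \<exists>l\<ge>k.
            is_AAP d l (int ` L) \<and> set_elasticity L = elasticity M)}"


section \<open>Free abelian monoids and zero-sum sequences\<close>

definition free_abelian_monoid :: "'a set \<Rightarrow> 'a multiset monoid" where
  "free_abelian_monoid P = \<lparr>carrier = {S. set_mset S \<subseteq> P}, mult = (+), one = {#}\<rparr>"

definition mset_product :: "('a, 'b) monoid_scheme \<Rightarrow> 'a multiset \<Rightarrow> 'a" where
  "mset_product M S = (\<Otimes>\<^bsub>M\<^esub>g\<in>set_mset S. g [^]\<^bsub>M\<^esub> count S g)"

text \<open>The group is written multiplicatively, so ``sum zero'' reads ``product one''.\<close>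

definition zero_sum_monoid :: "('a, 'b) monoid_scheme \<Rightarrow> 'a set \<Rightarrow> 'a multiset monoid" where
  "zero_sum_monoid G G0 =
     (free_abelian_monoid G0)
       \<lparr>carrier := {S \<in> carrier (free_abelian_monoid G0). mset_product G S = \<one>\<^bsub>G\<^esub>}\<rparr>"


section \<open>Monoids inside their quotient group\<close>

text \<open>
  A commutative cancellative monoid is given as a submonoid \<open>H\<close> of its quotient group \<open>Q\<close>; as a
  monoid in its own right it is \<open>Q\<lparr>carrier := H\<rparr>\<close>.  Up to isomorphism every commutative
  cancellative monoid arises in this way, with \<open>Q\<close> unique.  The localizations and the complete
  integral closure of \<open>H\<close> are again submonoids of \<open>Q\<close> with quotient group \<open>Q\<close>.
\<close>

definition is_quotient_group :: "('a, 'b) monoid_scheme \<Rightarrow> 'a set \<Rightarrow> bool" where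
  "is_quotient_group Q H \<longleftrightarrow>
     comm_group Q \<and> submonoid H Q \<and>
     (\<forall>x \<in> carrier Q. \<exists>a\<in>H. \<exists>b\<in>H. x = a \<otimes>\<^bsub>Q\<^esub> inv\<^bsub>Q\<^esub> b)"

abbreviation submon :: "('a, 'b) monoid_scheme \<Rightarrow> 'a set \<Rightarrow> ('a, 'b) monoid_scheme" where
  "submon Q H \<equiv> Q\<lparr>carrier := H\<rparr>"

text \<open>For \<open>H \<subseteq> K\<close>, the quotient \<open>K\<^sup>\<times>/H\<^sup>\<times>\<close> of the unit groups.\<close>

definition unit_quotient :: "('a, 'b) monoid_scheme \<Rightarrow> 'a set \<Rightarrow> 'a set \<Rightarrow> 'a set monoid" where
  "unit_quotient Q K H = units_of (submon Q K) Mod Units (submon Q H)"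

definition torsion_group :: "('a, 'b) monoid_scheme \<Rightarrow> bool" where
  "torsion_group G \<longleftrightarrow> group G \<and> (\<forall>x \<in> carrier G. \<exists>n::nat. n > 0 \<and> x [^]\<^bsub>G\<^esub> n = \<one>\<^bsub>G\<^esub>)"


subsection \<open>Prime s-ideals, localization, complete integral closure\<close>

definition s_ideal :: "('a, 'b) monoid_scheme \<Rightarrow> 'a set \<Rightarrow> 'a set \<Rightarrow> bool" where
  "s_ideal Q H I \<longleftrightarrow> I \<subseteq> H \<and> I <#>\<^bsub>Q\<^esub> H = I"

definition prime_s_ideal :: "('a, 'b) monoid_scheme \<Rightarrow> 'a set \<Rightarrow> 'a set \<Rightarrow> bool" where
  "prime_s_ideal Q H p \<longleftrightarrow> s_ideal Q H p \<and> submonoid (H - p) (submon Q H)"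

definition minimal_primes :: "('a, 'b) monoid_scheme \<Rightarrow> 'a set \<Rightarrow> 'a set set" where
  "minimal_primes Q H =
     {p. prime_s_ideal Q H p \<and> p \<noteq> {} \<and>
         (\<forall>q. prime_s_ideal Q H q \<and> q \<noteq> {} \<and> q \<subseteq> p \<longrightarrow> q = p)}"

definition localization :: "('a, 'b) monoid_scheme \<Rightarrow> 'a set \<Rightarrow> 'a set \<Rightarrow> 'a set" where
  "localization Q S K = (set_inv\<^bsub>Q\<^esub> S) <#>\<^bsub>Q\<^esub> K"

definition complete_integral_closure :: "('a, 'b) monoid_scheme \<Rightarrow> 'a set \<Rightarrow> 'a set" where
  "complete_integral_closure Q H =
     {x \<in> carrier Q. \<exists>c\<in>H. \<forall>n::nat. n > 0 \<longrightarrow> c \<otimes>\<^bsub>Q\<^esub> (x [^]\<^bsub>Q\<^esub> n) \<in> H}"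

definition colon :: "('a, 'b) monoid_scheme \<Rightarrow> 'a set \<Rightarrow> 'a set \<Rightarrow> 'a set" where
  "colon Q H X = {x \<in> carrier Q. x <#\<^bsub>Q\<^esub> X \<subseteq> H}"

definition conductor :: "('a, 'b) monoid_scheme \<Rightarrow> 'a set \<Rightarrow> 'a set" where
  "conductor Q H = colon Q H (complete_integral_closure Q H)"

definition loc :: "('a, 'b) monoid_scheme \<Rightarrow> 'a set \<Rightarrow> 'a set \<Rightarrow> 'a set" where
  "loc Q H p = localization Q (H - p) H"

definition loc_cic :: "('a, 'b) monoid_scheme \<Rightarrow> 'a set \<Rightarrow> 'a set \<Rightarrow> 'a set" where
  "loc_cic Q H p = localization Q (H - p) (complete_integral_closure Q H)"

definition conductor_primes :: "('a, 'b) monoid_scheme \<Rightarrow> 'a set \<Rightarrow> 'a set set" where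
  "conductor_primes Q H = {p \<in> minimal_primes Q H. conductor Q H \<subseteq> p}"

definition regular_primes :: "('a, 'b) monoid_scheme \<Rightarrow> 'a set \<Rightarrow> 'a set set" where
  "regular_primes Q H = minimal_primes Q H - conductor_primes Q H"


subsection \<open>v-ideals and the v-class group\<close>

definition v_closure :: "('a, 'b) monoid_scheme \<Rightarrow> 'a set \<Rightarrow> 'a set \<Rightarrow> 'a set" where
  "v_closure Q H X = colon Q H (colon Q H X)"

definition fractional_v_ideal :: "('a, 'b) monoid_scheme \<Rightarrow> 'a set \<Rightarrow> 'a set \<Rightarrow> bool" where
  "fractional_v_ideal Q H I \<longleftrightarrow>
     I \<noteq> {} \<and> I \<subseteq> carrier Q \<and> v_closure Q H I = I \<and> (\<exists>c\<in>H. c <#\<^bsub>Q\<^esub> I \<subseteq> H)"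

definition v_ideal :: "('a, 'b) monoid_scheme \<Rightarrow> 'a set \<Rightarrow> 'a set \<Rightarrow> bool" where
  "v_ideal Q H I \<longleftrightarrow> fractional_v_ideal Q H I \<and> I \<subseteq> H"

definition v_invertible :: "('a, 'b) monoid_scheme \<Rightarrow> 'a set \<Rightarrow> 'a set \<Rightarrow> bool" where
  "v_invertible Q H I \<longleftrightarrow> v_closure Q H (I <#>\<^bsub>Q\<^esub> colon Q H I) = H"

definition v_noetherian :: "('a, 'b) monoid_scheme \<Rightarrow> 'a set \<Rightarrow> bool" where
  "v_noetherian Q H \<longleftrightarrow>
     (\<forall>I :: nat \<Rightarrow> 'a set. (\<forall>n. v_ideal Q H (I n)) \<and> (\<forall>n. I n \<subseteq> I (Suc n))
        \<longrightarrow> (\<exists>N. \<forall>n\<ge>N. I n = I N))"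

definition v_invertible_fractional_ideals ::
  "('a, 'b) monoid_scheme \<Rightarrow> 'a set \<Rightarrow> 'a set monoid" where
  "v_invertible_fractional_ideals Q H =
     \<lparr>carrier = {I. fractional_v_ideal Q H I \<and> v_invertible Q H I},
      mult = (\<lambda>I J. v_closure Q H (I <#>\<^bsub>Q\<^esub> J)),
      one = H\<rparr>"

definition v_invertible_ideals ::
  "('a, 'b) monoid_scheme \<Rightarrow> 'a set \<Rightarrow> 'a set monoid" where
  "v_invertible_ideals Q H =
     (v_invertible_fractional_ideals Q H)\<lparr>carrier := {I. v_ideal Q H I \<and> v_invertible Q H I}\<rparr>"

definition v_class_group :: "('a, 'b) monoid_scheme \<Rightarrow> 'a set \<Rightarrow> 'a set set monoid" where
  "v_class_group Q H =
     v_invertible_fractional_ideals Q H Mod {x <#\<^bsub>Q\<^esub> H | x. x \<in> carrier Q}"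

definition regular_prime_classes :: "('a, 'b) monoid_scheme \<Rightarrow> 'a set \<Rightarrow> 'a set set set" where
  "regular_prime_classes Q H =
     {g \<in> carrier (v_class_group Q H). \<exists>p \<in> regular_primes Q H. p \<in> g}"


subsection \<open>Weakly Krull and finitely primary monoids\<close>

definition weakly_Krull :: "('a, 'b) monoid_scheme \<Rightarrow> 'a set \<Rightarrow> bool" where
  "weakly_Krull Q H \<longleftrightarrow>
     H = carrier Q \<inter> (\<Inter>p \<in> minimal_primes Q H. loc Q H p) \<and>
     (\<forall>a\<in>H. finite {p \<in> minimal_primes Q H. a \<in> p})"

text \<open>
  The factorial monoid \<open>F\<close> may be taken inside the quotient group \<open>Q\<close> of \<open>H\<close>:
  if \<open>q\<close> denotes the product of the primes, then \<open>q\<^sup>\<alpha> F \<subseteq> H\<close> gives \<open>F \<subseteq> q\<^sup>-\<^sup>\<alpha> H\<close>.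
  The set \<open>P\<close> is the set of the primes, and the rank \<open>s\<close> is its cardinality.
\<close>

definition finitely_primary :: "('a, 'b) monoid_scheme \<Rightarrow> 'a set \<Rightarrow> bool" where
  "finitely_primary Q H \<longleftrightarrow>
     (\<exists>F P (\<alpha>::nat). \<alpha> > 0 \<and> submonoid F Q \<and> finite P \<and> P \<noteq> {} \<and> P \<subseteq> F \<and>
        (\<lambda>(\<epsilon>, S). \<epsilon> \<otimes>\<^bsub>Q\<^esub> mset_product Q S)
          \<in> iso (units_of (submon Q F) \<times>\<times> free_abelian_monoid P) (submon Q F) \<and>
        submonoid H (submon Q F) \<and>
        H - Units (submon Q H) \<subseteq> (\<Otimes>\<^bsub>Q\<^esub>p\<in>P. p) <#\<^bsub>Q\<^esub> F \<and>
        ((\<Otimes>\<^bsub>Q\<^esub>p\<in>P. p) [^]\<^bsub>Q\<^esub> \<alpha>) <#\<^bsub>Q\<^esub> F \<subseteq> H)"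


subsection \<open>The primes at which the elasticity is attained\<close>

text \<open>
  The primes \<open>p\<^sub>1, \<dots>, p\<^sub>s\<close> containing the conductor whose localizations have the elasticity of the
  monoid of v-invertible v-ideals, this elasticity being accepted by the localization.  Without the
  latter, the formula for \<open>Delta_rho_star\<close> fails: a v-noetherian finitely primary monoid of rank one
  with infinite unit group may have finite elasticity that is not accepted, and such a component
  does not contribute to \<open>Delta_rho_star\<close>.  (Example: let \<open>a\<^sub>i > 0\<close> grow rapidly and put
  \<open>A = {a\<^sub>i | i \<ge> 0}\<close>, \<open>B = {- i - a\<^sub>i | i \<ge> 0}\<close>.  In \<open>\<nat> \<times> \<int>\<close> take
  the submonoid whose elements of first coordinate \<open>0, 1, 2, 3, 4\<close> have second coordinate in
  \<open>{0}\<close>, \<open>{0}\<close>, \<open>{0} \<union> A\<close>, \<open>{0} \<union> A \<union> B\<close>, \<open>{0} \<union> A \<union> B \<union> (A + A)\<close>, respectively, and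
  are unrestricted for first coordinate at least 5.  Its elasticity 5 is not accepted: the only atom
  with first coordinate 1 is \<open>(1, 0)\<close>, while the atoms with first coordinate 5, the largest
  possible, all have positive second coordinate.)
  The condition holds whenever the unit quotient at \<open>p\<close> is torsion.  The
  nonemptiness condition says that \<open>d\<^sub>i = min \<Delta>\<close> exists; it is automatic if the elasticity
  is greater than 1.
\<close>

definition extremal_primes :: "('a, 'b) monoid_scheme \<Rightarrow> 'a set \<Rightarrow> 'a set set" where
  "extremal_primes Q H =
     {p \<in> conductor_primes Q H.
        elasticity (submon Q (loc Q H p)) = elasticity (v_invertible_ideals Q H) \<and>
        accepted_elasticity (submon Q (loc Q H p)) \<and>
        distances_of (submon Q (loc Q H p)) (loc Q H p) \<noteq> {}}"

definition min_distance :: "('a, 'b) monoid_scheme \<Rightarrow> nat" where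
  "min_distance M = Inf (distances_of M (carrier M))"

end

theory Submission
  imports Defs
begin

text \<open>
  Everything is computed inside the quotient group \<open>Q\<close>. The proof replaces each monoid by its
  localizations at the minimal primes.

  The local structure. The valuations at the primes of the factorial monoid around a finitely primary
  monoid \<open>D\<close> determine it up to bounded error: a non-unit of \<open>D\<close> has positive valuation everywhere, and
  all elements of large valuation lie in \<open>D\<close> (locale \<open>primary_valuations\<close>). With at least two
  primes the elasticity is infinite (\<open>infinite_elasticity\<close>); with one prime a length lies between
  two fixed multiples of the valuation (\<open>rank_one_bounded\<close>), and the best constants are attained if
  the unit quotient is torsion (\<open>rank_one_torsion_accepted\<close>).

  From local to global. Any two minimal primes are separated by an element, and powers of such elements give
  an approximation theorem (\<open>approximation\<close>). It identifies the v-invertible fractional ideals with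
  families of local generators modulo local units (\<open>Frac_eq_ideal\<close>, \<open>ideal_eq_iff\<close>), so the
  monoid of v-invertible v-ideals is a coproduct of the reduced localizations, and its sets of lengths are
  sums of local ones (\<open>length_set_M\<close>). It also describes the complete integral closure and its minimal
  primes by the local valuations, so that contraction of primes is bijective if and only if every
  localization has one prime (\<open>contraction_bij_iff\<close>). Outside the finitely many primes that contain the
  conductor the localizations are discrete valuation monoids (\<open>regular_discrete\<close>). This gives the
  first two assertions.

  For the third assertion, an ideal attains the elasticity if and only if all its non-trivial local components do.
  The minimal distance in the powers of an element is the greatest common divisor of all length differences that
  occur (\<open>Inf_distances\<close>). For an ideal it is therefore the greatest common divisor of the local minimal
  distances over its support, where the powers of a single local non-unit already see all differences because
  every element divides one of them (\<open>gap_dvd_powers\<close>). Powers of an ideal then have long AAPs as sets of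
  lengths, and conversely a long AAP forces one local component to have large valuation, hence to be divisible
  by an element showing the local minimal distance.

  For the last assertion, an element of \<open>H\<close> factors according to its shape: its components at the primes
  containing the conductor and, for each class, the number of its regular prime divisors in that class
  (\<open>split_by_shape\<close>). So replacing regular primes by chosen representatives of their classes preserves
  sets of lengths, and so does replacing them by their classes when the other components are trivial
  (\<open>length_set_zero_sum\<close>). The submonoid over the representatives involves finitely many primes and
  finitely many local unit classes, hence has finitely many atoms up to units by Dickson's lemma
  (\<open>finitely_many_atoms_H'\<close>); a second use of Dickson's lemma, for pairs of factorizations, shows that
  its elasticity is accepted (\<open>accepted_elasticity_of_finitely_many_atoms\<close>).
\<close>

section \<open>Sets of lengths in cancellative monoids\<close>

context comm_monoid_cancel
begin

lemma irreducible_iff_split: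
  assumes "a \<in> carrier G"
  shows "irreducible G a \<longleftrightarrow> a \<notin> Units G \<and>
    (\<forall>b\<in>carrier G. \<forall>c\<in>carrier G. a = b \<otimes> c \<longrightarrow> b \<in> Units G \<or> c \<in> Units G)"
proof
  assume irr: "irreducible G a"
  show "a \<notin> Units G \<and>
    (\<forall>b\<in>carrier G. \<forall>c\<in>carrier G. a = b \<otimes> c \<longrightarrow> b \<in> Units G \<or> c \<in> Units G)"
  proof (intro conjI ballI impI)
    show "a \<notin> Units G" using irr by (auto simp: irreducible_def)
    fix b c assume bc: "b \<in> carrier G" "c \<in> carrier G" "a = b \<otimes> c"
    show "b \<in> Units G \<or> c \<in> Units G"
    proof (cases "properfactor G b a")
      case True
      then show ?thesis using irr bc by (auto simp: irreducible_def)
    next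
      case False
      then have "a divides b" using bc by (auto simp: properfactor_def)
      then obtain d where d: "d \<in> carrier G" "b = a \<otimes> d" by (auto simp: factor_def)
      then have "b \<otimes> \<one> = b \<otimes> (c \<otimes> d)" using bc by (simp add: m_assoc)
      then have "c \<otimes> d = \<one>" using bc d by (metis l_cancel m_closed one_closed)
      then show ?thesis using bc(2) d(1) unit_factor[of c d] by (metis Units_one_closed)
    qed
  qed
next
  assume r: "a \<notin> Units G \<and>
    (\<forall>b\<in>carrier G. \<forall>c\<in>carrier G. a = b \<otimes> c \<longrightarrow> b \<in> Units G \<or> c \<in> Units G)"
  show "irreducible G a" unfolding irreducible_def
  proof (intro conjI ballI impI)
    show "a \<notin> Units G" using r by blast
    fix b assume b: "b \<in> carrier G" "properfactor G b a"
    then obtain c where c: "c \<in> carrier G" "a = b \<otimes> c" by (auto simp: properfactor_def factor_def)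
    show "b \<in> Units G"
    proof (rule ccontr)
      assume "b \<notin> Units G"
      then have cu: "c \<in> Units G" using r b c by blast
      then have "b = a \<otimes> inv c" using b c by (simp add: m_assoc)
      then show False using b cu by (auto simp: properfactor_def factor_def)
    qed
  qed
qed

lemma length_set_eq_factors:
  assumes "a \<in> carrier G"
  shows "length_set G a = (if a \<in> Units G then {0}
    else {length us |us. set us \<subseteq> carrier G \<and> (\<forall>u\<in>set us. irreducible G u) \<and> foldr (\<otimes>) us \<one> = a})"
  by (auto simp: length_set_def factors_def)

lemma zero_in_length_set [simp]:
  assumes "a \<in> carrier G"
  shows "0 \<in> length_set G a \<longleftrightarrow> a \<in> Units G"
  using assms by (auto simp: length_set_eq_factors)

lemma length_set_Unit: "a \<in> Units G \<Longrightarrow> length_set G a = {0}"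
  by (simp add: length_set_def)

lemma irreducible_mult_not_Unit:
  assumes "irreducible G u" "u \<in> carrier G" "y \<in> carrier G"
  shows "u \<otimes> y \<notin> Units G"
  using assms unit_factor[of u y] by (auto simp: irreducible_def)

lemma Unit_mult_irreducible:
  assumes "irreducible G u" "u \<in> carrier G" "y \<in> Units G"
  shows "irreducible G (u \<otimes> y)"
  using assms by (intro irreducible_prod_rI) auto

text \<open>This recursion determines all sets of lengths, so they can be handled by induction on the
  length without mentioning lists of atoms.\<close>

lemma Suc_in_length_set:
  assumes a: "a \<in> carrier G"
  shows "Suc n \<in> length_set G a \<longleftrightarrow>
    (\<exists>u y. u \<in> carrier G \<and> y \<in> carrier G \<and> irreducible G u \<and> n \<in> length_set G y \<and> a = u \<otimes> y)"
    (is "?L = ?R")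
proof
  assume ?L
  then obtain us where us: "set us \<subseteq> carrier G" "\<forall>u\<in>set us. irreducible G u"
      "foldr (\<otimes>) us \<one> = a" "length us = Suc n"
    using a by (auto simp: length_set_eq_factors split: if_splits)
  then obtain u vs where vs: "us = u # vs" "length vs = n" by (cases us) auto
  define y where "y = foldr (\<otimes>) vs \<one>"
  have y: "y \<in> carrier G" using us vs by (auto simp: y_def intro!: multlist_closed)
  have "n \<in> length_set G y"
  proof (cases vs)
    case Nil
    then show ?thesis using vs by (simp add: y_def)
  next
    case (Cons w ws)
    then have "y \<notin> Units G" using us vs irreducible_mult_not_Unit[of w "foldr (\<otimes>) ws \<one>"]
      by (auto simp: y_def intro!: multlist_closed)
    then show ?thesis using y us vs by (auto simp: length_set_eq_factors y_def)
  qed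
  then show ?R using us vs y by (auto simp: y_def)
next
  assume ?R
  then obtain u y where uy: "u \<in> carrier G" "y \<in> carrier G" "irreducible G u"
    "n \<in> length_set G y" "a = u \<otimes> y" by auto
  have nu: "a \<notin> Units G" using irreducible_mult_not_Unit uy by auto
  have "\<exists>us. set us \<subseteq> carrier G \<and> (\<forall>u\<in>set us. irreducible G u) \<and> foldr (\<otimes>) us \<one> = a \<and> length us = Suc n"
  proof (cases "y \<in> Units G")
    case True
    then have "n = 0" using uy by (simp add: length_set_Unit)
    then show ?thesis using uy True Unit_mult_irreducible[of u y] by (intro exI[of _ "[a]"]) auto
  next
    case False
    then obtain us where "set us \<subseteq> carrier G" "\<forall>u\<in>set us. irreducible G u"
      "foldr (\<otimes>) us \<one> = y" "length us = n" using uy by (auto simp: length_set_eq_factors)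
    then show ?thesis using uy by (intro exI[of _ "u # us"]) auto
  qed
  then show ?L using nu a by (auto simp: length_set_eq_factors) metis
qed

lemma length_set_add:
  assumes "a \<in> carrier G" "b \<in> carrier G" "m \<in> length_set G a" "n \<in> length_set G b"
  shows "m + n \<in> length_set G (a \<otimes> b)"
  using assms
proof (induction m arbitrary: a)
  case 0
  then have au: "a \<in> Units G" by simp
  show ?case
  proof (cases n)
    case 0
    then show ?thesis using au "0.prems" by auto
  next
    case (Suc k)
    then obtain u y where "u \<in> carrier G" "y \<in> carrier G" "irreducible G u"
      "k \<in> length_set G y" "b = u \<otimes> y" using "0.prems" Suc_in_length_set by blast
    moreover have "a \<in> carrier G" using au by blast
    moreover have "a \<otimes> (u \<otimes> y) = u \<otimes> a \<otimes> y" using calculation by (simp add: m_ac)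
    ultimately have "Suc k \<in> length_set G (a \<otimes> b)"
      using au Unit_mult_irreducible[of u a] "0.prems" by (subst Suc_in_length_set) auto
    then show ?thesis using Suc by simp
  qed
next
  case (Suc m)
  obtain u y where "u \<in> carrier G" "y \<in> carrier G" "irreducible G u"
      "m \<in> length_set G y" "a = u \<otimes> y"
    using Suc_in_length_set[OF Suc.prems(1)] Suc.prems(3) by blast
  moreover have "m + n \<in> length_set G (y \<otimes> b)" by (rule Suc.IH[OF calculation(2) Suc.prems(2) calculation(4) Suc.prems(4)])
  moreover have "a \<otimes> b = u \<otimes> (y \<otimes> b)" using calculation Suc.prems by (simp add: m_assoc)
  ultimately have "Suc (m + n) \<in> length_set G (a \<otimes> b)"
    using Suc.prems by (subst Suc_in_length_set) auto
  then show ?case by simp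
qed

lemma length_set_mult_Unit:
  assumes "a \<in> carrier G" "e \<in> Units G"
  shows "length_set G (a \<otimes> e) = length_set G a"
proof -
  have *: "length_set G b \<subseteq> length_set G (b \<otimes> f)" if "b \<in> carrier G" "f \<in> Units G" for b f
    using length_set_add[of b f _ 0] that by auto
  have "a \<otimes> e \<otimes> inv e = a" using assms m_assoc[of a e "inv e"] Units_r_inv by auto
  then show ?thesis using *[of a e] *[of "a \<otimes> e" "inv e"] assms by auto
qed

lemma length_set_pow:
  assumes "a \<in> carrier G" "m \<in> length_set G a"
  shows "k * m \<in> length_set G (a [^] (k::nat))"
proof (induction k)
  case (Suc k)
  then show ?case using length_set_add[of "a [^] k" a "k * m" m] assms by (simp add: add.commute)
qed simp

lemma length_set_nonempty_or_zero:
  assumes "a \<in> carrier G"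
  shows "length_set G a = {0} \<or> 0 \<notin> length_set G a"
  using assms by (auto simp: length_set_Unit)

lemma length_set_eq_zero_iff:
  assumes "a \<in> carrier G"
  shows "length_set G a = {0} \<longleftrightarrow> a \<in> Units G"
  using assms by (metis insertI1 length_set_Unit zero_in_length_set)

lemma one_in_length_set:
  assumes "u \<in> carrier G" "irreducible G u"
  shows "1 \<in> length_set G u"
  using assms Suc_in_length_set[of u 0] r_one[of u] by (metis One_nat_def Units_one_closed one_closed zero_in_length_set)

lemma atomic_monoid_iff: "atomic_monoid G \<longleftrightarrow> (\<forall>a\<in>carrier G. length_set G a \<noteq> {})"
  by (auto simp: atomic_monoid_def length_set_def)

lemma length_set_nonempty_by_size:
  fixes sz :: "'a \<Rightarrow> nat"
  assumes unit: "\<And>a. a \<in> carrier G \<Longrightarrow> sz a = 0 \<Longrightarrow> a \<in> Units G"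
    and add: "\<And>a b. a \<in> carrier G \<Longrightarrow> b \<in> carrier G \<Longrightarrow> a \<notin> Units G \<Longrightarrow> b \<notin> Units G \<Longrightarrow> sz a < sz (a \<otimes> b)"
    and a: "a \<in> carrier G"
  shows "length_set G a \<noteq> {}"
  using a
proof (induction "sz a" arbitrary: a rule: less_induct)
  case less
  show ?case
  proof (cases "a \<in> Units G \<or> irreducible G a")
    case True
    then show ?thesis using less.prems one_in_length_set by (auto simp: length_set_Unit)
  next
    case False
    then obtain b c where bc: "b \<in> carrier G" "c \<in> carrier G" "a = b \<otimes> c" "b \<notin> Units G" "c \<notin> Units G"
      using irreducible_iff_split less.prems by blast
    then have "sz b < sz a" "sz c < sz a" using add[of b c] add[of c b] m_comm by auto
    then show ?thesis using less.hyps[of b] less.hyps[of c] bc length_set_add[of b c] by blast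
  qed
qed

end

lemma irreducible_transfer:
  assumes A: "comm_monoid_cancel A" and B: "comm_monoid_cancel B"
    and R: "R a b" and car: "a \<in> carrier A" "b \<in> carrier B"
    and unit: "\<And>a b. R a b \<Longrightarrow> a \<in> carrier A \<Longrightarrow> b \<in> carrier B \<Longrightarrow> a \<in> Units A \<longleftrightarrow> b \<in> Units B"
    and lift: "\<And>a b b1 b2. R a b \<Longrightarrow> a \<in> carrier A \<Longrightarrow> b1 \<in> carrier B \<Longrightarrow> b2 \<in> carrier B \<Longrightarrow> b = b1 \<otimes>\<^bsub>B\<^esub> b2 \<Longrightarrow>
      \<exists>a1\<in>carrier A. \<exists>a2\<in>carrier A. a = a1 \<otimes>\<^bsub>A\<^esub> a2 \<and> R a1 b1 \<and> R a2 b2"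
    and irr: "irreducible A a"
  shows "irreducible B b"
proof -
  interpret A: comm_monoid_cancel A by fact
  interpret B: comm_monoid_cancel B by fact
  show ?thesis unfolding B.irreducible_iff_split[OF car(2)]
  proof (intro conjI ballI impI)
    show "b \<notin> Units B" using irr unit[OF R car] by (auto simp: irreducible_def)
    fix b1 b2 assume b: "b1 \<in> carrier B" "b2 \<in> carrier B" "b = b1 \<otimes>\<^bsub>B\<^esub> b2"
    then obtain a1 a2 where a: "a1 \<in> carrier A" "a2 \<in> carrier A" "a = a1 \<otimes>\<^bsub>A\<^esub> a2" "R a1 b1" "R a2 b2"
      using lift[OF R car(1)] by blast
    then have "a1 \<in> Units A \<or> a2 \<in> Units A" using irr A.irreducible_iff_split[OF car(1)] by blast
    then show "b1 \<in> Units B \<or> b2 \<in> Units B" using unit[of a1 b1] unit[of a2 b2] a b by blast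
  qed
qed

lemma length_set_transfer_subset:
  assumes A: "comm_monoid_cancel A" and B: "comm_monoid_cancel B"
    and R: "R a b" and car: "a \<in> carrier A" "b \<in> carrier B"
    and unit: "\<And>a b. R a b \<Longrightarrow> a \<in> carrier A \<Longrightarrow> b \<in> carrier B \<Longrightarrow> a \<in> Units A \<longleftrightarrow> b \<in> Units B"
    and lift: "\<And>a b b1 b2. R a b \<Longrightarrow> a \<in> carrier A \<Longrightarrow> b1 \<in> carrier B \<Longrightarrow> b2 \<in> carrier B \<Longrightarrow> b = b1 \<otimes>\<^bsub>B\<^esub> b2 \<Longrightarrow>
      \<exists>a1\<in>carrier A. \<exists>a2\<in>carrier A. a = a1 \<otimes>\<^bsub>A\<^esub> a2 \<and> R a1 b1 \<and> R a2 b2"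
    and split: "\<And>a b a1 a2. R a b \<Longrightarrow> b \<in> carrier B \<Longrightarrow> a1 \<in> carrier A \<Longrightarrow> a2 \<in> carrier A \<Longrightarrow> a = a1 \<otimes>\<^bsub>A\<^esub> a2 \<Longrightarrow>
      \<exists>b1\<in>carrier B. \<exists>b2\<in>carrier B. b = b1 \<otimes>\<^bsub>B\<^esub> b2 \<and> R a1 b1 \<and> R a2 b2"
    and n: "n \<in> length_set A a"
  shows "n \<in> length_set B b"
  using n R car
proof (induction n arbitrary: a b)
  interpret A: comm_monoid_cancel A by fact
  interpret B: comm_monoid_cancel B by fact
  case 0
  then show ?case using unit by auto
next
  interpret A: comm_monoid_cancel A by fact
  interpret B: comm_monoid_cancel B by fact
  case (Suc n)
  obtain u y where uy: "u \<in> carrier A" "y \<in> carrier A" "irreducible A u"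
    "n \<in> length_set A y" "a = u \<otimes>\<^bsub>A\<^esub> y"
    using A.Suc_in_length_set[OF Suc.prems(3)] Suc.prems(1) by blast
  then obtain b1 b2 where b: "b1 \<in> carrier B" "b2 \<in> carrier B" "b = b1 \<otimes>\<^bsub>B\<^esub> b2" "R u b1" "R y b2"
    using split[OF Suc.prems(2,4) uy(1,2,5)] by blast
  have "irreducible B b1"
    by (rule irreducible_transfer[where R = R and A = A and B = B, OF A B b(4) uy(1) b(1) unit lift uy(3)])
  then show ?case using b Suc.IH[OF uy(4) b(5) uy(2) b(2)] B.Suc_in_length_set[OF Suc.prems(4)] by metis
qed

text \<open>A relation that can be split on either side along products and that detects units preserves
  sets of lengths: this is the symmetric form of a transfer homomorphism.  Being a relation, it need
  not be multiplicative and needs no choice of representatives.\<close>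

lemma length_set_transfer:
  assumes "comm_monoid_cancel A" and "comm_monoid_cancel B"
    and "R a b" and "a \<in> carrier A" "b \<in> carrier B"
    and unit: "\<And>a b. R a b \<Longrightarrow> a \<in> carrier A \<Longrightarrow> b \<in> carrier B \<Longrightarrow> a \<in> Units A \<longleftrightarrow> b \<in> Units B"
    and lift: "\<And>a b b1 b2. R a b \<Longrightarrow> a \<in> carrier A \<Longrightarrow> b1 \<in> carrier B \<Longrightarrow> b2 \<in> carrier B \<Longrightarrow> b = b1 \<otimes>\<^bsub>B\<^esub> b2 \<Longrightarrow>
      \<exists>a1\<in>carrier A. \<exists>a2\<in>carrier A. a = a1 \<otimes>\<^bsub>A\<^esub> a2 \<and> R a1 b1 \<and> R a2 b2"
    and split: "\<And>a b a1 a2. R a b \<Longrightarrow> b \<in> carrier B \<Longrightarrow> a1 \<in> carrier A \<Longrightarrow> a2 \<in> carrier A \<Longrightarrow> a = a1 \<otimes>\<^bsub>A\<^esub> a2 \<Longrightarrow>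
      \<exists>b1\<in>carrier B. \<exists>b2\<in>carrier B. b = b1 \<otimes>\<^bsub>B\<^esub> b2 \<and> R a1 b1 \<and> R a2 b2"
  shows "length_set A a = length_set B b"
proof (intro equalityI subsetI)
  fix n assume n: "n \<in> length_set A a"
  show "n \<in> length_set B b"
    by (rule length_set_transfer_subset[where R = R and A = A and B = B, OF assms(1-5)])
      (rule unit lift split n | assumption)+
next
  fix n assume n: "n \<in> length_set B b"
  show "n \<in> length_set A a"
    by (rule length_set_transfer_subset[where R = "\<lambda>b a. R a b" and A = B and B = A, OF assms(2,1,3,5,4)])
      (rule unit[symmetric] lift split n | assumption)+
qed

section \<open>Elasticities and distances of sets of natural numbers\<close>

text \<open>Ratios of lengths are compared by cross-multiplication in the reals. In this form no division by
  zero occurs, and infinite sets of lengths are covered as well.\<close>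

definition ratio_bounded :: "real \<Rightarrow> nat set \<Rightarrow> bool" where
  "ratio_bounded r L \<longleftrightarrow> (\<forall>m\<in>L. \<forall>n\<in>L. real m \<le> r * real n)"

definition ratio_attained :: "real \<Rightarrow> nat set \<Rightarrow> bool" where
  "ratio_attained r L \<longleftrightarrow> (\<exists>m\<in>L. \<exists>n\<in>L. 0 < n \<and> real m = r * real n)"

lemma ratio_attainedI:
  "m \<in> L \<Longrightarrow> n \<in> L \<Longrightarrow> 0 < n \<Longrightarrow> real m = r * real n \<Longrightarrow> ratio_attained r L"
  unfolding ratio_attained_def by blast

lemma set_elasticity_eq_SUP:
  assumes "L \<noteq> {}" "0 \<notin> L"
  shows "set_elasticity L = (SUP k\<in>L. ennreal (real k / real (Inf L)))"
proof -
  have "Inf L \<in> L" using assms by (simp add: Inf_nat_def1)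
  then have pos: "0 < Inf L" using assms by (metis neq0_conv)
  have "L \<noteq> {0}" using assms by auto
  then have "set_elasticity L = (SUP k\<in>L. of_nat k / of_nat (Inf L))"
    using assms by (simp add: set_elasticity_def SUP_divide_ennreal)
  also have "\<dots> = (SUP k\<in>L. ennreal (real k / real (Inf L)))"
    using pos by (intro SUP_cong refl) (simp add: ennreal_of_nat_eq_real_of_nat divide_ennreal)
  finally show ?thesis .
qed

lemma set_elasticity_le_iff:
  assumes "L \<noteq> {}" "L = {0} \<or> 0 \<notin> L" "1 \<le> r"
  shows "set_elasticity L \<le> ennreal r \<longleftrightarrow> ratio_bounded r L"
proof (cases "L = {0}")
  case True
  then show ?thesis using assms by (simp add: set_elasticity_def ratio_bounded_def)
next
  case False
  then have z: "0 \<notin> L" using assms by auto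
  have i: "Inf L \<in> L" using assms by (simp add: Inf_nat_def1)
  then have pos: "0 < Inf L" using z by (metis neq0_conv)
  have "set_elasticity L \<le> ennreal r \<longleftrightarrow> (\<forall>k\<in>L. real k \<le> r * real (Inf L))"
    using assms pos by (simp add: set_elasticity_eq_SUP z SUP_le_iff divide_le_eq)
  also have "\<dots> \<longleftrightarrow> ratio_bounded r L"
    unfolding ratio_bounded_def
  proof (intro iffI ballI)
    fix m n assume a: "\<forall>k\<in>L. real k \<le> r * real (Inf L)" "m \<in> L" "n \<in> L"
    then have "Inf L \<le> n" by (simp add: wellorder_Inf_le1)
    then have "r * real (Inf L) \<le> r * real n" using assms by (intro mult_left_mono) auto
    then show "real m \<le> r * real n" using a by fastforce
  qed (use i in auto)
  finally show ?thesis .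
qed

lemma ratio_bounded_finite:
  assumes "ratio_bounded r L"
  shows "finite L"
proof (cases "L = {}")
  case False
  then obtain n where n: "n \<in> L" by auto
  have "k \<le> nat \<lceil>r * real n\<rceil>" if "k \<in> L" for k
  proof -
    have "real k \<le> r * real n" using assms n that by (auto simp: ratio_bounded_def)
    then show ?thesis by linarith
  qed
  then have "L \<subseteq> {..nat \<lceil>r * real n\<rceil>}" by auto
  then show ?thesis using finite_subset by blast
qed auto

text \<open>A bound on the ratios forces the set to be finite, so a finite elasticity is the ratio of two
  actual lengths. The set \<open>{0}\<close> of lengths of a unit is the only one whose elasticity is a
  convention.\<close>

lemma set_elasticity_eq_iff:
  assumes L: "L \<noteq> {}" "L = {0} \<or> 0 \<notin> L" "1 \<le> r"
  shows "set_elasticity L = ennreal r \<longleftrightarrow>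
    ratio_bounded r L \<and> (if L = {0} then r = 1 else ratio_attained r L)"
proof (cases "L = {0}")
  case True
  then show ?thesis using assms
    by (auto simp: set_elasticity_def ratio_bounded_def simp flip: ennreal_1)
next
  case False
  then have z: "0 \<notin> L" using assms by auto
  show ?thesis
  proof
    assume e: "set_elasticity L = ennreal r"
    then have b: "ratio_bounded r L" using set_elasticity_le_iff[OF assms] by simp
    then have f: "finite L" by (rule ratio_bounded_finite)
    define s where "s = real (Max L) / real (Min L)"
    have m: "Min L \<in> L" "Max L \<in> L" using f L by auto
    then have pos: "0 < Min L" using z by (metis neq0_conv)
    have "Min L \<le> Max L" using f L by simp
    then have s1: "1 \<le> s" using pos by (simp add: s_def)
    have "ratio_bounded s L" unfolding ratio_bounded_def
    proof (intro ballI)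
      fix k n assume "k \<in> L" "n \<in> L"
      then have "k \<le> Max L" "Min L \<le> n" using f by auto
      then have "real k * real (Min L) \<le> real (Max L) * real n" by (intro mult_mono) auto
      then show "real k \<le> s * real n" using pos by (simp add: s_def field_simps)
    qed
    then have "set_elasticity L \<le> ennreal s" using set_elasticity_le_iff[OF L(1,2) s1] by simp
    then have "r \<le> s" using e s1 by (simp add: ennreal_le_iff)
    then have "r * real (Min L) \<le> real (Max L)" using pos by (simp add: s_def field_simps)
    moreover have "real (Max L) \<le> r * real (Min L)" using b m by (auto simp: ratio_bounded_def)
    ultimately show "ratio_bounded r L \<and> (if L = {0} then r = 1 else ratio_attained r L)"
      using b m pos False unfolding ratio_attained_def by (metis order_antisym)
  next
    assume a: "ratio_bounded r L \<and> (if L = {0} then r = 1 else ratio_attained r L)"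
    then obtain m n where mn: "m \<in> L" "n \<in> L" "0 < n" "real m = r * real n"
      using False by (auto simp: ratio_attained_def)
    have le: "set_elasticity L \<le> ennreal r" using set_elasticity_le_iff[OF assms] a by simp
    have i: "Inf L \<in> L" using L by (simp add: Inf_nat_def1)
    then have pos: "0 < Inf L" using z by (metis neq0_conv)
    have "Inf L \<le> n" using mn by (simp add: wellorder_Inf_le1)
    then have "r * real (Inf L) \<le> r * real n" using assms by (intro mult_left_mono) auto
    then have "r \<le> real m / real (Inf L)" using mn pos by (simp add: field_simps)
    then have "ennreal r \<le> ennreal (real m / real (Inf L))" by (rule ennreal_leI)
    also have "\<dots> \<le> set_elasticity L"
      unfolding set_elasticity_eq_SUP[OF L(1) z] by (rule SUP_upper[OF mn(1)])
    finally show "set_elasticity L = ennreal r" using le by simp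
  qed
qed

context comm_monoid_cancel
begin

lemma elasticity_ge_1: "1 \<le> elasticity G"
proof -
  have "length_set G \<one> = {0}" by (simp add: length_set_Unit)
  then have "{0} \<in> {L \<in> system_of_length_sets G. L \<noteq> {}}"
    by (auto simp: system_of_length_sets_def intro!: image_eqI[of _ _ \<one>])
  then have "set_elasticity {0} \<le> elasticity G" unfolding elasticity_def by (rule SUP_upper)
  then show ?thesis by (simp add: set_elasticity_def)
qed

lemma elasticity_le_iff:
  assumes "1 \<le> r"
  shows "elasticity G \<le> ennreal r \<longleftrightarrow> (\<forall>a\<in>carrier G. ratio_bounded r (length_set G a))"
proof -
  have "elasticity G \<le> ennreal r \<longleftrightarrow>
    (\<forall>a\<in>carrier G. length_set G a \<noteq> {} \<longrightarrow> set_elasticity (length_set G a) \<le> ennreal r)"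
    by (auto simp: elasticity_def SUP_le_iff system_of_length_sets_def)
  also have "\<dots> \<longleftrightarrow> (\<forall>a\<in>carrier G. length_set G a \<noteq> {} \<longrightarrow> ratio_bounded r (length_set G a))"
    using set_elasticity_le_iff[OF _ length_set_nonempty_or_zero assms] by blast
  also have "\<dots> \<longleftrightarrow> (\<forall>a\<in>carrier G. ratio_bounded r (length_set G a))"
    by (auto simp: ratio_bounded_def)
  finally show ?thesis .
qed

lemma finite_elasticity_obtains:
  assumes "elasticity G < \<infinity>"
  obtains r where "1 \<le> r" "elasticity G = ennreal r"
proof -
  obtain r where "0 \<le> r" "elasticity G = ennreal r" using assms by (cases "elasticity G") auto
  then show ?thesis using that elasticity_ge_1 by (auto simp: ennreal_ge_1)
qed

lemma set_elasticity_length_set_eq_iff: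
  assumes "a \<in> carrier G" "length_set G a \<noteq> {}" "1 \<le> r"
  shows "set_elasticity (length_set G a) = ennreal r \<longleftrightarrow> ratio_bounded r (length_set G a) \<and>
    (if a \<in> Units G then r = 1 else ratio_attained r (length_set G a))"
  using set_elasticity_eq_iff[OF assms(2) length_set_nonempty_or_zero[OF assms(1)] assms(3)]
    length_set_eq_zero_iff[OF assms(1)] by simp

lemma elasticity_eqI:
  assumes "1 \<le> r" "\<And>a. a \<in> carrier G \<Longrightarrow> ratio_bounded r (length_set G a)"
    and "r = 1 \<or> (\<exists>a\<in>carrier G. ratio_attained r (length_set G a))"
  shows "elasticity G = ennreal r"
    and "\<exists>L\<in>system_of_length_sets G. set_elasticity L = elasticity G"
proof -
  obtain a where a: "a \<in> carrier G" "set_elasticity (length_set G a) = ennreal r" "length_set G a \<noteq> {}"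
  proof (cases "\<exists>a\<in>carrier G. ratio_attained r (length_set G a)")
    case True
    then obtain a where a: "a \<in> carrier G" "ratio_attained r (length_set G a)" by auto
    then have "length_set G a \<noteq> {}" by (auto simp: ratio_attained_def)
    moreover have "a \<notin> Units G" using a by (auto simp: length_set_Unit ratio_attained_def)
    ultimately show ?thesis using that[of a] set_elasticity_length_set_eq_iff[OF a(1) _ assms(1)] a assms(2)
      by auto
  next
    case False
    then have "r = 1" using assms by auto
    then show ?thesis using that[of \<one>] by (simp add: length_set_Unit set_elasticity_def)
  qed
  have "ennreal r \<le> elasticity G" unfolding elasticity_def a(2)[symmetric]
    by (rule SUP_upper) (use a in \<open>auto simp: system_of_length_sets_def\<close>)
  moreover have "elasticity G \<le> ennreal r" using assms elasticity_le_iff by blast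
  ultimately show "elasticity G = ennreal r" by simp
  then show "\<exists>L\<in>system_of_length_sets G. set_elasticity L = elasticity G"
    using a by (auto simp: system_of_length_sets_def)
qed

lemma accepted_elasticityI:
  assumes "\<And>a. a \<in> carrier G \<Longrightarrow> length_set G a \<noteq> {}"
    and "1 \<le> r" "\<And>a. a \<in> carrier G \<Longrightarrow> ratio_bounded r (length_set G a)"
    and "r = 1 \<or> (\<exists>a\<in>carrier G. ratio_attained r (length_set G a))"
  shows "accepted_elasticity G"
  using elasticity_eqI[OF assms(2-4)] assms(1) unfolding accepted_elasticity_def atomic_monoid_iff
  by auto

lemma accepted_elasticity_obtains:
  assumes "accepted_elasticity G"
  obtains r where "1 \<le> r" "elasticity G = ennreal r"
    "\<And>a. a \<in> carrier G \<Longrightarrow> length_set G a \<noteq> {}"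
    "\<And>a. a \<in> carrier G \<Longrightarrow> ratio_bounded r (length_set G a)"
    "r > 1 \<Longrightarrow> \<exists>a\<in>carrier G. a \<notin> Units G \<and> ratio_attained r (length_set G a)"
proof -
  have ne: "\<And>a. a \<in> carrier G \<Longrightarrow> length_set G a \<noteq> {}" and fin: "elasticity G < \<infinity>"
    and ex: "\<exists>L\<in>system_of_length_sets G. set_elasticity L = elasticity G"
    using assms by (auto simp: accepted_elasticity_def atomic_monoid_iff)
  obtain r where r: "1 \<le> r" "elasticity G = ennreal r" using finite_elasticity_obtains[OF fin] .
  show ?thesis
  proof (rule that[OF r ne])
    show "ratio_bounded r (length_set G a)" if "a \<in> carrier G" for a
      using elasticity_le_iff[OF r(1)] r that by auto
    assume r1: "r > 1"
    obtain a where a: "a \<in> carrier G" "set_elasticity (length_set G a) = ennreal r"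
      using ex r by (auto simp: system_of_length_sets_def)
    then show "\<exists>a\<in>carrier G. a \<notin> Units G \<and> ratio_attained r (length_set G a)"
      using set_elasticity_length_set_eq_iff[OF a(1) ne[OF a(1)] r(1)] r1 by (auto split: if_splits)
  qed auto
qed

end

lemma elasticity_eq_of_system_eq:
  assumes "system_of_length_sets A = system_of_length_sets B"
  shows "elasticity A = elasticity B"
  using assms by (simp add: elasticity_def)

text \<open>Differences are taken in the integers, so that the divisibility does not depend on the order of
  the two lengths.\<close>

definition gap_dvd :: "nat \<Rightarrow> nat set \<Rightarrow> bool" where
  "gap_dvd d L \<longleftrightarrow> (\<forall>m\<in>L. \<forall>n\<in>L. int d dvd int m - int n)"

text \<open>Take the successor of \<open>m\<close> in \<open>L\<close>.\<close>

lemma distance_between: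
  assumes "m \<in> L" "n \<in> L" "m < n"
  obtains d where "d \<in> distances L" "d \<le> n - m"
proof -
  define k where "k = (LEAST k. k \<in> L \<and> m < k)"
  have k: "k \<in> L" "m < k" using LeastI[of "\<lambda>k. k \<in> L \<and> m < k" n] assms by (auto simp: k_def)
  have min: "k \<le> j" if "j \<in> L" "m < j" for j using that by (auto simp: k_def intro: Least_le)
  have "k - m \<in> distances L" unfolding distances_def using k min assms by fastforce
  moreover have "k - m \<le> n - m" using min[of n] assms by simp
  ultimately show ?thesis using that by blast
qed

lemma distances_pos: "d \<in> distances L \<Longrightarrow> 0 < d"
  by (auto simp: distances_def)

lemma distancesE:
  assumes "d \<in> distances L"
  obtains m where "m \<in> L" "m + d \<in> L"
proof -
  obtain m n where "m \<in> L" "n \<in> L" "m < n" "d = n - m" using assms by (auto simp: distances_def)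
  then show ?thesis using that[of m] by simp
qed

text \<open>A difference of lengths not divisible by the minimal distance would, after adding multiples of
  the latter, leave a smaller difference; closure of the family under sums supplies a set of lengths in
  which it occurs.\<close>

lemma Inf_distances:
  assumes closed: "\<And>L1 L2. L1 \<in> \<L> \<Longrightarrow> L2 \<in> \<L> \<Longrightarrow> \<exists>L3\<in>\<L>. \<forall>m\<in>L1. \<forall>n\<in>L2. m + n \<in> L3"
    and ne: "(\<Union>L\<in>\<L>. distances L) \<noteq> {}"
  defines "d \<equiv> Inf (\<Union>L\<in>\<L>. distances L)"
  shows "0 < d" and "d \<in> (\<Union>L\<in>\<L>. distances L)"
    and "x dvd d \<longleftrightarrow> (\<forall>L\<in>\<L>. gap_dvd x L)"
proof -
  show d: "d \<in> (\<Union>L\<in>\<L>. distances L)" using Inf_nat_def1[OF ne] d_def by simp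
  then show pos: "0 < d" using distances_pos by blast
  obtain L0 m0 where L0: "L0 \<in> \<L>" "m0 \<in> L0" "m0 + d \<in> L0" using d by (auto elim: distancesE)
  have small: False if "L \<in> \<L>" "m \<in> L" "n \<in> L" "m < n" "n - m < d" for L m n
  proof -
    note mn = that
    obtain e where "e \<in> distances L" "e \<le> n - m" using distance_between[OF mn(2,3,4)] by blast
    moreover have "e \<in> (\<Union>L\<in>\<L>. distances L)" using calculation mn by blast
    ultimately have "d \<le> e" unfolding d_def by (intro wellorder_Inf_le1)
    then show False using \<open>e \<le> n - m\<close> mn by simp
  qed
  have shift: "\<exists>L'\<in>\<L>. n + q * (m0 + d) \<in> L' \<and> m + q * m0 \<in> L'"
    if "L \<in> \<L>" "m \<in> L" "n \<in> L" for L m n q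
  proof (induction q)
    case 0
    then show ?case using that by auto
  next
    case (Suc q)
    then obtain L' where L': "L' \<in> \<L>" "n + q * (m0 + d) \<in> L'" "m + q * m0 \<in> L'" by auto
    obtain L3 where L3: "L3 \<in> \<L>" "\<forall>m\<in>L'. \<forall>n\<in>L0. m + n \<in> L3" using closed[OF L'(1) L0(1)] by auto
    have "n + q * (m0 + d) + (m0 + d) \<in> L3" "m + q * m0 + m0 \<in> L3" using L3 L' L0 by auto
    then show ?case using L3(1) by (auto intro!: bexI[of _ L3] simp: algebra_simps)
  qed
  have div: "d dvd m - n" if mn: "L \<in> \<L>" "m \<in> L" "n \<in> L" "n \<le> m" for L m n
  proof (rule ccontr)
    assume nd: "\<not> d dvd m - n"
    define q where "q = (m - n) div d"
    have r: "0 < (m - n) mod d" "(m - n) mod d < d" using nd pos by (auto simp: dvd_eq_mod_eq_0)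
    have e: "m - n = q * d + (m - n) mod d" by (simp add: q_def)
    obtain L' where L': "L' \<in> \<L>" "n + q * (m0 + d) \<in> L'" "m + q * m0 \<in> L'"
      using shift[OF mn(1-3)] by auto
    have "m + q * m0 = (n + q * (m0 + d)) + (m - n) mod d" using e mn(4) by (simp add: algebra_simps)
    then show False using small[OF L'] r by simp
  qed
  have gap: "gap_dvd d L" if "L \<in> \<L>" for L
    unfolding gap_dvd_def
  proof (intro ballI)
    fix m n assume mn: "m \<in> L" "n \<in> L"
    show "int d dvd int m - int n"
    proof (cases "n \<le> m")
      case True
      then show ?thesis using div[OF that mn] by (metis int_dvd_int_iff of_nat_diff)
    next
      case False
      then have "int d dvd int n - int m" using div[OF that mn(2,1)] by (metis int_dvd_int_iff of_nat_diff nat_le_linear)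
      then show ?thesis by (metis dvd_minus_iff minus_diff_eq)
    qed
  qed
  show "x dvd d \<longleftrightarrow> (\<forall>L\<in>\<L>. gap_dvd x L)"
  proof
    assume "x dvd d"
    then have "int x dvd int d" by simp
    then have "gap_dvd x L" if "L \<in> \<L>" for L
      using gap[OF that] dvd_trans[of "int x" "int d"] by (simp add: gap_dvd_def)
    then show "\<forall>L\<in>\<L>. gap_dvd x L" by blast
  next
    assume "\<forall>L\<in>\<L>. gap_dvd x L"
    then have "int x dvd int (m0 + d) - int m0" using L0 unfolding gap_dvd_def by blast
    then show "x dvd d" by simp
  qed
qed

lemma unique_length_if_no_distances:
  assumes "(\<Union>L\<in>\<L>. distances L) = {}" "L \<in> \<L>" "m \<in> L" "n \<in> L"
  shows "m = n"
  using assms distance_between[of m L n] distance_between[of n L m] by (metis UN_I empty_iff linorder_neqE_nat)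

context comm_monoid_cancel
begin

lemma min_distance_facts:
  assumes "distances_of G (carrier G) \<noteq> {}"
  shows "0 < min_distance G" "min_distance G \<in> distances_of G (carrier G)"
    "x dvd min_distance G \<longleftrightarrow> (\<forall>b\<in>carrier G. gap_dvd x (length_set G b))"
proof -
  have u: "distances_of G (carrier G) = (\<Union>L\<in>length_set G ` carrier G. distances L)"
    by (simp add: distances_of_def)
  have c: "\<exists>L3\<in>length_set G ` carrier G. \<forall>m\<in>L1. \<forall>n\<in>L2. m + n \<in> L3"
    if L: "L1 \<in> length_set G ` carrier G" "L2 \<in> length_set G ` carrier G" for L1 L2
  proof -
    obtain b1 b2 where "b1 \<in> carrier G" "b2 \<in> carrier G" "L1 = length_set G b1" "L2 = length_set G b2"
      using L by auto
    then have "\<forall>m\<in>L1. \<forall>n\<in>L2. m + n \<in> length_set G (b1 \<otimes> b2)" "b1 \<otimes> b2 \<in> carrier G"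
      using length_set_add[of b1 b2] by auto
    then show ?thesis by blast
  qed
  have ne: "(\<Union>L\<in>length_set G ` carrier G. distances L) \<noteq> {}" using assms u by simp
  note * = Inf_distances[OF c ne]
  show "0 < min_distance G" unfolding min_distance_def u by (rule *(1))
  show "min_distance G \<in> distances_of G (carrier G)" unfolding min_distance_def u by (rule *(2))
  show "x dvd min_distance G \<longleftrightarrow> (\<forall>b\<in>carrier G. gap_dvd x (length_set G b))"
    unfolding min_distance_def u using *(3)[of x] by blast
qed

lemma min_distance_powers_facts:
  assumes a: "a \<in> carrier G" and ne: "distances_of G (powers_of G a) \<noteq> {}"
  defines "d \<equiv> Inf (distances_of G (powers_of G a))"
  shows "0 < d" "d \<in> distances_of G (powers_of G a)"
    "x dvd d \<longleftrightarrow> (\<forall>k. gap_dvd x (length_set G (a [^] (k::nat))))"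
proof -
  have u: "distances_of G (powers_of G a) = (\<Union>L\<in>range (\<lambda>k::nat. length_set G (a [^] k)). distances L)"
    by (auto simp: distances_of_def powers_of_def)
  have c: "\<exists>L3\<in>range (\<lambda>k::nat. length_set G (a [^] k)). \<forall>m\<in>L1. \<forall>n\<in>L2. m + n \<in> L3"
    if L: "L1 \<in> range (\<lambda>k::nat. length_set G (a [^] k))" "L2 \<in> range (\<lambda>k::nat. length_set G (a [^] k))" for L1 L2
  proof -
    obtain k1 k2 :: nat where "L1 = length_set G (a [^] k1)" "L2 = length_set G (a [^] k2)" using L by auto
    then have "\<forall>m\<in>L1. \<forall>n\<in>L2. m + n \<in> length_set G (a [^] (k1 + k2))"
      using length_set_add[of "a [^] k1" "a [^] k2"] a by (simp add: nat_pow_mult)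
    then show ?thesis by blast
  qed
  have ne': "(\<Union>L\<in>range (\<lambda>k::nat. length_set G (a [^] k)). distances L) \<noteq> {}" using ne u by simp
  note * = Inf_distances[OF c ne']
  show "0 < d" unfolding d_def u by (rule *(1))
  show "d \<in> distances_of G (powers_of G a)" unfolding d_def u by (rule *(2))
  show "x dvd d \<longleftrightarrow> (\<forall>k. gap_dvd x (length_set G (a [^] (k::nat))))"
    unfolding d_def u using *(3)[of x] by blast
qed

end

section \<open>Monoids with finitely many atoms\<close>

text \<open>A monotone subsequence exists over any linear order; over the naturals a decreasing one is
  eventually constant.\<close>

lemma mono_subseq_nat:
  fixes s :: "nat \<Rightarrow> nat"
  shows "\<exists>g::nat\<Rightarrow>nat. strict_mono g \<and> (\<forall>i j. i \<le> j \<longrightarrow> s (g i) \<le> s (g j))"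
proof -
  obtain f :: "nat \<Rightarrow> nat" where f: "strict_mono f" "monoseq (\<lambda>n. s (f n))"
    using seq_monosub[of s] by auto
  show ?thesis
  proof (cases "\<forall>m n. m \<le> n \<longrightarrow> s (f m) \<le> s (f n)")
    case True
    then show ?thesis using f by auto
  next
    case False
    then have dec: "\<forall>m n. m \<le> n \<longrightarrow> s (f n) \<le> s (f m)" using f(2) by (auto simp: monoseq_def)
    define N where "N = (ARG_MIN (\<lambda>n. s (f n)) n. True)"
    have min: "s (f N) \<le> s (f n)" for n unfolding N_def by (rule arg_min_nat_le) simp
    have const: "s (f (N + i)) = s (f N)" for i
      using dec[rule_format, of N "N + i"] min[of "N + i"] by simp
    have "strict_mono (\<lambda>i. f (N + i))" using f(1) by (simp add: strict_mono_def)
    then show ?thesis using const by (intro exI[of _ "\<lambda>i. f (N + i)"]) auto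
  qed
qed

lemma mono_subseq_finite_coordinates:
  fixes f :: "nat \<Rightarrow> 'k \<Rightarrow> nat"
  assumes "finite K"
  shows "\<exists>g::nat\<Rightarrow>nat. strict_mono g \<and> (\<forall>k\<in>K. \<forall>i j. i \<le> j \<longrightarrow> f (g i) k \<le> f (g j) k)"
  using assms
proof (induction K)
  case empty
  then show ?case by (auto intro!: exI[of _ "\<lambda>x. x"] simp: strict_mono_def)
next
  case (insert k K)
  then obtain g :: "nat \<Rightarrow> nat" where g: "strict_mono g" "\<forall>k\<in>K. \<forall>i j. i \<le> j \<longrightarrow> f (g i) k \<le> f (g j) k" by auto
  obtain h :: "nat \<Rightarrow> nat" where h: "strict_mono h" "\<forall>i j. i \<le> j \<longrightarrow> f (g (h i)) k \<le> f (g (h j)) k"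
    using mono_subseq_nat[of "\<lambda>n. f (g n) k"] by auto
  have "h i \<le> h j" if "i \<le> j" for i j using h(1) that by (simp add: strict_mono_less_eq)
  moreover have "strict_mono (\<lambda>i. g (h i))" using g(1) h(1) by (simp add: strict_mono_def)
  ultimately show ?case using g h by (intro exI[of _ "\<lambda>i. g (h i)"]) auto
qed

text \<open>Dickson's lemma: a subsequence that is non-decreasing in all coordinates has infinitely many
  terms, so two of them have the same colour.\<close>

lemma dickson_coloured:
  fixes f :: "nat \<Rightarrow> 'k \<Rightarrow> nat" and c :: "nat \<Rightarrow> 'c"
  assumes "finite K" "finite (range c)"
  shows "\<exists>i j. i < j \<and> c i = c j \<and> (\<forall>k\<in>K. f i k \<le> f j k)"
proof -
  obtain g :: "nat \<Rightarrow> nat" where g: "strict_mono g" "\<forall>k\<in>K. \<forall>i j. i \<le> j \<longrightarrow> f (g i) k \<le> f (g j) k"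
    using mono_subseq_finite_coordinates[OF assms(1)] by blast
  have "finite (range (\<lambda>n. c (g n)))" by (rule finite_subset[OF _ assms(2)]) auto
  then have "\<not> inj (\<lambda>n. c (g n))" using finite_imageD by fastforce
  then obtain i j where "i < j" "c (g i) = c (g j)" by (metis injI linorder_neqE_nat)
  then show ?thesis using g by (intro exI[of _ "g i"] exI[of _ "g j"]) (auto simp: strict_mono_def)
qed

lemma finite_antichain:
  fixes A :: "('k \<Rightarrow> nat) set"
  assumes K: "finite K" and ext: "\<And>x k. x \<in> A \<Longrightarrow> k \<notin> K \<Longrightarrow> x k = 0"
    and minimal: "\<And>x y. x \<in> A \<Longrightarrow> y \<in> A \<Longrightarrow> (\<And>k. k \<in> K \<Longrightarrow> x k \<le> y k) \<Longrightarrow> x = y"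
  shows "finite A"
proof (rule ccontr)
  assume "infinite A"
  then obtain f :: "nat \<Rightarrow> 'k \<Rightarrow> nat" where f: "inj f" "range f \<subseteq> A"
    using infinite_countable_subset by blast
  obtain i j where ij: "i < j" "\<forall>k\<in>K. f i k \<le> f j k"
    using dickson_coloured[OF K, of "\<lambda>_. ()" f] by auto
  then have "f i = f j" using minimal[of "f i" "f j"] f(2) by blast
  then show False using f(1) ij(1) by (simp add: inj_eq)
qed

context comm_monoid_cancel
begin

definition power_product :: "'a set \<Rightarrow> ('a \<Rightarrow> nat) \<Rightarrow> 'a" where
  "power_product U x = (\<Otimes>u\<in>U. u [^] x u)"

lemma power_product_closed [simp]: "U \<subseteq> carrier G \<Longrightarrow> power_product U x \<in> carrier G"
  unfolding power_product_def by (rule finprod_closed) auto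

lemma power_product_add:
  assumes "U \<subseteq> carrier G"
  shows "power_product U (\<lambda>u. x u + y u) = power_product U x \<otimes> power_product U y"
proof -
  have "power_product U x \<otimes> power_product U y = (\<Otimes>u\<in>U. u [^] x u \<otimes> u [^] y u)"
    unfolding power_product_def using assms by (subst finprod_multf) auto
  also have "\<dots> = power_product U (\<lambda>u. x u + y u)"
    unfolding power_product_def using assms by (intro finprod_cong') (auto simp: nat_pow_mult)
  finally show ?thesis by simp
qed

lemma power_product_single:
  assumes "U \<subseteq> carrier G" "finite U" "u \<in> U"
  shows "power_product U (\<lambda>v. if v = u then 1 else 0) = u"
proof -
  have "power_product U (\<lambda>v. if v = u then 1 else 0) = (\<Otimes>v\<in>U. if u = v then v else \<one>)"
    unfolding power_product_def using assms by (intro finprod_cong') auto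
  also have "\<dots> = u" using assms by (intro finprod_singleton) auto
  finally show ?thesis .
qed

lemma sum_in_length_set_power_product:
  assumes "finite U" "U \<subseteq> carrier G" "\<And>u. u \<in> U \<Longrightarrow> irreducible G u"
  shows "sum x U \<in> length_set G (power_product U x)"
  using assms
proof (induction U)
  case empty
  then show ?case by (simp add: power_product_def)
next
  case (insert u U)
  have "x u * 1 \<in> length_set G (u [^] x u)" using insert one_in_length_set by (intro length_set_pow) auto
  moreover have "sum x U \<in> length_set G (power_product U x)" using insert by auto
  ultimately have "x u * 1 + sum x U \<in> length_set G (u [^] x u \<otimes> power_product U x)"
    using insert by (intro length_set_add) auto
  moreover have "power_product (insert u U) x = u [^] x u \<otimes> power_product U x"
    unfolding power_product_def using insert by (intro finprod_insert) auto
  ultimately show ?case using insert by simp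
qed

lemma length_set_power_product:
  assumes U: "finite U" "U \<subseteq> carrier G" "\<And>u. u \<in> U \<Longrightarrow> irreducible G u"
    and all: "\<And>a. a \<in> carrier G \<Longrightarrow> irreducible G a \<Longrightarrow> \<exists>u\<in>U. \<exists>e\<in>Units G. a = u \<otimes> e"
    and "a \<in> carrier G" "n \<in> length_set G a"
  shows "\<exists>x. \<exists>e\<in>Units G. (\<forall>u. u \<notin> U \<longrightarrow> x u = 0) \<and> a = power_product U x \<otimes> e \<and> n = sum x U"
  using assms(5,6)
proof (induction n arbitrary: a)
  case 0
  then have "a \<in> Units G" by simp
  then show ?case by (intro exI[of _ "\<lambda>_. 0"] bexI[of _ a]) (auto simp: power_product_def)
next
  case (Suc n)
  obtain v y where vy: "v \<in> carrier G" "y \<in> carrier G" "irreducible G v"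
    "n \<in> length_set G y" "a = v \<otimes> y"
    using Suc_in_length_set[OF Suc.prems(1)] Suc.prems(2) by blast
  obtain u f where u: "u \<in> U" "f \<in> Units G" "v = u \<otimes> f" using all[OF vy(1,3)] by blast
  obtain x e where x: "e \<in> Units G" "\<forall>u. u \<notin> U \<longrightarrow> x u = 0" "y = power_product U x \<otimes> e" "n = sum x U"
    using Suc.IH[OF vy(2,4)] by blast
  define x' where "x' = (\<lambda>w. x w + (if w = u then 1 else 0))"
  have car: "u \<in> carrier G" "f \<in> carrier G" "e \<in> carrier G" using u x U by auto
  have "power_product U x' = power_product U x \<otimes> u"
    unfolding x'_def using U u by (simp add: power_product_add power_product_single)
  then have "a = power_product U x' \<otimes> (f \<otimes> e)"
    using vy(5) u x(3) car U by (simp add: m_ac)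
  moreover have "Suc n = sum x' U" using x(4) U(1) u(1) by (simp add: x'_def sum.distrib)
  moreover have "\<forall>w. w \<notin> U \<longrightarrow> x' w = 0" using x(2) u(1) by (auto simp: x'_def)
  ultimately show ?case using u x by blast
qed

text \<open>Pairs of factorizations of a common element are closed under componentwise differences, so
  by Dickson's lemma there are finitely many minimal ones; the ratio of the two lengths of any pair
  is a mediant of ratios of minimal pairs, hence at most the largest of these.\<close>

lemma accepted_elasticity_of_finitely_many_atoms:
  assumes ne: "\<And>a. a \<in> carrier G \<Longrightarrow> length_set G a \<noteq> {}"
    and U: "finite U" "U \<subseteq> carrier G" "\<And>u. u \<in> U \<Longrightarrow> irreducible G u"
    and all: "\<And>a. a \<in> carrier G \<Longrightarrow> irreducible G a \<Longrightarrow> \<exists>u\<in>U. \<exists>e\<in>Units G. a = u \<otimes> e"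
  shows "accepted_elasticity G"
proof -
  let ?\<pi> = "power_product U"
  (* A pair of exponent vectors is one function on a disjoint sum, to which Dickson's lemma applies. *)
  define Z where "Z = {z :: 'a + 'a \<Rightarrow> nat. (\<forall>k. k \<notin> U <+> U \<longrightarrow> z k = 0) \<and>
     (\<exists>e\<in>Units G. ?\<pi> (\<lambda>u. z (Inl u)) = ?\<pi> (\<lambda>u. z (Inr u)) \<otimes> e)}"
  define l where "l = (\<lambda>z :: 'a + 'a \<Rightarrow> nat. \<Sum>u\<in>U. z (Inl u))"
  define r where "r = (\<lambda>z :: 'a + 'a \<Rightarrow> nat. \<Sum>u\<in>U. z (Inr u))"
  have fK: "finite (U <+> U)" using U by simp
  have len: "l z \<in> length_set G (?\<pi> (\<lambda>u. z (Inl u)))" "r z \<in> length_set G (?\<pi> (\<lambda>u. z (Inl u)))"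
    if z: "z \<in> Z" for z
  proof -
    show "l z \<in> length_set G (?\<pi> (\<lambda>u. z (Inl u)))"
      unfolding l_def by (rule sum_in_length_set_power_product[OF U])
    obtain e where e: "e \<in> Units G" "?\<pi> (\<lambda>u. z (Inl u)) = ?\<pi> (\<lambda>u. z (Inr u)) \<otimes> e"
      using z by (auto simp: Z_def)
    show "r z \<in> length_set G (?\<pi> (\<lambda>u. z (Inl u)))"
      unfolding e(2) r_def using length_set_mult_Unit[OF _ e(1)] U sum_in_length_set_power_product[OF U] by simp
  qed
  have zero: "z = (\<lambda>_. 0)" if z: "z \<in> Z" "l z = 0 \<or> r z = 0" for z
  proof -
    have c: "?\<pi> (\<lambda>u. z (Inl u)) \<in> carrier G" using U by simp
    have "0 \<in> length_set G (?\<pi> (\<lambda>u. z (Inl u)))" using len[OF z(1)] z(2) by auto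
    then have "length_set G (?\<pi> (\<lambda>u. z (Inl u))) = {0}" using length_set_nonempty_or_zero[OF c] by auto
    then have "l z = 0" "r z = 0" using len[OF z(1)] by auto
    then have "z k = 0" if "k \<in> U <+> U" for k using that U(1) by (auto simp: l_def r_def)
    then show ?thesis using z(1) by (auto simp: Z_def)
  qed
  have diff: "(\<lambda>k. z k - w k) \<in> Z" if zw: "z \<in> Z" "w \<in> Z" "\<And>k. w k \<le> z k" for z w
  proof -
    obtain e where e: "e \<in> Units G" "?\<pi> (\<lambda>u. z (Inl u)) = ?\<pi> (\<lambda>u. z (Inr u)) \<otimes> e"
      using zw by (auto simp: Z_def)
    obtain f where f: "f \<in> Units G" "?\<pi> (\<lambda>u. w (Inl u)) = ?\<pi> (\<lambda>u. w (Inr u)) \<otimes> f"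
      using zw by (auto simp: Z_def)
    let ?d = "\<lambda>i. ?\<pi> (\<lambda>u. z (i u) - w (i u))"
    have s: "?\<pi> (\<lambda>u. z (i u)) = ?\<pi> (\<lambda>u. w (i u)) \<otimes> ?d i" for i :: "'a \<Rightarrow> 'a + 'a"
      using power_product_add[OF U(2), of "\<lambda>u. w (i u)" "\<lambda>u. z (i u) - w (i u)"] zw(3) by simp
    have c: "?\<pi> x \<in> carrier G" for x using U by simp
    have fc: "f \<in> carrier G" "inv f \<in> Units G" "inv f \<in> carrier G" "e \<in> carrier G" using f e by auto
    have "?\<pi> (\<lambda>u. w (Inr u)) \<otimes> (f \<otimes> ?d Inl) = ?\<pi> (\<lambda>u. w (Inr u)) \<otimes> (?d Inr \<otimes> e)"
      using e(2) unfolding s f(2) using c fc by (simp add: m_assoc)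
    then have "f \<otimes> ?d Inl = ?d Inr \<otimes> e"
      by (rule l_cancel) (use c fc in auto)
    then have "inv f \<otimes> (f \<otimes> ?d Inl) = ?d Inr \<otimes> (inv f \<otimes> e)" using c fc by (simp add: m_ac)
    moreover have "inv f \<otimes> (f \<otimes> ?d Inl) = ?d Inl" using c fc f(1) by (simp flip: m_assoc)
    ultimately have "?d Inl = ?d Inr \<otimes> (inv f \<otimes> e)" by simp
    moreover have "inv f \<otimes> e \<in> Units G" using fc e by blast
    ultimately show ?thesis using zw by (auto simp: Z_def)
  qed
  (* The minimal non-trivial pairs. *)
  define A where "A = {z \<in> Z. z \<noteq> (\<lambda>_. 0) \<and> (\<forall>w\<in>Z. w \<noteq> (\<lambda>_. 0) \<and> (\<forall>k. w k \<le> z k) \<longrightarrow> w = z)}"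
  have "finite A"
  proof (rule finite_antichain[OF fK])
    show "x k = 0" if "x \<in> A" "k \<notin> U <+> U" for x k using that by (auto simp: A_def Z_def)
    fix x y assume xy: "x \<in> A" "y \<in> A" "\<And>k. k \<in> U <+> U \<Longrightarrow> x k \<le> y k"
    have "x k \<le> y k" for k
    proof (cases "k \<in> U <+> U")
      case False
      then have "x k = 0" using xy(1) by (auto simp: A_def Z_def)
      then show ?thesis by simp
    qed (use xy in auto)
    then show "x = y" using xy(1,2) by (auto simp: A_def)
  qed
  show ?thesis
  proof (cases "A = {}")
    case True
    (* Below a non-trivial pair there would be a minimal one; so there are no atoms at all. *)
    have none: "z = (\<lambda>_. 0)" if "z \<in> Z" for z
      using that
    proof (induction "sum z (U <+> U)" arbitrary: z rule: less_induct)
      case less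
      show ?case
      proof (rule ccontr)
        assume nz: "z \<noteq> (\<lambda>_. 0)"
        then obtain w where w: "w \<in> Z" "w \<noteq> (\<lambda>_. 0)" "\<forall>k. w k \<le> z k" "w \<noteq> z"
          using True less.prems by (auto simp: A_def)
        have "sum w (U <+> U) < sum z (U <+> U)"
        proof (rule sum_strict_mono_ex1[OF fK])
          show "\<exists>k\<in>U <+> U. w k < z k"
          proof (rule ccontr)
            assume n: "\<not> (\<exists>k\<in>U <+> U. w k < z k)"
            have "w k = z k" for k
              using n w(1,3) less.prems by (cases "k \<in> U <+> U") (auto simp: Z_def le_less)
            then show False using w(4) by auto
          qed
        qed (use w in auto)
        then show False using less.hyps[of w] w by auto
      qed
    qed
    have "ratio_bounded 1 (length_set G a)" if a: "a \<in> carrier G" for a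
      unfolding ratio_bounded_def
    proof (intro ballI)
      fix m n assume mn: "m \<in> length_set G a" "n \<in> length_set G a"
      obtain x e where x: "e \<in> Units G" "\<forall>u. u \<notin> U \<longrightarrow> x u = 0" "a = ?\<pi> x \<otimes> e" "m = sum x U"
        using length_set_power_product[OF U all a mn(1)] by blast
      define z where "z = case_sum x x"
      have "z \<in> Z" using x U by (auto simp: Z_def z_def split: sum.splits intro!: bexI[of _ \<one>])
      then have "z = (\<lambda>_. 0)" by (rule none)
      then have "x u = 0" for u by (metis z_def sum.case(1))
      then have "m = 0" using x by simp
      then show "real m \<le> 1 * real n" by simp
    qed
    then show ?thesis using accepted_elasticityI[OF ne, of 1] by simp
  next
    case False
    define q where "q = (\<lambda>z. real (l z) / real (r z))"
    define \<rho> where "\<rho> = Max (q ` A)"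
    have posr: "0 < r z \<and> 0 < l z" if "z \<in> A" for z using zero[of z] that by (auto simp: A_def)
    have bA: "real (l z) \<le> \<rho> * real (r z)" if "z \<in> A" for z
    proof -
      have "q z \<le> \<rho>" using that \<open>finite A\<close> by (simp add: \<rho>_def)
      then show ?thesis using posr[OF that] by (simp add: q_def field_simps)
    qed
    have bZ: "real (l z) \<le> \<rho> * real (r z)" if "z \<in> Z" for z
      using that
    proof (induction "sum z (U <+> U)" arbitrary: z rule: less_induct)
      case less
      show ?case
      proof (cases "z = (\<lambda>_. 0) \<or> z \<in> A")
        case True
        then show ?thesis using bA by (auto simp: l_def r_def)
      next
        case False
        then obtain w where w: "w \<in> Z" "w \<noteq> (\<lambda>_. 0)" "\<forall>k. w k \<le> z k" "w \<noteq> z"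
          using less.prems by (auto simp: A_def)
        let ?v = "\<lambda>k. z k - w k"
        have v: "?v \<in> Z" using diff[of z w] less.prems w by auto
        have nv: "?v \<noteq> (\<lambda>_. 0)"
        proof
          assume "?v = (\<lambda>_. 0)"
          then have "w k = z k" for k using w(3) by (metis diff_is_0_eq le_antisym)
          then show False using w(4) by auto
        qed
        have sum: "sum z (U <+> U) = sum w (U <+> U) + sum ?v (U <+> U)"
          unfolding sum.distrib[symmetric] using w(3) by (intro sum.cong) auto
        have pos: "0 < sum z' (U <+> U)" if "z' \<in> Z" "z' \<noteq> (\<lambda>_. 0)" for z'
        proof (rule ccontr)
          assume "\<not> 0 < sum z' (U <+> U)"
          then have "\<forall>k\<in>U <+> U. z' k = 0" using fK by simp
          then have "z' = (\<lambda>_. 0)" using that(1) by (auto simp: Z_def)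
          then show False using that by simp
        qed
        have "real (l w) \<le> \<rho> * real (r w)" "real (l ?v) \<le> \<rho> * real (r ?v)"
          using less.hyps[of w] less.hyps[of ?v] pos[OF w(1,2)] pos[OF v nv] sum w(1) v by auto
        moreover have "l z = l w + l ?v" "r z = r w + r ?v"
          unfolding l_def r_def sum.distrib[symmetric] using w(3) by (auto intro!: sum.cong)
        ultimately show ?thesis by (simp add: algebra_simps)
      qed
    qed
    have bound: "ratio_bounded \<rho> (length_set G a)" if a: "a \<in> carrier G" for a
      unfolding ratio_bounded_def
    proof (intro ballI)
      fix m n assume mn: "m \<in> length_set G a" "n \<in> length_set G a"
      obtain x e where x: "e \<in> Units G" "\<forall>u. u \<notin> U \<longrightarrow> x u = 0" "a = ?\<pi> x \<otimes> e" "m = sum x U"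
        using length_set_power_product[OF U all a mn(1)] by blast
      obtain y f where y: "f \<in> Units G" "\<forall>u. u \<notin> U \<longrightarrow> y u = 0" "a = ?\<pi> y \<otimes> f" "n = sum y U"
        using length_set_power_product[OF U all a mn(2)] by blast
      have c: "?\<pi> x \<in> carrier G" "?\<pi> y \<in> carrier G" using U by auto
      have "?\<pi> x = ?\<pi> x \<otimes> e \<otimes> inv e" using x(1) c by (simp add: m_assoc Units_closed)
      also have "\<dots> = ?\<pi> y \<otimes> (f \<otimes> inv e)" using x y c by (metis Units_closed Units_inv_closed m_assoc)
      finally have "?\<pi> x = ?\<pi> y \<otimes> (f \<otimes> inv e)" .
      moreover have "f \<otimes> inv e \<in> Units G" using x y by blast
      ultimately have "case_sum x y \<in> Z" using x y by (auto simp: Z_def split: sum.splits)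
      then show "real m \<le> \<rho> * real n" using bZ[of "case_sum x y"] x y by (simp add: l_def r_def)
    qed
    have "\<rho> \<in> q ` A" unfolding \<rho>_def using False \<open>finite A\<close> by (intro Max_in) auto
    then obtain z where z: "z \<in> A" "\<rho> = q z" by auto
    let ?a = "?\<pi> (\<lambda>u. z (Inl u))"
    have a: "?a \<in> carrier G" using U by simp
    have "real (l z) = \<rho> * real (r z)" using posr[OF z(1)] z(2) by (simp add: q_def)
    moreover have "z \<in> Z" using z(1) by (simp add: A_def)
    ultimately have att: "ratio_attained \<rho> (length_set G ?a)"
      unfolding ratio_attained_def using len[of z] posr[OF z(1)] by blast
    have "real (l z) \<le> \<rho> * real (l z)" using bound[OF a] len(1)[of z] z by (auto simp: ratio_bounded_def A_def)
    then have "1 \<le> \<rho>" using posr[OF z(1)] by auto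
    then show ?thesis using accepted_elasticityI[OF ne _ bound] att a by blast
  qed
qed

end

section \<open>Submonoids of an abelian group\<close>

context comm_group
begin

lemma comm_monoid_cancel_submon:
  assumes "submonoid D G"
  shows "comm_monoid_cancel (submon G D)"
proof -
  interpret D: submonoid D G by fact
  have "comm_monoid (submon G D)" by (rule submonoid_is_comm_monoid[OF assms])
  then show ?thesis
  proof (rule comm_monoid_cancelI)
    fix a b c assume "a \<otimes>\<^bsub>submon G D\<^esub> c = b \<otimes>\<^bsub>submon G D\<^esub> c" "a \<in> carrier (submon G D)"
      "b \<in> carrier (submon G D)" "c \<in> carrier (submon G D)"
    then show "a = b" by simp
  qed
qed

lemma Units_submon:
  assumes "submonoid D G"
  shows "Units (submon G D) = {x \<in> D. inv x \<in> D}"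
proof -
  interpret D: submonoid D G by fact
  show ?thesis
  proof (intro equalityI subsetI)
    fix x assume "x \<in> Units (submon G D)"
    then obtain y where y: "x \<in> D" "y \<in> D" "y \<otimes> x = \<one>" by (auto simp: Units_def)
    then have "inv x = y" by (intro inv_equality) auto
    then show "x \<in> {x \<in> D. inv x \<in> D}" using y by simp
  next
    fix x assume "x \<in> {x \<in> D. inv x \<in> D}"
    then show "x \<in> Units (submon G D)" by (auto simp: Units_def intro!: bexI[of _ "inv x"])
  qed
qed

lemma pow_submon: "x [^]\<^bsub>submon G D\<^esub> (k::nat) = x [^] k"
  by (simp add: nat_pow_def)

lemma cancel_inv:
  assumes "x \<in> carrier G" "y \<in> carrier G"
  shows "x \<otimes> (inv x \<otimes> y) = y" "inv x \<otimes> (x \<otimes> y) = y" "x \<otimes> (y \<otimes> inv x) = y"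
    "y \<otimes> inv x \<otimes> x = y" "y \<otimes> x \<otimes> inv x = y"
proof -
  show "x \<otimes> (inv x \<otimes> y) = y" using assms by (simp flip: m_assoc)
  show "inv x \<otimes> (x \<otimes> y) = y" using assms by (simp flip: m_assoc)
  show "x \<otimes> (y \<otimes> inv x) = y" using assms m_lcomm[of x y "inv x"] by simp
  show "y \<otimes> inv x \<otimes> x = y" using assms by (simp add: m_assoc)
  show "y \<otimes> x \<otimes> inv x = y" using assms by (simp add: m_assoc)
qed

lemma cross_mult:
  assumes "a \<in> carrier G" "b \<in> carrier G" "c \<in> carrier G" "d \<in> carrier G"
    and e: "a \<otimes> inv b = c \<otimes> inv d"
  shows "a \<otimes> d = c \<otimes> b"
proof -
  have "a \<otimes> d = (a \<otimes> inv b) \<otimes> (b \<otimes> d)" using assms(1-4) by (simp add: m_assoc cancel_inv)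
  also have "\<dots> = c \<otimes> (b \<otimes> (inv d \<otimes> d))" unfolding e using assms(1-4) by (simp add: m_ac del: l_inv r_inv)
  also have "\<dots> = c \<otimes> b" using assms(1-4) by simp
  finally show ?thesis .
qed

lemma inv_mult': "x \<in> carrier G \<Longrightarrow> y \<in> carrier G \<Longrightarrow> inv (x \<otimes> y) = inv x \<otimes> inv y"
  by (rule inv_mult)

lemma pow_closed_submonoid:
  assumes "submonoid D G" "x \<in> D"
  shows "x [^] (n::nat) \<in> D"
proof -
  interpret D: submonoid D G by fact
  show ?thesis using assms(2) by (induction n) auto
qed

end

section \<open>Finitely primary monoids\<close>

text \<open>A finitely primary monoid is used through the valuations at the primes of the surrounding
  factorial monoid.\<close>

locale primary_valuations = comm_group Q for Q :: "('a, 'b) monoid_scheme" (structure) +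
  fixes D :: "'a set" and P :: "'a set" and v :: "'a \<Rightarrow> 'a \<Rightarrow> int" and \<alpha> :: nat
  assumes submonoid_D: "submonoid D Q"
    and finite_P: "finite P" and P_nonempty: "P \<noteq> {}" and P_closed: "P \<subseteq> carrier Q"
    and v_mult: "r \<in> P \<Longrightarrow> x \<in> carrier Q \<Longrightarrow> y \<in> carrier Q \<Longrightarrow> v r (x \<otimes> y) = v r x + v r y"
    and v_prime: "r \<in> P \<Longrightarrow> s \<in> P \<Longrightarrow> v r s = (if r = s then 1 else 0)"
    and v_nonneg: "x \<in> D \<Longrightarrow> r \<in> P \<Longrightarrow> 0 \<le> v r x"
    and v_nonunit: "x \<in> D \<Longrightarrow> inv x \<notin> D \<Longrightarrow> r \<in> P \<Longrightarrow> 1 \<le> v r x"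
    and v_large: "x \<in> carrier Q \<Longrightarrow> (\<And>r. r \<in> P \<Longrightarrow> int \<alpha> \<le> v r x) \<Longrightarrow> x \<in> D"
    and \<alpha>_pos: "0 < \<alpha>"

text \<open>The valuations are the exponents in the factorial monoid \<open>F\<close>, extended to quotients. They
  carry the same information as \<open>F\<close>, which consists of the elements with non-negative valuations.\<close>

lemma (in comm_group) primary_valuationsI:
  assumes fp: "finitely_primary G D" and gen: "\<And>x. x \<in> carrier G \<Longrightarrow> \<exists>a\<in>D. \<exists>b\<in>D. x = a \<otimes> inv b"
  shows "\<exists>P v \<alpha>. primary_valuations G D P v \<alpha>"
proof -
  obtain F P and \<alpha> :: nat where \<alpha>: "\<alpha> > 0" and F: "submonoid F G" and P: "finite P" "P \<noteq> {}" "P \<subseteq> F"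
    and iso: "(\<lambda>(\<epsilon>, S). \<epsilon> \<otimes> mset_product G S)
          \<in> iso (units_of (submon G F) \<times>\<times> free_abelian_monoid P) (submon G F)"
    and D: "submonoid D (submon G F)"
    and nonunit: "D - Units (submon G D) \<subseteq> (\<Otimes>p\<in>P. p) <# F"
    and cond: "((\<Otimes>p\<in>P. p) [^] \<alpha>) <# F \<subseteq> D"
    using fp unfolding finitely_primary_def by (elim exE conjE) (rule that)
  interpret F: submonoid F G by fact
  let ?U = "Units (submon G F)"
  let ?M = "{S. set_mset S \<subseteq> P}"
  let ?\<phi> = "\<lambda>(\<epsilon>, S). \<epsilon> \<otimes> mset_product G S"
  let ?q = "\<Otimes>p\<in>P. p"
  have DF: "D \<subseteq> F" using submonoid.subset[OF D] by simp
  have D1: "submonoid D G"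
    using D DF F.subset by (auto simp: submonoid_def)
  interpret D: submonoid D G by fact
  have bij: "bij_betw ?\<phi> (?U \<times> ?M) F"
    using iso by (simp add: iso_def free_abelian_monoid_def units_of_carrier)
  have hom: "?\<phi> (\<epsilon> \<otimes> \<eta>, S + T) = ?\<phi> (\<epsilon>, S) \<otimes> ?\<phi> (\<eta>, T)"
    if "\<epsilon> \<in> ?U" "\<eta> \<in> ?U" "S \<in> ?M" "T \<in> ?M" for \<epsilon> \<eta> S T
  proof -
    have h: "?\<phi> \<in> hom (units_of (submon G F) \<times>\<times> free_abelian_monoid P) (submon G F)"
      using iso by (simp add: iso_def)
    show ?thesis using hom_mult[OF h, of "(\<epsilon>, S)" "(\<eta>, T)"] that
      by (simp add: free_abelian_monoid_def units_of_carrier units_of_mult)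
  qed
  define dec where "dec = inv_into (?U \<times> ?M) ?\<phi>"
  have dec: "dec f \<in> ?U \<times> ?M" "?\<phi> (dec f) = f" if "f \<in> F" for f
    using that bij unfolding dec_def by (auto simp: bij_betw_def intro: inv_into_into f_inv_into_f simp del: mem_Sigma_iff)
  have dec_eq: "dec f = z" if "z \<in> ?U \<times> ?M" "?\<phi> z = f" for f z
    using that bij unfolding dec_def by (metis (no_types, lifting) bij_betw_def inv_into_f_f)
  define w where "w = (\<lambda>r f. int (count (snd (dec f)) r))"
  have U_mult: "\<epsilon> \<otimes> \<eta> \<in> ?U" if "\<epsilon> \<in> ?U" "\<eta> \<in> ?U" for \<epsilon> \<eta>
    using that by (auto simp: Units_submon[OF F] inv_mult')
  have w_mult: "w r (f \<otimes> g) = w r f + w r g" if fg: "f \<in> F" "g \<in> F" for r f g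
  proof -
    obtain \<epsilon> S \<eta> T where e: "dec f = (\<epsilon>, S)" "dec g = (\<eta>, T)" by (meson surj_pair)
    then have m: "\<epsilon> \<in> ?U" "S \<in> ?M" "\<eta> \<in> ?U" "T \<in> ?M" using dec[OF fg(1)] dec[OF fg(2)] by auto
    have "?\<phi> (\<epsilon> \<otimes> \<eta>, S + T) = f \<otimes> g"
      using hom[OF m(1,3,2,4)] dec(2)[OF fg(1)] dec(2)[OF fg(2)] e by simp
    then have "dec (f \<otimes> g) = (\<epsilon> \<otimes> \<eta>, S + T)" using m U_mult by (intro dec_eq) auto
    then show ?thesis using e by (simp add: w_def)
  qed
  have one_U: "\<one> \<in> ?U" by (simp add: Units_submon[OF F])
  have w_prod: "w r (mset_product G S) = int (count S r)" if "S \<in> ?M" for r S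
  proof -
    have c: "mset_product G S \<in> carrier G"
      unfolding mset_product_def using that P(3) F.subset by (intro finprod_closed) auto
    then have "dec (mset_product G S) = (\<one>, S)" using one_U that by (intro dec_eq) auto
    then show ?thesis by (simp add: w_def)
  qed
  define v where "v = (\<lambda>r x. let (a, b) = (SOME z. fst z \<in> F \<and> snd z \<in> F \<and> x = fst z \<otimes> inv (snd z))
     in w r a - w r b)"
  have v_eq: "v r (a \<otimes> inv b) = w r a - w r b" if ab: "a \<in> F" "b \<in> F" for r a b
  proof -
    let ?z = "SOME z. fst z \<in> F \<and> snd z \<in> F \<and> a \<otimes> inv b = fst z \<otimes> inv (snd z)"
    have z: "fst ?z \<in> F \<and> snd ?z \<in> F \<and> a \<otimes> inv b = fst ?z \<otimes> inv (snd ?z)"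
      by (rule someI[of _ "(a, b)"]) (use ab in auto)
    obtain c d where cd: "?z = (c, d)" by (cases ?z) auto
    have c: "c \<in> F" "d \<in> F" and e: "a \<otimes> inv b = c \<otimes> inv d" using z unfolding cd by auto
    have "a \<otimes> d = c \<otimes> b" by (rule cross_mult[OF _ _ _ _ e]) (use ab c in auto)
    then have "w r (a \<otimes> d) = w r (c \<otimes> b)" by simp
    then have "w r a + w r d = w r c + w r b" using c ab by (simp add: w_mult)
    then show ?thesis unfolding v_def cd by simp
  qed
  have v_F: "v r f = w r f" if "f \<in> F" for r f
  proof -
    have "dec \<one> = (\<one>, {#})" using one_U by (intro dec_eq) (auto simp: mset_product_def)
    then have "w r \<one> = 0" by (simp add: w_def)
    then show ?thesis using v_eq[OF that F.one_closed, of r] that by simp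
  qed
  have genF: "\<exists>a\<in>F. \<exists>b\<in>F. x = a \<otimes> inv b" if x: "x \<in> carrier G" for x
  proof -
    obtain a b where "a \<in> D" "b \<in> D" "x = a \<otimes> inv b" using gen[OF x] by auto
    then show ?thesis using DF by auto
  qed
  have v_mult: "v r (x \<otimes> y) = v r x + v r y" if xy: "x \<in> carrier G" "y \<in> carrier G" for r x y
  proof -
    obtain a b a' b' where e: "a \<in> F" "b \<in> F" "x = a \<otimes> inv b" "a' \<in> F" "b' \<in> F" "y = a' \<otimes> inv b'"
      using genF[OF xy(1)] genF[OF xy(2)] by (elim bexE) (rule that)
    then have "x \<otimes> y = (a \<otimes> a') \<otimes> inv (b \<otimes> b')" by (simp add: inv_mult' m_ac)
    then have "v r (x \<otimes> y) = w r (a \<otimes> a') - w r (b \<otimes> b')" using v_eq e by simp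
    then show ?thesis using e v_eq w_mult by simp
  qed
  (* Unique factorization: an element with non-negative exponents is an element of F. *)
  have mem_F: "x \<in> F" if x: "x \<in> carrier G" "\<And>r. r \<in> P \<Longrightarrow> 0 \<le> v r x" for x
  proof -
    obtain a b where e: "a \<in> F" "b \<in> F" "x = a \<otimes> inv b" using genF[OF x(1)] by (elim bexE) (rule that)
    obtain \<epsilon> S \<eta> T where d: "dec a = (\<epsilon>, S)" "dec b = (\<eta>, T)" by (meson surj_pair)
    then have m: "\<epsilon> \<in> ?U" "S \<in> ?M" "\<eta> \<in> ?U" "T \<in> ?M" using dec[OF e(1)] dec[OF e(2)] by auto
    have "count T r \<le> count S r" for r
    proof (cases "r \<in> P")
      case True
      have "v r x = int (count S r) - int (count T r)" using v_eq[OF e(1,2), of r] e(3) d by (simp add: w_def)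
      then show ?thesis using x(2)[OF True] by linarith
    next
      case False
      then have "count T r = 0" using m(4) by (auto simp: count_eq_zero_iff)
      then show ?thesis by simp
    qed
    then have TS: "T \<subseteq># S" by (simp add: subseteq_mset_def)
    have ST: "S - T \<in> ?M" using m(2) by (auto dest: in_diffD)
    have inv\<eta>: "inv \<eta> \<in> ?U" "\<eta> \<in> carrier G" "\<epsilon> \<in> carrier G" using m by (auto simp: Units_submon[OF F])
    let ?y = "?\<phi> (\<epsilon> \<otimes> inv \<eta>, S - T)"
    have yF: "?y \<in> F" using bij_betwE[OF bij] ST U_mult[OF m(1) inv\<eta>(1)] by blast
    have "\<epsilon> \<otimes> inv \<eta> \<otimes> \<eta> = \<epsilon>" using inv\<eta> by (simp add: cancel_inv)
    then have "?y \<otimes> b = a" using hom[OF U_mult[OF m(1) inv\<eta>(1)] m(3) ST m(4)] TS dec(2)[OF e(1)] dec(2)[OF e(2)] d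
      by simp
    then have "x = ?y" using e yF by (metis F.mem_carrier cancel_inv(5))
    then show ?thesis using yF by simp
  qed
  have qF: "?q \<in> F" "v r ?q = 1" if "r \<in> P" for r
  proof -
    have e: "?q = mset_product G (mset_set P)"
      unfolding mset_product_def using P F.subset by (intro finprod_cong') auto
    have M: "mset_set P \<in> ?M" using P by simp
    have "?\<phi> (\<one>, mset_set P) \<in> F" using bij_betwE[OF bij] one_U M by blast
    moreover have "mset_product G (mset_set P) \<in> carrier G"
      unfolding e[symmetric] using P F.subset by (intro finprod_closed) auto
    ultimately show "?q \<in> F" unfolding e by simp
    then show "v r ?q = 1" using v_F w_prod[OF M] e P that by simp
  qed
  have qc: "?q \<in> carrier G" using P F.subset by (intro finprod_closed) auto
  have v_one: "v r \<one> = 0" for r using v_mult[of \<one> \<one> r] by simp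
  have v_pow: "v r (x [^] n) = int n * v r x" if "x \<in> carrier G" for r x and n :: nat
    using that by (induction n) (auto simp: v_one v_mult algebra_simps)
  have v_inv: "v r (inv x) = - v r x" if "x \<in> carrier G" for r x
    using v_mult[of x "inv x" r] that v_one[of r] by simp
  have "primary_valuations G D P v \<alpha>"
  proof (intro primary_valuations.intro primary_valuations_axioms.intro comm_group_axioms)
    show "submonoid D G" by fact
    show "finite P" "P \<noteq> {}" by fact+
    show "P \<subseteq> carrier G" using P F.subset by auto
    show "0 < \<alpha>" by fact
    show "v r (x \<otimes> y) = v r x + v r y" if "x \<in> carrier G" "y \<in> carrier G" for r x y
      by (rule v_mult[OF that])
    show "v r s = (if r = s then 1 else 0)" if "r \<in> P" "s \<in> P" for r s
    proof -
      have "mset_product G {#s#} = s" using that P F.subset by (auto simp: mset_product_def)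
      then show ?thesis using w_prod[of "{#s#}" r] v_F[of s r] that P by auto
    qed
    show "0 \<le> v r x" if "x \<in> D" for x r using v_F DF that by (auto simp: w_def)
    show "1 \<le> v r x" if "x \<in> D" "inv x \<notin> D" "r \<in> P" for x r
    proof -
      have "x \<in> ?q <# F" using nonunit that by (auto simp: Units_submon[OF D1])
      then obtain f where f: "f \<in> F" "x = ?q \<otimes> f" by (auto simp: l_coset_def)
      then have "v r x = 1 + w r f" using v_mult qc qF(2)[OF that(3)] v_F by simp
      then show ?thesis by (simp add: w_def)
    qed
    show "x \<in> D" if x: "x \<in> carrier G" "\<And>r. r \<in> P \<Longrightarrow> int \<alpha> \<le> v r x" for x
    proof -
      let ?p = "?q [^] \<alpha>"
      have p: "?p \<in> carrier G" using qc by simp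
      have "inv ?p \<otimes> x \<in> F"
      proof (rule mem_F)
        fix r assume r: "r \<in> P"
        show "0 \<le> v r (inv ?p \<otimes> x)" using x p qF(2)[OF r] x(2)[OF r] qc by (simp add: v_mult v_inv v_pow)
      qed (use p x in auto)
      then have "?p \<otimes> (inv ?p \<otimes> x) \<in> ?p <# F" by (auto simp: l_coset_def)
      then show ?thesis using cond p x by (auto simp: cancel_inv)
    qed
  qed
  then show ?thesis by blast
qed

context primary_valuations
begin

sublocale D: submonoid D Q by (rule submonoid_D)
sublocale DM: comm_monoid_cancel "submon Q D" by (rule comm_monoid_cancel_submon[OF submonoid_D])

lemma v_one [simp]: "r \<in> P \<Longrightarrow> v r \<one> = 0" using v_mult[of r \<one> \<one>] by simp

lemma v_inv: "r \<in> P \<Longrightarrow> x \<in> carrier Q \<Longrightarrow> v r (inv x) = - v r x"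
  using v_mult[of r x "inv x"] by simp

lemma v_pow: "r \<in> P \<Longrightarrow> x \<in> carrier Q \<Longrightarrow> v r (x [^] (n::nat)) = int n * v r x"
  by (induction n) (auto simp: v_mult algebra_simps)

lemma v_int_pow:
  assumes "r \<in> P" "x \<in> carrier Q"
  shows "v r (x [^] (k::int)) = k * v r x"
proof (cases k rule: int_cases2)
  case (nonneg n)
  then show ?thesis using v_pow[OF assms, of n] int_pow_int[of Q x n] by simp
next
  case (nonpos n)
  then show ?thesis using v_pow[OF assms, of n] int_pow_neg_int[OF assms(2), of n] v_inv[OF assms(1), of "x [^] n"] assms(2)
    by simp
qed

lemma v_Unit: "x \<in> D \<Longrightarrow> inv x \<in> D \<Longrightarrow> r \<in> P \<Longrightarrow> v r x = 0"
  using v_nonneg[of x r] v_nonneg[of "inv x" r] v_inv[of r x] by simp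

lemma Unit_iff: "x \<in> D \<Longrightarrow> r \<in> P \<Longrightarrow> inv x \<in> D \<longleftrightarrow> v r x = 0"
  using v_Unit[of x r] v_nonunit[of x r] by (cases "inv x \<in> D") auto

lemma v_prescribed: "\<exists>x\<in>carrier Q. \<forall>r\<in>P. v r x = f r"
proof -
  have "\<exists>x\<in>carrier Q. \<forall>r\<in>P. v r x = (if r \<in> S then f r else 0)" if "S \<subseteq> P" for S
    using finite_subset[OF that finite_P] that
  proof (induction S)
    case empty
    then show ?case by (intro bexI[of _ \<one>]) auto
  next
    case (insert s S)
    then obtain x where x: "x \<in> carrier Q" "\<forall>r\<in>P. v r x = (if r \<in> S then f r else 0)" by auto
    have s: "s \<in> carrier Q" "s \<in> P" using insert P_closed by auto
    have i: "v r (s [^] (f s)) = f s * v r s" if r: "r \<in> P" for r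
      by (rule v_int_pow[OF r s(1)])
    show ?case
      using x s insert(2) i by (intro bexI[of _ "x \<otimes> s [^] (f s)"]) (auto simp: v_mult v_prime)
  qed
  from this[OF subset_refl] show ?thesis by auto
qed

text \<open>Each atom contributes at least one to every valuation.\<close>

lemma length_le_v:
  assumes "a \<in> D" "n \<in> length_set (submon Q D) a" "r \<in> P"
  shows "int n \<le> v r a"
  using assms
proof (induction n arbitrary: a)
  case 0
  then show ?case using v_nonneg by simp
next
  case (Suc n)
  obtain u y where uy: "u \<in> D" "y \<in> D" "irreducible (submon Q D) u"
    "n \<in> length_set (submon Q D) y" "a = u \<otimes> y"
    using DM.Suc_in_length_set[of a n] Suc.prems by auto
  have "1 \<le> v r u" using uy v_nonunit[of u r] Suc.prems(3) by (auto simp: irreducible_def Units_submon[OF submonoid_D])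
  moreover have "int n \<le> v r y" using Suc uy by blast
  ultimately show ?case using uy v_mult[OF Suc.prems(3)] by simp
qed

lemma length_set_nonempty: "a \<in> D \<Longrightarrow> length_set (submon Q D) a \<noteq> {}"
proof -
  obtain r where r: "r \<in> P" using P_nonempty by auto
  assume a: "a \<in> D"
  show ?thesis
  proof (rule DM.length_set_nonempty_by_size[where sz = "\<lambda>x. nat (v r x)"])
    fix x assume "x \<in> carrier (submon Q D)" "nat (v r x) = 0"
    then show "x \<in> Units (submon Q D)" using Unit_iff[of x r] v_nonneg[of x r] r by (simp add: Units_submon[OF submonoid_D])
  next
    fix x y assume xy: "x \<in> carrier (submon Q D)" "y \<in> carrier (submon Q D)" "x \<notin> Units (submon Q D)"
      "y \<notin> Units (submon Q D)"
    then have "1 \<le> v r y" "0 \<le> v r x" using v_nonunit v_nonneg r by (auto simp: Units_submon[OF submonoid_D])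
    then show "nat (v r x) < nat (v r (x \<otimes>\<^bsub>submon Q D\<^esub> y))" using xy v_mult r by simp
  qed (use a in simp)
qed

text \<open>With two primes \<open>r\<close>, \<open>s\<close> a product of two elements of bounded valuation at \<open>r\<close> resp.
  \<open>s\<close> (hence of bounded length) can have arbitrarily large valuations everywhere, and then it has
  arbitrarily long factorizations.\<close>

lemma infinite_elasticity:
  assumes rs: "r \<in> P" "s \<in> P" "r \<noteq> s"
  shows "\<not> elasticity (submon Q D) < \<infinity>"
proof
  assume "elasticity (submon Q D) < \<infinity>"
  then obtain \<rho> where \<rho>: "1 \<le> \<rho>" "elasticity (submon Q D) = ennreal \<rho>"
    by (rule DM.finite_elasticity_obtains)
  have "elasticity (submon Q D) \<le> ennreal \<rho>" by (rule eq_refl) (rule \<rho>(2))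
  then have "\<forall>a\<in>carrier (submon Q D). ratio_bounded \<rho> (length_set (submon Q D) a)"
    by (rule DM.elasticity_le_iff[OF \<rho>(1), THEN iffD1])
  then have bd: "ratio_bounded \<rho> (length_set (submon Q D) a)" if "a \<in> D" for a
    using that by simp
  obtain x where x: "x \<in> carrier Q" "\<forall>t\<in>P. v t x = int \<alpha>"
    using v_prescribed[of "\<lambda>_. int \<alpha>"] by blast
  have xD: "x \<in> D" using x by (intro v_large) auto
  obtain lx where lx: "lx \<in> length_set (submon Q D) x" using length_set_nonempty[OF xD] by auto
  have lx1: "1 \<le> lx"
  proof (rule ccontr)
    assume "\<not> 1 \<le> lx"
    then have "lx = 0" by simp
    then have "inv x \<in> D" using lx DM.zero_in_length_set[of x] xD by (simp add: Units_submon[OF submonoid_D])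
    then show False using v_Unit[OF xD _ rs(1)] x rs \<alpha>_pos by simp
  qed
  have "real N \<le> \<rho> * (2 * real \<alpha>)" for N :: nat
  proof (cases "N = 0")
    case True
    then show ?thesis using \<rho> by simp
  next
    case False
    then have N: "\<alpha> \<le> \<alpha> * N" by simp
    obtain y where y: "y \<in> carrier Q" "\<forall>t\<in>P. v t y = (if t = r then int \<alpha> else int (\<alpha> * N))"
      using v_prescribed[of "\<lambda>t. if t = r then int \<alpha> else int (\<alpha> * N)"] by blast
    obtain z where z: "z \<in> carrier Q" "\<forall>t\<in>P. v t z = (if t = r then int (\<alpha> * N) else int \<alpha>)"
      using v_prescribed[of "\<lambda>t. if t = r then int (\<alpha> * N) else int \<alpha>"] by blast
    have D: "y \<in> D" "z \<in> D" using y z N by (auto intro!: v_large simp del: of_nat_mult)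
    obtain ly lz where l: "ly \<in> length_set (submon Q D) y" "lz \<in> length_set (submon Q D) z"
      using length_set_nonempty[OF D(1)] length_set_nonempty[OF D(2)] by auto
    have "int ly \<le> int \<alpha>" "int lz \<le> int \<alpha>"
      using length_le_v[OF D(1) l(1) rs(1)] length_le_v[OF D(2) l(2) rs(2)] y z rs by auto
    then have small: "ly + lz \<le> 2 * \<alpha>" by simp
    let ?w = "inv (x [^] N) \<otimes> (y \<otimes> z)"
    have "v t ?w = int \<alpha>" if "t \<in> P" for t
      using that x y z by (auto simp: v_mult v_inv v_pow)
    then have wD: "?w \<in> D" using x y z by (intro v_large) auto
    obtain lw where lw: "lw \<in> length_set (submon Q D) ?w" using length_set_nonempty[OF wD] by auto
    have eq: "x [^] N \<otimes> ?w = y \<otimes> z" using x y z by (simp add: cancel_inv)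
    have "N * lx \<in> length_set (submon Q D) (x [^] N)"
      using DM.length_set_pow[of x lx N] lx xD by (simp add: pow_submon)
    then have "N * lx + lw \<in> length_set (submon Q D) (y \<otimes> z)"
      using DM.length_set_add[of "x [^] N" ?w] lw wD xD eq pow_closed_submonoid[OF submonoid_D xD] by simp
    moreover have "ly + lz \<in> length_set (submon Q D) (y \<otimes> z)" using DM.length_set_add[of y z] D l by simp
    ultimately have "real (N * lx + lw) \<le> \<rho> * real (ly + lz)"
      using bd[of "y \<otimes> z"] D unfolding ratio_bounded_def by blast
    moreover have "\<rho> * real (ly + lz) \<le> \<rho> * (2 * real \<alpha>)" using small \<rho> by (intro mult_left_mono) linarith+
    moreover have "N \<le> N * lx + lw" using lx1 by (simp add: trans_le_add1)
    ultimately show ?thesis by linarith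
  qed
  then have "real (nat \<lceil>\<rho> * (2 * real \<alpha>)\<rceil> + 1) \<le> \<rho> * (2 * real \<alpha>)" by blast
  then show False by linarith
qed

text \<open>Choose \<open>k\<close> such that all elements of valuation at least \<open>k\<close> lie in \<open>D\<close> but some element
  \<open>z\<close> of valuation at least \<open>k - 1\<close> does not; multiplication by a non-unit of \<open>D\<close> raises all
  valuations by at least one.\<close>

lemma exists_multiplier_into_D:
  "\<exists>z\<in>carrier Q. z \<notin> D \<and> (\<forall>x\<in>D. inv x \<notin> D \<longrightarrow> z \<otimes> x \<in> D)"
proof -
  (* The shift by one lets the search start at valuation -1, where the inverse of a prime is outside D. *)
  define pr where "pr = (\<lambda>k::nat. \<forall>z\<in>carrier Q. (\<forall>r\<in>P. int k \<le> v r z + 1) \<longrightarrow> z \<in> D)"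
  have "pr (\<alpha> + 1)" unfolding pr_def using v_large by auto
  have "\<not> pr 0"
  proof
    assume p: "pr 0"
    obtain r where r: "r \<in> P" using P_nonempty by auto
    then have rc: "r \<in> carrier Q" using P_closed by auto
    have "inv r \<in> D" using p rc r unfolding pr_def by (auto simp: v_inv v_prime)
    then show False using v_nonneg[of "inv r" r] r rc by (simp add: v_inv v_prime)
  qed
  obtain k where k: "pr (Suc k)" "\<not> pr k"
  proof -
    have "\<exists>k. \<not> pr k \<and> pr (Suc k)"
    proof (rule ccontr)
      assume n: "\<nexists>k. \<not> pr k \<and> pr (Suc k)"
      have "\<not> pr n" for n by (induction n) (use n \<open>\<not> pr 0\<close> in auto)
      then show False using \<open>pr (\<alpha> + 1)\<close> by blast
    qed
    then show ?thesis using that by blast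
  qed
  then obtain z where z: "z \<in> carrier Q" "\<forall>r\<in>P. int k \<le> v r z + 1" "z \<notin> D" by (auto simp: pr_def)
  have "z \<otimes> x \<in> D" if x: "x \<in> D" "inv x \<notin> D" for x
  proof -
    have "int (Suc k) \<le> v r (z \<otimes> x) + 1" if "r \<in> P" for r
      using z x v_nonunit[OF x that] that v_mult[OF that, of z x] by fastforce
    then show ?thesis using k(1) z(1) x unfolding pr_def by auto
  qed
  then show ?thesis using z by blast
qed

lemma multiple_of_power_in_D:
  assumes "s \<in> D" "inv s \<notin> D" "x \<in> carrier Q"
  shows "\<exists>n::nat. \<forall>m\<ge>n. s [^] m \<otimes> x \<in> D"
proof -
  define n where "n = nat (int \<alpha> + (\<Sum>r\<in>P. \<bar>v r x\<bar>))"
  have "s [^] m \<otimes> x \<in> D" if m: "n \<le> m" for m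
  proof (rule v_large)
    fix r assume r: "r \<in> P"
    have "\<bar>v r x\<bar> \<le> (\<Sum>r\<in>P. \<bar>v r x\<bar>)" using r finite_P by (intro member_le_sum) auto
    then have "int \<alpha> - v r x \<le> int m" using m unfolding n_def by linarith
    moreover have "int m * 1 \<le> int m * v r s" using v_nonunit[OF assms(1,2) r] by (intro mult_left_mono) auto
    ultimately show "int \<alpha> \<le> v r (s [^] m \<otimes> x)" using r assms by (simp add: v_mult v_pow)
  qed (use assms in auto)
  then show ?thesis by blast
qed

text \<open>Otherwise \<open>r ^ \<alpha>\<close> splits off, and the cofactor still has valuation at least \<open>\<alpha>\<close>.\<close>

lemma atom_v_bound:
  assumes P: "P = {r}" and u: "u \<in> D" "irreducible (submon Q D) u"
  shows "v r u < 2 * int \<alpha>"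
proof (rule ccontr)
  assume l: "\<not> v r u < 2 * int \<alpha>"
  have r: "r \<in> P" "r \<in> carrier Q" using P P_closed by auto
  have 1: "r [^] \<alpha> \<in> D" using r P by (intro v_large) (auto simp: v_pow v_prime)
  have 2: "inv (r [^] \<alpha>) \<otimes> u \<in> D" using r P u l by (intro v_large) (auto simp: v_mult v_inv v_pow v_prime)
  have "u = r [^] \<alpha> \<otimes> (inv (r [^] \<alpha>) \<otimes> u)" using r u by (simp add: cancel_inv)
  then have "r [^] \<alpha> \<in> Units (submon Q D) \<or> inv (r [^] \<alpha>) \<otimes> u \<in> Units (submon Q D)"
    using u 1 2 DM.irreducible_iff_split[of u] by auto
  then have "v r (r [^] \<alpha>) = 0 \<or> v r (inv (r [^] \<alpha>) \<otimes> u) = 0"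
    using v_Unit[OF 1 _ r(1)] v_Unit[OF 2 _ r(1)] by (simp only: Units_submon[OF submonoid_D]) blast
  moreover have "v r (r [^] \<alpha>) = int \<alpha>" using r by (simp add: v_pow v_prime)
  moreover have "v r (inv (r [^] \<alpha>) \<otimes> u) = v r u - int \<alpha>" using r u by (simp add: v_mult v_inv v_pow v_prime)
  ultimately show False using l \<alpha>_pos by linarith
qed

lemma v_le_length:
  assumes P: "P = {r}" and N: "\<And>u. u \<in> D \<Longrightarrow> irreducible (submon Q D) u \<Longrightarrow> v r u \<le> N"
    and "a \<in> D" "n \<in> length_set (submon Q D) a"
  shows "v r a \<le> int n * N"
  using assms(3,4)
proof (induction n arbitrary: a)
  case 0
  then have "a \<in> Units (submon Q D)" by simp
  then show ?case using v_Unit P by (simp add: Units_submon[OF submonoid_D])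
next
  case (Suc n)
  obtain u y where uy: "u \<in> D" "y \<in> D" "irreducible (submon Q D) u"
    "n \<in> length_set (submon Q D) y" "a = u \<otimes> y"
    using DM.Suc_in_length_set[of a n] Suc.prems by auto
  have "v r y \<le> int n * N" using Suc uy by blast
  then show ?case using uy N[of u] v_mult[of r u y] P by (simp add: algebra_simps)
qed

lemma le_v_of_length:
  assumes P: "P = {r}" and N: "\<And>x. x \<in> D \<Longrightarrow> inv x \<notin> D \<Longrightarrow> N \<le> v r x"
    and "a \<in> D" "n \<in> length_set (submon Q D) a"
  shows "int n * N \<le> v r a"
  using assms(3,4)
proof (induction n arbitrary: a)
  case 0
  then show ?case using v_nonneg P by simp
next
  case (Suc n)
  obtain u y where uy: "u \<in> D" "y \<in> D" "irreducible (submon Q D) u"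
    "n \<in> length_set (submon Q D) y" "a = u \<otimes> y"
    using DM.Suc_in_length_set[of a n] Suc.prems by auto
  have "N \<le> v r u" using uy N[of u] by (auto simp: irreducible_def Units_submon[OF submonoid_D])
  moreover have "int n * N \<le> v r y" using Suc uy by blast
  ultimately show ?case using uy v_mult[of r u y] P by (simp add: algebra_simps)
qed

lemma rank_one_bounded:
  assumes P: "P = {r}" and a: "a \<in> D"
  shows "ratio_bounded (2 * real \<alpha>) (length_set (submon Q D) a)"
  unfolding ratio_bounded_def
proof (intro ballI)
  fix m n assume mn: "m \<in> length_set (submon Q D) a" "n \<in> length_set (submon Q D) a"
  have "int m \<le> v r a" using length_le_v[OF a mn(1)] P by simp
  also have "\<dots> \<le> int n * (2 * int \<alpha>)"
    using atom_v_bound[OF P] by (intro v_le_length[OF P _ a mn(2)]) fastforce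
  finally have "int m \<le> int (n * (2 * \<alpha>))" by simp
  then have "m \<le> n * (2 * \<alpha>)" by (simp only: of_nat_le_iff)
  then have "real m \<le> real (n * (2 * \<alpha>))" by (simp only: of_nat_le_iff)
  then show "real m \<le> 2 * real \<alpha> * real n" by (simp add: mult_ac)
qed

text \<open>An atom \<open>x\<close> of least and an atom \<open>u0\<close> of largest valuation have powers that differ by an
  element of valuation zero, and a power of the latter is a unit; so the ratio of the two
  valuations, which bounds the elasticity, is attained.\<close>

lemma rank_one_torsion_accepted:
  assumes P: "P = {r}"
    and tors: "\<And>e. e \<in> carrier Q \<Longrightarrow> v r e = 0 \<Longrightarrow> \<exists>n::nat. 0 < n \<and> e [^] n \<in> D"
  shows "accepted_elasticity (submon Q D)"
proof -
  have r: "r \<in> P" "r \<in> carrier Q" using P P_closed by auto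
  let ?NU = "{x \<in> D. inv x \<notin> D}"
  have ra: "r [^] \<alpha> \<in> D" using r P by (intro v_large) (auto simp: v_pow v_prime)
  have ranu: "r [^] \<alpha> \<in> ?NU" using ra Unit_iff[OF ra r(1)] r \<alpha>_pos by (simp add: v_pow v_prime)
  define x where "x = (ARG_MIN (\<lambda>x. nat (v r x)) x. x \<in> ?NU)"
  have x: "x \<in> ?NU" "\<And>y. y \<in> ?NU \<Longrightarrow> nat (v r x) \<le> nat (v r y)"
    unfolding x_def using arg_min_natI[of "\<lambda>x. x \<in> ?NU" "r [^] \<alpha>"] ranu
      arg_min_nat_le[of "\<lambda>x. x \<in> ?NU" _ "\<lambda>x. nat (v r x)"] by blast+
  have vx: "1 \<le> v r x" using x(1) v_nonunit r by auto
  have min: "v r x \<le> v r y" if "y \<in> D" "inv y \<notin> D" for y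
    using x(2)[of y] that vx v_nonneg[OF that(1) r(1)] by (simp add: nat_le_iff)
  have xirr: "irreducible (submon Q D) x"
  proof -
    have "\<forall>b\<in>D. \<forall>c\<in>D. x = b \<otimes> c \<longrightarrow> inv b \<in> D \<or> inv c \<in> D"
    proof (intro ballI impI)
      fix b c assume bc: "b \<in> D" "c \<in> D" "x = b \<otimes> c"
      show "inv b \<in> D \<or> inv c \<in> D"
      proof (rule ccontr)
        assume "\<not> (inv b \<in> D \<or> inv c \<in> D)"
        then have "v r x \<le> v r b" "1 \<le> v r c" using min bc v_nonunit r by auto
        then show False using bc v_mult[OF r(1), of b c] by simp
      qed
    qed
    then show ?thesis using x(1) DM.irreducible_iff_split[of x] by (simp add: Units_submon[OF submonoid_D])
  qed
  let ?A = "{u \<in> D. irreducible (submon Q D) u}"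
  obtain u0 where w0: "u0 \<in> ?A" "\<And>y. y \<in> ?A \<Longrightarrow> nat (v r y) \<le> nat (v r u0)"
  proof -
    let ?u = "ARG_MAX (\<lambda>x. nat (v r x)) x. x \<in> ?A"
    have b: "\<forall>y. y \<in> ?A \<longrightarrow> nat (v r y) < 2 * \<alpha>"
    proof (intro allI impI)
      fix y assume "y \<in> ?A"
      then have "v r y < 2 * int \<alpha>" using atom_v_bound[OF P, of y] by simp
      then show "nat (v r y) < 2 * \<alpha>" using \<alpha>_pos by linarith
    qed
    have "?u \<in> ?A \<and> (\<forall>y. y \<in> ?A \<longrightarrow> nat (v r y) \<le> nat (v r ?u))"
      using arg_max_nat_lemma[of "\<lambda>x. x \<in> ?A" x "\<lambda>x. nat (v r x)", OF _ b] x(1) xirr by blast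
    then show ?thesis using that by blast
  qed
  have max: "v r y \<le> v r u0" if "y \<in> D" "irreducible (submon Q D) y" for y
    using w0(2)[of y] that v_nonneg[OF that(1) r(1)] v_nonneg[of u0 r] w0(1) r by simp
  define n where "n = nat (v r x)"
  define N where "N = nat (v r u0)"
  have nN: "v r x = int n" "v r u0 = int N" "0 < n" "n \<le> N"
    using vx max[of x] xirr x(1) by (auto simp: n_def N_def)
  have u0: "u0 \<in> D" "irreducible (submon Q D) u0" using w0 by auto
  let ?\<rho> = "real N / real n"
  have bd: "ratio_bounded ?\<rho> (length_set (submon Q D) a)" if a: "a \<in> D" for a
    unfolding ratio_bounded_def
  proof (intro ballI)
    fix k l assume kl: "k \<in> length_set (submon Q D) a" "l \<in> length_set (submon Q D) a"
    have "int k * int n \<le> v r a" using le_v_of_length[OF P _ a kl(1), of "int n"] min nN by simp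
    also have "\<dots> \<le> int l * int N" using v_le_length[OF P _ a kl(2), of "int N"] max nN by simp
    finally have "int (k * n) \<le> int (l * N)" by simp
    then have "k * n \<le> l * N" by (simp only: of_nat_le_iff)
    then have "real (k * n) \<le> real (l * N)" by (simp only: of_nat_le_iff)
    then have "real k * real n \<le> real l * real N" by simp
    then show "real k \<le> ?\<rho> * real l" using nN(3) by (simp add: field_simps)
  qed
  let ?e = "x [^] N \<otimes> inv (u0 [^] n)"
  have xc: "x \<in> D" "x \<in> carrier Q" "u0 \<in> carrier Q" using x(1) u0 by auto
  have ec: "?e \<in> carrier Q" "v r ?e = 0" using xc nN r by (auto simp: v_mult v_inv v_pow)
  obtain k where k: "0 < k" "?e [^] (k::nat) \<in> D" using tors[OF ec] by blast
  have eu: "?e [^] k \<in> Units (submon Q D)"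
    using k(2) Unit_iff[OF k(2) r(1)] ec r by (simp add: Units_submon[OF submonoid_D] v_pow)
  have "x [^] N = u0 [^] n \<otimes> ?e" using xc by (simp add: cancel_inv)
  then have "(x [^] N) [^] k = (u0 [^] n) [^] k \<otimes> ?e [^] k"
    using nat_pow_distrib[of "u0 [^] n" ?e k] xc ec by simp
  then have eq: "x [^] (N * k) = u0 [^] (n * k) \<otimes> ?e [^] k" using xc by (simp add: nat_pow_pow)
  have "N * k * 1 \<in> length_set (submon Q D) (x [^] (N * k))"
    using DM.length_set_pow[of x 1 "N * k"] DM.one_in_length_set[of x] xc xirr by (simp add: pow_submon)
  moreover have "n * k * 1 \<in> length_set (submon Q D) (u0 [^] (n * k))"
    using DM.length_set_pow[of u0 1 "n * k"] DM.one_in_length_set[of u0] u0 by (simp add: pow_submon)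
  moreover have "length_set (submon Q D) (x [^] (N * k)) = length_set (submon Q D) (u0 [^] (n * k))"
    unfolding eq using DM.length_set_mult_Unit[OF _ eu, of "u0 [^] (n * k)"] pow_closed_submonoid[OF submonoid_D u0(1)]
    by simp
  ultimately have "ratio_attained ?\<rho> (length_set (submon Q D) (x [^] (N * k)))"
    using nN(3) k(1) by (intro ratio_attainedI[of "N * k" _ "n * k"]) auto
  then show ?thesis
    using DM.accepted_elasticityI[of ?\<rho>] length_set_nonempty bd nN pow_closed_submonoid[OF submonoid_D xc(1)] by auto
qed

end

section \<open>Divisorial ideals of a weakly Krull monoid\<close>

context comm_group
begin

lemma inv_chain:
  assumes "a \<in> carrier G" "b \<in> carrier G" "x \<in> carrier G"
  shows "(inv a \<otimes> b) \<otimes> (inv b \<otimes> x) = inv a \<otimes> x"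
  using assms by (simp add: m_assoc cancel_inv)

lemma inv_interchange:
  assumes "a \<in> carrier G" "b \<in> carrier G" "x \<in> carrier G" "y \<in> carrier G"
  shows "(inv a \<otimes> x) \<otimes> (inv b \<otimes> y) = inv (a \<otimes> b) \<otimes> (x \<otimes> y)"
  using assms by (simp add: inv_mult' m_ac)

lemma inv_quotient:
  assumes "a \<in> carrier G" "x \<in> carrier G"
  shows "inv (inv a \<otimes> x) = inv x \<otimes> a"
  using assms by (simp add: inv_mult' m_comm)

end

text \<open>A weakly Krull monoid is given by its localizations \<open>D p\<close>, which are finitely primary with
  valuations \<open>v p r\<close>. The index set plays the role of the set of minimal primes, and
  \<open>separated\<close> is the form in which their minimality is used.\<close>

locale weakly_Krull_family = comm_group Q for Q :: "('a, 'b) monoid_scheme" (structure) +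
  fixes H :: "'a set" and X :: "'i set" and D :: "'i \<Rightarrow> 'a set"
    and P :: "'i \<Rightarrow> 'a set" and v :: "'i \<Rightarrow> 'a \<Rightarrow> 'a \<Rightarrow> int" and \<alpha> :: "'i \<Rightarrow> nat"
  assumes quotients: "x \<in> carrier Q \<Longrightarrow> \<exists>a\<in>H. \<exists>b\<in>H. x = a \<otimes> inv b"
    and primary: "p \<in> X \<Longrightarrow> primary_valuations Q (D p) (P p) (v p) (\<alpha> p)"
    and H_eq: "H = {x \<in> carrier Q. \<forall>p\<in>X. x \<in> D p}"
    and finite_character: "a \<in> H \<Longrightarrow> finite {p \<in> X. inv a \<notin> D p}"
    and separated: "p \<in> X \<Longrightarrow> q \<in> X \<Longrightarrow> p \<noteq> q \<Longrightarrow> \<exists>s\<in>H. inv s \<in> D p \<and> inv s \<notin> D q"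
begin

definition U :: "'i \<Rightarrow> 'a set" where "U p = {x \<in> D p. inv x \<in> D p}"

lemma submonoid_D: "p \<in> X \<Longrightarrow> submonoid (D p) Q"
  using primary primary_valuations.submonoid_D by blast

lemma DM: "p \<in> X \<Longrightarrow> comm_monoid_cancel (submon Q (D p))"
  by (rule comm_monoid_cancel_submon[OF submonoid_D])

lemma Units_D: "p \<in> X \<Longrightarrow> Units (submon Q (D p)) = U p"
  by (simp add: Units_submon[OF submonoid_D] U_def)

lemma D_carrier: "p \<in> X \<Longrightarrow> x \<in> D p \<Longrightarrow> x \<in> carrier Q"
  using submonoid.subset[OF submonoid_D] by blast

lemma D_mult: "p \<in> X \<Longrightarrow> x \<in> D p \<Longrightarrow> y \<in> D p \<Longrightarrow> x \<otimes> y \<in> D p"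
  using submonoid.m_closed[OF submonoid_D] by blast

lemma D_one: "p \<in> X \<Longrightarrow> \<one> \<in> D p"
  using submonoid.one_closed[OF submonoid_D] by blast

lemma D_pow: "p \<in> X \<Longrightarrow> x \<in> D p \<Longrightarrow> x [^] (n::nat) \<in> D p"
  by (rule pow_closed_submonoid[OF submonoid_D])

lemma U_D: "x \<in> U p \<Longrightarrow> x \<in> D p" by (simp add: U_def)

lemma U_carrier: "p \<in> X \<Longrightarrow> x \<in> U p \<Longrightarrow> x \<in> carrier Q" using U_D D_carrier by blast

lemma U_one: "p \<in> X \<Longrightarrow> \<one> \<in> U p" by (simp add: U_def D_one)

lemma U_mult: "p \<in> X \<Longrightarrow> x \<in> U p \<Longrightarrow> y \<in> U p \<Longrightarrow> x \<otimes> y \<in> U p"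
  using D_carrier[of p x] D_carrier[of p y] by (simp add: U_def D_mult inv_mult')

lemma U_inv: "p \<in> X \<Longrightarrow> x \<in> U p \<Longrightarrow> inv x \<in> U p"
  using D_carrier[of p x] by (simp add: U_def)

lemma U_cancel:
  assumes "p \<in> X" "x \<in> carrier Q" "u \<in> U p"
  shows "u \<otimes> x \<in> D p \<longleftrightarrow> x \<in> D p" "u \<otimes> x \<in> U p \<longleftrightarrow> x \<in> U p"
proof -
  have uc: "u \<in> carrier Q" using U_carrier assms by blast
  have e: "inv u \<otimes> (u \<otimes> x) = x" using assms uc by (simp add: cancel_inv)
  show "u \<otimes> x \<in> D p \<longleftrightarrow> x \<in> D p"
    using D_mult[OF assms(1), of u x] D_mult[OF assms(1), of "inv u" "u \<otimes> x"] U_D[OF assms(3)]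
      U_D[OF U_inv[OF assms(1,3)]] e by auto
  show "u \<otimes> x \<in> U p \<longleftrightarrow> x \<in> U p"
    using U_mult[OF assms(1), of u x] U_mult[OF assms(1), of "inv u" "u \<otimes> x"] assms(3)
      U_inv[OF assms(1,3)] e by auto
qed

lemma U_factor:
  assumes "p \<in> X" "x \<in> D p" "y \<in> D p" "x \<otimes> y \<in> U p"
  shows "x \<in> U p" "y \<in> U p"
proof -
  have c: "x \<in> carrier Q" "y \<in> carrier Q" using D_carrier assms by auto
  have i: "inv (x \<otimes> y) \<in> D p" using assms(4) by (simp add: U_def)
  have "inv x = inv (x \<otimes> y) \<otimes> y" "inv y = inv (x \<otimes> y) \<otimes> x"
    using c by (simp_all add: inv_mult' m_assoc cancel_inv m_comm[of "inv x"])
  then have "inv x \<in> D p" "inv y \<in> D p" using D_mult[OF assms(1) i] assms(2,3) by metis+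
  then show "x \<in> U p" "y \<in> U p" using assms by (simp_all add: U_def)
qed

lemma H_D: "p \<in> X \<Longrightarrow> x \<in> H \<Longrightarrow> x \<in> D p" using H_eq by blast

lemma H_carrier: "x \<in> H \<Longrightarrow> x \<in> carrier Q" using H_eq by blast

lemma submonoid_H: "submonoid H Q"
proof
  show "H \<subseteq> carrier Q" using H_carrier by blast
  show "\<one> \<in> H" using H_eq D_one by simp
  show "x \<otimes> y \<in> H" if "x \<in> H" "y \<in> H" for x y
    using that H_eq D_mult by simp
qed

lemma H_mult: "x \<in> H \<Longrightarrow> y \<in> H \<Longrightarrow> x \<otimes> y \<in> H" using submonoid.m_closed[OF submonoid_H] .

lemma finite_nonunits:
  assumes "x \<in> carrier Q"
  shows "finite {p \<in> X. x \<notin> U p}"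
proof -
  obtain a b where ab: "a \<in> H" "b \<in> H" "x = a \<otimes> inv b" using quotients[OF assms] by auto
  have "{p \<in> X. x \<notin> U p} \<subseteq> {p \<in> X. inv a \<notin> D p} \<union> {p \<in> X. inv b \<notin> D p}"
  proof
    fix p assume p: "p \<in> {p \<in> X. x \<notin> U p}"
    then have "a \<notin> U p \<or> b \<notin> U p" using ab U_mult[of p a "inv b"] U_inv[of p b] by auto
    then show "p \<in> {p \<in> X. inv a \<notin> D p} \<union> {p \<in> X. inv b \<notin> D p}"
      using p ab H_D by (auto simp: U_def)
  qed
  then show ?thesis using finite_character[OF ab(1)] finite_character[OF ab(2)] finite_subset by blast
qed

text \<open>Families of local generators; they form a group under pointwise multiplication, and each
  gives an ideal.\<close>

definition families :: "('i \<Rightarrow> 'a) set" where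
  "families = {a. (\<forall>p\<in>X. a p \<in> carrier Q) \<and> finite {p \<in> X. a p \<notin> U p}}"

definition ideal :: "('i \<Rightarrow> 'a) \<Rightarrow> 'a set" where
  "ideal a = {x \<in> carrier Q. \<forall>p\<in>X. inv (a p) \<otimes> x \<in> D p}"

lemma families_carrier: "a \<in> families \<Longrightarrow> p \<in> X \<Longrightarrow> a p \<in> carrier Q" by (simp add: families_def)

lemma families_finite: "a \<in> families \<Longrightarrow> finite {p \<in> X. a p \<notin> U p}" by (simp add: families_def)

lemma families_mult:
  assumes "a \<in> families" "b \<in> families"
  shows "(\<lambda>p. a p \<otimes> b p) \<in> families"
proof -
  have "{p \<in> X. a p \<otimes> b p \<notin> U p} \<subseteq> {p \<in> X. a p \<notin> U p} \<union> {p \<in> X. b p \<notin> U p}"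
    using U_mult by auto
  then have "finite {p \<in> X. a p \<otimes> b p \<notin> U p}"
    using families_finite[OF assms(1)] families_finite[OF assms(2)] by (meson finite_UnI finite_subset)
  then show ?thesis using assms by (simp add: families_def)
qed

lemma families_inv:
  assumes "a \<in> families"
  shows "(\<lambda>p. inv (a p)) \<in> families"
proof -
  have "{p \<in> X. inv (a p) \<notin> U p} \<subseteq> {p \<in> X. a p \<notin> U p}" using U_inv by auto
  then have "finite {p \<in> X. inv (a p) \<notin> U p}" using families_finite[OF assms] finite_subset by blast
  then show ?thesis using assms by (simp add: families_def)
qed

lemma families_const: "x \<in> carrier Q \<Longrightarrow> (\<lambda>p. x) \<in> families"
  using finite_nonunits by (simp add: families_def)

lemma families_update:
  assumes "a \<in> families" "x \<in> carrier Q"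
  shows "a(p := x) \<in> families"
proof -
  have "{q \<in> X. (a(p := x)) q \<notin> U q} \<subseteq> insert p {q \<in> X. a q \<notin> U q}" by auto
  then have "finite {q \<in> X. (a(p := x)) q \<notin> U q}"
    using families_finite[OF assms(1)] by (meson finite_insert finite_subset)
  then show ?thesis using assms by (simp add: families_def)
qed

text \<open>Approximation: for each of the finitely many places \<open>q\<close> where the required membership fails,
  an element that is a unit at \<open>p\<close> and a non-unit at \<open>q\<close> has a power large enough to enforce it.\<close>

lemma approximation:
  assumes p: "p \<in> X" and x: "x \<in> carrier Q" and b: "b \<in> families"
  shows "\<exists>s\<in>H. inv s \<in> D p \<and> (\<forall>q\<in>X. q \<noteq> p \<longrightarrow> inv (b q) \<otimes> (s \<otimes> x) \<in> D q)"
proof -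
  let ?B = "{q \<in> X. q \<noteq> p \<and> inv (b q) \<otimes> x \<notin> D q}"
  have "?B \<subseteq> {q \<in> X. x \<notin> U q} \<union> {q \<in> X. b q \<notin> U q}"
    using U_D U_mult U_inv by blast
  then have fin: "finite ?B" using finite_nonunits[OF x] families_finite[OF b] finite_subset by blast
  have step: "\<exists>s\<in>H. inv s \<in> D p \<and> (\<forall>q\<in>S. inv (b q) \<otimes> (s \<otimes> x) \<in> D q)"
    if "finite S" "S \<subseteq> X - {p}" for S
    using that
  proof (induction S)
    case empty
    then show ?case using submonoid.one_closed[OF submonoid_H] D_one[OF p] by (intro bexI[of _ \<one>]) auto
  next
    case (insert q S)
    then obtain s where s: "s \<in> H" "inv s \<in> D p" "\<forall>q\<in>S. inv (b q) \<otimes> (s \<otimes> x) \<in> D q" by auto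
    have q: "q \<in> X" "q \<noteq> p" using insert by auto
    obtain t where t: "t \<in> H" "inv t \<in> D p" "inv t \<notin> D q" using separated[OF p q(1)] q(2) by blast
    have c: "b q \<in> carrier Q" "s \<in> carrier Q" "t \<in> carrier Q"
      using families_carrier[OF b q(1)] H_carrier s t by auto
    obtain n :: nat where n: "\<And>m. m \<ge> n \<Longrightarrow> t [^] m \<otimes> (inv (b q) \<otimes> (s \<otimes> x)) \<in> D q"
      using primary_valuations.multiple_of_power_in_D[OF primary[OF q(1)] H_D[OF q(1) t(1)] t(3), of "inv (b q) \<otimes> (s \<otimes> x)"]
        c x by auto
    have tn: "t [^] n \<in> H" using pow_closed_submonoid[OF submonoid_H t(1)] .
    have "inv (t [^] n \<otimes> s) = (inv t) [^] n \<otimes> inv s" using c by (simp add: inv_mult' nat_pow_inv)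
    moreover have "(inv t) [^] n \<in> D p" using D_pow[OF p t(2)] .
    ultimately have 1: "inv (t [^] n \<otimes> s) \<in> D p" using D_mult[OF p] s(2) by simp
    have 2: "inv (b q') \<otimes> (t [^] n \<otimes> s \<otimes> x) \<in> D q'" if q': "q' \<in> insert q S" for q'
    proof -
      have X: "q' \<in> X" using insert.prems q' by auto
      have c': "b q' \<in> carrier Q" using families_carrier[OF b X] .
      have e: "inv (b q') \<otimes> (t [^] n \<otimes> s \<otimes> x) = t [^] n \<otimes> (inv (b q') \<otimes> (s \<otimes> x))"
        using c c' x by (simp add: m_ac)
      show ?thesis
      proof (cases "q' = q")
        case True
        then show ?thesis using e n[of n] by simp
      next
        case False
        then show ?thesis unfolding e using D_mult[OF X H_D[OF X tn]] s(3) q' by auto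
      qed
    qed
    show ?case using 1 2 H_mult[OF tn s(1)] by blast
  qed
  have "?B \<subseteq> X - {p}" by auto
  then obtain s where s: "s \<in> H" "inv s \<in> D p" "\<forall>q\<in>?B. inv (b q) \<otimes> (s \<otimes> x) \<in> D q"
    using step[OF fin] by blast
  have "inv (b q) \<otimes> (s \<otimes> x) \<in> D q" if q: "q \<in> X" "q \<noteq> p" for q
  proof (cases "q \<in> ?B")
    case False
    then have "s \<otimes> (inv (b q) \<otimes> x) \<in> D q" using D_mult[OF q(1) H_D[OF q(1) s(1)]] q by auto
    moreover have "s \<otimes> (inv (b q) \<otimes> x) = inv (b q) \<otimes> (s \<otimes> x)"
      using families_carrier[OF b q(1)] H_carrier[OF s(1)] x by (simp add: m_lcomm)
    ultimately show ?thesis by simp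
  qed (use s in blast)
  then show ?thesis using s by blast
qed

lemma ideal_carrier: "x \<in> ideal a \<Longrightarrow> x \<in> carrier Q" by (simp add: ideal_def)

lemma ideal_local: "x \<in> ideal a \<Longrightarrow> p \<in> X \<Longrightarrow> inv (a p) \<otimes> x \<in> D p" by (simp add: ideal_def)

text \<open>Approximation multiplies \<open>a p\<close> into the ideal by a factor that is a unit at \<open>p\<close>.\<close>

lemma ideal_local_generator:
  assumes "a \<in> families" "p \<in> X"
  obtains x where "x \<in> ideal a" "inv (a p) \<otimes> x \<in> U p"
proof -
  have c: "a p \<in> carrier Q" using families_carrier assms by blast
  obtain s where s: "s \<in> H" "inv s \<in> D p" "\<forall>q\<in>X. q \<noteq> p \<longrightarrow> inv (a q) \<otimes> (s \<otimes> a p) \<in> D q"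
    using approximation[OF assms(2) c assms(1)] by blast
  have sc: "s \<in> carrier Q" using H_carrier s by blast
  have e: "inv (a p) \<otimes> (s \<otimes> a p) = s" using c sc by (simp add: m_comm[of s] cancel_inv)
  have sD: "s \<in> D p" using H_D assms s by blast
  have "inv (a q) \<otimes> (s \<otimes> a p) \<in> D q" if "q \<in> X" for q
    using s(3) that e sD by (cases "q = p") auto
  then have "s \<otimes> a p \<in> ideal a" using sc c by (simp add: ideal_def)
  then show ?thesis using that[of "s \<otimes> a p"] e s sD by (simp add: U_def)
qed

lemma ideal_nonempty:
  assumes "a \<in> families"
  obtains x where "x \<in> ideal a"
proof (cases "X = {}")
  case True
  then have "\<one> \<in> ideal a" unfolding ideal_def by blast
  then show ?thesis using that by blast
next
  case False
  then show ?thesis using ideal_local_generator[OF assms] that by blast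
qed

lemma ideal_subset_iff:
  assumes "a \<in> families" "b \<in> families"
  shows "ideal a \<subseteq> ideal b \<longleftrightarrow> (\<forall>p\<in>X. inv (b p) \<otimes> a p \<in> D p)"
proof
  assume sub: "ideal a \<subseteq> ideal b"
  show "\<forall>p\<in>X. inv (b p) \<otimes> a p \<in> D p"
  proof
    fix p assume p: "p \<in> X"
    obtain x where x: "x \<in> ideal a" "inv (a p) \<otimes> x \<in> U p" using ideal_local_generator[OF assms(1) p] .
    have c: "a p \<in> carrier Q" "b p \<in> carrier Q" "x \<in> carrier Q"
      using families_carrier assms p ideal_carrier x by auto
    have "inv (b p) \<otimes> x \<in> D p" using sub x ideal_local p by blast
    moreover have "inv (b p) \<otimes> x = (inv (a p) \<otimes> x) \<otimes> (inv (b p) \<otimes> a p)"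
      using inv_chain[of "b p" "a p" x] c by (simp add: m_comm)
    ultimately show "inv (b p) \<otimes> a p \<in> D p" using U_cancel(1)[OF p _ x(2)] c by simp
  qed
next
  assume r: "\<forall>p\<in>X. inv (b p) \<otimes> a p \<in> D p"
  show "ideal a \<subseteq> ideal b"
  proof
    fix x assume x: "x \<in> ideal a"
    have "inv (b p) \<otimes> x \<in> D p" if p: "p \<in> X" for p
      using inv_chain[of "b p" "a p" x] families_carrier[OF assms(1) p] families_carrier[OF assms(2) p]
        ideal_carrier[OF x] D_mult[OF p r[rule_format, OF p] ideal_local[OF x p]] by simp
    then show "x \<in> ideal b" using ideal_carrier[OF x] by (simp add: ideal_def)
  qed
qed

lemma ideal_eq_iff:
  assumes "a \<in> families" "b \<in> families"
  shows "ideal a = ideal b \<longleftrightarrow> (\<forall>p\<in>X. inv (a p) \<otimes> b p \<in> U p)"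
proof -
  have "inv (inv (a p) \<otimes> b p) = inv (b p) \<otimes> a p" if "p \<in> X" for p
    using inv_quotient families_carrier assms that by blast
  then show ?thesis
    using ideal_subset_iff[OF assms] ideal_subset_iff[OF assms(2,1)] by (auto simp: U_def)
qed

lemma ideal_one: "ideal (\<lambda>p. \<one>) = H"
  using H_eq by (auto simp: ideal_def)

lemma ideal_subset_H_iff: "a \<in> families \<Longrightarrow> ideal a \<subseteq> H \<longleftrightarrow> (\<forall>p\<in>X. a p \<in> D p)"
  using ideal_subset_iff[of a "\<lambda>p. \<one>"] families_const[of \<one>] families_carrier[of a]
  by (simp add: ideal_one)

lemma ideal_const:
  assumes "x \<in> carrier Q"
  shows "ideal (\<lambda>p. x) = x <# H"
proof (intro equalityI subsetI)
  fix y assume y: "y \<in> ideal (\<lambda>p. x)"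
  then have "inv x \<otimes> y \<in> H" using assms H_eq by (simp add: ideal_def)
  moreover have "y = x \<otimes> (inv x \<otimes> y)" using y assms by (simp add: ideal_def cancel_inv)
  ultimately show "y \<in> x <# H" by (auto simp: l_coset_def)
next
  fix y assume "y \<in> x <# H"
  then obtain h where h: "h \<in> H" "y = x \<otimes> h" by (auto simp: l_coset_def)
  then show "y \<in> ideal (\<lambda>p. x)" using assms H_carrier[OF h(1)] H_D by (simp add: ideal_def cancel_inv)
qed

text \<open>Membership in the colon ideal is tested at \<open>p\<close> on elements of the two ideals that generate them
  at \<open>p\<close>.\<close>

lemma colon_ideal_mult:
  assumes "a \<in> families" "b \<in> families"
  shows "colon Q H (ideal a <#> ideal b) = ideal (\<lambda>p. inv (a p \<otimes> b p))"
proof (intro equalityI subsetI)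
  fix x assume x: "x \<in> colon Q H (ideal a <#> ideal b)"
  then have xc: "x \<in> carrier Q" and xm: "\<And>y z. y \<in> ideal a \<Longrightarrow> z \<in> ideal b \<Longrightarrow> x \<otimes> (y \<otimes> z) \<in> H"
    by (auto simp: colon_def l_coset_def set_mult_def)
  have "inv (inv (a p \<otimes> b p)) \<otimes> x \<in> D p" if p: "p \<in> X" for p
  proof -
    obtain y where y: "y \<in> ideal a" "inv (a p) \<otimes> y \<in> U p" using ideal_local_generator[OF assms(1) p] .
    obtain z where z: "z \<in> ideal b" "inv (b p) \<otimes> z \<in> U p" using ideal_local_generator[OF assms(2) p] .
    have c: "a p \<in> carrier Q" "b p \<in> carrier Q" "y \<in> carrier Q" "z \<in> carrier Q"
      using families_carrier assms p ideal_carrier y z by auto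
    let ?u = "inv (a p \<otimes> b p) \<otimes> (y \<otimes> z)"
    have u: "?u \<in> U p" using U_mult[OF p y(2) z(2)] c by (simp add: inv_interchange)
    have "?u \<otimes> (a p \<otimes> b p \<otimes> x) = x \<otimes> (y \<otimes> z)"
    proof -
      have "?u \<otimes> (a p \<otimes> b p \<otimes> x) = (inv (a p \<otimes> b p) \<otimes> (a p \<otimes> b p)) \<otimes> (x \<otimes> (y \<otimes> z))"
        using c xc by (simp add: m_ac del: l_inv r_inv inv_mult_group)
      then show ?thesis using c xc by simp
    qed
    then have "?u \<otimes> (a p \<otimes> b p \<otimes> x) \<in> D p" using xm[OF y(1) z(1)] H_D[OF p] by simp
    then show ?thesis using U_cancel(1)[OF p _ u] c xc by simp
  qed
  then show "x \<in> ideal (\<lambda>p. inv (a p \<otimes> b p))" using xc by (simp add: ideal_def)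
next
  fix x assume x: "x \<in> ideal (\<lambda>p. inv (a p \<otimes> b p))"
  have xc: "x \<in> carrier Q" using ideal_carrier x by blast
  have "x \<otimes> (y \<otimes> z) \<in> H" if yz: "y \<in> ideal a" "z \<in> ideal b" for y z
  proof -
    have yc: "y \<in> carrier Q" "z \<in> carrier Q" using yz ideal_carrier by auto
    have "x \<otimes> (y \<otimes> z) \<in> D p" if p: "p \<in> X" for p
    proof -
      have c: "a p \<in> carrier Q" "b p \<in> carrier Q" using families_carrier assms p by auto
      have "(a p \<otimes> b p) \<otimes> x \<in> D p" using ideal_local[OF x p] c by simp
      moreover have "inv (a p \<otimes> b p) \<otimes> (y \<otimes> z) \<in> D p"
        using D_mult[OF p ideal_local[OF yz(1) p] ideal_local[OF yz(2) p]] c yc by (simp add: inv_interchange)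
      ultimately have "((a p \<otimes> b p) \<otimes> x) \<otimes> (inv (a p \<otimes> b p) \<otimes> (y \<otimes> z)) \<in> D p" by (rule D_mult[OF p])
      moreover have "((a p \<otimes> b p) \<otimes> x) \<otimes> (inv (a p \<otimes> b p) \<otimes> (y \<otimes> z)) =
          (inv (a p \<otimes> b p) \<otimes> (a p \<otimes> b p)) \<otimes> (x \<otimes> (y \<otimes> z))"
        using c xc yc by (simp add: m_ac del: l_inv r_inv inv_mult_group)
      ultimately show ?thesis using c xc yc by simp
    qed
    then show ?thesis using xc yc H_eq by simp
  qed
  then show "x \<in> colon Q H (ideal a <#> ideal b)"
    using xc by (auto simp: colon_def l_coset_def set_mult_def)
qed

lemma ideal_cong: "(\<And>p. p \<in> X \<Longrightarrow> a p = b p) \<Longrightarrow> ideal a = ideal b" by (auto simp: ideal_def)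

lemma H_families: "(\<lambda>p. \<one>) \<in> families" by (simp add: families_const)

lemma ideal_mult_H:
  assumes "a \<in> families"
  shows "ideal a <#> H = ideal a"
proof (intro equalityI subsetI)
  fix x assume "x \<in> ideal a <#> H"
  then obtain y h where y: "y \<in> ideal a" "h \<in> H" "x = y \<otimes> h" by (auto simp: set_mult_def)
  have "inv (a p) \<otimes> x \<in> D p" if p: "p \<in> X" for p
    using D_mult[OF p ideal_local[OF y(1) p] H_D[OF p y(2)]] families_carrier[OF assms p] y
      ideal_carrier[OF y(1)] H_carrier[OF y(2)] by (simp add: m_assoc)
  then show "x \<in> ideal a" using y ideal_carrier[OF y(1)] H_carrier[OF y(2)] by (simp add: ideal_def)
next
  fix x assume x: "x \<in> ideal a"
  then have "x = x \<otimes> \<one>" using ideal_carrier by simp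
  then show "x \<in> ideal a <#> H" using x submonoid.one_closed[OF submonoid_H]
    unfolding set_mult_def by blast
qed

lemma colon_ideal:
  assumes "a \<in> families"
  shows "colon Q H (ideal a) = ideal (\<lambda>p. inv (a p))"
proof -
  have "colon Q H (ideal a) = ideal (\<lambda>p. inv (a p \<otimes> \<one>))"
    using colon_ideal_mult[OF assms H_families] ideal_mult_H[OF assms] by (simp add: ideal_one)
  then show ?thesis using families_carrier[OF assms] by (simp cong: ideal_cong)
qed

lemma v_closure_ideal_mult:
  assumes "a \<in> families" "b \<in> families"
  shows "v_closure Q H (ideal a <#> ideal b) = ideal (\<lambda>p. a p \<otimes> b p)"
  using colon_ideal_mult[OF assms] colon_ideal[OF families_inv[OF families_mult[OF assms]]]
    families_carrier[OF assms(1)] families_carrier[OF assms(2)]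
  by (simp add: v_closure_def cong: ideal_cong)

lemma v_closure_ideal:
  assumes "a \<in> families"
  shows "v_closure Q H (ideal a) = ideal a"
  using colon_ideal[OF assms] colon_ideal[OF families_inv[OF assms]] families_carrier[OF assms]
  by (simp add: v_closure_def cong: ideal_cong)

abbreviation Frac where "Frac \<equiv> v_invertible_fractional_ideals Q H"

lemma ideal_in_Frac:
  assumes a: "a \<in> families"
  shows "ideal a \<in> carrier Frac"
proof -
  have i: "(\<lambda>p. inv (a p)) \<in> families" using families_inv[OF a] .
  obtain j where j: "j \<in> ideal (\<lambda>p. inv (a p))" using ideal_nonempty[OF i] .
  obtain x y where xy: "x \<in> H" "y \<in> H" "j = x \<otimes> inv y" using quotients[OF ideal_carrier[OF j]] by blast
  have c: "x \<in> carrier Q" "y \<in> carrier Q" using H_carrier xy by auto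
  have "x <# ideal a \<subseteq> H"
  proof
    fix z assume "z \<in> x <# ideal a"
    then obtain w where w: "w \<in> ideal a" "z = x \<otimes> w" by (auto simp: l_coset_def)
    have wc: "w \<in> carrier Q" using ideal_carrier w by blast
    have "j \<otimes> w \<in> H" using j w colon_ideal[OF a] by (auto simp: colon_def l_coset_def)
    then have "y \<otimes> (j \<otimes> w) \<in> H" using H_mult xy by blast
    moreover have "y \<otimes> (j \<otimes> w) = x \<otimes> w" using xy(3) c wc by (simp add: m_lcomm cancel_inv m_assoc)
    ultimately show "z \<in> H" using w by simp
  qed
  moreover have "ideal a \<noteq> {}" using ideal_nonempty[OF a] by blast
  moreover have "ideal a \<subseteq> carrier Q" using ideal_carrier by blast
  moreover have "v_closure Q H (ideal a <#> colon Q H (ideal a)) = H"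
  proof -
    have "v_closure Q H (ideal a <#> colon Q H (ideal a)) = ideal (\<lambda>p. a p \<otimes> inv (a p))"
      unfolding colon_ideal[OF a] by (rule v_closure_ideal_mult[OF a i])
    also have "\<dots> = ideal (\<lambda>p. \<one>)" using families_carrier[OF a] by (simp cong: ideal_cong)
    finally show ?thesis by (simp add: ideal_one)
  qed
  ultimately show ?thesis using v_closure_ideal[OF a] xy
    by (auto simp: v_invertible_fractional_ideals_def fractional_v_ideal_def v_invertible_def)
qed

text \<open>A subset of \<open>H\<close> consisting of non-units at \<open>p\<close> is multiplied into \<open>H\<close> by some element
  outside \<open>H\<close>: the conductor of the finitely primary monoid \<open>D p\<close> provides such an element for
  \<open>D p\<close>, and the approximation property moves it to \<open>H\<close>.\<close>

lemma exists_local_unit: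
  assumes p: "p \<in> X" and W: "W \<subseteq> H" "v_closure Q H W = H"
  shows "\<exists>w\<in>W. w \<in> U p"
proof (rule ccontr)
  assume "\<not> (\<exists>w\<in>W. w \<in> U p)"
  then have nu: "inv w \<notin> D p" if "w \<in> W" for w using that W H_D[OF p] by (auto simp: U_def)
  obtain z where z: "z \<in> carrier Q" "z \<notin> D p" "\<And>x. x \<in> D p \<Longrightarrow> inv x \<notin> D p \<Longrightarrow> z \<otimes> x \<in> D p"
    using primary_valuations.exists_multiplier_into_D[OF primary[OF p]] by blast
  obtain s where s: "s \<in> H" "inv s \<in> D p" "\<forall>q\<in>X. q \<noteq> p \<longrightarrow> inv \<one> \<otimes> (s \<otimes> z) \<in> D q"
    using approximation[OF p z(1) H_families] by blast
  have sc: "s \<in> carrier Q" using H_carrier s by blast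
  have "s \<otimes> z \<otimes> w \<in> H" if w: "w \<in> W" for w
  proof -
    have wH: "w \<in> H" "w \<in> carrier Q" using w W H_carrier by auto
    have "s \<otimes> z \<otimes> w \<in> D q" if q: "q \<in> X" for q
    proof (cases "q = p")
      case True
      have "s \<otimes> (z \<otimes> w) \<in> D p" using D_mult[OF p H_D[OF p s(1)] z(3)] H_D[OF p wH(1)] nu[OF w] by blast
      then show ?thesis using True sc z(1) wH by (simp add: m_assoc)
    next
      case False
      then have "s \<otimes> z \<in> D q" using s(3) q sc z(1) by simp
      then show ?thesis using D_mult[OF q] H_D[OF q wH(1)] by blast
    qed
    then show ?thesis using H_eq sc z(1) wH by simp
  qed
  then have "s \<otimes> z \<in> colon Q H W" using sc z(1) by (auto simp: colon_def l_coset_def)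
  moreover have "\<one> \<in> colon Q H (colon Q H W)" using W(2) submonoid.one_closed[OF submonoid_H]
    by (simp add: v_closure_def)
  ultimately have "\<one> \<otimes> (s \<otimes> z) \<in> H" unfolding colon_def l_coset_def by blast
  then have "s \<otimes> z \<in> D p" using H_D[OF p] sc z(1) by simp
  then have "inv s \<otimes> (s \<otimes> z) \<in> D p" using D_mult[OF p s(2)] by blast
  then show False using z sc by (simp add: cancel_inv)
qed

text \<open>Since \<open>I\<close> is invertible, for each place \<open>p\<close> some product of elements of \<open>I\<close> and of its inverse
  is a unit at \<open>p\<close>; the factor from \<open>I\<close> generates \<open>I\<close> at \<open>p\<close>, and \<open>I\<close> is recovered from
  its localizations because it is divisorial.\<close>

lemma Frac_eq_ideal:
  assumes I: "I \<in> carrier Frac"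
  shows "\<exists>a\<in>families. I = ideal a"
proof -
  have ne: "I \<noteq> {}" and Ic: "I \<subseteq> carrier Q" and Iv: "v_closure Q H I = I"
    and inv: "v_closure Q H (I <#> colon Q H I) = H" and frac: "\<exists>c\<in>H. c <# I \<subseteq> H"
    using I by (auto simp: v_invertible_fractional_ideals_def fractional_v_ideal_def v_invertible_def)
  have prod_in_H: "y \<otimes> z \<in> H" if "y \<in> I" "z \<in> colon Q H I" for y z
  proof -
    have "z \<otimes> y \<in> H" "z \<in> carrier Q" "y \<in> carrier Q" using that Ic by (auto simp: colon_def l_coset_def)
    then show ?thesis by (simp add: m_comm)
  qed
  have W: "I <#> colon Q H I \<subseteq> H" using prod_in_H by (auto simp: set_mult_def)
  have "\<forall>p\<in>X. \<exists>y. y \<in> I \<and> (\<exists>z\<in>colon Q H I. y \<otimes> z \<in> U p)"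
  proof
    fix p assume p: "p \<in> X"
    obtain w where "w \<in> I <#> colon Q H I" "w \<in> U p" using exists_local_unit[OF p W inv] by blast
    then show "\<exists>y. y \<in> I \<and> (\<exists>z\<in>colon Q H I. y \<otimes> z \<in> U p)" unfolding set_mult_def by blast
  qed
  then obtain a where a: "\<forall>p\<in>X. a p \<in> I \<and> (\<exists>z\<in>colon Q H I. a p \<otimes> z \<in> U p)" by metis
  have ac: "a p \<in> carrier Q" if "p \<in> X" for p using a that Ic by blast
  have loc: "inv (a p) \<otimes> y \<in> D p" if p: "p \<in> X" and y: "y \<in> I" for p y
  proof -
    obtain z where z: "z \<in> colon Q H I" "a p \<otimes> z \<in> U p" using a p by blast
    have c: "y \<in> carrier Q" "z \<in> carrier Q" "a p \<in> carrier Q" using y Ic z ac[OF p] by (auto simp: colon_def)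
    have "y \<otimes> z \<in> D p" using prod_in_H[OF y z(1)] H_D[OF p] by blast
    moreover have "(a p \<otimes> z) \<otimes> (inv (a p) \<otimes> y) = y \<otimes> z"
    proof -
      have "(a p \<otimes> z) \<otimes> (inv (a p) \<otimes> y) = a p \<otimes> (inv (a p) \<otimes> (y \<otimes> z))" using c by (simp add: m_ac del: r_inv l_inv)
      then show ?thesis using c by (simp add: cancel_inv)
    qed
    ultimately have "(a p \<otimes> z) \<otimes> (inv (a p) \<otimes> y) \<in> D p" by simp
    then show ?thesis by (rule U_cancel(1)[OF p _ z(2), THEN iffD1, rotated]) (use c in simp)
  qed
  obtain c where c: "c \<in> H" "c <# I \<subseteq> H" using frac by blast
  obtain y0 where y0: "y0 \<in> I" using ne by blast
  have cc: "c \<in> carrier Q" "y0 \<in> carrier Q" using c y0 H_carrier Ic by auto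
  have "{p \<in> X. a p \<notin> U p} \<subseteq> {p \<in> X. c \<notin> U p} \<union> {p \<in> X. y0 \<notin> U p}"
  proof
    fix p assume "p \<in> {p \<in> X. a p \<notin> U p}"
    then have p: "p \<in> X" "a p \<notin> U p" by auto
    show "p \<in> {p \<in> X. c \<notin> U p} \<union> {p \<in> X. y0 \<notin> U p}"
    proof (rule ccontr)
      assume "p \<notin> {p \<in> X. c \<notin> U p} \<union> {p \<in> X. y0 \<notin> U p}"
      then have u: "c \<in> U p" "y0 \<in> U p" using p by auto
      have "c \<otimes> a p \<in> H" using c(2) a p by (auto simp: l_coset_def)
      then have 1: "a p \<in> D p" using U_cancel(1)[OF p(1) ac[OF p(1)] u(1)] H_D[OF p(1)] by blast
      have "inv (a p) \<otimes> y0 \<in> D p" using loc[OF p(1) y0] .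
      then have "inv (a p) \<in> D p" using U_cancel(1)[OF p(1) _ u(2), of "inv (a p)"] ac[OF p(1)] cc
        by (simp add: m_comm)
      then show False using 1 p by (simp add: U_def)
    qed
  qed
  then have af: "a \<in> families"
    using finite_nonunits[OF cc(1)] finite_nonunits[OF cc(2)] ac finite_subset unfolding families_def by blast
  have "ideal a \<subseteq> v_closure Q H I"
  proof
    fix x assume x: "x \<in> ideal a"
    have xc: "x \<in> carrier Q" using ideal_carrier x by blast
    have "x \<otimes> z \<in> H" if z: "z \<in> colon Q H I" for z
    proof -
      have zc: "z \<in> carrier Q" using z by (simp add: colon_def)
      have "x \<otimes> z \<in> D p" if p: "p \<in> X" for p
      proof -
        have "a p \<otimes> z \<in> D p" using prod_in_H[OF _ z] a p H_D[OF p] by blast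
        then have "(inv (a p) \<otimes> x) \<otimes> (a p \<otimes> z) \<in> D p" using D_mult[OF p ideal_local[OF x p]] by blast
        moreover have "(inv (a p) \<otimes> x) \<otimes> (a p \<otimes> z) = inv (a p) \<otimes> (a p \<otimes> (x \<otimes> z))"
          using ac[OF p] xc zc by (simp add: m_ac del: r_inv l_inv)
        ultimately show ?thesis using ac[OF p] xc zc by (simp add: cancel_inv)
      qed
      then show ?thesis using H_eq xc zc by simp
    qed
    then show "x \<in> v_closure Q H I" using xc by (auto simp: v_closure_def colon_def l_coset_def)
  qed
  moreover have "I \<subseteq> ideal a" using loc Ic by (auto simp: ideal_def)
  ultimately show ?thesis using af Iv by blast
qed

lemma mult_Frac:
  "a \<in> families \<Longrightarrow> b \<in> families \<Longrightarrow> ideal a \<otimes>\<^bsub>Frac\<^esub> ideal b = ideal (\<lambda>p. a p \<otimes> b p)"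
  using v_closure_ideal_mult by (simp add: v_invertible_fractional_ideals_def)

lemma one_Frac: "\<one>\<^bsub>Frac\<^esub> = ideal (\<lambda>p. \<one>)"
  by (simp add: v_invertible_fractional_ideals_def ideal_one)

lemma comm_group_Frac: "comm_group Frac"
proof (rule comm_groupI)
  fix I J assume IJ: "I \<in> carrier Frac" "J \<in> carrier Frac"
  obtain a b where ab: "a \<in> families" "I = ideal a" "b \<in> families" "J = ideal b"
    using Frac_eq_ideal[OF IJ(1)] Frac_eq_ideal[OF IJ(2)] by blast
  show "I \<otimes>\<^bsub>Frac\<^esub> J \<in> carrier Frac" using ab mult_Frac ideal_in_Frac families_mult by simp
  show "I \<otimes>\<^bsub>Frac\<^esub> J = J \<otimes>\<^bsub>Frac\<^esub> I"
    using ab mult_Frac families_carrier by (simp add: m_comm cong: ideal_cong)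
  fix K assume "K \<in> carrier Frac"
  then obtain c where c: "c \<in> families" "K = ideal c" using Frac_eq_ideal by blast
  show "I \<otimes>\<^bsub>Frac\<^esub> J \<otimes>\<^bsub>Frac\<^esub> K = I \<otimes>\<^bsub>Frac\<^esub> (J \<otimes>\<^bsub>Frac\<^esub> K)"
    using ab c mult_Frac families_mult families_carrier by (simp add: m_assoc cong: ideal_cong)
next
  show "\<one>\<^bsub>Frac\<^esub> \<in> carrier Frac" unfolding one_Frac by (rule ideal_in_Frac[OF H_families])
next
  fix I assume "I \<in> carrier Frac"
  then obtain a where a: "a \<in> families" "I = ideal a" using Frac_eq_ideal by blast
  show "\<one>\<^bsub>Frac\<^esub> \<otimes>\<^bsub>Frac\<^esub> I = I"
    unfolding one_Frac using a mult_Frac[OF H_families a(1)] families_carrier by (simp cong: ideal_cong)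
  have "ideal (\<lambda>p. inv (a p)) \<otimes>\<^bsub>Frac\<^esub> I = \<one>\<^bsub>Frac\<^esub>"
    unfolding one_Frac using a mult_Frac[OF families_inv[OF a(1)] a(1)] families_carrier by (simp cong: ideal_cong)
  then show "\<exists>J\<in>carrier Frac. J \<otimes>\<^bsub>Frac\<^esub> I = \<one>\<^bsub>Frac\<^esub>"
    using ideal_in_Frac[OF families_inv[OF a(1)]] by blast
qed

lemma inv_Frac:
  assumes "a \<in> families"
  shows "inv\<^bsub>Frac\<^esub> ideal a = ideal (\<lambda>p. inv (a p))"
proof -
  interpret F: comm_group Frac by (rule comm_group_Frac)
  have "ideal (\<lambda>p. inv (a p)) \<otimes>\<^bsub>Frac\<^esub> ideal a = \<one>\<^bsub>Frac\<^esub>"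
    unfolding one_Frac using mult_Frac[OF families_inv[OF assms] assms] families_carrier[OF assms]
    by (simp cong: ideal_cong)
  then show ?thesis using ideal_in_Frac assms families_inv by (intro F.inv_equality) auto
qed

end

section \<open>Sets of lengths of divisorial ideals\<close>

context weakly_Krull_family
begin

abbreviation M where "M \<equiv> v_invertible_ideals Q H"

abbreviation L where "L p x \<equiv> length_set (submon Q (D p)) x"

definition integral :: "('i \<Rightarrow> 'a) set" where
  "integral = {a \<in> families. \<forall>p\<in>X. a p \<in> D p}"

definition supp :: "('i \<Rightarrow> 'a) \<Rightarrow> 'i set" where
  "supp a = {p \<in> X. a p \<notin> U p}"

lemma integral_families: "a \<in> integral \<Longrightarrow> a \<in> families" by (simp add: integral_def)

lemma integral_D: "a \<in> integral \<Longrightarrow> p \<in> X \<Longrightarrow> a p \<in> D p" by (simp add: integral_def)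

lemma integral_one: "(\<lambda>p. \<one>) \<in> integral" by (simp add: integral_def H_families D_one)

lemma integral_update: "a \<in> integral \<Longrightarrow> p \<in> X \<Longrightarrow> x \<in> D p \<Longrightarrow> a(p := x) \<in> integral"
  using families_update[of a x p] D_carrier[of p x] by (auto simp: integral_def)

lemma integral_mult: "a \<in> integral \<Longrightarrow> b \<in> integral \<Longrightarrow> (\<lambda>p. a p \<otimes> b p) \<in> integral"
  using families_mult D_mult by (simp add: integral_def)

lemma finite_supp: "a \<in> integral \<Longrightarrow> finite (supp a)"
  using families_finite integral_families by (simp add: supp_def)

lemma carrier_M: "carrier M = ideal ` integral"
proof -
  have "carrier M = {I \<in> carrier Frac. I \<subseteq> H}"
    by (auto simp: v_invertible_ideals_def v_invertible_fractional_ideals_def v_ideal_def)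
  also have "\<dots> = ideal ` integral"
    using Frac_eq_ideal ideal_in_Frac ideal_subset_H_iff by (fastforce simp: integral_def)
  finally show ?thesis .
qed

lemma ideal_in_M: "a \<in> integral \<Longrightarrow> ideal a \<in> carrier M" by (simp add: carrier_M)

lemma M_eq_submon: "M = submon Frac (carrier M)"
  by (simp add: v_invertible_ideals_def)

lemma mult_M: "a \<in> integral \<Longrightarrow> b \<in> integral \<Longrightarrow> ideal a \<otimes>\<^bsub>M\<^esub> ideal b = ideal (\<lambda>p. a p \<otimes> b p)"
  using mult_Frac[OF integral_families integral_families, of a b] by (simp add: v_invertible_ideals_def)

lemma submonoid_M: "submonoid (carrier M) Frac"
proof
  show "carrier M \<subseteq> carrier Frac" using ideal_in_Frac integral_families by (auto simp: carrier_M)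
  show "\<one>\<^bsub>Frac\<^esub> \<in> carrier M" using one_Frac integral_one by (simp add: carrier_M)
  fix I J assume "I \<in> carrier M" "J \<in> carrier M"
  then obtain a b where "a \<in> integral" "b \<in> integral" "I = ideal a" "J = ideal b" by (auto simp: carrier_M)
  then show "I \<otimes>\<^bsub>Frac\<^esub> J \<in> carrier M"
    using mult_Frac[OF integral_families integral_families] integral_mult by (simp add: carrier_M)
qed

lemma MM: "comm_monoid_cancel M"
  using comm_group.comm_monoid_cancel_submon[OF comm_group_Frac submonoid_M] M_eq_submon by simp

lemma Units_M:
  assumes a: "a \<in> integral"
  shows "ideal a \<in> Units M \<longleftrightarrow> supp a = {}"
proof -
  have "Units M = {I \<in> carrier M. inv\<^bsub>Frac\<^esub> I \<in> carrier M}"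
    using comm_group.Units_submon[OF comm_group_Frac submonoid_M] M_eq_submon by simp
  then have "ideal a \<in> Units M \<longleftrightarrow> ideal (\<lambda>p. inv (a p)) \<in> carrier M"
    using inv_Frac[OF integral_families[OF a]] ideal_in_M[OF a] by simp
  also have "\<dots> \<longleftrightarrow> ideal (\<lambda>p. inv (a p)) \<subseteq> H"
  proof
    assume "ideal (\<lambda>p. inv (a p)) \<in> carrier M"
    then show "ideal (\<lambda>p. inv (a p)) \<subseteq> H" by (simp add: v_invertible_ideals_def v_ideal_def)
  next
    assume "ideal (\<lambda>p. inv (a p)) \<subseteq> H"
    then have "(\<lambda>p. inv (a p)) \<in> integral"
      using ideal_subset_H_iff families_inv integral_families[OF a] by (simp add: integral_def)
    then show "ideal (\<lambda>p. inv (a p)) \<in> carrier M" by (rule ideal_in_M)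
  qed
  also have "\<dots> \<longleftrightarrow> supp a = {}"
    using ideal_subset_H_iff[OF families_inv[OF integral_families[OF a]]] integral_D[OF a]
    by (auto simp: supp_def U_def)
  finally show ?thesis .
qed

lemma pow_M:
  assumes a: "a \<in> integral"
  shows "ideal a [^]\<^bsub>M\<^esub> (k::nat) = ideal (\<lambda>p. a p [^] k)" and "(\<lambda>p. a p [^] k) \<in> integral"
proof -
  have "ideal a [^]\<^bsub>M\<^esub> k = ideal (\<lambda>p. a p [^] k) \<and> (\<lambda>p. a p [^] k) \<in> integral"
  proof (induction k)
    case 0
    have "\<one>\<^bsub>M\<^esub> = ideal (\<lambda>p. \<one>)" using one_Frac by (simp add: v_invertible_ideals_def)
    then show ?case using integral_one by simp
  next
    case (Suc k)
    then show ?case using mult_M[OF _ a] integral_mult[OF _ a] by simp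
  qed
  then show "ideal a [^]\<^bsub>M\<^esub> (k::nat) = ideal (\<lambda>p. a p [^] k)" and "(\<lambda>p. a p [^] k) \<in> integral" by auto
qed

lemma ideal_eq_mult_iff:
  assumes "a \<in> integral" "b \<in> integral" "c \<in> integral"
  shows "ideal a = ideal b \<otimes>\<^bsub>M\<^esub> ideal c \<longleftrightarrow> (\<forall>p\<in>X. \<exists>e\<in>U p. a p = b p \<otimes> c p \<otimes> e)"
proof -
  have "ideal a = ideal b \<otimes>\<^bsub>M\<^esub> ideal c \<longleftrightarrow> (\<forall>p\<in>X. inv (b p \<otimes> c p) \<otimes> a p \<in> U p)"
    unfolding mult_M[OF assms(2,3)]
    using ideal_eq_iff[OF integral_families[OF integral_mult[OF assms(2,3)]] integral_families[OF assms(1)]] by auto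
  also have "\<dots> \<longleftrightarrow> (\<forall>p\<in>X. \<exists>e\<in>U p. a p = b p \<otimes> c p \<otimes> e)"
  proof (rule ball_cong[OF refl])
    fix p assume p: "p \<in> X"
    have c: "a p \<in> carrier Q" "b p \<otimes> c p \<in> carrier Q"
      using assms[THEN integral_D, OF p] D_carrier[OF p] by auto
    show "inv (b p \<otimes> c p) \<otimes> a p \<in> U p \<longleftrightarrow> (\<exists>e\<in>U p. a p = b p \<otimes> c p \<otimes> e)"
    proof
      assume u: "inv (b p \<otimes> c p) \<otimes> a p \<in> U p"
      have "a p = b p \<otimes> c p \<otimes> (inv (b p \<otimes> c p) \<otimes> a p)" using c by (simp only: cancel_inv)
      then show "\<exists>e\<in>U p. a p = b p \<otimes> c p \<otimes> e" using u by blast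
    next
      assume "\<exists>e\<in>U p. a p = b p \<otimes> c p \<otimes> e"
      then obtain e where e: "e \<in> U p" "a p = b p \<otimes> c p \<otimes> e" by blast
      have "inv (b p \<otimes> c p) \<otimes> a p = e" unfolding e(2) using c U_carrier[OF p e(1)] by (simp only: cancel_inv)
      then show "inv (b p \<otimes> c p) \<otimes> a p \<in> U p" using e by simp
    qed
  qed
  finally show ?thesis .
qed

lemma L_mult_U:
  assumes "p \<in> X" "x \<in> D p" "e \<in> U p"
  shows "L p (x \<otimes> e) = L p x"
  using comm_monoid_cancel.length_set_mult_Unit[OF DM[OF assms(1)], of x e] assms Units_D by simp

text \<open>If an ideal is non-trivial at \<open>p\<close>, then its part at \<open>p\<close> and the rest form a factorization; for an
  atom the rest must be trivial.\<close>

lemma irreducible_M_local: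
  assumes u: "u \<in> integral" and irr: "irreducible M (ideal u)"
  obtains p where "p \<in> X" "irreducible (submon Q (D p)) (u p)" "\<And>q. q \<in> X \<Longrightarrow> q \<noteq> p \<Longrightarrow> u q \<in> U q"
proof -
  interpret MM: comm_monoid_cancel M by (rule MM)
  have nu: "supp u \<noteq> {}" using irr Units_M[OF u] by (auto simp: irreducible_def)
  then obtain p where p: "p \<in> X" "u p \<notin> U p" by (auto simp: supp_def)
  interpret Dp: comm_monoid_cancel "submon Q (D p)" by (rule DM[OF p(1)])
  have split: "supp b = {} \<or> supp c = {}"
    if bc: "b \<in> integral" "c \<in> integral" "\<forall>p\<in>X. \<exists>e\<in>U p. u p = b p \<otimes> c p \<otimes> e" for b c
  proof -
    have "ideal u = ideal b \<otimes>\<^bsub>M\<^esub> ideal c" using ideal_eq_mult_iff[OF u bc(1,2)] bc(3) by simp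
    then have "ideal b \<in> Units M \<or> ideal c \<in> Units M"
      using irr MM.irreducible_iff_split[OF ideal_in_M[OF u]] ideal_in_M[OF bc(1)] ideal_in_M[OF bc(2)] by blast
    then show ?thesis using Units_M bc by blast
  qed
  have uD: "\<And>q. q \<in> X \<Longrightarrow> u q \<in> D q" using integral_D[OF u] .
  have uc: "\<And>q. q \<in> X \<Longrightarrow> u q \<in> carrier Q" using uD D_carrier by blast
  show ?thesis
  proof (rule that[OF p(1)])
    let ?b = "(\<lambda>p. \<one>)(p := u p)" and ?c = "u(p := \<one>)"
    have bc: "?b \<in> integral" "?c \<in> integral" using integral_update integral_one u p uD D_one by auto
    have "\<forall>q\<in>X. \<exists>e\<in>U q. u q = ?b q \<otimes> ?c q \<otimes> e" using uc U_one by (auto intro!: bexI[of _ \<one>])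
    then have "supp ?b = {} \<or> supp ?c = {}" by (rule split[OF bc])
    moreover have "supp ?b \<noteq> {}" using p by (auto simp: supp_def)
    ultimately show "u q \<in> U q" if "q \<in> X" "q \<noteq> p" for q using that by (auto simp: supp_def split: if_splits)
    show "irreducible (submon Q (D p)) (u p)"
      using Dp.irreducible_iff_split[of "u p"] uD[OF p(1)] p Units_D[OF p(1)]
    proof (simp, intro ballI impI)
      fix x y assume xy: "x \<in> D p" "y \<in> D p" "u p = x \<otimes> y"
      let ?b = "u(p := x)" and ?c = "(\<lambda>p. \<one>)(p := y)"
      have bc: "?b \<in> integral" "?c \<in> integral" using integral_update integral_one u p xy by auto
      have xyc: "x \<in> carrier Q" "y \<in> carrier Q" using D_carrier p xy by auto
      have "\<forall>q\<in>X. \<exists>e\<in>U q. u q = ?b q \<otimes> ?c q \<otimes> e"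
      proof
        fix q assume q: "q \<in> X"
        show "\<exists>e\<in>U q. u q = ?b q \<otimes> ?c q \<otimes> e"
          using uc[OF q] xy(3) xyc U_one[OF q] by (intro bexI[of _ \<one>]) auto
      qed
      then have "supp ?b = {} \<or> supp ?c = {}" by (rule split[OF bc])
      then show "x \<in> U p \<or> y \<in> U p" using p(1) by (auto simp: supp_def split: if_splits)
    qed
  qed
qed

lemma irreducible_local_M:
  assumes p: "p \<in> X" and x: "x \<in> D p" "irreducible (submon Q (D p)) x"
  shows "irreducible M (ideal ((\<lambda>p. \<one>)(p := x)))"
proof -
  interpret MM: comm_monoid_cancel M by (rule MM)
  interpret Dp: comm_monoid_cancel "submon Q (D p)" by (rule DM[OF p])
  let ?u = "(\<lambda>p. \<one>)(p := x)"
  have u: "?u \<in> integral" using integral_update integral_one p x by auto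
  have nu: "x \<notin> U p" using x Units_D[OF p] by (auto simp: irreducible_def)
  show ?thesis unfolding MM.irreducible_iff_split[OF ideal_in_M[OF u]]
  proof (intro conjI ballI impI)
    show "ideal ?u \<notin> Units M" using Units_M[OF u] nu p by (auto simp: supp_def)
    fix I J assume IJ: "I \<in> carrier M" "J \<in> carrier M" "ideal ?u = I \<otimes>\<^bsub>M\<^esub> J"
    then obtain b c where bc: "b \<in> integral" "c \<in> integral" "I = ideal b" "J = ideal c" by (auto simp: carrier_M)
    have eq: "\<forall>q\<in>X. \<exists>e\<in>U q. ?u q = b q \<otimes> c q \<otimes> e" using ideal_eq_mult_iff[OF u bc(1,2)] IJ(3) bc by simp
    have off: "b q \<in> U q" "c q \<in> U q" if q: "q \<in> X" "q \<noteq> p" for q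
    proof -
      obtain e where e: "e \<in> U q" "?u q = b q \<otimes> c q \<otimes> e" using eq q by blast
      have D: "b q \<in> D q" "c q \<in> D q" using bc integral_D q by auto
      have one: "b q \<otimes> c q \<otimes> e \<in> U q" using e q U_one by simp
      have "b q \<otimes> c q \<in> U q" by (rule U_factor(1)[OF q(1) _ _ one]) (use D D_mult[OF q(1)] U_D e in auto)
      then show "b q \<in> U q" "c q \<in> U q" using U_factor[OF q(1) D] by auto
    qed
    obtain e where e: "e \<in> U p" "x = b p \<otimes> c p \<otimes> e" using eq p by fastforce
    have D: "b p \<in> D p" "c p \<in> D p" "e \<in> D p" using bc integral_D p U_D e by auto
    have c: "b p \<in> carrier Q" "c p \<in> carrier Q" "e \<in> carrier Q" using D D_carrier p by auto
    have "x = b p \<otimes> (c p \<otimes> e)" using e c by (simp add: m_assoc)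
    then have "b p \<in> U p \<or> c p \<otimes> e \<in> U p"
      using x Dp.irreducible_iff_split[of x] D D_mult[OF p D(2,3)] Units_D[OF p] by auto
    then have "b p \<in> U p \<or> c p \<in> U p" using U_factor(1)[OF p D(2,3)] by blast
    then have "supp b = {} \<or> supp c = {}" using off by (auto simp: supp_def)
    then show "I \<in> Units M \<or> J \<in> Units M" using Units_M bc by blast
  qed
qed

lemma L_zero: "p \<in> X \<Longrightarrow> x \<in> D p \<Longrightarrow> 0 \<in> L p x \<longleftrightarrow> x \<in> U p"
  using comm_monoid_cancel.zero_in_length_set[OF DM, of p x] Units_D by simp

lemma L_Unit: "p \<in> X \<Longrightarrow> x \<in> U p \<Longrightarrow> L p x = {0}"
  using comm_monoid_cancel.length_set_Unit[OF DM, of p x] Units_D by simp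

lemma sum_supp:
  assumes a: "a \<in> integral" and l: "\<forall>p\<in>X. l p \<in> L p (a p)" and S: "supp a \<subseteq> S" "S \<subseteq> X" "finite S"
  shows "sum l (supp a) = sum l S"
proof (rule sum.mono_neutral_left[OF S(3,1)])
  show "\<forall>p\<in>S - supp a. l p = 0"
  proof
    fix p assume "p \<in> S - supp a"
    then have "p \<in> X" "a p \<in> U p" using S by (auto simp: supp_def)
    then show "l p = 0" using l L_Unit by auto
  qed
qed

text \<open>Each atom is non-trivial at exactly one place, so the atoms of a factorization can be counted
  place by place.\<close>

lemma length_set_M:
  assumes "a \<in> integral"
  shows "n \<in> length_set M (ideal a) \<longleftrightarrow> (\<exists>l. (\<forall>p\<in>X. l p \<in> L p (a p)) \<and> n = sum l (supp a))"
proof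
  interpret MM: comm_monoid_cancel M by (rule MM)
  assume "n \<in> length_set M (ideal a)"
  then show "\<exists>l. (\<forall>p\<in>X. l p \<in> L p (a p)) \<and> n = sum l (supp a)"
    using assms
  proof (induction n arbitrary: a)
    case 0
    then have "supp a = {}" using Units_M MM.zero_in_length_set ideal_in_M by blast
    moreover have "\<forall>p\<in>X. 0 \<in> L p (a p)"
      using calculation L_zero integral_D[OF 0(2)] by (auto simp: supp_def)
    ultimately show ?case by (intro exI[of _ "\<lambda>_. 0"]) auto
  next
    case (Suc n)
    obtain I J where IJ: "I \<in> carrier M" "J \<in> carrier M" "irreducible M I" "n \<in> length_set M J"
      "ideal a = I \<otimes>\<^bsub>M\<^esub> J"
      using MM.Suc_in_length_set[OF ideal_in_M[OF Suc.prems(2)]] Suc.prems(1) by blast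
    obtain u y where u: "u \<in> integral" "I = ideal u" and y: "y \<in> integral" "J = ideal y"
      using IJ by (auto simp: carrier_M)
    obtain l where l: "\<forall>p\<in>X. l p \<in> L p (y p)" "n = sum l (supp y)" using Suc.IH y IJ by blast
    obtain p where p: "p \<in> X" "irreducible (submon Q (D p)) (u p)" "\<And>q. q \<in> X \<Longrightarrow> q \<noteq> p \<Longrightarrow> u q \<in> U q"
      using irreducible_M_local[OF u(1)] IJ u by blast
    have eq: "\<exists>e\<in>U q. a q = u q \<otimes> y q \<otimes> e" if "q \<in> X" for q
      using ideal_eq_mult_iff[OF Suc.prems(2) u(1) y(1)] IJ u y that by simp
    define l' where "l' = l(p := Suc (l p))"
    have l': "l' q \<in> L q (a q)" if q: "q \<in> X" for q
    proof -
      obtain e where e: "e \<in> U q" "a q = u q \<otimes> y q \<otimes> e" using eq[OF q] by blast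
      have D: "u q \<in> D q" "y q \<in> D q" using integral_D u y q by auto
      have La: "L q (a q) = L q (u q \<otimes> y q)" unfolding e(2) using L_mult_U[OF q _ e(1)] D_mult[OF q D] by simp
      show ?thesis
      proof (cases "q = p")
        case True
        interpret Dp: comm_monoid_cancel "submon Q (D q)" by (rule DM[OF q])
        have "l q \<in> L q (y q)" "irreducible (submon Q (D q)) (u q)" using l(1) q p True by auto
        then have "Suc (l q) \<in> L q (u q \<otimes> y q)"
          using Dp.Suc_in_length_set[of "u q \<otimes> y q" "l q"] D_mult[OF q D] D by fastforce
        then show ?thesis using La True by (simp add: l'_def)
      next
        case False
        have "L q (u q \<otimes> y q) = L q (y q)"
          using L_mult_U[OF q D(2) p(3)[OF q False]] D D_carrier[OF q] by (simp add: m_comm)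
        then show ?thesis using La False l(1) q by (simp add: l'_def)
      qed
    qed
    let ?S = "insert p (supp a \<union> supp y)"
    have S: "finite ?S" "?S \<subseteq> X" using finite_supp Suc.prems(2) y p by (auto simp: supp_def)
    have "sum l' (supp a) = sum l' ?S" by (rule sum_supp[OF Suc.prems(2)]) (use l' S in auto)
    also have "\<dots> = sum l ?S + 1"
      using S(1) by (simp add: l'_def sum.remove[OF S(1), of p] sum.insert_remove)
    also have "sum l ?S = sum l (supp y)" by (rule sum_supp[OF y(1) l(1), symmetric]) (use S in auto)
    finally show ?case using l' l(2) by (intro exI[of _ l']) auto
  qed
next
  interpret MM: comm_monoid_cancel M by (rule MM)
  assume "\<exists>l. (\<forall>p\<in>X. l p \<in> L p (a p)) \<and> n = sum l (supp a)"
  then obtain l where "\<forall>p\<in>X. l p \<in> L p (a p)" "n = sum l (supp a)" by blast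
  then show "n \<in> length_set M (ideal a)"
    using assms
  proof (induction n arbitrary: a l)
    case 0
    have "supp a = {}"
    proof (rule ccontr)
      assume "supp a \<noteq> {}"
      then obtain p where p: "p \<in> supp a" by auto
      then have "l p = 0" using 0(2) finite_supp[OF 0(3)] by simp
      then show False using p 0(1) L_zero integral_D[OF 0(3)] by (force simp: supp_def)
    qed
    then show ?case using Units_M MM.zero_in_length_set ideal_in_M 0 by blast
  next
    case (Suc n)
    then have "\<exists>p\<in>supp a. l p \<noteq> 0" by (metis nat.distinct(1) sum.neutral)
    then obtain p where p: "p \<in> supp a" "l p \<noteq> 0" by blast
    then obtain m where m: "l p = Suc m" using not0_implies_Suc by blast
    have pX: "p \<in> X" using p by (simp add: supp_def)
    interpret Dp: comm_monoid_cancel "submon Q (D p)" by (rule DM[OF pX])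
    have "Suc m \<in> L p (a p)" using Suc.prems(1) pX m by metis
    then obtain u y where uy: "u \<in> D p" "y \<in> D p" "irreducible (submon Q (D p)) u" "m \<in> L p y" "a p = u \<otimes> y"
      using Dp.Suc_in_length_set[of "a p" m] integral_D[OF Suc.prems(3) pX] by auto
    let ?u = "(\<lambda>p. \<one>)(p := u)" and ?y = "a(p := y)"
    have i: "?u \<in> integral" "?y \<in> integral" using integral_update integral_one Suc.prems(3) pX uy by auto
    define l' where "l' = l(p := m)"
    have l': "\<forall>q\<in>X. l' q \<in> L q (?y q)" using Suc.prems(1) uy by (simp add: l'_def)
    have S: "finite (supp a)" "supp a \<subseteq> X" "supp ?y \<subseteq> supp a" using finite_supp Suc.prems(3) p by (auto simp: supp_def)
    have "sum l' (supp ?y) = sum l' (supp a)" by (rule sum_supp[OF i(2) l' S(3,2,1)])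
    moreover have "sum l (supp a) = l p + sum l (supp a - {p})" using S(1) p by (simp add: sum.remove)
    moreover have "sum l' (supp a) = l' p + sum l' (supp a - {p})" using S(1) p by (simp add: sum.remove)
    moreover have "sum l' (supp a - {p}) = sum l (supp a - {p})" by (rule sum.cong) (auto simp: l'_def)
    ultimately have "n = sum l' (supp ?y)" using Suc.prems(2) m by (simp add: l'_def)
    then have n: "n \<in> length_set M (ideal ?y)" by (rule Suc.IH[OF l' _ i(2)])
    have "\<forall>q\<in>X. \<exists>e\<in>U q. a q = ?u q \<otimes> ?y q \<otimes> e"
    proof
      fix q assume q: "q \<in> X"
      have "a q \<in> carrier Q" using integral_D[OF Suc.prems(3) q] D_carrier q by blast
      then show "\<exists>e\<in>U q. a q = ?u q \<otimes> ?y q \<otimes> e"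
        using U_one[OF q] uy(5) D_carrier[OF pX uy(1)] D_carrier[OF pX uy(2)] by (intro bexI[of _ \<one>]) auto
    qed
    then have "ideal a = ideal ?u \<otimes>\<^bsub>M\<^esub> ideal ?y" using ideal_eq_mult_iff[OF Suc.prems(3) i] by simp
    then show ?case
      using MM.Suc_in_length_set[OF ideal_in_M[OF Suc.prems(3)]] ideal_in_M[OF i(1)] ideal_in_M[OF i(2)]
        irreducible_local_M[OF pX uy(1,3)] n by blast
  qed
qed

lemma L_nonempty: "p \<in> X \<Longrightarrow> x \<in> D p \<Longrightarrow> L p x \<noteq> {}"
  using primary_valuations.length_set_nonempty[OF primary] by blast

lemma some_lengths:
  assumes "a \<in> integral"
  obtains l where "\<forall>p\<in>X. l p \<in> L p (a p)"
proof -
  have "\<forall>p\<in>X. \<exists>k. k \<in> L p (a p)"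
  proof
    fix p assume p: "p \<in> X"
    show "\<exists>k. k \<in> L p (a p)" using L_nonempty[OF p integral_D[OF assms p]] by auto
  qed
  then show ?thesis using that by (metis (no_types))
qed

lemma length_set_M_nonempty: "I \<in> carrier M \<Longrightarrow> length_set M I \<noteq> {}"
proof -
  assume "I \<in> carrier M"
  then obtain a where a: "a \<in> integral" "I = ideal a" by (auto simp: carrier_M)
  obtain l where "\<forall>p\<in>X. l p \<in> L p (a p)" using some_lengths[OF a(1)] .
  then have "sum l (supp a) \<in> length_set M (ideal a)" using length_set_M[OF a(1)] by blast
  then show ?thesis using a by auto
qed

lemma length_set_M_local:
  assumes p: "p \<in> X" and x: "x \<in> D p"
  shows "length_set M (ideal ((\<lambda>p. \<one>)(p := x))) = L p x"
proof -
  let ?u = "(\<lambda>p. \<one>)(p := x)"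
  have u: "?u \<in> integral" using integral_update integral_one p x by auto
  have s: "supp ?u \<subseteq> {p}" using U_one by (auto simp: supp_def split: if_splits)
  have *: "sum l (supp ?u) = l p" if "\<forall>q\<in>X. l q \<in> L q (?u q)" for l
    using sum_supp[OF u that s] p by simp
  show ?thesis
  proof (intro equalityI subsetI)
    fix n assume "n \<in> length_set M (ideal ?u)"
    then obtain l where "\<forall>q\<in>X. l q \<in> L q (?u q)" "n = sum l (supp ?u)" using length_set_M[OF u] by blast
    then show "n \<in> L p x" using * p by fastforce
  next
    fix n assume n: "n \<in> L p x"
    have l: "\<forall>q\<in>X. ((\<lambda>_. 0)(p := n)) q \<in> L q (?u q)" using n L_Unit[OF _ U_one] by auto
    have "n = sum ((\<lambda>_. 0)(p := n)) (supp ?u)" using *[OF l] by simp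
    then show "n \<in> length_set M (ideal ?u)" using length_set_M[OF u] l by blast
  qed
qed

lemma ratio_bounded_M:
  assumes a: "a \<in> integral" and b: "\<And>p. p \<in> X \<Longrightarrow> ratio_bounded r (L p (a p))"
  shows "ratio_bounded r (length_set M (ideal a))"
  unfolding ratio_bounded_def
proof (intro ballI)
  fix m n assume "m \<in> length_set M (ideal a)" "n \<in> length_set M (ideal a)"
  then obtain l l' where l: "\<forall>p\<in>X. l p \<in> L p (a p)" "m = sum l (supp a)"
    and l': "\<forall>p\<in>X. l' p \<in> L p (a p)" "n = sum l' (supp a)"
    using length_set_M[OF a] by blast
  have "real m = (\<Sum>p\<in>supp a. real (l p))" using l(2) by simp
  also have "\<dots> \<le> (\<Sum>p\<in>supp a. r * real (l' p))"
    by (rule sum_mono) (use b l l' in \<open>auto simp: ratio_bounded_def supp_def\<close>)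
  also have "\<dots> = r * real n" using l'(2) by (simp add: sum_distrib_left)
  finally show "real m \<le> r * real n" .
qed

text \<open>The local lengths can be varied independently.\<close>

lemma gap_dvd_M_iff:
  assumes a: "a \<in> integral"
  shows "gap_dvd x (length_set M (ideal a)) \<longleftrightarrow> (\<forall>p\<in>supp a. gap_dvd x (L p (a p)))"
proof
  assume g: "gap_dvd x (length_set M (ideal a))"
  obtain l0 where l0: "\<forall>p\<in>X. l0 p \<in> L p (a p)" using some_lengths[OF a] .
  show "\<forall>p\<in>supp a. gap_dvd x (L p (a p))"
    unfolding gap_dvd_def
  proof (intro ballI)
    fix p m n assume p: "p \<in> supp a" and mn: "m \<in> L p (a p)" "n \<in> L p (a p)"
    have s: "sum (l0(p := k)) (supp a) = k + sum l0 (supp a - {p})" for k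
    proof -
      have "sum (l0(p := k)) (supp a) = k + sum (l0(p := k)) (supp a - {p})"
        using finite_supp[OF a] p by (simp add: sum.remove)
      also have "sum (l0(p := k)) (supp a - {p}) = sum l0 (supp a - {p})" by (rule sum.cong) auto
      finally show ?thesis .
    qed
    have "sum (l0(p := k)) (supp a) \<in> length_set M (ideal a)" if "k \<in> L p (a p)" for k
      using length_set_M[OF a] l0 that by (metis fun_upd_apply)
    then have "int x dvd int (sum (l0(p := m)) (supp a)) - int (sum (l0(p := n)) (supp a))"
      using g mn unfolding gap_dvd_def by blast
    then show "int x dvd int m - int n" unfolding s by simp
  qed
next
  assume g: "\<forall>p\<in>supp a. gap_dvd x (L p (a p))"
  show "gap_dvd x (length_set M (ideal a))"
    unfolding gap_dvd_def
  proof (intro ballI)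
    fix m n assume "m \<in> length_set M (ideal a)" "n \<in> length_set M (ideal a)"
    then obtain l l' where l: "\<forall>p\<in>X. l p \<in> L p (a p)" "m = sum l (supp a)"
      and l': "\<forall>p\<in>X. l' p \<in> L p (a p)" "n = sum l' (supp a)"
      using length_set_M[OF a] by blast
    have "int m - int n = (\<Sum>p\<in>supp a. int (l p) - int (l' p))" using l(2) l'(2) by (simp add: sum_subtractf)
    moreover have "int x dvd (\<Sum>p\<in>supp a. int (l p) - int (l' p))"
    proof (rule dvd_sum)
      fix p assume p: "p \<in> supp a"
      then have "l p \<in> L p (a p)" "l' p \<in> L p (a p)" using l l' by (auto simp: supp_def)
      then show "int x dvd int (l p) - int (l' p)" using g p unfolding gap_dvd_def by blast
    qed
    ultimately show "int x dvd int m - int n" by simp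
  qed
qed

end

section \<open>Elasticity and distances of the monoid of divisorial ideals\<close>

lemma ratio_bounded_mono: "ratio_bounded r L \<Longrightarrow> r \<le> s \<Longrightarrow> ratio_bounded s L"
  unfolding ratio_bounded_def by (meson mult_right_mono of_nat_0_le_iff order_trans)

text \<open>The parts of \<open>L\<close> below and above the run serve as the two irregular ends of the AAP.\<close>

lemma is_AAPI:
  assumes d: "0 < d" and fin: "finite L" and run: "\<And>j. j \<le> l \<Longrightarrow> y + j * d \<in> L"
    and gap: "gap_dvd d L"
  shows "is_AAP d l (int ` L)"
proof -
  define K where "K = y + l * d + Max (insert 0 L)"
  let ?L1 = "{i. i < 0 \<and> int y + i \<in> int ` L}"
  let ?L2 = "{i. int (l * d) < i \<and> int y + i \<in> int ` L}"
  have le: "n \<le> Max (insert 0 L)" if "n \<in> L" for n using that fin by simp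
  have dv: "int d dvd int n - int y" if "n \<in> L" for n
    using gap run[of 0] that unfolding gap_dvd_def by simp
  have "int y \<le> int K" by (simp add: K_def)
  then have 1: "?L1 \<subseteq> {- int K .. -1}" by auto
  have 2: "?L2 \<subseteq> (\<lambda>i. int (l * d) + i) ` {1 .. int K}"
  proof
    fix i assume "i \<in> ?L2"
    then obtain n where n: "int (l * d) < i" "n \<in> L" "int y + i = int n" by auto
    then have "i \<le> int (Max (insert 0 L))" using le[OF n(2)] by linarith
    moreover have "int K = int y + int (l * d) + int (Max (insert 0 L))" by (simp add: K_def)
    moreover have "0 \<le> int (l * d)" by simp
    ultimately have "i - int (l * d) \<in> {1 .. int K}" using n(1) unfolding atLeastAtMost_iff by linarith
    then show "i \<in> (\<lambda>i. int (l * d) + i) ` {1 .. int K}" by (intro image_eqI[of _ _ "i - int (l * d)"]) auto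
  qed
  have 3: "int ` L = (\<lambda>i. int y + i) ` (?L1 \<union> (\<lambda>j. int (j * d)) ` {0 .. l} \<union> ?L2)"
  proof (intro equalityI subsetI)
    fix z assume "z \<in> int ` L"
    then obtain n where n: "n \<in> L" "z = int n" by auto
    let ?i = "int n - int y"
    have "?i \<in> ?L1 \<union> (\<lambda>j. int (j * d)) ` {0 .. l} \<union> ?L2"
    proof (cases "?i < 0 \<or> int (l * d) < ?i")
      case True
      then show ?thesis using n by auto
    next
      case False
      obtain j where j: "?i = int d * j" using dv[OF n(1)] by (auto simp: dvd_def)
      then have "0 \<le> j" using False d by (metis linorder_not_less mult_pos_neg of_nat_0_less_iff)
      then obtain k where k: "j = int k" using nonneg_int_cases by blast
      have "int (k * d) \<le> int (l * d)" using False j k by (simp add: mult.commute)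
      then have "k * d \<le> l * d" by (simp only: of_nat_le_iff)
      then have "k \<le> l" using d by simp
      then show ?thesis using j k by (auto simp: mult.commute)
    qed
    then show "z \<in> (\<lambda>i. int y + i) ` (?L1 \<union> (\<lambda>j. int (j * d)) ` {0 .. l} \<union> ?L2)"
      using n by (intro image_eqI[of _ _ ?i]) auto
  next
    fix z assume "z \<in> (\<lambda>i. int y + i) ` (?L1 \<union> (\<lambda>j. int (j * d)) ` {0 .. l} \<union> ?L2)"
    then consider i where "z = int y + i" "i \<in> ?L1 \<union> ?L2" | j where "j \<le> l" "z = int y + int (j * d)" by auto
    then show "z \<in> int ` L"
    proof cases
      case 2
      then have "z = int (y + j * d)" by simp
      then show ?thesis using run[OF 2(1)] by (simp only: imageI)
    qed auto
  qed
  have 4: "int ` L \<subseteq> range (\<lambda>z. int y + int d * z)"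
  proof
    fix z assume "z \<in> int ` L"
    then obtain n where n: "n \<in> L" "z = int n" by auto
    then obtain j where "int n - int y = int d * j" using dv by (auto simp: dvd_def)
    then have "z = int y + int d * j" using n by simp
    then show "z \<in> range (\<lambda>z. int y + int d * z)" by blast
  qed
  show ?thesis unfolding is_AAP_def using d 1 2 3 4 by blast
qed

lemma is_AAP_facts:
  assumes "is_AAP d l (int ` L)"
  shows "gap_dvd d L" and "\<exists>y\<in>L. y + l * d \<in> L"
proof -
  obtain y K L' L'' where 3: "int ` L = (\<lambda>i. y + i) ` (L' \<union> (\<lambda>j. int (j * d)) ` {0 .. l} \<union> L'')"
    and 4: "int ` L \<subseteq> range (\<lambda>z. y + int d * z)"
    using assms unfolding is_AAP_def by (elim conjE exE) (rule that)
  show "gap_dvd d L" unfolding gap_dvd_def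
  proof (intro ballI)
    fix m n assume "m \<in> L" "n \<in> L"
    then have "int m \<in> range (\<lambda>z. y + int d * z)" "int n \<in> range (\<lambda>z. y + int d * z)" using 4 by auto
    then obtain z w where "int m = y + int d * z" "int n = y + int d * w" by auto
    then have "int m - int n = int d * (z - w)" by (simp add: algebra_simps)
    then show "int d dvd int m - int n" by simp
  qed
  have "y + int (0 * d) \<in> int ` L" "y + int (l * d) \<in> int ` L" unfolding 3 by (intro imageI; force)+
  then obtain m n where mn: "m \<in> L" "n \<in> L" "y = int m" "y + int (l * d) = int n" by auto
  then have "int n = int (m + l * d)" by simp
  then have "n = m + l * d" by (simp only: of_nat_eq_iff)
  then show "\<exists>y\<in>L. y + l * d \<in> L" using mn(1,2) by blast
qed

locale weakly_Krull_conductor = weakly_Krull_family Q H X D P v \<alpha>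
  for Q :: "('a, 'b) monoid_scheme" (structure) and H X and D :: "'i \<Rightarrow> 'a set" and P v \<alpha> +
  fixes E :: "'i set"
  assumes finite_E: "finite E" and E_X: "E \<subseteq> X"
    and discrete: "p \<in> X \<Longrightarrow> p \<notin> E \<Longrightarrow> \<exists>r. P p = {r} \<and> (\<forall>x\<in>carrier Q. 0 \<le> v p r x \<longrightarrow> x \<in> D p)"
begin

text \<open>In a discrete valuation monoid all atoms have valuation one.\<close>

lemma L_regular:
  assumes p: "p \<in> X" "p \<notin> E" and P: "P p = {r}" and x: "x \<in> D p"
  shows "L p x = {nat (v p r x)}"
proof -
  interpret pv: primary_valuations Q "D p" "P p" "v p" "\<alpha> p" by (rule primary[OF p(1)])
  have r: "r \<in> P p" "r \<in> carrier Q" using P pv.P_closed by auto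
  have D: "x \<in> D p" if "x \<in> carrier Q" "0 \<le> v p r x" for x using discrete[OF p] P that by auto
  have rD: "r \<in> D p" using D r pv.v_prime by simp
  have atom: "v p r u \<le> 1" if u: "u \<in> D p" "irreducible (submon Q (D p)) u" for u
  proof (rule ccontr)
    assume n: "\<not> v p r u \<le> 1"
    have uc: "u \<in> carrier Q" using u D_carrier p by blast
    have w: "v p r (inv r \<otimes> u) = v p r u - 1" using uc r by (simp add: pv.v_mult pv.v_inv pv.v_prime)
    then have y: "inv r \<otimes> u \<in> D p" using D uc r n by simp
    have "u = r \<otimes> (inv r \<otimes> u)" using uc r by (simp add: cancel_inv)
    then have "r \<in> U p \<or> inv r \<otimes> u \<in> U p"
      using pv.DM.irreducible_iff_split[of u] u rD y Units_D[OF p(1)] by auto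
    then have "v p r r = 0 \<or> v p r (inv r \<otimes> u) = 0" using pv.v_Unit[OF _ _ r(1)] unfolding U_def by blast
    then show False using w n pv.v_prime[OF r(1) r(1)] by simp
  qed
  have eq: "n = nat (v p r x)" if n: "n \<in> L p x" for n
    using pv.length_le_v[OF x n r(1)] pv.v_le_length[OF P atom x n] by simp
  then show ?thesis using pv.length_set_nonempty[OF x] by auto
qed

lemma ratio_bounded_regular:
  assumes "p \<in> X" "p \<notin> E" "x \<in> D p"
  shows "ratio_bounded 1 (L p x)"
  using discrete[OF assms(1,2)] L_regular[OF assms(1,2) _ assms(3)] by (auto simp: ratio_bounded_def)

lemma ratio_bounded_local:
  assumes "\<And>I. I \<in> carrier M \<Longrightarrow> ratio_bounded r (length_set M I)" "p \<in> X" "x \<in> D p"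
  shows "ratio_bounded r (L p x)"
  using assms(1)[OF ideal_in_M, of "(\<lambda>p. \<one>)(p := x)"] length_set_M_local[OF assms(2,3)]
    integral_update[OF integral_one assms(2,3)] by simp

text \<open>The elasticity of each localization is a lower bound. Conversely, finitely many localizations of
  rank one have a common bound, the others are half-factorial, and bounds on ratios are inherited by
  sums.\<close>

theorem finite_elasticity_M_iff:
  "elasticity M < \<infinity> \<longleftrightarrow> (\<forall>p\<in>X. \<exists>r. P p = {r})"
proof
  interpret MM: comm_monoid_cancel M by (rule MM)
  assume "elasticity M < \<infinity>"
  then obtain \<rho> where \<rho>: "1 \<le> \<rho>" "elasticity M = ennreal \<rho>" by (rule MM.finite_elasticity_obtains)
  have b: "ratio_bounded \<rho> (length_set M I)" if "I \<in> carrier M" for I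
    using MM.elasticity_le_iff[OF \<rho>(1)] \<rho>(2) that by (metis order_refl)
  show "\<forall>p\<in>X. \<exists>r. P p = {r}"
  proof
    fix p assume p: "p \<in> X"
    interpret pv: primary_valuations Q "D p" "P p" "v p" "\<alpha> p" by (rule primary[OF p])
    have "\<forall>a\<in>carrier (submon Q (D p)). ratio_bounded \<rho> (L p a)" using ratio_bounded_local[OF b p] by simp
    then have "elasticity (submon Q (D p)) \<le> ennreal \<rho>" by (rule pv.DM.elasticity_le_iff[OF \<rho>(1), THEN iffD2])
    then have fin: "elasticity (submon Q (D p)) < \<infinity>"
      using ennreal_less_top[of \<rho>] by (metis infinity_ennreal_def le_less_trans)
    obtain r where r: "r \<in> P p" using pv.P_nonempty by blast
    have "s = r" if "s \<in> P p" for s using pv.infinite_elasticity[OF that r] fin by blast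
    then show "\<exists>r. P p = {r}" using r by blast
  qed
next
  interpret MM: comm_monoid_cancel M by (rule MM)
  assume rank: "\<forall>p\<in>X. \<exists>r. P p = {r}"
  define \<rho> where "\<rho> = Max (insert 1 ((\<lambda>p. 2 * real (\<alpha> p)) ` E))"
  have f: "finite (insert 1 ((\<lambda>p. 2 * real (\<alpha> p)) ` E))" using finite_E by simp
  have \<rho>1: "1 \<le> \<rho>" unfolding \<rho>_def by (rule Max_ge[OF f]) simp
  have b: "ratio_bounded \<rho> (L p x)" if p: "p \<in> X" "x \<in> D p" for p x
  proof (cases "p \<in> E")
    case True
    obtain r where "P p = {r}" using rank p by blast
    then have "ratio_bounded (2 * real (\<alpha> p)) (L p x)"
      using primary_valuations.rank_one_bounded[OF primary[OF p(1)] _ p(2)] by blast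
    moreover have "2 * real (\<alpha> p) \<le> \<rho>" unfolding \<rho>_def by (rule Max_ge[OF f]) (use True in simp)
    ultimately show ?thesis by (rule ratio_bounded_mono)
  next
    case False
    then show ?thesis using ratio_bounded_regular[OF p(1) _ p(2)] \<rho>1 ratio_bounded_mono by blast
  qed
  have "\<forall>I\<in>carrier M. ratio_bounded \<rho> (length_set M I)"
    using ratio_bounded_M b integral_D unfolding carrier_M by blast
  then have "elasticity M \<le> ennreal \<rho>" using MM.elasticity_le_iff[OF \<rho>1] by blast
  then show "elasticity M < \<infinity>" using ennreal_less_top[of \<rho>] by (metis infinity_ennreal_def le_less_trans)
qed

theorem accepted_elasticity_M:
  assumes acc: "\<And>p. p \<in> E \<Longrightarrow> accepted_elasticity (submon Q (D p))"
  shows "accepted_elasticity M"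
proof -
  interpret MM: comm_monoid_cancel M by (rule MM)
  have "\<exists>\<rho>\<ge>1. (\<forall>x\<in>D p. ratio_bounded \<rho> (L p x)) \<and> (\<rho> > 1 \<longrightarrow> (\<exists>x\<in>D p. ratio_attained \<rho> (L p x)))"
    if p: "p \<in> E" for p
  proof -
    have pX: "p \<in> X" using p E_X by blast
    interpret Dp: comm_monoid_cancel "submon Q (D p)" by (rule DM[OF pX])
    show ?thesis
    proof (rule Dp.accepted_elasticity_obtains[OF acc[OF p]])
      fix r assume r: "1 \<le> r" "\<And>a. a \<in> carrier (submon Q (D p)) \<Longrightarrow> ratio_bounded r (L p a)"
        "1 < r \<Longrightarrow> \<exists>a\<in>carrier (submon Q (D p)). a \<notin> Units (submon Q (D p)) \<and> ratio_attained r (L p a)"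
      then show ?thesis by (intro exI[of _ r]) auto
    qed
  qed
  then obtain \<rho> where \<rho>: "\<And>p. p \<in> E \<Longrightarrow> 1 \<le> \<rho> p" "\<And>p x. p \<in> E \<Longrightarrow> x \<in> D p \<Longrightarrow> ratio_bounded (\<rho> p) (L p x)"
    "\<And>p. p \<in> E \<Longrightarrow> \<rho> p > 1 \<Longrightarrow> \<exists>x\<in>D p. ratio_attained (\<rho> p) (L p x)" by metis
  define R where "R = Max (insert 1 (\<rho> ` E))"
  have f: "finite (insert 1 (\<rho> ` E))" using finite_E by simp
  have R1: "1 \<le> R" unfolding R_def by (rule Max_ge[OF f]) simp
  have b: "ratio_bounded R (L p x)" if p: "p \<in> X" "x \<in> D p" for p x
  proof (cases "p \<in> E")
    case True
    have "\<rho> p \<le> R" unfolding R_def by (rule Max_ge[OF f]) (use True in simp)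
    then show ?thesis using ratio_bounded_mono[OF \<rho>(2)[OF True p(2)]] by blast
  next
    case False
    then show ?thesis using ratio_bounded_regular[OF p(1) _ p(2)] R1 ratio_bounded_mono by blast
  qed
  have bM: "ratio_bounded R (length_set M I)" if "I \<in> carrier M" for I
    using ratio_bounded_M b integral_D that unfolding carrier_M by blast
  have att: "R = 1 \<or> (\<exists>I\<in>carrier M. ratio_attained R (length_set M I))"
  proof (cases "R = 1")
    case False
    have "R \<in> insert 1 (\<rho> ` E)" unfolding R_def by (rule Max_in[OF f]) simp
    then obtain p where p: "p \<in> E" "R = \<rho> p" using False by blast
    then obtain x where x: "x \<in> D p" "ratio_attained R (L p x)" using \<rho>(3)[OF p(1)] R1 False by auto
    have pX: "p \<in> X" using p E_X by blast
    show ?thesis using x length_set_M_local[OF pX x(1)] ideal_in_M[OF integral_update[OF integral_one pX x(1)]]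
      by fastforce
  qed simp
  show ?thesis by (rule MM.accepted_elasticityI[OF length_set_M_nonempty R1 bM att])
qed

text \<open>The counterpart of \<open>extremal_primes\<close> for the index set.\<close>

definition Ext :: "'i set" where
  "Ext = {p \<in> E. elasticity (submon Q (D p)) = elasticity M \<and>
     accepted_elasticity (submon Q (D p)) \<and> distances_of (submon Q (D p)) (D p) \<noteq> {}}"

abbreviation d where "d p \<equiv> min_distance (submon Q (D p))"

lemma d_facts:
  assumes "p \<in> X" "distances_of (submon Q (D p)) (D p) \<noteq> {}"
  shows "0 < d p" "\<exists>b\<in>D p. \<exists>m\<in>L p b. m + d p \<in> L p b"
    "x dvd d p \<longleftrightarrow> (\<forall>b\<in>D p. gap_dvd x (L p b))"
proof -
  interpret Dp: comm_monoid_cancel "submon Q (D p)" by (rule DM[OF assms(1)])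
  note * = Dp.min_distance_facts[simplified, OF assms(2)]
  show "0 < d p" "x dvd d p \<longleftrightarrow> (\<forall>b\<in>D p. gap_dvd x (L p b))" using * by auto
  obtain b where "b \<in> D p" "d p \<in> distances (L p b)" using *(2) by (auto simp: distances_of_def)
  then show "\<exists>b\<in>D p. \<exists>m\<in>L p b. m + d p \<in> L p b" by (meson distancesE)
qed

lemma divides_power:
  assumes p: "p \<in> X" and a: "a \<in> D p" "a \<notin> U p" and b: "b \<in> D p"
  shows "\<exists>k::nat. \<exists>c\<in>D p. a [^] k = b \<otimes> c"
proof -
  have c: "a \<in> carrier Q" "b \<in> carrier Q" using D_carrier p a b by auto
  have "inv a \<notin> D p" using a by (simp add: U_def)
  then obtain n :: nat where n: "\<forall>m\<ge>n. a [^] m \<otimes> inv b \<in> D p"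
    using primary_valuations.multiple_of_power_in_D[OF primary[OF p] a(1), of "inv b"] c by auto
  have "a [^] n = b \<otimes> (a [^] n \<otimes> inv b)" using c by (simp add: cancel_inv)
  then show ?thesis using n by blast
qed

text \<open>In a finitely primary monoid every element divides some power of a given non-unit, so the
  powers of one element already see all distances.\<close>

lemma gap_dvd_powers:
  assumes p: "p \<in> X" and a: "a \<in> D p" "a \<notin> U p"
  shows "(\<forall>k::nat. gap_dvd x (L p (a [^] k))) \<longleftrightarrow> (\<forall>b\<in>D p. gap_dvd x (L p b))"
proof
  interpret Dp: comm_monoid_cancel "submon Q (D p)" by (rule DM[OF p])
  assume g: "\<forall>k::nat. gap_dvd x (L p (a [^] k))"
  show "\<forall>b\<in>D p. gap_dvd x (L p b)"
  proof
    fix b assume b: "b \<in> D p"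
    obtain k c where kc: "c \<in> D p" "a [^] (k::nat) = b \<otimes> c" using divides_power[OF p a b] by blast
    obtain l where l: "l \<in> L p c" using L_nonempty[OF p kc(1)] by blast
    show "gap_dvd x (L p b)" unfolding gap_dvd_def
    proof (intro ballI)
      fix m n assume mn: "m \<in> L p b" "n \<in> L p b"
      have "m + l \<in> L p (a [^] k)" "n + l \<in> L p (a [^] k)"
        unfolding kc(2) using Dp.length_set_add[of b c] b kc(1) mn l by auto
      then have "int x dvd int (m + l) - int (n + l)" using g unfolding gap_dvd_def by blast
      then show "int x dvd int m - int n" by simp
    qed
  qed
next
  assume "\<forall>b\<in>D p. gap_dvd x (L p b)"
  then show "\<forall>k::nat. gap_dvd x (L p (a [^] k))" using D_pow[OF p a(1)] by blast
qed

lemma U_pow_iff: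
  assumes "p \<in> X" "a \<in> D p" "0 < (k::nat)"
  shows "a [^] k \<in> U p \<longleftrightarrow> a \<in> U p"
proof -
  obtain j where k: "k = Suc j" using assms(3) gr0_conv_Suc by blast
  show ?thesis
  proof
    assume "a [^] k \<in> U p"
    then show "a \<in> U p" using U_factor(2)[OF assms(1) D_pow[OF assms(1,2)] assms(2), of j] k by simp
  next
    assume a: "a \<in> U p"
    have "a [^] k \<in> U p" for k :: nat
      by (induction k) (use a U_one[OF assms(1)] U_mult[OF assms(1)] in auto)
    then show "a [^] k \<in> U p" .
  qed
qed

text \<open>Both sides have the same divisors: an integer divides all length differences of an ideal if and
  only if it does so locally.\<close>

lemma min_distance_powers_M:
  assumes a: "a \<in> integral" "supp a \<noteq> {}"
    and dist: "\<And>p. p \<in> supp a \<Longrightarrow> distances_of (submon Q (D p)) (D p) \<noteq> {}"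
  shows "distances_of M (powers_of M (ideal a)) \<noteq> {}"
    and "Inf (distances_of M (powers_of M (ideal a))) = Gcd (d ` supp a)"
proof -
  interpret MM: comm_monoid_cancel M by (rule MM)
  have pow: "ideal a [^]\<^bsub>M\<^esub> k = ideal (\<lambda>p. a p [^] k)" "(\<lambda>p. a p [^] k) \<in> integral" for k :: nat
    using pow_M[OF a(1)] by auto
  have sp: "supp (\<lambda>p. a p [^] k) = (if k = 0 then {} else supp a)" for k :: nat
    using U_pow_iff integral_D[OF a(1)] U_one by (auto simp: supp_def)
  have g: "(\<forall>k::nat. gap_dvd x (length_set M (ideal a [^]\<^bsub>M\<^esub> k))) \<longleftrightarrow> (\<forall>p\<in>supp a. x dvd d p)" for x
  proof -
    have "(\<forall>k::nat. gap_dvd x (length_set M (ideal a [^]\<^bsub>M\<^esub> k))) \<longleftrightarrow>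
      (\<forall>k::nat. \<forall>p\<in>supp (\<lambda>p. a p [^] k). gap_dvd x (L p (a p [^] k)))"
      unfolding pow(1) using gap_dvd_M_iff[OF pow(2)] by simp
    also have "\<dots> \<longleftrightarrow> (\<forall>p\<in>supp a. \<forall>k::nat. gap_dvd x (L p (a p [^] k)))"
    proof -
      have "gap_dvd x (L p (a p [^] (0::nat)))" if "p \<in> supp a" for p
        using L_Unit[OF _ U_one, of p] that by (simp add: supp_def gap_dvd_def)
      then show ?thesis unfolding sp by (metis empty_iff)
    qed
    also have "\<dots> \<longleftrightarrow> (\<forall>p\<in>supp a. x dvd d p)"
    proof (rule ball_cong[OF refl])
      fix p assume p: "p \<in> supp a"
      then have pp: "p \<in> X" "a p \<in> D p" "a p \<notin> U p" using integral_D[OF a(1)] by (auto simp: supp_def)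
      show "(\<forall>k::nat. gap_dvd x (L p (a p [^] k))) \<longleftrightarrow> x dvd d p"
        using gap_dvd_powers[OF pp] d_facts(3)[OF pp(1) dist[OF p]] by simp
    qed
    finally show ?thesis .
  qed
  show ne: "distances_of M (powers_of M (ideal a)) \<noteq> {}"
  proof
    assume e: "distances_of M (powers_of M (ideal a)) = {}"
    have "gap_dvd 0 (length_set M (ideal a [^]\<^bsub>M\<^esub> k))" for k :: nat
      unfolding gap_dvd_def
    proof (intro ballI)
      fix m n assume mn: "m \<in> length_set M (ideal a [^]\<^bsub>M\<^esub> k)" "n \<in> length_set M (ideal a [^]\<^bsub>M\<^esub> k)"
      have "(\<Union>L\<in>range (\<lambda>k::nat. length_set M (ideal a [^]\<^bsub>M\<^esub> k)). distances L) = {}"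
        using e by (auto simp: distances_of_def powers_of_def)
      then have "m = n" by (rule unique_length_if_no_distances[OF _ _ mn]) simp
      then show "int 0 dvd int m - int n" by simp
    qed
    then have "\<forall>p\<in>supp a. 0 dvd d p" using g by blast
    then show False using a(2) d_facts(1)[OF _ dist] by (fastforce simp: supp_def)
  qed
  show "Inf (distances_of M (powers_of M (ideal a))) = Gcd (d ` supp a)"
  proof (rule dvd_antisym)
    have *: "x dvd Inf (distances_of M (powers_of M (ideal a))) \<longleftrightarrow> (\<forall>p\<in>supp a. x dvd d p)" for x
      using MM.min_distance_powers_facts(3)[OF ideal_in_M[OF a(1)] ne] g by simp
    show "Inf (distances_of M (powers_of M (ideal a))) dvd Gcd (d ` supp a)"
      using *[of "Inf (distances_of M (powers_of M (ideal a)))"] by (intro Gcd_greatest) auto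
    show "Gcd (d ` supp a) dvd Inf (distances_of M (powers_of M (ideal a)))"
      unfolding * by (auto intro: Gcd_dvd)
  qed
qed

context
  fixes \<rho> :: real
  assumes \<rho>: "1 \<le> \<rho>" "elasticity M = ennreal \<rho>"
    and bounded: "\<And>I. I \<in> carrier M \<Longrightarrow> ratio_bounded \<rho> (length_set M I)"
begin

text \<open>The elasticity of a localization is at most that of the monoid of ideals; so if a local element
  has the largest possible ratio, then its localization has the same elasticity, and accepts it.\<close>

lemma elasticity_local_of_attained:
  assumes p: "p \<in> X" and x: "x \<in> D p" "ratio_attained \<rho> (L p x)" and \<rho>1: "1 < \<rho>"
  shows "p \<in> Ext"
proof -
  interpret Dp: comm_monoid_cancel "submon Q (D p)" by (rule DM[OF p])
  have b: "ratio_bounded \<rho> (L p y)" if "y \<in> carrier (submon Q (D p))" for y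
    using ratio_bounded_local[OF bounded p] that by simp
  have att: "\<rho> = 1 \<or> (\<exists>a\<in>carrier (submon Q (D p)). ratio_attained \<rho> (L p a))" using x by auto
  have el: "elasticity (submon Q (D p)) = ennreal \<rho>" by (rule Dp.elasticity_eqI(1)[OF \<rho>(1) b att])
  have ne: "L p a \<noteq> {}" if "a \<in> carrier (submon Q (D p))" for a using L_nonempty[OF p] that by simp
  have acc: "accepted_elasticity (submon Q (D p))" by (rule Dp.accepted_elasticityI[OF ne \<rho>(1) b att])
  obtain m n where mn: "m \<in> L p x" "n \<in> L p x" "0 < n" "real m = \<rho> * real n"
    using x(2) unfolding ratio_attained_def by blast
  have "real n < real m" using mn \<rho>1 by simp
  then have "n < m" by simp
  then obtain e where "e \<in> distances (L p x)" using distance_between[OF mn(2,1)] by blast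
  then have dist: "distances_of (submon Q (D p)) (D p) \<noteq> {}" using x(1) unfolding distances_of_def by blast
  have "p \<in> E"
  proof (rule ccontr)
    assume "p \<notin> E"
    then have "ratio_bounded 1 (L p x)" using ratio_bounded_regular p x by blast
    then have "real m \<le> real n" using mn unfolding ratio_bounded_def by fastforce
    then show False using \<open>n < m\<close> by simp
  qed
  then show ?thesis using el \<rho>(2) acc dist by (simp add: Ext_def)
qed

text \<open>A sum of inequalities \<open>m \<le> \<rho> n\<close> is an equality only if every summand is one.\<close>

lemma attained_M_iff:
  assumes a: "a \<in> integral" "supp a \<noteq> {}"
  shows "ratio_attained \<rho> (length_set M (ideal a)) \<longleftrightarrow> (\<forall>p\<in>supp a. ratio_attained \<rho> (L p (a p)))"
proof
  assume "ratio_attained \<rho> (length_set M (ideal a))"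
  then obtain m n where mn: "m \<in> length_set M (ideal a)" "n \<in> length_set M (ideal a)" "real m = \<rho> * real n"
    unfolding ratio_attained_def by blast
  obtain l l' where l: "\<forall>p\<in>X. l p \<in> L p (a p)" "m = sum l (supp a)"
    and l': "\<forall>p\<in>X. l' p \<in> L p (a p)" "n = sum l' (supp a)"
    using mn length_set_M[OF a(1)] by blast
  have le: "real (l p) \<le> \<rho> * real (l' p)" if "p \<in> supp a" for p
  proof -
    have "p \<in> X" using that by (simp add: supp_def)
    then show ?thesis
      using ratio_bounded_local[OF bounded, of p "a p"] integral_D[OF a(1)] l l' unfolding ratio_bounded_def by blast
  qed
  have s: "(\<Sum>p\<in>supp a. real (l p)) = (\<Sum>p\<in>supp a. \<rho> * real (l' p))"
    using mn(3) l(2) l'(2) by (simp add: sum_distrib_left)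
  show "\<forall>p\<in>supp a. ratio_attained \<rho> (L p (a p))"
  proof
    fix p assume p: "p \<in> supp a"
    then have pX: "p \<in> X" "a p \<notin> U p" by (auto simp: supp_def)
    have "real (l p) = \<rho> * real (l' p)"
      by (rule sum_mono_inv[OF s le p finite_supp[OF a(1)]])
    moreover have "l' p \<noteq> 0" using l' L_zero[OF pX(1) integral_D[OF a(1) pX(1)]] pX by metis
    ultimately show "ratio_attained \<rho> (L p (a p))" using l l' pX by (intro ratio_attainedI) auto
  qed
next
  assume att: "\<forall>p\<in>supp a. ratio_attained \<rho> (L p (a p))"
  obtain l0 where l0: "\<forall>p\<in>X. l0 p \<in> L p (a p)" using some_lengths[OF a(1)] .
  have "\<forall>p\<in>X. \<exists>z. fst z \<in> L p (a p) \<and> snd z \<in> L p (a p) \<and>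
      (p \<in> supp a \<longrightarrow> 0 < snd z \<and> real (fst z) = \<rho> * real (snd z))"
  proof
    fix p assume p: "p \<in> X"
    show "\<exists>z. fst z \<in> L p (a p) \<and> snd z \<in> L p (a p) \<and>
      (p \<in> supp a \<longrightarrow> 0 < snd z \<and> real (fst z) = \<rho> * real (snd z))"
    proof (cases "p \<in> supp a")
      case True
      then obtain m n where "m \<in> L p (a p)" "n \<in> L p (a p)" "0 < n" "real m = \<rho> * real n"
        using att unfolding ratio_attained_def by blast
      then show ?thesis by (intro exI[of _ "(m, n)"]) simp
    next
      case False
      then show ?thesis using l0 p by (intro exI[of _ "(l0 p, l0 p)"]) simp
    qed
  qed
  from bchoice[OF this] obtain z where z: "\<forall>p\<in>X. fst (z p) \<in> L p (a p) \<and> snd (z p) \<in> L p (a p) \<and>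
      (p \<in> supp a \<longrightarrow> 0 < snd (z p) \<and> real (fst (z p)) = \<rho> * real (snd (z p)))" by blast
  define l where "l = (\<lambda>p. fst (z p))"
  define l' where "l' = (\<lambda>p. snd (z p))"
  have l: "\<And>p. p \<in> X \<Longrightarrow> l p \<in> L p (a p) \<and> l' p \<in> L p (a p)"
    "\<And>p. p \<in> supp a \<Longrightarrow> 0 < l' p \<and> real (l p) = \<rho> * real (l' p)"
    using z by (auto simp: l_def l'_def supp_def)
  show "ratio_attained \<rho> (length_set M (ideal a))"
  proof (rule ratio_attainedI)
    show "sum l (supp a) \<in> length_set M (ideal a)" "sum l' (supp a) \<in> length_set M (ideal a)"
      using length_set_M[OF a(1)] l by blast+
    show "0 < sum l' (supp a)" using l(2) a(2) finite_supp[OF a(1)] by (intro sum_pos) auto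
    show "real (sum l (supp a)) = \<rho> * real (sum l' (supp a))"
      using l(2) by (simp add: sum_distrib_left)
  qed
qed

lemma set_elasticity_M_iff:
  assumes a: "a \<in> integral" and \<rho>1: "1 < \<rho>"
  shows "set_elasticity (length_set M (ideal a)) = elasticity M \<longleftrightarrow>
    supp a \<noteq> {} \<and> (\<forall>p\<in>supp a. ratio_attained \<rho> (L p (a p)))"
proof -
  interpret MM: comm_monoid_cancel M by (rule MM)
  show ?thesis
    using MM.set_elasticity_length_set_eq_iff[OF ideal_in_M[OF a] length_set_M_nonempty[OF ideal_in_M[OF a]] \<rho>(1)]
      bounded[OF ideal_in_M[OF a]] Units_M[OF a] attained_M_iff[OF a] \<rho>(2) \<rho>1 by auto
qed

lemma one_length_if_half_factorial:
  assumes "\<rho> = 1" "I \<in> carrier M" "m \<in> length_set M I" "n \<in> length_set M I"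
  shows "m = n"
proof -
  have "real m \<le> 1 * real n" "real n \<le> 1 * real m"
    using bounded[OF assms(2)] assms unfolding ratio_bounded_def by blast+
  then show ?thesis by simp
qed

lemma Ext_X: "p \<in> Ext \<Longrightarrow> p \<in> X" using E_X by (auto simp: Ext_def)

lemma Ext_empty_if_half_factorial:
  assumes "\<rho> = 1"
  shows "Ext = {}"
proof (rule ccontr)
  assume "Ext \<noteq> {}"
  then obtain p where p: "p \<in> Ext" by blast
  have pX: "p \<in> X" using Ext_X p .
  have dist: "distances_of (submon Q (D p)) (D p) \<noteq> {}" using p by (simp add: Ext_def)
  obtain b m where b: "b \<in> D p" "m \<in> L p b" "m + d p \<in> L p b" using d_facts(2)[OF pX dist] by blast
  have "m = m + d p"
    by (rule one_length_if_half_factorial[OF assms ideal_in_M[OF integral_update[OF integral_one pX b(1)]],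
          unfolded length_set_M_local[OF pX b(1)], OF b(2,3)])
  then show False using d_facts(1)[OF pX dist] by simp
qed

theorem Delta_rho_star_M:
  "{Gcd (d ` I) | I. I \<noteq> {} \<and> I \<subseteq> Ext} = Delta_rho_star M"
proof (cases "\<rho> = 1")
  case True
  have "distances_of M (powers_of M I) = {}" if "I \<in> carrier M" for I
  proof (rule ccontr)
    interpret MM: comm_monoid_cancel M by (rule MM)
    assume "distances_of M (powers_of M I) \<noteq> {}"
    then obtain e k where "e \<in> distances (length_set M (I [^]\<^bsub>M\<^esub> (k::nat)))"
      by (auto simp: distances_of_def powers_of_def)
    then show False
      using one_length_if_half_factorial[OF True MM.nat_pow_closed[OF that]] distances_pos distancesE
      by (metis add_cancel_left_right less_numeral_extra(3))
  qed
  then show ?thesis using Ext_empty_if_half_factorial[OF True] by (auto simp: Delta_rho_star_def)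
next
  case False
  then have \<rho>1: "1 < \<rho>" using \<rho> by simp
  show ?thesis
  proof (intro equalityI subsetI)
    fix e assume "e \<in> {Gcd (d ` I) | I. I \<noteq> {} \<and> I \<subseteq> Ext}"
    then obtain I where I: "I \<noteq> {}" "I \<subseteq> Ext" "e = Gcd (d ` I)" by blast
    have IX: "I \<subseteq> X" using I Ext_X by blast
    have "I \<subseteq> E" using I(2) by (auto simp: Ext_def)
    then have fI: "finite I" using finite_E by (rule finite_subset)
    have "\<forall>p\<in>I. \<exists>x. x \<in> D p \<and> x \<notin> U p \<and> ratio_attained \<rho> (L p x)"
    proof
      fix p assume p: "p \<in> I"
      then have pX: "p \<in> X" and el: "elasticity (submon Q (D p)) = ennreal \<rho>"
        and acc: "accepted_elasticity (submon Q (D p))" using I IX \<rho> by (auto simp: Ext_def)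
      interpret Dp: comm_monoid_cancel "submon Q (D p)" by (rule DM[OF pX])
      show "\<exists>x. x \<in> D p \<and> x \<notin> U p \<and> ratio_attained \<rho> (L p x)"
      proof (rule Dp.accepted_elasticity_obtains[OF acc])
        fix r assume r: "1 \<le> r" "elasticity (submon Q (D p)) = ennreal r"
          "1 < r \<Longrightarrow> \<exists>a\<in>carrier (submon Q (D p)). a \<notin> Units (submon Q (D p)) \<and> ratio_attained r (L p a)"
        have "ennreal r = ennreal \<rho>" using r(2) el by simp
        then have "r = \<rho>" using r(1) \<rho>(1) by simp
        then show ?thesis using r(3) \<rho>1 Units_D[OF pX] by auto
      qed
    qed
    then obtain x where x: "\<And>p. p \<in> I \<Longrightarrow> x p \<in> D p \<and> x p \<notin> U p \<and> ratio_attained \<rho> (L p (x p))" by metis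
    define a where "a = (\<lambda>p. if p \<in> I then x p else \<one>)"
    have sub: "{p \<in> X. a p \<notin> U p} \<subseteq> I" using U_one by (auto simp: a_def)
    have aD: "a p \<in> D p" if "p \<in> X" for p using x D_one that by (simp add: a_def)
    have a: "a \<in> integral"
      using finite_subset[OF sub fI] aD D_carrier by (simp add: integral_def families_def)
    have s: "supp a = I" using sub IX x by (auto simp: supp_def a_def)
    have el: "set_elasticity (length_set M (ideal a)) = elasticity M"
      using set_elasticity_M_iff[OF a \<rho>1] s I(1) x by (simp add: a_def)
    have dist: "distances_of (submon Q (D p)) (D p) \<noteq> {}" if "p \<in> supp a" for p
      using that s I by (auto simp: Ext_def)
    have "supp a \<noteq> {}" using s I by simp
    note md = min_distance_powers_M[OF a this dist]
    show "e \<in> Delta_rho_star M"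
      unfolding Delta_rho_star_def mem_Collect_eq
      by (rule exI[of _ "ideal a"]) (use md el ideal_in_M[OF a] I(3) s in simp)
  next
    fix e assume "e \<in> Delta_rho_star M"
    then obtain J where J: "J \<in> carrier M" "set_elasticity (length_set M J) = elasticity M"
      "e = Inf (distances_of M (powers_of M J))" by (auto simp: Delta_rho_star_def)
    then obtain a where a: "a \<in> integral" "J = ideal a" by (auto simp: carrier_M)
    have s: "supp a \<noteq> {}" "\<forall>p\<in>supp a. ratio_attained \<rho> (L p (a p))"
      using set_elasticity_M_iff[OF a(1) \<rho>1] J a by auto
    have ext: "p \<in> Ext" if "p \<in> supp a" for p
      using elasticity_local_of_attained[OF _ integral_D[OF a(1)] _ \<rho>1] s(2) that by (simp add: supp_def)
    have "e = Gcd (d ` supp a)"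
      using min_distance_powers_M(2)[OF a(1) s(1)] ext J a by (simp add: Ext_def)
    then show "e \<in> {Gcd (d ` I) | I. I \<noteq> {} \<and> I \<subseteq> Ext}" using s(1) ext by blast
  qed
qed

text \<open>If \<open>m\<close> and \<open>m + e\<close> are lengths of \<open>c\<close>, then \<open>l m + j e\<close> with \<open>j \<le> l\<close> are lengths of
  \<open>c ^ l\<close>; for a minimal distance \<open>e\<close> this run makes the set of lengths an AAP.\<close>

theorem Delta_rho_star_subset_Delta_rho: "Delta_rho_star M \<subseteq> Delta_rho M"
proof
  interpret MM: comm_monoid_cancel M by (rule MM)
  fix e assume "e \<in> Delta_rho_star M"
  then obtain J where J: "J \<in> carrier M" "set_elasticity (length_set M J) = elasticity M"
    "e = Inf (distances_of M (powers_of M J))" "distances_of M (powers_of M J) \<noteq> {}" by (auto simp: Delta_rho_star_def)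
  note md = MM.min_distance_powers_facts[OF J(1,4), folded J(3)]
  obtain k m where k: "m \<in> length_set M (J [^]\<^bsub>M\<^esub> (k::nat))" "m + e \<in> length_set M (J [^]\<^bsub>M\<^esub> k)"
    using md(2) by (auto simp: distances_of_def powers_of_def elim: distancesE)
  have \<rho>1: "\<rho> \<noteq> 1" using one_length_if_half_factorial[OF _ MM.nat_pow_closed[OF J(1)] k] md(1) by auto
  have nu: "J \<notin> Units M" and att: "ratio_attained \<rho> (length_set M J)"
    using MM.set_elasticity_length_set_eq_iff[OF J(1) length_set_M_nonempty[OF J(1)] \<rho>(1)] J(2) \<rho>(2) \<rho>1
    by (auto split: if_splits)
  have run: "l * m + j * e \<in> length_set M ((J [^]\<^bsub>M\<^esub> k) [^]\<^bsub>M\<^esub> l)" if "j \<le> l" for j l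
    using that
  proof (induction l arbitrary: j)
    case 0
    then show ?case by (simp add: MM.length_set_Unit)
  next
    case (Suc l)
    show ?case
    proof (cases "j \<le> l")
      case True
      then show ?thesis using MM.length_set_add[OF _ _ Suc.IH[OF True] k(1)] J(1) by (simp add: algebra_simps)
    next
      case False
      then have "j = Suc l" using Suc.prems by simp
      then show ?thesis using MM.length_set_add[OF _ _ Suc.IH[OF order_refl] k(2)] J(1) by (simp add: algebra_simps)
    qed
  qed
  have "\<exists>L\<in>system_of_length_sets M. \<exists>l\<ge>n. is_AAP e l (int ` L) \<and> set_elasticity L = elasticity M" if n: "0 < n" for n
  proof -
    let ?K = "J [^]\<^bsub>M\<^esub> (k * n)"
    have e: "(J [^]\<^bsub>M\<^esub> k) [^]\<^bsub>M\<^esub> n = ?K" by (rule MM.nat_pow_pow[OF J(1)])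
    have K: "?K \<in> carrier M" using J(1) by simp
    have k0: "k \<noteq> 0"
    proof
      assume "k = 0"
      then show False using k md(1) by (simp add: MM.length_set_Unit)
    qed
    obtain x y where xy: "x \<in> length_set M J" "y \<in> length_set M J" "0 < y" "real x = \<rho> * real y"
      using att unfolding ratio_attained_def by blast
    have attK: "ratio_attained \<rho> (length_set M ?K)"
      using MM.length_set_pow[OF J(1) xy(1), of "k * n"] MM.length_set_pow[OF J(1) xy(2), of "k * n"] xy k0 n
      by (intro ratio_attainedI[of "k * n * x" _ "k * n * y"]) auto
    have nuK: "?K \<notin> Units M"
    proof
      assume "?K \<in> Units M"
      then show False using attK by (simp add: MM.length_set_Unit ratio_attained_def)
    qed
    have "set_elasticity (length_set M ?K) = ennreal \<rho>"
      using MM.set_elasticity_length_set_eq_iff[OF K length_set_M_nonempty[OF K] \<rho>(1)] attK nuK bounded[OF K] by simp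
    moreover have "is_AAP e n (int ` length_set M ?K)"
    proof (rule is_AAPI[OF md(1) ratio_bounded_finite[OF bounded[OF K]]])
      show "n * m + j * e \<in> length_set M ?K" if "j \<le> n" for j using run[OF that] e by simp
      show "gap_dvd e (length_set M ?K)" using md(3)[of e] by simp
    qed
    ultimately show ?thesis using K \<rho>(2) by (auto simp: system_of_length_sets_def)
  qed
  then show "e \<in> Delta_rho M" using md(1) by (simp add: Delta_rho_def)
qed

text \<open>A long AAP forces a large valuation at some extremal place \<open>p\<close>; there the ideal is divisible
  by an element realizing the minimal distance \<open>d p\<close>.\<close>

theorem Delta_rho_M_divides:
  assumes e: "e \<in> Delta_rho M"
  shows "\<exists>e'\<in>Delta_rho_star M. e dvd e'"
proof -
  interpret MM: comm_monoid_cancel M by (rule MM)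
  have e0: "0 < e" using e by (simp add: Delta_rho_def)
  have fE: "finite Ext" using finite_E by (simp add: Ext_def)
  have dist: "distances_of (submon Q (D p)) (D p) \<noteq> {}" if "p \<in> Ext" for p using that by (simp add: Ext_def)
  have "\<exists>b. p \<in> Ext \<longrightarrow> b \<in> D p \<and> (\<exists>m\<in>L p b. m + d p \<in> L p b)" for p
    using d_facts(2)[OF Ext_X dist, of p] by blast
  then obtain b where b: "\<And>p. p \<in> Ext \<Longrightarrow> b p \<in> D p \<and> (\<exists>m\<in>L p (b p). m + d p \<in> L p (b p))" by metis
  have "\<exists>r. p \<in> X \<longrightarrow> P p = {r}" for p
  proof -
    have "elasticity M < \<infinity>" using \<rho>(2) by simp
    then show ?thesis using finite_elasticity_M_iff by blast
  qed
  then obtain r where r: "\<And>p. p \<in> X \<Longrightarrow> P p = {r p}" by metis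
  define B where "B = (\<lambda>p. nat (int (\<alpha> p) + v p (r p) (b p)))"
  define k where "k = Suc (sum B Ext)"
  obtain LL l where LL: "LL \<in> system_of_length_sets M" "k \<le> l" "is_AAP e l (int ` LL)" "set_elasticity LL = elasticity M"
    using e unfolding Delta_rho_def k_def by blast
  obtain a where a: "a \<in> integral" "LL = length_set M (ideal a)"
    using LL(1) by (auto simp: system_of_length_sets_def carrier_M)
  obtain y where y: "y \<in> LL" "y + l * e \<in> LL" using is_AAP_facts(2)[OF LL(3)] by blast
  have l0: "0 < l * e" using LL(2) e0 by (simp add: k_def)
  have "\<rho> \<noteq> 1"
  proof
    assume "\<rho> = 1"
    then have "y = y + l * e" using one_length_if_half_factorial[OF _ ideal_in_M[OF a(1)]] y a(2) by blast
    then show False using l0 by simp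
  qed
  then have \<rho>1: "1 < \<rho>" using \<rho>(1) by simp
  have s: "\<forall>p\<in>supp a. ratio_attained \<rho> (L p (a p))" using set_elasticity_M_iff[OF a(1) \<rho>1] LL(4) a(2) by simp
  have ext: "supp a \<subseteq> Ext"
    using elasticity_local_of_attained[OF _ integral_D[OF a(1)] _ \<rho>1] s by (auto simp: supp_def)
  obtain t where t: "\<forall>p\<in>X. t p \<in> L p (a p)" "y + l * e = sum t (supp a)"
    using length_set_M[OF a(1)] y(2) a(2) by blast
  have "\<exists>p\<in>supp a. B p < t p"
  proof (rule ccontr)
    assume "\<not> (\<exists>p\<in>supp a. B p < t p)"
    then have "sum t (supp a) \<le> sum B (supp a)" by (intro sum_mono) (simp add: not_less)
    also have "\<dots> \<le> sum B Ext" using ext fE by (intro sum_mono2) auto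
    also have "\<dots> < k" by (simp add: k_def)
    also have "k \<le> l" by (rule LL(2))
    also have "l \<le> l * e" using e0 by simp
    also have "l * e \<le> sum t (supp a)" using t(2) by simp
    finally show False by simp
  qed
  then obtain p where p: "p \<in> supp a" "B p < t p" by blast
  have pX: "p \<in> X" and pE: "p \<in> Ext" using p ext by (auto simp: supp_def)
  interpret pv: primary_valuations Q "D p" "P p" "v p" "\<alpha> p" by (rule primary[OF pX])
  have aD: "a p \<in> D p" using integral_D[OF a(1) pX] .
  have bD: "b p \<in> D p" using b[OF pE] by blast
  have rP: "r p \<in> P p" using r[OF pX] by simp
  have "int (t p) \<le> v p (r p) (a p)" using pv.length_le_v[OF aD _ rP] t(1) pX by blast
  moreover have "int (\<alpha> p) + v p (r p) (b p) \<le> int (B p)" by (simp add: B_def)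
  ultimately have big: "int (\<alpha> p) + v p (r p) (b p) \<le> v p (r p) (a p)" using p(2) by linarith
  have cc: "a p \<in> carrier Q" "b p \<in> carrier Q" using D_carrier[OF pX] aD bD by auto
  have "a p \<otimes> inv (b p) \<in> D p"
    using big cc r[OF pX] by (intro pv.v_large) (auto simp: pv.v_mult pv.v_inv)
  moreover have "a p = b p \<otimes> (a p \<otimes> inv (b p))" using cc by (simp add: cancel_inv)
  ultimately obtain c where c: "c \<in> D p" "a p = b p \<otimes> c" by blast
  obtain w where w: "w \<in> L p c" using L_nonempty[OF pX c(1)] by blast
  obtain m where m: "m \<in> L p (b p)" "m + d p \<in> L p (b p)" using b[OF pE] by blast
  have "m + w \<in> L p (a p)" "m + d p + w \<in> L p (a p)"
    unfolding c(2) using pv.DM.length_set_add[of "b p" c] bD c(1) m w by auto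
  moreover have "gap_dvd e (L p (a p))"
    using is_AAP_facts(1)[OF LL(3)] a(2) gap_dvd_M_iff[OF a(1)] p(1) by simp
  ultimately have "int e dvd int (m + d p + w) - int (m + w)" unfolding gap_dvd_def by blast
  then have "e dvd d p" by simp
  moreover have "Gcd (d ` {p}) \<in> Delta_rho_star M" unfolding Delta_rho_star_M[symmetric] using pE by blast
  ultimately show ?thesis by (intro bexI[of _ "Gcd (d ` {p})"]) auto
qed

end

end

section \<open>The complete integral closure\<close>

context weakly_Krull_family
begin

abbreviation cic where "cic \<equiv> complete_integral_closure Q H"

lemma pv: "p \<in> X \<Longrightarrow> primary_valuations Q (D p) (P p) (v p) (\<alpha> p)" by (rule primary)

lemmas v_mult = primary_valuations.v_mult[OF pv]
lemmas v_inv = primary_valuations.v_inv[OF pv]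
lemmas v_pow = primary_valuations.v_pow[OF pv]
lemmas v_one = primary_valuations.v_one[OF pv]

lemma v_D: "p \<in> X \<Longrightarrow> r \<in> P p \<Longrightarrow> x \<in> D p \<Longrightarrow> 0 \<le> v p r x"
  using primary_valuations.v_nonneg[OF pv] by blast

lemma v_U: "p \<in> X \<Longrightarrow> r \<in> P p \<Longrightarrow> x \<in> U p \<Longrightarrow> v p r x = 0"
  using primary_valuations.v_Unit[OF pv] unfolding U_def by blast

lemma v_nonunit_D: "p \<in> X \<Longrightarrow> r \<in> P p \<Longrightarrow> x \<in> D p \<Longrightarrow> x \<notin> U p \<Longrightarrow> 1 \<le> v p r x"
  using primary_valuations.v_nonunit[OF pv] unfolding U_def by blast

lemma approximation_one:
  assumes "p \<in> X" "x \<in> carrier Q"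
  obtains s where "s \<in> H" "inv s \<in> D p" "\<And>q. q \<in> X \<Longrightarrow> q \<noteq> p \<Longrightarrow> s \<otimes> x \<in> D q"
proof -
  obtain s where s: "s \<in> H" "inv s \<in> D p" "\<forall>q\<in>X. q \<noteq> p \<longrightarrow> inv \<one> \<otimes> (s \<otimes> x) \<in> D q"
    using approximation[OF assms H_families] by blast
  have "s \<otimes> x \<in> D q" if "q \<in> X" "q \<noteq> p" for q
    using s(3) that H_carrier[OF s(1)] assms(2) by simp
  then show ?thesis using that s by blast
qed

text \<open>A common multiplier into the local conductors at finitely many places.\<close>

lemma exists_large_at:
  assumes "finite S" "S \<subseteq> X"
  shows "\<exists>c\<in>H. \<forall>p\<in>S. \<forall>r\<in>P p. int (\<alpha> p) \<le> v p r c"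
  using assms
proof (induction S)
  case empty
  then show ?case using submonoid.one_closed[OF submonoid_H] by blast
next
  case (insert p S)
  then obtain c where c: "c \<in> H" "\<forall>p\<in>S. \<forall>r\<in>P p. int (\<alpha> p) \<le> v p r c" by auto
  have p: "p \<in> X" using insert by simp
  interpret pv: primary_valuations Q "D p" "P p" "v p" "\<alpha> p" by (rule pv[OF p])
  obtain y where y: "y \<in> carrier Q" "\<forall>r\<in>P p. v p r y = int (\<alpha> p)"
    using pv.v_prescribed[of "\<lambda>_. int (\<alpha> p)"] by blast
  have yD: "y \<in> D p" using y by (intro pv.v_large) auto
  obtain s where s: "s \<in> H" "inv s \<in> D p" "\<And>q. q \<in> X \<Longrightarrow> q \<noteq> p \<Longrightarrow> s \<otimes> y \<in> D q"
    using approximation_one[OF p y(1)] by blast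
  have sc: "s \<in> carrier Q" using H_carrier s(1) .
  have "s \<otimes> y \<in> D q" if q: "q \<in> X" for q
    using s(3)[OF q] D_mult[OF p H_D[OF p s(1)] yD] by (cases "q = p") auto
  then have sy: "s \<otimes> y \<in> H" using sc y H_eq by simp
  have cc: "c \<in> carrier Q" using H_carrier c(1) .
  have "int (\<alpha> q) \<le> v q r (c \<otimes> (s \<otimes> y))" if q: "q \<in> insert p S" and r: "r \<in> P q" for q r
  proof -
    have qX: "q \<in> X" using q insert.prems by auto
    have e: "v q r (c \<otimes> (s \<otimes> y)) = v q r c + v q r (s \<otimes> y)" using v_mult[OF qX r cc] sc y(1) by simp
    have nn: "0 \<le> v q r c" "0 \<le> v q r (s \<otimes> y)" using v_D[OF qX r] H_D[OF qX] c(1) sy by auto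
    show ?thesis
    proof (cases "q = p")
      case True
      have "s \<in> U p" using s(1,2) H_D[OF p] by (simp add: U_def)
      then have "v q r s = 0" using v_U[OF p] r True by blast
      then have "v q r (s \<otimes> y) = int (\<alpha> q)" using v_mult[OF qX r sc y(1)] y(2) r True by simp
      then show ?thesis using e nn by simp
    next
      case False
      then have "int (\<alpha> q) \<le> v q r c" using c(2) q r by blast
      then show ?thesis using e nn by simp
    qed
  qed
  then show ?case using H_mult[OF c(1) sy] by blast
qed

text \<open>An element with non-negative valuations lies in \<open>D p\<close> for all but finitely many \<open>p\<close>, and at the
  remaining places a fixed element of large valuation multiplies all its powers into \<open>D p\<close>.\<close>

lemma cic_eq: "cic = {x \<in> carrier Q. \<forall>p\<in>X. \<forall>r\<in>P p. 0 \<le> v p r x}"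
proof (intro equalityI subsetI)
  fix x assume "x \<in> cic"
  then obtain c where x: "x \<in> carrier Q" and c: "c \<in> H" "\<And>n::nat. n > 0 \<Longrightarrow> c \<otimes> x [^] n \<in> H"
    by (auto simp: complete_integral_closure_def)
  have "0 \<le> v p r x" if p: "p \<in> X" and r: "r \<in> P p" for p r
  proof (rule ccontr)
    assume n: "\<not> 0 \<le> v p r x"
    have cc: "c \<in> carrier Q" using H_carrier c(1) .
    define n where "n = Suc (nat (v p r c))"
    have "0 \<le> v p r (c \<otimes> x [^] n)" by (rule v_D[OF p r H_D[OF p c(2)]]) (simp add: n_def)
    also have "\<dots> = v p r c + int n * v p r x"
      using v_mult[OF p r cc, of "x [^] n"] v_pow[OF p r x, of n] x by simp
    also have "\<dots> \<le> v p r c + int n * (-1)" using n by (intro add_left_mono mult_left_mono) auto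
    also have "\<dots> < 0" by (simp add: n_def)
    finally show False by simp
  qed
  then show "x \<in> {x \<in> carrier Q. \<forall>p\<in>X. \<forall>r\<in>P p. 0 \<le> v p r x}" using x by blast
next
  fix x assume x0: "x \<in> {x \<in> carrier Q. \<forall>p\<in>X. \<forall>r\<in>P p. 0 \<le> v p r x}"
  then have x: "x \<in> carrier Q" "\<And>p r. p \<in> X \<Longrightarrow> r \<in> P p \<Longrightarrow> 0 \<le> v p r x" by auto
  let ?B = "{p \<in> X. x \<notin> U p}"
  obtain c where c: "c \<in> H" "\<forall>p\<in>?B. \<forall>r\<in>P p. int (\<alpha> p) \<le> v p r c"
    using exists_large_at[OF finite_nonunits[OF x(1)]] by blast
  have cc: "c \<in> carrier Q" using H_carrier c(1) .
  have "c \<otimes> x [^] n \<in> H" for n :: nat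
  proof -
    have "c \<otimes> x [^] n \<in> D p" if p: "p \<in> X" for p
    proof (cases "p \<in> ?B")
      case True
      show ?thesis
      proof (rule primary_valuations.v_large[OF pv[OF p]])
        fix r assume r: "r \<in> P p"
        have "0 \<le> int n * v p r x" using x(2)[OF p r] by simp
        then show "int (\<alpha> p) \<le> v p r (c \<otimes> x [^] n)"
          using v_mult[OF p r cc, of "x [^] n"] v_pow[OF p r x(1), of n] x(1) c(2) True r by fastforce
      qed (use cc x in simp)
    next
      case False
      then have "x \<in> D p" using p by (simp add: U_def)
      then show ?thesis using D_mult[OF p H_D[OF p c(1)] D_pow[OF p]] by blast
    qed
    then show ?thesis using H_eq cc x by simp
  qed
  then show "x \<in> cic" using x(1) c(1) by (auto simp: complete_integral_closure_def)
qed

lemma cic_carrier: "x \<in> cic \<Longrightarrow> x \<in> carrier Q" by (simp add: complete_integral_closure_def)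

lemma v_cic: "x \<in> cic \<Longrightarrow> p \<in> X \<Longrightarrow> r \<in> P p \<Longrightarrow> 0 \<le> v p r x" using cic_eq by blast

lemma H_cic: "x \<in> H \<Longrightarrow> x \<in> cic" using cic_eq H_carrier H_D v_D by blast

lemma submonoid_cic: "submonoid cic Q"
proof
  show "cic \<subseteq> carrier Q" using cic_carrier by blast
  show "\<one> \<in> cic" using H_cic submonoid.one_closed[OF submonoid_H] by blast
  fix x y assume xy: "x \<in> cic" "y \<in> cic"
  then have c: "x \<in> carrier Q" "y \<in> carrier Q" using cic_carrier by auto
  have "0 \<le> v p r (x \<otimes> y)" if "p \<in> X" "r \<in> P p" for p r
    using v_mult[OF that c] v_cic[OF xy(1) that] v_cic[OF xy(2) that] by simp
  then show "x \<otimes> y \<in> cic" using c by (simp add: cic_eq)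
qed

lemma cic_mult: "x \<in> cic \<Longrightarrow> y \<in> cic \<Longrightarrow> x \<otimes> y \<in> cic" using submonoid.m_closed[OF submonoid_cic] .

lemma local_cic_multiple:
  assumes p: "p \<in> X" and x: "x \<in> carrier Q" "\<And>r. r \<in> P p \<Longrightarrow> 0 \<le> v p r x"
  obtains s where "s \<in> H" "inv s \<in> D p" "s \<otimes> x \<in> cic"
proof -
  obtain s where s: "s \<in> H" "inv s \<in> D p" "\<And>q. q \<in> X \<Longrightarrow> q \<noteq> p \<Longrightarrow> s \<otimes> x \<in> D q"
    using approximation_one[OF p x(1)] by blast
  have sc: "s \<in> carrier Q" using H_carrier s(1) .
  have "0 \<le> v q r (s \<otimes> x)" if q: "q \<in> X" and r: "r \<in> P q" for q r
  proof (cases "q = p")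
    case True
    then show ?thesis using v_mult[OF q r sc x(1)] x(2) r v_D[OF q r H_D[OF q s(1)]] by simp
  next
    case False
    then show ?thesis using v_D[OF q r s(3)[OF q]] by simp
  qed
  then have "s \<otimes> x \<in> cic" using sc x(1) by (simp add: cic_eq)
  then show ?thesis using that s by blast
qed

definition cic_prime :: "'i \<Rightarrow> 'a \<Rightarrow> 'a set" where
  "cic_prime p r = {x \<in> cic. 1 \<le> v p r x}"

lemma cic_prime_is_prime:
  assumes p: "p \<in> X" and r: "r \<in> P p"
  shows "prime_s_ideal Q cic (cic_prime p r)"
proof -
  have mem: "x \<otimes> y \<in> cic_prime p r" if "x \<in> cic_prime p r" "y \<in> cic" for x y
    using that cic_mult v_mult[OF p r, of x y] cic_carrier v_cic[OF that(2) p r] by (auto simp: cic_prime_def)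
  have "cic_prime p r <#> cic = cic_prime p r"
  proof (intro equalityI subsetI)
    fix x assume "x \<in> cic_prime p r <#> cic"
    then show "x \<in> cic_prime p r" using mem by (auto simp: set_mult_def)
  next
    fix x assume x: "x \<in> cic_prime p r"
    then have "x = x \<otimes> \<one>" using cic_carrier by (auto simp: cic_prime_def)
    then show "x \<in> cic_prime p r <#> cic"
      using x submonoid.one_closed[OF submonoid_cic] unfolding set_mult_def by blast
  qed
  moreover have "submonoid (cic - cic_prime p r) (submon Q cic)"
  proof (rule submonoid.intro)
    show "\<one>\<^bsub>submon Q cic\<^esub> \<in> cic - cic_prime p r"
      using submonoid.one_closed[OF submonoid_cic] v_one[OF p r] by (simp add: cic_prime_def)
    fix x y assume "x \<in> cic - cic_prime p r" "y \<in> cic - cic_prime p r"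
    then show "x \<otimes>\<^bsub>submon Q cic\<^esub> y \<in> cic - cic_prime p r"
      using cic_mult v_mult[OF p r, of x y] cic_carrier by (auto simp: cic_prime_def)
  qed auto
  ultimately show ?thesis by (auto simp: prime_s_ideal_def s_ideal_def cic_prime_def)
qed

lemma cic_prime_uniformizer:
  assumes p: "p \<in> X" and r: "r \<in> P p"
  obtains y where "y \<in> cic" "v p r y = 1" "\<forall>s\<in>P p. s \<noteq> r \<longrightarrow> v p s y = 0"
proof -
  interpret pv: primary_valuations Q "D p" "P p" "v p" "\<alpha> p" by (rule pv[OF p])
  have rc: "r \<in> carrier Q" using pv.P_closed r by blast
  obtain s where s: "s \<in> H" "inv s \<in> D p" "s \<otimes> r \<in> cic"
    using local_cic_multiple[OF p rc] pv.v_prime r by (metis zero_le_one order_refl)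
  have "s \<in> U p" using s H_D[OF p] by (simp add: U_def)
  then have "v p t (s \<otimes> r) = v p t r" if "t \<in> P p" for t
    using pv.v_mult[OF that H_carrier[OF s(1)] rc] v_U[OF p that] by simp
  then show ?thesis using that[of "s \<otimes> r"] s(3) pv.v_prime r by simp
qed

text \<open>Distinct valuations are independent: at one place because of the primes of the factorial monoid,
  at two places because the places are separated.\<close>

lemma cic_prime_subset:
  assumes p: "p \<in> X" "r \<in> P p" and q: "q \<in> X" "s \<in> P q" and sub: "cic_prime q s \<subseteq> cic_prime p r"
  shows "q = p \<and> s = r"
proof (rule ccontr)
  assume n: "\<not> (q = p \<and> s = r)"
  show False
  proof (cases "p = q")
    case True
    obtain y where y: "y \<in> cic" "v q s y = 1" "\<forall>t\<in>P q. t \<noteq> s \<longrightarrow> v q t y = 0"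
      using cic_prime_uniformizer[OF q] .
    then have "y \<in> cic_prime p r" using sub by (auto simp: cic_prime_def)
    then show False using y(3) True n p(2) by (auto simp: cic_prime_def)
  next
    case False
    obtain a where a: "a \<in> H" "inv a \<in> D p" "inv a \<notin> D q" using separated[OF p(1) q(1) False] by blast
    have "a \<in> U p" "a \<notin> U q" using a H_D[OF p(1)] by (auto simp: U_def)
    then have "1 \<le> v q s a" "v p r a = 0" using v_nonunit_D[OF q H_D[OF q(1) a(1)]] v_U[OF p] by auto
    then have "a \<in> cic_prime q s" "a \<notin> cic_prime p r" using H_cic[OF a(1)] by (auto simp: cic_prime_def)
    then show False using sub by blast
  qed
qed

text \<open>If each of the finitely many valuation primes containing a given \<open>x \<in> I\<close> had an element outside
  \<open>I\<close>, then a product of powers of these elements would be a multiple of \<open>x\<close> outside \<open>I\<close>.\<close>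

lemma prime_contains_cic_prime:
  assumes I: "prime_s_ideal Q cic I" "I \<noteq> {}"
  obtains p r where "p \<in> X" "r \<in> P p" "cic_prime p r \<subseteq> I"
proof -
  have Isub: "I \<subseteq> cic" and IH: "I <#> cic = I" and sm: "submonoid (cic - I) (submon Q cic)"
    using I by (auto simp: prime_s_ideal_def s_ideal_def)
  obtain x where x: "x \<in> I" using I by blast
  have xc: "x \<in> cic" "x \<in> carrier Q" using x Isub cic_carrier by auto
  have "\<exists>p\<in>X. \<exists>r\<in>P p. cic_prime p r \<subseteq> I"
  proof (rule ccontr)
    assume none: "\<not> (\<exists>p\<in>X. \<exists>r\<in>P p. cic_prime p r \<subseteq> I)"
    define S where "S = (SIGMA p:{p \<in> X. x \<notin> U p}. P p)"
    have fS: "finite S" unfolding S_def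
      using finite_nonunits[OF xc(2)] primary_valuations.finite_P[OF pv] by (intro finite_SigmaI) auto
    have "\<exists>y\<in>cic - I. \<forall>(p, r)\<in>T. v p r x \<le> v p r y" if "finite T" "T \<subseteq> S" for T
      using that
    proof (induction T)
      case empty
      then show ?case using submonoid.one_closed[OF sm] by auto
    next
      case (insert z T)
      obtain p r where z: "z = (p, r)" by (cases z)
      have p: "p \<in> X" "r \<in> P p" using insert.prems z by (auto simp: S_def)
      obtain y where y: "y \<in> cic - I" "\<forall>(p, r)\<in>T. v p r x \<le> v p r y" using insert by auto
      obtain w where w: "w \<in> cic" "1 \<le> v p r w" "w \<notin> I" using none p by (auto simp: cic_prime_def)
      define n where "n = nat (v p r x)"
      have wn: "w [^] n \<in> cic - I"
      proof (induction n)
        case 0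
        then show ?case using submonoid.one_closed[OF sm] by simp
      next
        case (Suc n)
        then show ?case using submonoid.m_closed[OF sm, of "w [^] n" w] w by simp
      qed
      have c: "y \<in> carrier Q" "w \<in> carrier Q" using y w cic_carrier by auto
      have yw: "y \<otimes> w [^] n \<in> cic - I" using submonoid.m_closed[OF sm y(1) wn] by simp
      have "v q s x \<le> v q s (y \<otimes> w [^] n)" if qs: "(q, s) \<in> insert z T" for q s
      proof -
        have q: "q \<in> X" "s \<in> P q" using qs insert.prems by (auto simp: S_def)
        have e: "v q s (y \<otimes> w [^] n) = v q s y + int n * v q s w"
          using v_mult[OF q c(1), of "w [^] n"] v_pow[OF q c(2)] c by simp
        have nn: "0 \<le> v q s y" "0 \<le> v q s w" using v_cic[OF _ q] y w by auto
        show ?thesis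
        proof (cases "(q, s) = z")
          case True
          then have "q = p" "s = r" using z by auto
          have "int n * 1 \<le> int n * v p r w" using w(2) by (intro mult_left_mono) auto
          moreover have "v p r x \<le> int n" by (simp add: n_def)
          ultimately have "v q s x \<le> int n" "int n \<le> int n * v q s w" using \<open>q = p\<close> \<open>s = r\<close> by simp_all
          then show ?thesis using e nn by linarith
        next
          case False
          then have "v q s x \<le> v q s y" using qs y(2) by auto
          moreover have "0 \<le> int n * v q s w" using nn by simp
          ultimately show ?thesis using e by linarith
        qed
      qed
      then show ?case using yw by blast
    qed
    then obtain y where y: "y \<in> cic - I" "\<forall>(p, r)\<in>S. v p r x \<le> v p r y" using fS by blast
    have yc: "y \<in> carrier Q" using y cic_carrier by blast
    have "0 \<le> v p r (inv x \<otimes> y)" if p: "p \<in> X" "r \<in> P p" for p r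
    proof -
      have e: "v p r (inv x \<otimes> y) = v p r y - v p r x" using v_mult[OF p, of "inv x" y] v_inv[OF p xc(2)] xc yc by simp
      show ?thesis
      proof (cases "(p, r) \<in> S")
        case True
        then show ?thesis using y(2) e by auto
      next
        case False
        then have "x \<in> U p" using p by (simp add: S_def)
        then show ?thesis using v_U[OF p] e v_cic[OF _ p] y by simp
      qed
    qed
    then have "inv x \<otimes> y \<in> cic" using xc yc by (simp add: cic_eq)
    then have "x \<otimes> (inv x \<otimes> y) \<in> I <#> cic" using x by (auto simp: set_mult_def)
    then have "y \<in> I" using IH xc yc by (simp add: cancel_inv)
    then show False using y by blast
  qed
  then show ?thesis using that by blast
qed

lemma minimal_primes_cic: "minimal_primes Q cic = {cic_prime p r | p r. p \<in> X \<and> r \<in> P p}"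
proof (intro equalityI subsetI)
  fix I assume "I \<in> minimal_primes Q cic"
  then have I: "prime_s_ideal Q cic I" "I \<noteq> {}"
    "\<And>J. prime_s_ideal Q cic J \<Longrightarrow> J \<noteq> {} \<Longrightarrow> J \<subseteq> I \<Longrightarrow> J = I" by (auto simp: minimal_primes_def)
  obtain p r where p: "p \<in> X" "r \<in> P p" "cic_prime p r \<subseteq> I" using prime_contains_cic_prime[OF I(1,2)] .
  obtain y where y: "y \<in> cic" "v p r y = 1" using cic_prime_uniformizer[OF p(1,2)] by blast
  then have "cic_prime p r \<noteq> {}" by (auto simp: cic_prime_def)
  then have "cic_prime p r = I" using I(3) cic_prime_is_prime[OF p(1,2)] p(3) by blast
  then show "I \<in> {cic_prime p r | p r. p \<in> X \<and> r \<in> P p}" using p by blast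
next
  fix I assume "I \<in> {cic_prime p r | p r. p \<in> X \<and> r \<in> P p}"
  then obtain p r where p: "p \<in> X" "r \<in> P p" and I: "I = cic_prime p r" by blast
  obtain y where y: "y \<in> cic" "v p r y = 1" using cic_prime_uniformizer[OF p] by blast
  have "J = I" if J: "prime_s_ideal Q cic J" "J \<noteq> {}" "J \<subseteq> I" for J
  proof -
    obtain q s where q: "q \<in> X" "s \<in> P q" "cic_prime q s \<subseteq> J" using prime_contains_cic_prime[OF J(1,2)] .
    then have "q = p \<and> s = r" using cic_prime_subset[OF p q(1,2)] J(3) I by blast
    then show ?thesis using q J I by blast
  qed
  moreover have "I \<noteq> {}" using y I by (auto simp: cic_prime_def)
  ultimately show "I \<in> minimal_primes Q cic" using cic_prime_is_prime[OF p] I by (simp add: minimal_primes_def)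
qed

lemma cic_prime_Int_H:
  assumes p: "p \<in> X" "r \<in> P p"
  shows "cic_prime p r \<inter> H = {h \<in> H. inv h \<notin> D p}"
proof -
  have "1 \<le> v p r h \<longleftrightarrow> inv h \<notin> D p" if h: "h \<in> H" for h
    using v_nonunit_D[OF p H_D[OF p(1) h]] v_U[OF p, of h] H_D[OF p(1) h] by (auto simp: U_def)
  then show ?thesis using H_cic by (auto simp: cic_prime_def)
qed

text \<open>All valuation primes at \<open>p\<close> contract to the set of elements of \<open>H\<close> that are non-units at \<open>p\<close>;
  so contraction is injective only if there is a single one at each place.\<close>

lemma contraction_bij_iff:
  assumes c: "\<And>p. p \<in> X \<Longrightarrow> c p = {h \<in> H. inv h \<notin> D p}"
  shows "bij_betw (\<lambda>I. I \<inter> H) (minimal_primes Q cic) (c ` X) \<longleftrightarrow> (\<forall>p\<in>X. \<exists>r. P p = {r})"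
proof
  assume bij: "bij_betw (\<lambda>I. I \<inter> H) (minimal_primes Q cic) (c ` X)"
  show "\<forall>p\<in>X. \<exists>r. P p = {r}"
  proof
    fix p assume p: "p \<in> X"
    obtain r where r: "r \<in> P p" using primary_valuations.P_nonempty[OF pv[OF p]] by blast
    have "s = r" if s: "s \<in> P p" for s
    proof -
      have "cic_prime p s \<inter> H = cic_prime p r \<inter> H" using cic_prime_Int_H[OF p] r s by simp
      moreover have "cic_prime p s \<in> minimal_primes Q cic" "cic_prime p r \<in> minimal_primes Q cic"
        using minimal_primes_cic p r s by auto
      ultimately have "cic_prime p s = cic_prime p r" using bij by (auto simp: bij_betw_def inj_on_def)
      then show "s = r" using cic_prime_subset[OF p r p s] by blast
    qed
    then show "\<exists>r. P p = {r}" using r by blast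
  qed
next
  assume rank: "\<forall>p\<in>X. \<exists>r. P p = {r}"
  have m: "cic_prime p r \<inter> H = c p" if "p \<in> X" "r \<in> P p" for p r using cic_prime_Int_H c that by simp
  have inj: "p = q" if pq: "p \<in> X" "q \<in> X" "c p = c q" for p q
  proof (rule ccontr)
    assume "p \<noteq> q"
    then obtain s where "s \<in> H" "inv s \<in> D p" "inv s \<notin> D q" using separated[OF pq(1,2)] by blast
    then have "s \<in> c q" "s \<notin> c p" using c pq by auto
    then show False using pq by simp
  qed
  show "bij_betw (\<lambda>I. I \<inter> H) (minimal_primes Q cic) (c ` X)"
    unfolding bij_betw_def
  proof
    show "inj_on (\<lambda>I. I \<inter> H) (minimal_primes Q cic)"
    proof (rule inj_onI)
      fix I J assume "I \<in> minimal_primes Q cic" "J \<in> minimal_primes Q cic" and e: "I \<inter> H = J \<inter> H"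
      then obtain p r q s where i: "p \<in> X" "r \<in> P p" "I = cic_prime p r" "q \<in> X" "s \<in> P q" "J = cic_prime q s"
        using minimal_primes_cic by auto
      then have "p = q" using inj m e by metis
      then show "I = J" using i rank by (metis singletonD)
    qed
    show "(\<lambda>I. I \<inter> H) ` minimal_primes Q cic = c ` X"
    proof (intro equalityI subsetI)
      fix J assume "J \<in> (\<lambda>I. I \<inter> H) ` minimal_primes Q cic"
      then show "J \<in> c ` X" using minimal_primes_cic m by auto
    next
      fix J assume "J \<in> c ` X"
      then obtain p where p: "p \<in> X" "J = c p" by blast
      obtain r where r: "r \<in> P p" using rank p by blast
      have "cic_prime p r \<in> minimal_primes Q cic" using minimal_primes_cic p r by blast
      then show "J \<in> (\<lambda>I. I \<inter> H) ` minimal_primes Q cic" using m[OF p(1) r] p(2) by (metis image_eqI)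
    qed
  qed
qed

end

section \<open>Minimal primes as places\<close>

lemma set_inv_mult_iff: "x \<in> (set_inv\<^bsub>Q\<^esub> S) <#>\<^bsub>Q\<^esub> K \<longleftrightarrow> (\<exists>s\<in>S. \<exists>k\<in>K. x = inv\<^bsub>Q\<^esub> s \<otimes>\<^bsub>Q\<^esub> k)"
  by (auto simp: SET_INV_def set_mult_def)

locale weakly_Krull_monoid = comm_group Q for Q :: "('a, 'b) monoid_scheme" (structure) +
  fixes H :: "'a set"
  assumes quot: "is_quotient_group Q H"
    and wK: "weakly_Krull Q H"
    and fin_prim: "\<And>p. p \<in> minimal_primes Q H \<Longrightarrow> finitely_primary Q (loc Q H p)"
begin

lemma submon_H: "submonoid H Q" using quot by (simp add: is_quotient_group_def)

sublocale H: submonoid H Q by (rule submon_H)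

lemma prime_facts:
  assumes "p \<in> minimal_primes Q H"
  shows "p \<subseteq> H" "\<one> \<notin> p" "\<And>x h. x \<in> p \<Longrightarrow> h \<in> H \<Longrightarrow> x \<otimes> h \<in> p"
    "\<And>x y. x \<in> H - p \<Longrightarrow> y \<in> H - p \<Longrightarrow> x \<otimes> y \<in> H - p"
proof -
  have s: "s_ideal Q H p" and m: "submonoid (H - p) (submon Q H)"
    using assms by (auto simp: minimal_primes_def prime_s_ideal_def)
  show "p \<subseteq> H" using s by (simp add: s_ideal_def)
  show "\<one> \<notin> p" using submonoid.one_closed[OF m] by simp
  show "x \<otimes> h \<in> p" if "x \<in> p" "h \<in> H" for x h
    using s that unfolding s_ideal_def set_mult_def by blast
  show "x \<otimes> y \<in> H - p" if "x \<in> H - p" "y \<in> H - p" for x y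
    using submonoid.m_closed[OF m that] by simp
qed

lemma loc_iff: "x \<in> loc Q H p \<longleftrightarrow> (\<exists>s\<in>H - p. \<exists>h\<in>H. x = inv s \<otimes> h)"
  by (simp add: loc_def localization_def set_inv_mult_iff)

lemma H_loc: "p \<in> minimal_primes Q H \<Longrightarrow> H \<subseteq> loc Q H p"
  using prime_facts(2) unfolding loc_iff subset_iff
  by (metis DiffI H.one_closed H.mem_carrier inv_one l_one)

lemma inv_in_loc_iff:
  assumes p: "p \<in> minimal_primes Q H" and h: "h \<in> H"
  shows "inv h \<in> loc Q H p \<longleftrightarrow> h \<notin> p"
proof
  assume "inv h \<in> loc Q H p"
  then obtain s k where s: "s \<in> H - p" "k \<in> H" "inv h = inv s \<otimes> k" by (auto simp: loc_iff)
  have c: "s \<in> carrier Q" "k \<in> carrier Q" "h \<in> carrier Q" using s h by auto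
  have "h \<otimes> k = s"
  proof -
    have "h \<otimes> k = s \<otimes> (inv s \<otimes> k) \<otimes> h" using c by (simp add: cancel_inv m_comm)
    also have "\<dots> = s" unfolding s(3)[symmetric] using c by (simp add: cancel_inv)
    finally show ?thesis .
  qed
  then show "h \<notin> p" using prime_facts(3)[OF p _ s(2)] s(1) by blast
next
  assume "h \<notin> p"
  then have "h \<in> H - p" "inv h = inv h \<otimes> \<one>" using h by auto
  then show "inv h \<in> loc Q H p" unfolding loc_iff using H.one_closed by blast
qed

lemma quotients_H: "x \<in> carrier Q \<Longrightarrow> \<exists>a\<in>H. \<exists>b\<in>H. x = a \<otimes> inv b"
  using quot by (simp add: is_quotient_group_def)

lemma exists_valuations:
  "\<exists>P v \<alpha>. weakly_Krull_family Q H (minimal_primes Q H) (loc Q H) P v \<alpha>"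
proof -
  have "\<forall>p\<in>minimal_primes Q H. \<exists>z. primary_valuations Q (loc Q H p) (fst z) (fst (snd z)) (snd (snd z))"
  proof
    fix p assume p: "p \<in> minimal_primes Q H"
    have "\<exists>P v \<alpha>. primary_valuations Q (loc Q H p) P v \<alpha>"
    proof (rule primary_valuationsI[OF fin_prim[OF p]])
      fix x assume "x \<in> carrier Q"
      then obtain a b where "a \<in> H" "b \<in> H" "x = a \<otimes> inv b" using quotients_H by blast
      then show "\<exists>a\<in>loc Q H p. \<exists>b\<in>loc Q H p. x = a \<otimes> inv b" using H_loc[OF p] by auto
    qed
    then show "\<exists>z. primary_valuations Q (loc Q H p) (fst z) (fst (snd z)) (snd (snd z))" by fastforce
  qed
  from bchoice[OF this] obtain z where z: "\<forall>p\<in>minimal_primes Q H.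
    primary_valuations Q (loc Q H p) (fst (z p)) (fst (snd (z p))) (snd (snd (z p)))" by blast
  have "weakly_Krull_family Q H (minimal_primes Q H) (loc Q H) (\<lambda>p. fst (z p)) (\<lambda>p. fst (snd (z p))) (\<lambda>p. snd (snd (z p)))"
  proof (intro weakly_Krull_family.intro weakly_Krull_family_axioms.intro comm_group_axioms)
    show "\<exists>a\<in>H. \<exists>b\<in>H. x = a \<otimes> inv b" if "x \<in> carrier Q" for x using quotients_H[OF that] .
    show "primary_valuations Q (loc Q H p) (fst (z p)) (fst (snd (z p))) (snd (snd (z p)))"
      if "p \<in> minimal_primes Q H" for p using z that by blast
    have "H = carrier Q \<inter> (\<Inter>p \<in> minimal_primes Q H. loc Q H p)" using wK by (simp add: weakly_Krull_def)
    then show "H = {x \<in> carrier Q. \<forall>p\<in>minimal_primes Q H. x \<in> loc Q H p}" by blast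
    show "finite {p \<in> minimal_primes Q H. inv a \<notin> loc Q H p}" if "a \<in> H" for a
    proof -
      have "{p \<in> minimal_primes Q H. inv a \<notin> loc Q H p} = {p \<in> minimal_primes Q H. a \<in> p}"
        using inv_in_loc_iff that by auto
      then show ?thesis using wK that by (simp add: weakly_Krull_def)
    qed
    show "\<exists>s\<in>H. inv s \<in> loc Q H p \<and> inv s \<notin> loc Q H q"
      if pq: "p \<in> minimal_primes Q H" "q \<in> minimal_primes Q H" "p \<noteq> q" for p q
    proof -
      have "\<not> q \<subseteq> p" using pq by (auto simp: minimal_primes_def)
      then obtain s where "s \<in> q" "s \<notin> p" by blast
      then show ?thesis using inv_in_loc_iff pq prime_facts(1)[OF pq(2)] by blast
    qed
  qed
  then show ?thesis by blast
qed

end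

section \<open>The primes containing the conductor\<close>

lemma pow_units_of_submon:
  "x [^]\<^bsub>units_of (submon Q K)\<^esub> (n::nat) = x [^]\<^bsub>Q\<^esub> n"
  by (simp add: nat_pow_def units_of_def)

lemma (in comm_group) normal_Units_submon:
  assumes K: "submonoid K G" and D: "submonoid D G" "D \<subseteq> K"
  shows "Units (submon G D) \<lhd> units_of (submon G K)"
proof -
  interpret KM: comm_monoid_cancel "submon G K" by (rule comm_monoid_cancel_submon[OF K])
  interpret UG: comm_group "units_of (submon G K)" by (rule KM.units_comm_group)
  interpret D: submonoid D G by fact
  have UD: "Units (submon G D) = {x \<in> D. inv x \<in> D}" by (rule Units_submon[OF D(1)])
  have UK: "Units (submon G K) = {x \<in> K. inv x \<in> K}" by (rule Units_submon[OF K])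
  have "subgroup (Units (submon G D)) (units_of (submon G K))"
  proof
    show "Units (submon G D) \<subseteq> carrier (units_of (submon G K))"
      unfolding units_of_carrier UD UK using D(2) by auto
    show "\<one>\<^bsub>units_of (submon G K)\<^esub> \<in> Units (submon G D)" unfolding UD by (simp add: units_of_one)
    show "x \<otimes>\<^bsub>units_of (submon G K)\<^esub> y \<in> Units (submon G D)"
      if "x \<in> Units (submon G D)" "y \<in> Units (submon G D)" for x y
      using that unfolding UD by (simp add: units_of_mult inv_mult')
    show "inv\<^bsub>units_of (submon G K)\<^esub> x \<in> Units (submon G D)" if x: "x \<in> Units (submon G D)" for x
    proof -
      have xD: "x \<in> D" "inv x \<in> D" using x UD by auto
      then have xK: "x \<in> Units (submon G K)" unfolding UK using D(2) by auto
      then have "inv\<^bsub>units_of (submon G K)\<^esub> x = inv x"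
        using KM.units_of_inv[OF xK] m_inv_monoid_consistent[OF xK K] by simp
      then show ?thesis using xD unfolding UD by simp
    qed
  qed
  then show ?thesis by (rule UG.subgroup_imp_normal)
qed

text \<open>Torsion of the quotient group, read off on representatives.\<close>

lemma (in comm_group) torsion_unit_quotient:
  assumes K: "submonoid K G" and D: "submonoid D G" "D \<subseteq> K"
    and tor: "torsion_group (unit_quotient G K D)" and e: "e \<in> K" "inv e \<in> K"
  shows "\<exists>n::nat. 0 < n \<and> e [^] n \<in> D"
proof -
  let ?G = "units_of (submon G K)" and ?N = "Units (submon G D)"
  interpret N: normal ?N ?G by (rule normal_Units_submon[OF K D])
  have eG: "e \<in> carrier ?G" using e by (simp add: units_of_carrier Units_submon[OF K])
  have "?N #>\<^bsub>?G\<^esub> e \<in> carrier (?G Mod ?N)" using eG by (simp add: carrier_FactGroup)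
  then obtain n :: nat where n: "n > 0" "(?N #>\<^bsub>?G\<^esub> e) [^]\<^bsub>?G Mod ?N\<^esub> n = ?N"
    using tor by (auto simp: torsion_group_def unit_quotient_def)
  have "?N #>\<^bsub>?G\<^esub> (e [^]\<^bsub>?G\<^esub> n) = ?N" using n(2) N.FactGroup_pow[OF eG, of n] by simp
  moreover have "e [^]\<^bsub>?G\<^esub> n \<in> ?N #>\<^bsub>?G\<^esub> (e [^]\<^bsub>?G\<^esub> n)"
    by (rule N.rcos_self) (use eG N.nat_pow_closed in blast, rule N.is_subgroup)
  ultimately have "e [^]\<^bsub>?G\<^esub> n \<in> ?N" by simp
  then show ?thesis using n(1) by (auto simp: pow_units_of_submon Units_submon[OF D(1)])
qed

locale weakly_Krull_valuations = weakly_Krull_monoid Q H +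
  weakly_Krull_family Q H "minimal_primes Q H" "loc Q H" P v \<alpha>
  for Q :: "('a, 'b) monoid_scheme" (structure) and H P v \<alpha> +
  assumes conductor_nonempty: "conductor Q H \<noteq> {}" and conductor_proper: "conductor Q H \<subset> H"
begin

abbreviation X where "X \<equiv> minimal_primes Q H"
abbreviation D where "D \<equiv> loc Q H"
abbreviation E where "E \<equiv> conductor_primes Q H"

lemma prime_eq: "p \<in> X \<Longrightarrow> p = {h \<in> H. inv h \<notin> D p}"
  using inv_in_loc_iff prime_facts(1) by blast

lemma loc_cic_eq:
  assumes p: "p \<in> X"
  shows "loc_cic Q H p = {x \<in> carrier Q. \<forall>r\<in>P p. 0 \<le> v p r x}"
proof (intro equalityI subsetI)
  fix x assume "x \<in> loc_cic Q H p"
  then obtain s y where s: "s \<in> H - p" "y \<in> cic" "x = inv s \<otimes> y"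
    by (auto simp: loc_cic_def localization_def set_inv_mult_iff)
  have c: "s \<in> carrier Q" "y \<in> carrier Q" using s H_carrier cic_carrier by auto
  have "s \<in> U p" using s(1) inv_in_loc_iff[OF p] H_D[OF p] by (auto simp: U_def)
  then have "v p r x = v p r y" if "r \<in> P p" for r
    using s(3) v_mult[OF p that, of "inv s" y] v_inv[OF p that c(1)] v_U[OF p that] c by simp
  then show "x \<in> {x \<in> carrier Q. \<forall>r\<in>P p. 0 \<le> v p r x}" using v_cic[OF s(2) p] s(3) c by simp
next
  fix x assume x: "x \<in> {x \<in> carrier Q. \<forall>r\<in>P p. 0 \<le> v p r x}"
  then obtain s where s: "s \<in> H" "inv s \<in> D p" "s \<otimes> x \<in> cic" using local_cic_multiple[OF p, of x] by blast
  have "x = inv s \<otimes> (s \<otimes> x)" using x H_carrier[OF s(1)] by (simp add: cancel_inv)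
  moreover have "s \<in> H - p" using s inv_in_loc_iff[OF p s(1)] by simp
  ultimately show "x \<in> loc_cic Q H p"
    using s(3) unfolding loc_cic_def localization_def set_inv_mult_iff by blast
qed

text \<open>An element of the conductor outside \<open>p\<close> moves the complete integral closure into the localization
  at \<open>p\<close>, so the localization consists of all elements with non-negative valuations. Then a prime
  \<open>r\<close> is a non-unit of it, which has positive valuation at every other prime; so there is no other.\<close>

lemma regular_discrete:
  assumes p: "p \<in> X" "p \<notin> E"
  shows "\<exists>r. P p = {r} \<and> (\<forall>x\<in>carrier Q. 0 \<le> v p r x \<longrightarrow> x \<in> D p)"
proof -
  interpret pv: primary_valuations Q "D p" "P p" "v p" "\<alpha> p" by (rule pv[OF p(1)])
  obtain f where f: "f \<in> conductor Q H" "f \<notin> p" using p by (auto simp: conductor_primes_def)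
  have fH: "f \<in> H" "f \<in> carrier Q" using f conductor_proper H_carrier by auto
  have D: "x \<in> D p" if x: "x \<in> carrier Q" "\<forall>r\<in>P p. 0 \<le> v p r x" for x
  proof -
    have "x \<in> loc_cic Q H p" using loc_cic_eq[OF p(1)] x by blast
    then obtain s y where s: "s \<in> H - p" "y \<in> cic" "x = inv s \<otimes> y"
      by (auto simp: loc_cic_def localization_def set_inv_mult_iff)
    have c: "s \<in> carrier Q" "y \<in> carrier Q" using s H_carrier cic_carrier by auto
    have "f \<otimes> y \<in> H" using f(1) s(2) by (auto simp: conductor_def colon_def l_coset_def)
    moreover have "s \<otimes> f \<in> H - p" using prime_facts(4)[OF p(1) s(1)] f(2) fH by blast
    moreover have "x = inv (s \<otimes> f) \<otimes> (f \<otimes> y)"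
    proof -
      have "inv (s \<otimes> f) \<otimes> (f \<otimes> y) = inv s \<otimes> (inv f \<otimes> (f \<otimes> y))" using c fH by (simp add: inv_mult' m_assoc)
      then show ?thesis using s(3) c fH by (simp add: cancel_inv)
    qed
    ultimately show ?thesis unfolding loc_iff by blast
  qed
  obtain r where r: "r \<in> P p" using pv.P_nonempty by blast
  have rc: "r \<in> carrier Q" using r pv.P_closed by blast
  have rD: "r \<in> D p" using D[OF rc] pv.v_prime r by simp
  have "s = r" if s: "s \<in> P p" for s
  proof (rule ccontr)
    assume "s \<noteq> r"
    then have "inv r \<in> D p" using pv.Unit_iff[OF rD s] pv.v_prime[OF s r] by simp
    then show False using pv.v_Unit[OF rD _ r] pv.v_prime[OF r r] by simp
  qed
  then have "P p = {r}" using r by blast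
  then show ?thesis using D by auto
qed

lemma finite_conductor_primes: "finite E"
proof -
  obtain f where f: "f \<in> conductor Q H" using conductor_nonempty by blast
  then have "f \<in> H" using conductor_proper by blast
  then have "finite {p \<in> X. f \<in> p}" using wK unfolding weakly_Krull_def by blast
  moreover have "E \<subseteq> {p \<in> X. f \<in> p}" using f by (auto simp: conductor_primes_def)
  ultimately show ?thesis by (rule finite_subset[rotated])
qed

sublocale weakly_Krull_conductor Q H "minimal_primes Q H" "loc Q H" P v \<alpha> "conductor_primes Q H"
  by unfold_locales (use finite_conductor_primes regular_discrete in \<open>auto simp: conductor_primes_def\<close>)

lemma extremal_primes_eq: "extremal_primes Q H = Ext"
  by (simp add: extremal_primes_def Ext_def)

lemma contraction_bij_iff_rank_one:
  "bij_betw (\<lambda>I. I \<inter> H) (minimal_primes Q cic) X \<longleftrightarrow> (\<forall>p\<in>X. \<exists>r. P p = {r})"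
  using contraction_bij_iff[of "\<lambda>p. p"] prime_eq by simp

lemma torsion_accepted_local:
  assumes rank: "\<forall>p\<in>X. \<exists>r. P p = {r}" and p: "p \<in> E"
    and tor: "torsion_group (unit_quotient Q (loc_cic Q H p) (D p))"
  shows "accepted_elasticity (submon Q (D p))"
proof -
  have pX: "p \<in> X" using p by (simp add: conductor_primes_def)
  interpret pv: primary_valuations Q "D p" "P p" "v p" "\<alpha> p" by (rule pv[OF pX])
  obtain r where P: "P p = {r}" using rank pX by blast
  have r: "r \<in> P p" using P by simp
  have K: "loc_cic Q H p = {x \<in> carrier Q. 0 \<le> v p r x}" using loc_cic_eq[OF pX] P by simp
  have sub: "submonoid (loc_cic Q H p) Q"
    unfolding K by (rule submonoid.intro) (use pv.v_mult[OF r] pv.v_one[OF r] in auto)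
  show ?thesis
  proof (rule pv.rank_one_torsion_accepted[OF P])
    fix e assume e: "e \<in> carrier Q" "v p r e = 0"
    show "\<exists>n::nat. 0 < n \<and> e [^] n \<in> D p"
    proof (rule torsion_unit_quotient[OF sub pv.submonoid_D _ tor])
      show "D p \<subseteq> loc_cic Q H p" unfolding K using pv.v_nonneg[OF _ r] pv.D.mem_carrier by blast
      show "e \<in> loc_cic Q H p" "inv e \<in> loc_cic Q H p" unfolding K using e pv.v_inv[OF r e(1)] by auto
    qed
  qed
qed

end

section \<open>Classes of divisorial ideals\<close>

lemma exists_summands_below:
  fixes f :: "'k \<Rightarrow> nat"
  assumes "finite S" "n \<le> sum f S"
  shows "\<exists>t. (\<forall>i. t i \<le> f i) \<and> sum t S = n"
  using assms
proof (induction S arbitrary: n)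
  case empty
  then show ?case by (intro exI[of _ "\<lambda>_. 0"]) auto
next
  case (insert i S)
  obtain t where t: "\<forall>i. t i \<le> f i" "sum t S = n - min n (f i)"
    using insert.IH[of "n - min n (f i)"] insert.prems insert.hyps by fastforce
  have "sum (t(i := min n (f i))) S = sum t S" by (rule sum.cong) (use insert.hyps in auto)
  then have "sum (t(i := min n (f i))) (insert i S) = n" using insert.hyps t by simp
  then show ?case using t by (intro exI[of _ "t(i := min n (f i))"]) auto
qed

text \<open>Here \<open>\<pi> p\<close> is the only prime at \<open>p\<close>.\<close>

locale rank_one_weakly_Krull = weakly_Krull_valuations Q H P v \<alpha>
  for Q :: "('a, 'b) monoid_scheme" (structure) and H P v \<alpha> +
  fixes \<pi> :: "'a set \<Rightarrow> 'a"
  assumes rank_one: "p \<in> minimal_primes Q H \<Longrightarrow> P p = {\<pi> p}"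
begin

abbreviation R where "R \<equiv> regular_primes Q H"

definition w :: "'a set \<Rightarrow> 'a \<Rightarrow> int" where "w p x = v p (\<pi> p) x"

lemma H_memI: "x \<in> carrier Q \<Longrightarrow> (\<And>p. p \<in> X \<Longrightarrow> x \<in> D p) \<Longrightarrow> x \<in> H" using H_eq by blast

lemma R_X: "p \<in> R \<Longrightarrow> p \<in> X" by (simp add: regular_primes_def)
lemma E_X': "p \<in> E \<Longrightarrow> p \<in> X" by (simp add: conductor_primes_def)
lemma X_cases: "p \<in> X \<Longrightarrow> p \<in> E \<or> p \<in> R" by (auto simp: regular_primes_def)

lemma \<pi>_P: "p \<in> X \<Longrightarrow> \<pi> p \<in> P p" using rank_one by simp

lemma \<pi>_carrier: "p \<in> X \<Longrightarrow> \<pi> p \<in> carrier Q"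
  using \<pi>_P primary_valuations.P_closed[OF pv] by blast

lemma w_\<pi>: "p \<in> X \<Longrightarrow> w p (\<pi> p) = 1"
  using primary_valuations.v_prime[OF pv \<pi>_P \<pi>_P] by (simp add: w_def)

lemma w_mult: "p \<in> X \<Longrightarrow> x \<in> carrier Q \<Longrightarrow> y \<in> carrier Q \<Longrightarrow> w p (x \<otimes> y) = w p x + w p y"
  using v_mult \<pi>_P by (simp add: w_def)

lemma w_inv: "p \<in> X \<Longrightarrow> x \<in> carrier Q \<Longrightarrow> w p (inv x) = - w p x"
  using v_inv \<pi>_P by (simp add: w_def)

lemma w_pow: "p \<in> X \<Longrightarrow> x \<in> carrier Q \<Longrightarrow> w p (x [^] (n::nat)) = int n * w p x"
  using v_pow \<pi>_P by (simp add: w_def)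

lemma w_int_pow: "p \<in> X \<Longrightarrow> x \<in> carrier Q \<Longrightarrow> w p (x [^] (n::int)) = n * w p x"
  using primary_valuations.v_int_pow[OF pv \<pi>_P] by (simp add: w_def)

lemma w_one: "p \<in> X \<Longrightarrow> w p \<one> = 0"
  using v_one \<pi>_P by (simp add: w_def)

lemma w_D: "p \<in> X \<Longrightarrow> x \<in> D p \<Longrightarrow> 0 \<le> w p x" using v_D \<pi>_P by (simp add: w_def)

lemma w_U: "p \<in> X \<Longrightarrow> x \<in> U p \<Longrightarrow> w p x = 0" using v_U \<pi>_P by (simp add: w_def)

lemma U_iff_w: "p \<in> X \<Longrightarrow> x \<in> D p \<Longrightarrow> x \<in> U p \<longleftrightarrow> w p x = 0"
  using v_U[of p "\<pi> p" x] v_nonunit_D[of p "\<pi> p" x] \<pi>_P[of p]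
  by (cases "x \<in> U p") (auto simp: w_def)

lemma D_large: "p \<in> X \<Longrightarrow> x \<in> carrier Q \<Longrightarrow> int (\<alpha> p) \<le> w p x \<Longrightarrow> x \<in> D p"
  using primary_valuations.v_large[OF pv] rank_one by (simp add: w_def)

lemma regular_D_iff: "p \<in> R \<Longrightarrow> x \<in> carrier Q \<Longrightarrow> x \<in> D p \<longleftrightarrow> 0 \<le> w p x"
  using regular_discrete[of p] rank_one[OF R_X, of p] w_D[OF R_X, of p x] by (auto simp: regular_primes_def w_def)

lemma regular_U_iff: "p \<in> R \<Longrightarrow> x \<in> carrier Q \<Longrightarrow> x \<in> U p \<longleftrightarrow> w p x = 0"
  using regular_D_iff[of p x] U_iff_w[OF R_X, of p x] w_U[OF R_X, of p x] by auto

lemma cic_Unit_w: "x \<in> carrier Q \<Longrightarrow> (\<And>p. p \<in> X \<Longrightarrow> w p x = 0) \<Longrightarrow> x \<in> cic \<and> inv x \<in> cic"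
  unfolding cic_eq using rank_one w_inv by (auto simp: w_def)

abbreviation C where "C \<equiv> v_class_group Q H"

definition principals :: "'a set set" where "principals = {x <# H | x. x \<in> carrier Q}"

lemma C_eq: "C = Frac Mod principals" by (simp add: v_class_group_def principals_def)

lemma principals_eq: "principals = {ideal (\<lambda>p. x) | x. x \<in> carrier Q}"
  using ideal_const by (auto simp: principals_def)

lemma subgroup_principals: "subgroup principals Frac"
proof
  show "principals \<subseteq> carrier Frac" using ideal_in_Frac families_const by (auto simp: principals_eq)
  show "\<one>\<^bsub>Frac\<^esub> \<in> principals" using one_Frac by (auto simp: principals_eq)
  show "I \<otimes>\<^bsub>Frac\<^esub> J \<in> principals" if IJ: "I \<in> principals" "J \<in> principals" for I J
  proof -
    obtain x y where xy: "x \<in> carrier Q" "y \<in> carrier Q" "I = ideal (\<lambda>p. x)" "J = ideal (\<lambda>p. y)"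
      using IJ by (auto simp: principals_eq)
    then have "I \<otimes>\<^bsub>Frac\<^esub> J = ideal (\<lambda>p. x \<otimes> y)" using mult_Frac families_const by simp
    then show ?thesis using xy m_closed[OF xy(1,2)] unfolding principals_eq by blast
  qed
  show "inv\<^bsub>Frac\<^esub> I \<in> principals" if I: "I \<in> principals" for I
  proof -
    obtain x where x: "x \<in> carrier Q" "I = ideal (\<lambda>p. x)" using I by (auto simp: principals_eq)
    then have "inv\<^bsub>Frac\<^esub> I = ideal (\<lambda>p. inv x)" using inv_Frac[OF families_const] by simp
    then show ?thesis using inv_closed[OF x(1)] unfolding principals_eq by blast
  qed
qed

sublocale F: comm_group Frac by (rule comm_group_Frac)

sublocale NF: normal principals Frac by (rule F.subgroup_imp_normal[OF subgroup_principals])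

lemma comm_group_C: "comm_group C" unfolding C_eq by (rule F.abelian_FactGroup[OF subgroup_principals])

sublocale C: comm_group C by (rule comm_group_C)

definition cls :: "('a set \<Rightarrow> 'a) \<Rightarrow> 'a set set" where
  "cls a = principals #>\<^bsub>Frac\<^esub> ideal a"

lemma cls_carrier: "a \<in> families \<Longrightarrow> cls a \<in> carrier C"
  unfolding C_eq cls_def carrier_FactGroup using ideal_in_Frac by blast

lemma carrier_C: "carrier C = cls ` families"
proof (intro equalityI subsetI)
  fix g assume "g \<in> carrier C"
  then obtain I where "I \<in> carrier Frac" "g = principals #>\<^bsub>Frac\<^esub> I" unfolding C_eq carrier_FactGroup by blast
  then show "g \<in> cls ` families" using Frac_eq_ideal unfolding cls_def by blast
qed (use cls_carrier in auto)

lemma cls_mult: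
  assumes "a \<in> families" "b \<in> families"
  shows "cls (\<lambda>p. a p \<otimes> b p) = cls a \<otimes>\<^bsub>C\<^esub> cls b"
  using NF.rcos_sum[OF ideal_in_Frac[OF assms(1)] ideal_in_Frac[OF assms(2)]] mult_Frac[OF assms]
  by (simp add: cls_def C_eq)

lemma cls_cong:
  assumes "a \<in> families" "b \<in> families" "\<And>p. p \<in> X \<Longrightarrow> inv (a p) \<otimes> b p \<in> U p"
  shows "cls a = cls b"
  using ideal_eq_iff[OF assms(1,2)] assms(3) by (simp add: cls_def)

lemma cls_const: "x \<in> carrier Q \<Longrightarrow> cls (\<lambda>p. x) = \<one>\<^bsub>C\<^esub>"
proof -
  assume x: "x \<in> carrier Q"
  have "ideal (\<lambda>p. x) \<in> principals" using x unfolding principals_eq by blast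
  then show ?thesis
    using F.coset_join2[OF ideal_in_Frac[OF families_const[OF x]] subgroup_principals] by (simp add: cls_def C_eq)
qed

lemma cls_one_obtains:
  assumes a: "a \<in> families" "cls a = \<one>\<^bsub>C\<^esub>"
  obtains x where "x \<in> carrier Q" "\<And>p. p \<in> X \<Longrightarrow> inv (a p) \<otimes> x \<in> U p"
proof -
  have "principals #>\<^bsub>Frac\<^esub> ideal a = principals" using a(2) by (simp add: cls_def C_eq)
  then have "ideal a \<in> principals" by (rule F.coset_join1[OF _ ideal_in_Frac[OF a(1)] subgroup_principals])
  then obtain x where x: "x \<in> carrier Q" "ideal a = ideal (\<lambda>p. x)" unfolding principals_eq by blast
  then show ?thesis using that ideal_eq_iff[OF a(1) families_const[OF x(1)]] by blast
qed

definition single :: "'a set \<Rightarrow> 'a \<Rightarrow> 'a set \<Rightarrow> 'a" where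
  "single p x = (\<lambda>q. \<one>)(p := x)"

lemma single_families: "x \<in> carrier Q \<Longrightarrow> single p x \<in> families"
  unfolding single_def by (rule families_update[OF H_families])

lemma single_hom:
  assumes p: "p \<in> X"
  shows "(\<lambda>x. cls (single p x)) \<in> hom Q C"
proof (rule homI)
  show "cls (single p x) \<in> carrier C" if "x \<in> carrier Q" for x using cls_carrier single_families that by blast
  fix x y assume xy: "x \<in> carrier Q" "y \<in> carrier Q"
  have "single p (x \<otimes> y) = (\<lambda>q. single p x q \<otimes> single p y q)" by (auto simp: single_def)
  then show "cls (single p (x \<otimes> y)) = cls (single p x) \<otimes>\<^bsub>C\<^esub> cls (single p y)"
    using cls_mult[OF single_families single_families] xy by simp
qed

definition prime_class :: "'a set \<Rightarrow> 'a set set" where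
  "prime_class p = cls (single p (\<pi> p))"

lemma prime_class_carrier: "p \<in> X \<Longrightarrow> prime_class p \<in> carrier C"
  unfolding prime_class_def by (rule cls_carrier[OF single_families[OF \<pi>_carrier]])

lemma ideal_regular_prime:
  assumes p: "p \<in> R"
  shows "ideal (single p (\<pi> p)) = p"
proof -
  have pX: "p \<in> X" using p by (rule R_X)
  have "x \<in> ideal (single p (\<pi> p)) \<longleftrightarrow> x \<in> p" if x: "x \<in> carrier Q" for x
  proof -
    have e: "inv (\<pi> p) \<otimes> x \<in> D p \<longleftrightarrow> 1 \<le> w p x"
      using regular_D_iff[OF p, of "inv (\<pi> p) \<otimes> x"] \<pi>_carrier[OF pX] x
      by (simp add: w_mult[OF pX] w_inv[OF pX] w_\<pi>[OF pX] int_one_le_iff_zero_less)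
    have off: "inv (single p (\<pi> p) q) \<otimes> x \<in> D q \<longleftrightarrow> x \<in> D q" if "q \<in> X" "q \<noteq> p" for q
      using that x by (simp add: single_def)
    have "x \<in> ideal (single p (\<pi> p)) \<longleftrightarrow> (\<forall>q\<in>X. q \<noteq> p \<longrightarrow> x \<in> D q) \<and> 1 \<le> w p x"
    proof -
      have on: "inv (single p (\<pi> p) p) \<otimes> x \<in> D p \<longleftrightarrow> 1 \<le> w p x" using e by (simp add: single_def)
      have "x \<in> ideal (single p (\<pi> p)) \<longleftrightarrow> (\<forall>q\<in>X. inv (single p (\<pi> p) q) \<otimes> x \<in> D q)"
        using x by (simp add: ideal_def)
      also have "\<dots> \<longleftrightarrow> (\<forall>q\<in>X. if q = p then 1 \<le> w p x else x \<in> D q)"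
        by (rule ball_cong[OF refl]) (use off on in auto)
      finally show ?thesis using pX by auto
    qed
    also have "\<dots> \<longleftrightarrow> x \<in> H \<and> 1 \<le> w p x"
      using H_eq x regular_D_iff[OF p x] by auto
    also have "\<dots> \<longleftrightarrow> x \<in> H \<and> inv x \<notin> D p"
      using regular_D_iff[OF p, of "inv x"] x w_inv[OF pX x] by auto
    also have "\<dots> \<longleftrightarrow> x \<in> p" using prime_eq[OF pX] by blast
    finally show ?thesis .
  qed
  moreover have "p \<subseteq> carrier Q" using prime_facts(1)[OF pX] H_carrier by blast
  ultimately show ?thesis using ideal_carrier by blast
qed

definition G0 :: "'a set set set" where "G0 = regular_prime_classes Q H"

lemma G0_eq: "G0 = prime_class ` R"
proof (intro equalityI subsetI)
  fix g assume "g \<in> G0"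
  then obtain p where p: "p \<in> R" "p \<in> g" and g: "g \<in> carrier C"
    by (auto simp: G0_def regular_prime_classes_def)
  obtain a where a: "a \<in> families" "g = principals #>\<^bsub>Frac\<^esub> ideal a" using g carrier_C by (auto simp: cls_def)
  have "principals #>\<^bsub>Frac\<^esub> ideal a = principals #>\<^bsub>Frac\<^esub> p"
    by (rule F.repr_independence[OF _ ideal_in_Frac[OF a(1)] subgroup_principals]) (use p(2) a(2) in simp)
  then have "g = prime_class p" using a(2) ideal_regular_prime[OF p(1)] by (simp add: prime_class_def cls_def)
  then show "g \<in> prime_class ` R" using p(1) by blast
next
  fix g assume "g \<in> prime_class ` R"
  then obtain p where p: "p \<in> R" "g = prime_class p" by blast
  have "ideal (single p (\<pi> p)) \<in> principals #>\<^bsub>Frac\<^esub> ideal (single p (\<pi> p))"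
    by (rule F.rcos_self[OF ideal_in_Frac[OF single_families[OF \<pi>_carrier[OF R_X[OF p(1)]]]] subgroup_principals])
  then have "p \<in> g" using ideal_regular_prime[OF p(1)] p(2) by (simp add: prime_class_def cls_def)
  then show "g \<in> G0" using p prime_class_carrier[OF R_X[OF p(1)]] by (auto simp: G0_def regular_prime_classes_def)
qed

lemma G0_carrier: "G0 \<subseteq> carrier C" using G0_eq prime_class_carrier R_X by auto

text \<open>The multiplicity with which regular primes of class \<open>g\<close> occur; the sum runs over non-zero
  valuations because there may be infinitely many primes in a class.\<close>

definition deg :: "'a set set \<Rightarrow> ('a set \<Rightarrow> 'a) \<Rightarrow> int" where
  "deg g c = (\<Sum>p | p \<in> R \<and> prime_class p = g \<and> w p (c p) \<noteq> 0. w p (c p))"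

lemma finite_regular_support:
  assumes "c \<in> families"
  shows "finite {p \<in> R. w p (c p) \<noteq> 0}"
proof (rule finite_subset[OF _ families_finite[OF assms]])
  show "{p \<in> R. w p (c p) \<noteq> 0} \<subseteq> {p \<in> X. c p \<notin> U p}" using R_X w_U by blast
qed

lemma deg_eq:
  assumes "finite S" "S \<subseteq> R" "\<And>p. p \<in> R \<Longrightarrow> p \<notin> S \<Longrightarrow> w p (c p) = 0"
  shows "deg g c = (\<Sum>p\<in>{p \<in> S. prime_class p = g}. w p (c p))"
  unfolding deg_def
  by (rule sum.mono_neutral_left) (use assms in auto)

lemma deg_cong: "(\<And>p. p \<in> R \<Longrightarrow> w p (c p) = w p (c' p)) \<Longrightarrow> deg g c = deg g c'"
  unfolding deg_def by (rule sum.cong) auto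

lemma deg_mult:
  assumes "a \<in> families" "b \<in> families"
  shows "deg g (\<lambda>p. a p \<otimes> b p) = deg g a + deg g b"
proof -
  let ?S = "{p \<in> R. w p (a p) \<noteq> 0} \<union> {p \<in> R. w p (b p) \<noteq> 0}"
  have S: "finite ?S" "?S \<subseteq> R" using finite_regular_support assms by auto
  have wm: "w p (a p \<otimes> b p) = w p (a p) + w p (b p)" if "p \<in> R" for p
    using w_mult[OF R_X[OF that]] families_carrier assms R_X[OF that] by blast
  have "deg g (\<lambda>p. a p \<otimes> b p) = (\<Sum>p\<in>{p \<in> ?S. prime_class p = g}. w p (a p \<otimes> b p))"
    by (rule deg_eq[OF S]) (use wm in auto)
  also have "\<dots> = (\<Sum>p\<in>{p \<in> ?S. prime_class p = g}. w p (a p) + w p (b p))"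
    by (rule sum.cong) (use wm in auto)
  also have "\<dots> = deg g a + deg g b"
    unfolding sum.distrib using deg_eq[OF S, of a] deg_eq[OF S, of b] by auto
  finally show ?thesis .
qed

lemma deg_inv:
  assumes "a \<in> families"
  shows "deg g (\<lambda>p. inv (a p)) = - deg g a"
proof -
  have "deg g (\<lambda>p. a p \<otimes> inv (a p)) = deg g a + deg g (\<lambda>p. inv (a p))"
    by (rule deg_mult[OF assms families_inv[OF assms]])
  moreover have "deg g (\<lambda>p. a p \<otimes> inv (a p)) = 0"
    unfolding deg_def using families_carrier[OF assms] R_X w_one by (intro sum.neutral) auto
  ultimately show ?thesis by simp
qed

lemma deg_nonneg:
  assumes "\<And>p. p \<in> R \<Longrightarrow> c p \<in> D p"
  shows "0 \<le> deg g c"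
  unfolding deg_def using assms w_D R_X by (intro sum_nonneg) auto

lemma deg_zero_iff:
  assumes "c \<in> integral"
  shows "(\<forall>g\<in>G0. deg g c = 0) \<longleftrightarrow> (\<forall>p\<in>R. c p \<in> U p)"
proof
  assume z: "\<forall>g\<in>G0. deg g c = 0"
  show "\<forall>p\<in>R. c p \<in> U p"
  proof
    fix p assume p: "p \<in> R"
    let ?S = "{q \<in> R. w q (c q) \<noteq> 0}"
    have f: "finite {q \<in> insert p ?S. prime_class q = prime_class p}"
      using finite_regular_support[OF integral_families[OF assms]] by simp
    have "deg (prime_class p) c = (\<Sum>q\<in>{q \<in> insert p ?S. prime_class q = prime_class p}. w q (c q))"
      by (rule deg_eq) (use finite_regular_support[OF integral_families[OF assms]] p in auto)
    moreover have "deg (prime_class p) c = 0" using z G0_eq p by blast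
    moreover have "\<forall>q\<in>{q \<in> insert p ?S. prime_class q = prime_class p}. 0 \<le> w q (c q)"
      using w_D R_X integral_D[OF assms] p by auto
    ultimately have "w p (c p) = 0" using sum_nonneg_eq_0_iff[OF f, of "\<lambda>q. w q (c q)"] by simp
    then show "c p \<in> U p" using U_iff_w R_X p integral_D[OF assms] by blast
  qed
next
  assume "\<forall>p\<in>R. c p \<in> U p"
  then show "\<forall>g\<in>G0. deg g c = 0" unfolding deg_def using w_U R_X by (intro ballI sum.neutral) auto
qed

text \<open>A family that is trivial at the primes containing the conductor is a product of regular primes
  up to units, so its class depends on the multiplicities only.\<close>

lemma cls_eq_prod:
  assumes fin: "finite G0" and c: "c \<in> families" "\<And>p. p \<in> E \<Longrightarrow> c p \<in> U p"
  shows "cls c = (\<Otimes>\<^bsub>C\<^esub>g\<in>G0. g [^]\<^bsub>C\<^esub> deg g c)"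
proof -
  have "cls c = (\<Otimes>\<^bsub>C\<^esub>g\<in>G0. g [^]\<^bsub>C\<^esub> deg g c)"
    if "finite T" "c \<in> families" "\<forall>p\<in>E. c p \<in> U p" "{p \<in> R. w p (c p) \<noteq> 0} \<subseteq> T" for T c
    using that
  proof (induction T arbitrary: c)
    case empty
    have "inv (c p) \<otimes> \<one> \<in> U p" if p: "p \<in> X" for p
    proof -
      have "c p \<in> U p" using X_cases[OF p] empty regular_U_iff families_carrier[OF empty(1) p] by blast
      then show ?thesis using U_inv[OF p] U_carrier[OF p] by simp
    qed
    then have "cls c = cls (\<lambda>p. \<one>)" by (rule cls_cong[OF empty(1) H_families])
    then have "cls c = \<one>\<^bsub>C\<^esub>" using cls_const by simp
    moreover have "deg g c = 0" for g unfolding deg_def using empty(3) by (intro sum.neutral) auto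
    ultimately show ?case using C.finprod_one_eqI[of G0] by simp
  next
    case (insert p T)
    show ?case
    proof (cases "p \<in> R")
      case False
      then have "{p \<in> R. w p (c p) \<noteq> 0} \<subseteq> T" using insert.prems by auto
      then show ?thesis using insert by blast
    next
      case True
      have pX: "p \<in> X" using True by (rule R_X)
      let ?k = "w p (c p)" and ?g = "prime_class p"
      let ?c = "c(p := \<one>)" and ?e = "single p (\<pi> p [^] ?k)"
      have cc: "\<And>q. q \<in> X \<Longrightarrow> c q \<in> carrier Q" using families_carrier[OF insert.prems(1)] .
      have \<pi>k: "\<pi> p [^] ?k \<in> carrier Q" using \<pi>_carrier[OF pX] by simp
      have f: "?c \<in> families" "?e \<in> families" using families_update[OF insert.prems(1)] single_families[OF \<pi>k] by auto
      have "inv (c q) \<otimes> (?c q \<otimes> ?e q) \<in> U q" if q: "q \<in> X" for q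
      proof (cases "q = p")
        case True
        have "w p (inv (c p) \<otimes> \<pi> p [^] ?k) = 0"
          using cc[OF pX] \<pi>k by (simp add: w_mult[OF pX] w_inv[OF pX] w_int_pow[OF pX \<pi>_carrier[OF pX]] w_\<pi>[OF pX])
        then have "inv (c p) \<otimes> \<pi> p [^] ?k \<in> U p" using regular_U_iff[OF \<open>p \<in> R\<close>] cc[OF pX] \<pi>k by simp
        then show ?thesis using True \<pi>k by (simp add: single_def)
      next
        case False
        then show ?thesis using cc[OF q] U_one[OF q] by (simp add: single_def)
      qed
      then have "cls c = cls (\<lambda>q. ?c q \<otimes> ?e q)" by (rule cls_cong[OF insert.prems(1) families_mult[OF f]])
      then have 1: "cls c = cls ?c \<otimes>\<^bsub>C\<^esub> cls ?e" using cls_mult[OF f] by simp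
      have 2: "cls ?e = ?g [^]\<^bsub>C\<^esub> ?k"
        using hom_int_pow[OF single_hom[OF pX] \<pi>_carrier[OF pX], of ?k] group_axioms C.group_axioms
        by (simp add: prime_class_def)
      have pE: "p \<notin> E" using True by (simp add: regular_primes_def)
      have 3: "cls ?c = (\<Otimes>\<^bsub>C\<^esub>g\<in>G0. g [^]\<^bsub>C\<^esub> deg g ?c)"
      proof (rule insert.IH[OF f(1)])
        show "\<forall>q\<in>E. ?c q \<in> U q" using insert.prems(2) pE by auto
        show "{q \<in> R. w q (?c q) \<noteq> 0} \<subseteq> T" using insert.prems(3) w_one[OF pX] by auto
      qed
      have g: "?g \<in> G0" using G0_eq True by blast
      have kin: "?g [^]\<^bsub>C\<^esub> ?k \<in> carrier C" using g G0_carrier by auto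
      have dg: "deg g c = deg g ?c + (if ?g = g then ?k else 0)" for g
      proof -
        let ?S = "{q \<in> R. w q (c q) \<noteq> 0}"
        have S: "finite (insert p ?S)" "insert p ?S \<subseteq> R"
          using finite_regular_support[OF insert.prems(1)] True by auto
        have "deg g c = (\<Sum>q\<in>{q \<in> insert p ?S. prime_class q = g}. w q (c q))"
          by (rule deg_eq[OF S]) auto
        also have "\<dots> = (\<Sum>q\<in>{q \<in> insert p ?S. prime_class q = g}. w q (?c q) + (if q = p then ?k else 0))"
          by (rule sum.cong) (use w_one[OF pX] in auto)
        also have "\<dots> = (\<Sum>q\<in>{q \<in> insert p ?S. prime_class q = g}. w q (?c q)) +
            (\<Sum>q\<in>{q \<in> insert p ?S. prime_class q = g}. if q = p then ?k else 0)" by (rule sum.distrib)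
        also have "(\<Sum>q\<in>{q \<in> insert p ?S. prime_class q = g}. w q (?c q)) = deg g ?c"
          by (rule deg_eq[OF S, symmetric]) (use w_one[OF pX] in auto)
        also have "(\<Sum>q\<in>{q \<in> insert p ?S. prime_class q = g}. if q = p then ?k else 0) = (if ?g = g then ?k else 0)"
        proof -
          have "finite {q \<in> insert p ?S. prime_class q = g}" using S(1) by simp
          then show ?thesis by (simp add: sum.delta)
        qed
        finally show ?thesis .
      qed
      have "(\<Otimes>\<^bsub>C\<^esub>g\<in>G0. g [^]\<^bsub>C\<^esub> deg g c) =
          (\<Otimes>\<^bsub>C\<^esub>g\<in>G0. g [^]\<^bsub>C\<^esub> deg g ?c \<otimes>\<^bsub>C\<^esub> (if ?g = g then ?g [^]\<^bsub>C\<^esub> ?k else \<one>\<^bsub>C\<^esub>))"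
      proof (rule C.finprod_cong'[OF refl])
        show "(\<lambda>g. g [^]\<^bsub>C\<^esub> deg g ?c \<otimes>\<^bsub>C\<^esub> (if ?g = g then ?g [^]\<^bsub>C\<^esub> ?k else \<one>\<^bsub>C\<^esub>)) \<in> G0 \<rightarrow> carrier C"
          using G0_carrier kin by auto
        fix g assume "g \<in> G0"
        then have gC: "g \<in> carrier C" using G0_carrier by blast
        show "g [^]\<^bsub>C\<^esub> deg g c = g [^]\<^bsub>C\<^esub> deg g ?c \<otimes>\<^bsub>C\<^esub> (if ?g = g then ?g [^]\<^bsub>C\<^esub> ?k else \<one>\<^bsub>C\<^esub>)"
          unfolding dg using C.int_pow_mult[OF gC] gC by auto
      qed
      also have "\<dots> = (\<Otimes>\<^bsub>C\<^esub>g\<in>G0. g [^]\<^bsub>C\<^esub> deg g ?c) \<otimes>\<^bsub>C\<^esub>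
          (\<Otimes>\<^bsub>C\<^esub>g\<in>G0. if ?g = g then ?g [^]\<^bsub>C\<^esub> ?k else \<one>\<^bsub>C\<^esub>)"
        using G0_carrier kin by (intro C.finprod_multf) auto
      also have "(\<Otimes>\<^bsub>C\<^esub>g\<in>G0. if ?g = g then ?g [^]\<^bsub>C\<^esub> ?k else \<one>\<^bsub>C\<^esub>) = ?g [^]\<^bsub>C\<^esub> ?k"
        by (rule C.finprod_singleton[OF g fin, of "\<lambda>_. ?g [^]\<^bsub>C\<^esub> ?k"]) (use kin in auto)
      finally show ?thesis unfolding 1 2 3 by (rule sym)
    qed
  qed
  from this[OF finite_regular_support[OF c(1)] c(1)] c(2) show ?thesis by blast
qed

text \<open>The quotient of the two families is trivial at the primes containing the conductor and has all
  multiplicities zero.\<close>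

lemma cls_one_of_deg_eq:
  assumes fin: "finite G0" and c: "c \<in> families" and c': "c' \<in> families" "cls c' = \<one>\<^bsub>C\<^esub>"
    and loc: "\<And>p. p \<in> E \<Longrightarrow> inv (c' p) \<otimes> c p \<in> U p" and dg: "\<And>g. g \<in> G0 \<Longrightarrow> deg g c = deg g c'"
  shows "cls c = \<one>\<^bsub>C\<^esub>"
proof -
  let ?f = "\<lambda>p. inv (c' p) \<otimes> c p"
  have i: "(\<lambda>p. inv (c' p)) \<in> families" by (rule families_inv[OF c'(1)])
  have f: "?f \<in> families" by (rule families_mult[OF i c])
  have "deg g ?f = 0" if "g \<in> G0" for g
    using deg_mult[OF i c, of g] deg_inv[OF c'(1), of g] dg[OF that] by simp
  then have "(\<Otimes>\<^bsub>C\<^esub>g\<in>G0. g [^]\<^bsub>C\<^esub> deg g ?f) = \<one>\<^bsub>C\<^esub>" by (intro C.finprod_one_eqI) simp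
  then have "cls ?f = \<one>\<^bsub>C\<^esub>" using cls_eq_prod[OF fin f loc] by simp
  then have "cls (\<lambda>p. c' p \<otimes> ?f p) = \<one>\<^bsub>C\<^esub>" using cls_mult[OF c'(1) f] c'(2) by simp
  moreover have "cls c = cls (\<lambda>p. c' p \<otimes> ?f p)"
  proof (rule cls_cong[OF c families_mult[OF c'(1) f]])
    fix p assume p: "p \<in> X"
    have "c p \<in> carrier Q" "c' p \<in> carrier Q" using families_carrier c c' p by auto
    then show "inv (c p) \<otimes> (c' p \<otimes> ?f p) \<in> U p" using U_one[OF p] by (simp add: cancel_inv)
  qed
  ultimately show ?thesis by simp
qed

text \<open>The multiplicities of \<open>e\<close> can be distributed over the regular prime divisors of \<open>b\<close>. The
  resulting ideal divides \<open>b\<close> and has the same class as \<open>e\<close>, since the class depends on the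
  multiplicities and on the components at the primes containing the conductor only; so it is principal,
  and its generator is the required divisor.\<close>

lemma split_by_shape:
  assumes fin: "finite G0" and b: "b \<in> H" and e: "e \<in> integral" "cls e = \<one>\<^bsub>C\<^esub>"
    and loc: "\<And>p. p \<in> E \<Longrightarrow> inv (e p) \<otimes> b \<in> D p" and dg: "\<And>g. g \<in> G0 \<Longrightarrow> deg g e \<le> deg g (\<lambda>_. b)"
  shows "\<exists>b1\<in>H. \<exists>b2\<in>H. b = b1 \<otimes> b2 \<and> (\<forall>p\<in>E. inv (e p) \<otimes> b1 \<in> U p) \<and> (\<forall>g\<in>G0. deg g (\<lambda>_. b1) = deg g e)"
proof -
  have bc: "b \<in> carrier Q" using H_carrier b .
  have bf: "(\<lambda>_. b) \<in> families" by (rule families_const[OF bc])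
  let ?S = "{p \<in> R. w p b \<noteq> 0}"
  have S: "finite ?S" "?S \<subseteq> R" using finite_regular_support[OF bf] by auto
  have wb: "0 \<le> w p b" if "p \<in> X" for p using w_D[OF that H_D[OF that b]] .
  have eD: "\<And>p. p \<in> X \<Longrightarrow> e p \<in> D p" using integral_D[OF e(1)] .
  have ec: "\<And>p. p \<in> X \<Longrightarrow> e p \<in> carrier Q" using eD D_carrier by blast
  have dge: "0 \<le> deg g e" for g by (rule deg_nonneg) (use eD R_X in blast)
  have "\<forall>g\<in>G0. \<exists>t. (\<forall>p. t p \<le> nat (w p b)) \<and> sum t {p \<in> ?S. prime_class p = g} = nat (deg g e)"
  proof
    fix g assume g: "g \<in> G0"
    have "deg g (\<lambda>_. b) = (\<Sum>p\<in>{p \<in> ?S. prime_class p = g}. w p b)" by (rule deg_eq[OF S]) auto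
    also have "\<dots> = (\<Sum>p\<in>{p \<in> ?S. prime_class p = g}. int (nat (w p b)))"
      by (rule sum.cong) (use wb R_X in auto)
    also have "\<dots> = int (\<Sum>p\<in>{p \<in> ?S. prime_class p = g}. nat (w p b))" by simp
    finally have "nat (deg g e) \<le> (\<Sum>p\<in>{p \<in> ?S. prime_class p = g}. nat (w p b))" using dg[OF g] by linarith
    then show "\<exists>t. (\<forall>p. t p \<le> nat (w p b)) \<and> sum t {p \<in> ?S. prime_class p = g} = nat (deg g e)"
      by (intro exists_summands_below finite_subset[OF _ S(1)]) auto
  qed
  from bchoice[OF this] obtain t where t: "\<forall>g\<in>G0. (\<forall>p. t g p \<le> nat (w p b)) \<and>
      sum (t g) {p \<in> ?S. prime_class p = g} = nat (deg g e)" by blast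
  (* Keep the components of e at the primes containing the conductor and distribute its multiplicities
     over the regular prime divisors of b. *)
  define tt where "tt = (\<lambda>p. t (prime_class p) p)"
  have tt: "tt p \<le> nat (w p b)" if "p \<in> R" for p using t that G0_eq by (auto simp: tt_def)
  define c where "c = (\<lambda>p. if p \<in> E then e p else \<pi> p [^] tt p)"
  have cR: "c p = \<pi> p [^] tt p" if "p \<in> R" for p using that by (simp add: c_def regular_primes_def)
  have wc: "w p (c p) = int (tt p)" if "p \<in> R" for p
    using cR[OF that] w_pow[OF R_X \<pi>_carrier[OF R_X]] w_\<pi>[OF R_X] that by simp
  have cc: "c p \<in> carrier Q" if "p \<in> X" for p using ec[OF that] \<pi>_carrier[OF that] by (simp add: c_def)
  have cD: "c p \<in> D p" if p: "p \<in> X" for p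
  proof (cases "p \<in> E")
    case True
    then show ?thesis using eD[OF p] by (simp add: c_def)
  next
    case False
    then have "p \<in> R" using X_cases[OF p] by blast
    then show ?thesis using regular_D_iff[OF _ cc[OF p]] wc by simp
  qed
  have "{p \<in> X. c p \<notin> U p} \<subseteq> E \<union> ?S"
  proof
    fix p assume "p \<in> {p \<in> X. c p \<notin> U p}"
    then have p: "p \<in> X" "c p \<notin> U p" by auto
    show "p \<in> E \<union> ?S"
    proof (cases "p \<in> E")
      case False
      then have pR: "p \<in> R" using X_cases[OF p(1)] by blast
      then have "tt p \<noteq> 0" using regular_U_iff[OF pR cc[OF p(1)]] wc[OF pR] p(2) by simp
      then show ?thesis using tt[OF pR] pR by auto
    qed simp
  qed
  then have cf: "c \<in> families"
    using finite_subset[of _ "E \<union> ?S"] finite_conductor_primes S(1) cc by (auto simp: families_def)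
  have dgc: "deg g c = deg g e" if g: "g \<in> G0" for g
  proof -
    have "deg g c = (\<Sum>p\<in>{p \<in> ?S. prime_class p = g}. w p (c p))"
      by (rule deg_eq[OF S]) (use wc tt in force)
    also have "\<dots> = (\<Sum>p\<in>{p \<in> ?S. prime_class p = g}. int (t g p))"
      by (rule sum.cong) (use wc in \<open>auto simp: tt_def\<close>)
    also have "\<dots> = int (nat (deg g e))" using t g by (simp flip: of_nat_sum)
    finally show ?thesis using dge by simp
  qed
  have "cls c = \<one>\<^bsub>C\<^esub>"
  proof (rule cls_one_of_deg_eq[OF fin cf integral_families[OF e(1)] e(2) _ dgc])
    fix p assume p: "p \<in> E"
    then show "inv (e p) \<otimes> c p \<in> U p" using ec[OF E_X'[OF p]] U_one[OF E_X'[OF p]] by (simp add: c_def)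
  qed
  then obtain b1 where b1: "b1 \<in> carrier Q" "\<And>p. p \<in> X \<Longrightarrow> inv (c p) \<otimes> b1 \<in> U p"
    using cls_one_obtains[OF cf] by blast
  have b1D: "b1 \<in> D p" if p: "p \<in> X" for p
  proof -
    have "c p \<otimes> (inv (c p) \<otimes> b1) \<in> D p" using D_mult[OF p cD[OF p]] U_D[OF b1(2)[OF p]] by blast
    then show ?thesis using cc[OF p] b1(1) by (simp add: cancel_inv)
  qed
  then have b1H: "b1 \<in> H" using H_memI b1(1) by blast
  have wb1: "w p b1 = w p (c p)" if p: "p \<in> X" for p
    using w_U[OF p b1(2)[OF p]] cc[OF p] b1(1) by (simp add: w_mult[OF p] w_inv[OF p])
  have locb1: "inv (e p) \<otimes> b1 \<in> U p" if p: "p \<in> E" for p using b1(2)[OF E_X'[OF p]] p by (simp add: c_def)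
  have "inv b1 \<otimes> b \<in> D p" if p: "p \<in> X" for p
  proof (cases "p \<in> E")
    case True
    have "inv (inv (e p) \<otimes> b1) \<otimes> (inv (e p) \<otimes> b) \<in> D p"
      using D_mult[OF p U_D[OF U_inv[OF p locb1[OF True]]] loc[OF True]] .
    moreover have "inv (inv (e p) \<otimes> b1) \<otimes> (inv (e p) \<otimes> b) = inv b1 \<otimes> b"
      using ec[OF p] b1(1) bc by (simp add: inv_quotient inv_chain)
    ultimately show ?thesis by simp
  next
    case False
    then have pR: "p \<in> R" using X_cases[OF p] by blast
    have "w p (inv b1 \<otimes> b) = w p b - int (tt p)"
      using wb1[OF p] wc[OF pR] b1(1) bc by (simp add: w_mult[OF p] w_inv[OF p])
    then show ?thesis using regular_D_iff[OF pR] b1(1) bc tt[OF pR] wb[OF p] by simp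
  qed
  then have b2: "inv b1 \<otimes> b \<in> H" using H_memI[OF m_closed[OF inv_closed[OF b1(1)] bc]] by blast
  have "b = b1 \<otimes> (inv b1 \<otimes> b)" using b1(1) bc by (simp add: cancel_inv)
  moreover have "deg g (\<lambda>_. b1) = deg g e" if "g \<in> G0" for g
    using deg_cong[of "\<lambda>_. b1" c g] wb1 R_X dgc[OF that] by simp
  ultimately show ?thesis using b1H b2 locb1 by blast
qed

end

section \<open>Transfer to finitely many primes and to zero-sum sequences\<close>

lemma zero_sum_monoid_simps:
  "carrier (zero_sum_monoid C G0) = {S. set_mset S \<subseteq> G0 \<and> mset_product C S = \<one>\<^bsub>C\<^esub>}"
  "S \<otimes>\<^bsub>zero_sum_monoid C G0\<^esub> T = S + T"
  "\<one>\<^bsub>zero_sum_monoid C G0\<^esub> = {#}"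
  by (simp_all add: zero_sum_monoid_def free_abelian_monoid_def)

lemma (in comm_group) mset_product_eq:
  assumes "finite G0" "G0 \<subseteq> carrier G" "set_mset S \<subseteq> G0"
  shows "mset_product G S = (\<Otimes>g\<in>G0. g [^] count S g)"
  unfolding mset_product_def
  by (rule finprod_mono_neutral_cong_left) (use assms in \<open>auto simp: not_in_iff\<close>)

lemma (in comm_group) mset_product_add:
  assumes "finite G0" "G0 \<subseteq> carrier G" "set_mset S \<subseteq> G0" "set_mset T \<subseteq> G0"
  shows "mset_product G (S + T) = mset_product G S \<otimes> mset_product G T"
proof -
  have "mset_product G (S + T) = (\<Otimes>g\<in>G0. g [^] count S g \<otimes> g [^] count T g)"
    using assms mset_product_eq[OF assms(1,2), of "S + T"]
    by (simp, intro finprod_cong') (auto simp: nat_pow_mult)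
  also have "\<dots> = mset_product G S \<otimes> mset_product G T"
    unfolding mset_product_eq[OF assms(1,2,3)] mset_product_eq[OF assms(1,2,4)]
    using assms by (intro finprod_multf) auto
  finally show ?thesis .
qed

lemma (in comm_group) comm_monoid_cancel_zero_sum:
  assumes "finite G0" "G0 \<subseteq> carrier G"
  shows "comm_monoid_cancel (zero_sum_monoid G G0)"
proof (rule comm_monoid_cancelI)
  show "comm_monoid (zero_sum_monoid G G0)"
  proof (rule comm_monoidI)
    fix S T assume "S \<in> carrier (zero_sum_monoid G G0)" "T \<in> carrier (zero_sum_monoid G G0)"
    then show "S \<otimes>\<^bsub>zero_sum_monoid G G0\<^esub> T \<in> carrier (zero_sum_monoid G G0)"
      using mset_product_add[OF assms, of S T] by (simp add: zero_sum_monoid_simps)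
  next
    show "\<one>\<^bsub>zero_sum_monoid G G0\<^esub> \<in> carrier (zero_sum_monoid G G0)"
      by (simp add: zero_sum_monoid_simps mset_product_def)
  qed (simp_all add: zero_sum_monoid_simps add_ac)
qed (simp add: zero_sum_monoid_simps)

lemma Units_zero_sum: "{#} \<in> carrier (zero_sum_monoid G G0) \<Longrightarrow> Units (zero_sum_monoid G G0) = {{#}}"
  by (auto simp: Units_def zero_sum_monoid_simps)

locale finite_class_group = rank_one_weakly_Krull Q H P v \<alpha> \<pi>
  for Q :: "('a, 'b) monoid_scheme" (structure) and H P v \<alpha> \<pi> +
  assumes finite_C: "finite (carrier (v_class_group Q H))"
    and finite_unit_quotient: "finite (carrier (unit_quotient Q (complete_integral_closure Q H) H))"
begin

lemma finite_G0: "finite G0" using finite_subset[OF G0_carrier finite_C] .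

definition rep :: "'a set set \<Rightarrow> 'a set" where
  "rep g = (SOME p. p \<in> R \<and> prime_class p = g)"

lemma rep: "g \<in> G0 \<Longrightarrow> rep g \<in> R" "g \<in> G0 \<Longrightarrow> prime_class (rep g) = g"
proof -
  assume "g \<in> G0"
  then have "\<exists>p. p \<in> R \<and> prime_class p = g" using G0_eq by auto
  from someI_ex[OF this] show "rep g \<in> R" "prime_class (rep g) = g" unfolding rep_def by auto
qed

abbreviation reps where "reps \<equiv> rep ` G0"

lemma reps_R: "reps \<subseteq> R" using rep by auto

lemma finite_reps: "finite reps" using finite_G0 by simp

lemma reps_not_E: "p \<in> reps \<Longrightarrow> p \<notin> E" using reps_R by (auto simp: regular_primes_def)

text \<open>The family with prescribed components \<open>e\<close> at the primes containing the conductor and with the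
  prescribed multiplicity \<open>n g\<close> of each class, all of it at the representative of the class.\<close>

definition shape_family :: "('a set \<Rightarrow> 'a) \<Rightarrow> ('a set set \<Rightarrow> nat) \<Rightarrow> 'a set \<Rightarrow> 'a" where
  "shape_family e n = (\<lambda>p. if p \<in> E then e p else if p \<in> reps then \<pi> p [^] n (prime_class p) else \<one>)"

lemma shape_family:
  assumes e: "\<And>p. p \<in> E \<Longrightarrow> e p \<in> D p"
  shows "shape_family e n \<in> integral"
    and "g \<in> G0 \<Longrightarrow> deg g (shape_family e n) = int (n g)"
proof -
  let ?c = "shape_family e n"
  have wr: "w p (\<pi> p [^] k) = int k" if "p \<in> X" for p and k :: nat
    using w_pow[OF that \<pi>_carrier[OF that]] w_\<pi>[OF that] by simp
  have D: "?c p \<in> D p" if p: "p \<in> X" for p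
  proof -
    have "\<pi> p [^] n (prime_class p) \<in> D p" if "p \<in> reps"
      using regular_D_iff[of p "\<pi> p [^] n (prime_class p)"] wr[OF p] \<pi>_carrier[OF p] reps_R that by auto
    then show ?thesis using e D_one[OF p] by (simp add: shape_family_def)
  qed
  have "{p \<in> X. ?c p \<notin> U p} \<subseteq> E \<union> reps" using U_one by (auto simp: shape_family_def)
  then have "finite {p \<in> X. ?c p \<notin> U p}" by (rule finite_subset) (use finite_conductor_primes finite_reps in simp)
  then show i: "?c \<in> integral" using D D_carrier by (simp add: integral_def families_def)
  assume g: "g \<in> G0"
  have "deg g ?c = (\<Sum>p\<in>{p \<in> reps. prime_class p = g}. w p (?c p))"
  proof (rule deg_eq[OF finite_reps reps_R])
    fix p assume "p \<in> R" "p \<notin> reps"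
    then show "w p (?c p) = 0" using w_one[OF R_X] by (simp add: shape_family_def regular_primes_def)
  qed
  also have "{p \<in> reps. prime_class p = g} = {rep g}" using rep g by auto
  also have "(\<Sum>p\<in>{rep g}. w p (?c p)) = w (rep g) (\<pi> (rep g) [^] n g)"
    using reps_not_E[of "rep g"] rep(2)[OF g] g by (simp add: shape_family_def)
  also have "\<dots> = int (n g)" by (rule wr[OF R_X[OF rep(1)[OF g]]])
  finally show "deg g ?c = int (n g)" .
qed

lemma realize:
  assumes c: "c \<in> integral" "cls c = \<one>\<^bsub>C\<^esub>"
  shows "\<exists>b\<in>H. (\<forall>p\<in>X. inv (c p) \<otimes> b \<in> U p) \<and> (\<forall>g. deg g (\<lambda>_. b) = deg g c)"
proof -
  obtain b where b: "b \<in> carrier Q" "\<And>p. p \<in> X \<Longrightarrow> inv (c p) \<otimes> b \<in> U p"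
    using cls_one_obtains[OF integral_families[OF c(1)] c(2)] by blast
  have cc: "c p \<in> carrier Q" "c p \<in> D p" if "p \<in> X" for p
    using integral_D[OF c(1) that] D_carrier[OF that] by auto
  have "b \<in> D p" if p: "p \<in> X" for p
    using D_mult[OF p cc(2)[OF p] U_D[OF b(2)[OF p]]] cc(1)[OF p] b(1) by (simp add: cancel_inv)
  then have bH: "b \<in> H" using H_memI b(1) by blast
  have wb: "w p b = w p (c p)" if p: "p \<in> X" for p
    using w_U[OF p b(2)[OF p]] cc[OF p] b(1) by (simp add: w_mult[OF p] w_inv[OF p])
  have "deg g (\<lambda>_. b) = deg g c" for g by (rule deg_cong) (use wb R_X in blast)
  then show ?thesis using bH b(2) by blast
qed

text \<open>Two elements of the same shape have the same image in the block monoid over the classes and the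
  localizations at the primes containing the conductor.\<close>

definition same_shape :: "'a \<Rightarrow> 'a \<Rightarrow> bool" where
  "same_shape a b \<longleftrightarrow> (\<forall>p\<in>E. inv a \<otimes> b \<in> U p) \<and> (\<forall>g\<in>G0. deg g (\<lambda>_. a) = deg g (\<lambda>_. b))"

lemma const_integral: "a \<in> H \<Longrightarrow> (\<lambda>_. a) \<in> integral"
  using families_const H_carrier H_D by (simp add: integral_def)

lemma deg_const_mult:
  "a \<in> H \<Longrightarrow> b \<in> H \<Longrightarrow> deg g (\<lambda>_. a \<otimes> b) = deg g (\<lambda>_. a) + deg g (\<lambda>_. b)"
  using deg_mult[of "\<lambda>_. a" "\<lambda>_. b"] integral_families[OF const_integral] by simp

lemma deg_const_nonneg: "a \<in> H \<Longrightarrow> 0 \<le> deg g (\<lambda>_. a)"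
  by (rule deg_nonneg) (use H_D R_X in blast)

lemma same_shape_sym:
  assumes "same_shape a b" "a \<in> H" "b \<in> H"
  shows "same_shape b a"
proof -
  have c: "a \<in> carrier Q" "b \<in> carrier Q" using H_carrier assms by auto
  have "inv b \<otimes> a \<in> U p" if p: "p \<in> E" for p
  proof -
    have "inv a \<otimes> b \<in> U p" using assms(1) p by (simp add: same_shape_def)
    then have "inv (inv a \<otimes> b) \<in> U p" by (rule U_inv[OF E_X'[OF p]])
    then show ?thesis using c by (simp add: inv_quotient)
  qed
  then show ?thesis using assms(1) by (simp add: same_shape_def)
qed

text \<open>The factor of \<open>a\<close> is obtained by imposing the shape of \<open>b1\<close>; its cofactor has the right shape
  because shapes are multiplicative.\<close>

lemma same_shape_split:
  assumes s: "same_shape a b" and H: "a \<in> H" "b1 \<in> H" "b2 \<in> H" and b: "b = b1 \<otimes> b2"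
  shows "\<exists>a1\<in>H. \<exists>a2\<in>H. a = a1 \<otimes> a2 \<and> same_shape a1 b1 \<and> same_shape a2 b2"
proof -
  have c: "a \<in> carrier Q" "b1 \<in> carrier Q" "b2 \<in> carrier Q" "b \<in> carrier Q" using H_carrier H b by auto
  have sU: "inv a \<otimes> b \<in> U p" if "p \<in> E" for p using s that by (simp add: same_shape_def)
  have dab: "deg g (\<lambda>_. a) = deg g (\<lambda>_. b1) + deg g (\<lambda>_. b2)" if "g \<in> G0" for g
    using s that deg_const_mult[OF H(2,3)] b by (simp add: same_shape_def)
  have "\<exists>a1\<in>H. \<exists>a2\<in>H. a = a1 \<otimes> a2 \<and> (\<forall>p\<in>E. inv b1 \<otimes> a1 \<in> U p) \<and> (\<forall>g\<in>G0. deg g (\<lambda>_. a1) = deg g (\<lambda>_. b1))"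
  proof (rule split_by_shape[OF finite_G0 H(1) const_integral[OF H(2)] cls_const[OF c(2)]])
    fix p assume p: "p \<in> E"
    have "inv (inv a \<otimes> b) \<in> U p" using U_inv[OF E_X'[OF p] sU[OF p]] .
    then have "b2 \<otimes> inv (inv a \<otimes> b) \<in> D p" using D_mult[OF E_X'[OF p] H_D[OF E_X'[OF p] H(3)]] U_D by blast
    moreover have "b2 \<otimes> inv (inv a \<otimes> b) = inv b1 \<otimes> a"
    proof -
      have "b2 \<otimes> inv (inv a \<otimes> b) = b2 \<otimes> (inv (b1 \<otimes> b2) \<otimes> a)" using c b by (simp add: inv_quotient)
      also have "\<dots> = b2 \<otimes> (inv b2 \<otimes> (inv b1 \<otimes> a))" using c by (simp add: inv_mult' m_ac)
      finally show ?thesis using c by (simp add: cancel_inv)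
    qed
    ultimately show "inv b1 \<otimes> a \<in> D p" by simp
  next
    fix g assume "g \<in> G0"
    then show "deg g (\<lambda>_. b1) \<le> deg g (\<lambda>_. a)" using dab deg_const_nonneg[OF H(3)] by simp
  qed
  then obtain a1 a2 where a: "a1 \<in> H" "a2 \<in> H" "a = a1 \<otimes> a2" "\<forall>p\<in>E. inv b1 \<otimes> a1 \<in> U p"
    "\<forall>g\<in>G0. deg g (\<lambda>_. a1) = deg g (\<lambda>_. b1)" by blast
  have ac: "a1 \<in> carrier Q" "a2 \<in> carrier Q" using H_carrier a by auto
  have "same_shape b1 a1" using a by (simp add: same_shape_def)
  then have 1: "same_shape a1 b1" using same_shape_sym H a by blast
  have "inv a2 \<otimes> b2 \<in> U p" if p: "p \<in> E" for p
  proof -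
    have "(inv a \<otimes> b) \<otimes> (inv b1 \<otimes> a1) \<in> U p" using U_mult[OF E_X'[OF p] sU[OF p]] a(4) p by blast
    moreover have "(inv a \<otimes> b) \<otimes> (inv b1 \<otimes> a1) = inv a2 \<otimes> b2"
    proof -
      let ?x = "inv a1 \<otimes> b1" and ?y = "inv a2 \<otimes> b2" and ?z = "inv b1 \<otimes> a1"
      have xyz: "?x \<in> carrier Q" "?y \<in> carrier Q" "?z \<in> carrier Q" using ac c by auto
      have "inv a \<otimes> b = ?x \<otimes> ?y" unfolding a(3) b using inv_interchange ac c by simp
      moreover have "?x \<otimes> ?z = \<one>" using inv_chain[of a1 b1 a1] ac c by simp
      moreover have "?x \<otimes> ?y \<otimes> ?z = (?x \<otimes> ?z) \<otimes> ?y" using m_assoc[OF xyz(1)] m_comm[OF xyz(2,3)] xyz by simp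
      ultimately show ?thesis using xyz by simp
    qed
    ultimately show ?thesis by simp
  qed
  moreover have "deg g (\<lambda>_. a2) = deg g (\<lambda>_. b2)" if "g \<in> G0" for g
    using dab[OF that] deg_const_mult[OF a(1,2), of g] a(3,5) that by simp
  ultimately have "same_shape a2 b2" by (simp add: same_shape_def)
  then show ?thesis using a 1 by blast
qed

lemma unit_iff_shape:
  assumes a: "a \<in> H"
  shows "inv a \<in> H \<longleftrightarrow> (\<forall>p\<in>E. a \<in> U p) \<and> (\<forall>g\<in>G0. deg g (\<lambda>_. a) = 0)"
proof -
  have ac: "a \<in> carrier Q" using H_carrier a .
  have "inv a \<in> H \<longleftrightarrow> (\<forall>p\<in>X. a \<in> U p)"
  proof
    assume "inv a \<in> H"
    then show "\<forall>p\<in>X. a \<in> U p" using H_D a by (simp add: U_def)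
  next
    assume "\<forall>p\<in>X. a \<in> U p"
    then show "inv a \<in> H" using ac by (intro H_memI) (auto simp: U_def)
  qed
  also have "\<dots> \<longleftrightarrow> (\<forall>p\<in>E. a \<in> U p) \<and> (\<forall>p\<in>R. a \<in> U p)" using X_cases R_X E_X' by blast
  finally show ?thesis using deg_zero_iff[OF const_integral[OF a]] by blast
qed

lemma same_shape_unit_iff:
  assumes "same_shape a b" "a \<in> H" "b \<in> H"
  shows "inv a \<in> H \<longleftrightarrow> inv b \<in> H"
proof -
  have c: "a \<in> carrier Q" "b \<in> carrier Q" using H_carrier assms by auto
  have "a \<in> U p \<longleftrightarrow> b \<in> U p" if p: "p \<in> E" for p
  proof -
    have u: "inv a \<otimes> b \<in> U p" using assms(1) p by (simp add: same_shape_def)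
    have "(inv a \<otimes> b) \<otimes> a = b" using c by (simp add: m_comm cancel_inv)
    then show ?thesis using U_cancel(2)[OF E_X'[OF p] c(1) u] by simp
  qed
  then show ?thesis using assms unfolding unit_iff_shape[OF assms(2)] unit_iff_shape[OF assms(3)]
    by (simp add: same_shape_def)
qed

text \<open>Since every class of regular primes keeps one representative, this divisor-closed submonoid has
  the same sets of lengths as \<open>H\<close>.\<close>

definition H' :: "'a set" where "H' = {a \<in> H. \<forall>p\<in>R - reps. a \<in> U p}"

lemma H'_H: "a \<in> H' \<Longrightarrow> a \<in> H" by (simp add: H'_def)

lemma H'_carrier: "a \<in> H' \<Longrightarrow> a \<in> carrier Q" using H'_H H_carrier by blast

lemma submonoid_H': "submonoid H' Q"
proof
  show "H' \<subseteq> carrier Q" using H'_carrier by blast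
  show "\<one> \<in> H'" using submonoid.one_closed[OF submonoid_H] U_one R_X by (simp add: H'_def)
  show "x \<otimes> y \<in> H'" if "x \<in> H'" "y \<in> H'" for x y
    using that H_mult U_mult R_X by (simp add: H'_def)
qed

lemma H'_factor:
  assumes "b1 \<in> H" "b2 \<in> H" "b1 \<otimes> b2 \<in> H'"
  shows "b1 \<in> H'" "b2 \<in> H'"
proof -
  have "b1 \<in> U p \<and> b2 \<in> U p" if p: "p \<in> R - reps" for p
  proof -
    have pX: "p \<in> X" using p R_X by blast
    show ?thesis using U_factor[OF pX H_D[OF pX assms(1)] H_D[OF pX assms(2)]] assms(3) p by (simp add: H'_def)
  qed
  then show "b1 \<in> H'" "b2 \<in> H'" using assms by (auto simp: H'_def)
qed

lemma H'_inv: "a \<in> H' \<Longrightarrow> inv a \<in> H \<longleftrightarrow> inv a \<in> H'"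
  using U_inv R_X by (auto simp: H'_def)

lemma HM: "comm_monoid_cancel (submon Q H)" by (rule comm_monoid_cancel_submon[OF submonoid_H])
lemma H'M: "comm_monoid_cancel (submon Q H')" by (rule comm_monoid_cancel_submon[OF submonoid_H'])

text \<open>Elements of equal shape can be factored alike, so having the same shape is a transfer relation.\<close>

lemma length_set_H':
  assumes s: "same_shape a b" and a: "a \<in> H" and b: "b \<in> H'"
  shows "length_set (submon Q H) a = length_set (submon Q H') b"
proof (rule length_set_transfer[where R = same_shape, OF HM H'M s])
  show "a \<in> carrier (submon Q H)" "b \<in> carrier (submon Q H')" using a b by auto
next
  fix a b assume "same_shape a b" "a \<in> carrier (submon Q H)" "b \<in> carrier (submon Q H')"
  then show "a \<in> Units (submon Q H) \<longleftrightarrow> b \<in> Units (submon Q H')"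
    using same_shape_unit_iff[of a b] H'_inv[of b] H'_H[of b]
    by (simp add: Units_submon[OF submonoid_H] Units_submon[OF submonoid_H'])
next
  fix a b b1 b2 assume "same_shape a b" "a \<in> carrier (submon Q H)" "b1 \<in> carrier (submon Q H')"
    "b2 \<in> carrier (submon Q H')" "b = b1 \<otimes>\<^bsub>submon Q H'\<^esub> b2"
  then show "\<exists>a1\<in>carrier (submon Q H). \<exists>a2\<in>carrier (submon Q H).
      a = a1 \<otimes>\<^bsub>submon Q H\<^esub> a2 \<and> same_shape a1 b1 \<and> same_shape a2 b2"
    using same_shape_split[of a b b1 b2] H'_H[of b1] H'_H[of b2] by simp
next
  fix a b a1 a2 assume h: "same_shape a b" "b \<in> carrier (submon Q H')" "a1 \<in> carrier (submon Q H)"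
    "a2 \<in> carrier (submon Q H)" "a = a1 \<otimes>\<^bsub>submon Q H\<^esub> a2"
  then have m: "b \<in> H'" "a1 \<in> H" "a2 \<in> H" "a = a1 \<otimes> a2" "a \<in> H" using H_mult by auto
  obtain b1 b2 where b: "b1 \<in> H" "b2 \<in> H" "b = b1 \<otimes> b2" "same_shape b1 a1" "same_shape b2 a2"
    using same_shape_split[OF same_shape_sym[OF h(1) m(5) H'_H[OF m(1)]] H'_H[OF m(1)] m(2,3,4)] by blast
  have "b1 \<otimes> b2 \<in> H'" using m(1) b(3) by simp
  then have "b1 \<in> H'" "b2 \<in> H'" using H'_factor[OF b(1,2)] by auto
  moreover have "same_shape a1 b1" "same_shape a2 b2"
    using same_shape_sym[OF b(4,1) m(2)] same_shape_sym[OF b(5,2) m(3)] by auto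
  ultimately show "\<exists>b1\<in>carrier (submon Q H'). \<exists>b2\<in>carrier (submon Q H').
      b = b1 \<otimes>\<^bsub>submon Q H'\<^esub> b2 \<and> same_shape a1 b1 \<and> same_shape a2 b2"
    using b(3) by auto
qed

lemma exists_same_shape:
  assumes a: "a \<in> H"
  shows "\<exists>b\<in>H'. same_shape a b"
proof -
  define c where "c = shape_family (\<lambda>_. a) (\<lambda>g. nat (deg g (\<lambda>_. a)))"
  have aD: "p \<in> E \<Longrightarrow> a \<in> D p" for p using H_D[OF E_X' a] .
  have ac: "a \<in> carrier Q" using H_carrier a .
  have c: "c \<in> integral" "g \<in> G0 \<Longrightarrow> deg g c = deg g (\<lambda>_. a)" for g
    using shape_family[where e = "\<lambda>_. a" and n = "\<lambda>g. nat (deg g (\<lambda>_. a))", OF aD] deg_const_nonneg[OF a]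
    by (simp_all add: c_def)
  have "cls c = \<one>\<^bsub>C\<^esub>"
  proof (rule cls_one_of_deg_eq[OF finite_G0 integral_families[OF c(1)] families_const[OF ac] cls_const[OF ac] _ c(2)])
    fix p assume p: "p \<in> E"
    then show "inv a \<otimes> c p \<in> U p" using ac U_one[OF E_X'[OF p]] by (simp add: c_def shape_family_def)
  qed
  then obtain b where b: "b \<in> H" "\<forall>p\<in>X. inv (c p) \<otimes> b \<in> U p" "\<forall>g. deg g (\<lambda>_. b) = deg g c"
    using realize[OF c(1)] by blast
  have "inv a \<otimes> b \<in> U p" if p: "p \<in> E" for p
  proof -
    have "c p = a" using p by (simp add: c_def shape_family_def)
    then show ?thesis using b(2) E_X'[OF p] by metis
  qed
  then have "same_shape a b" using b(3) c(2) by (simp add: same_shape_def)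
  moreover have "b \<in> U p" if p: "p \<in> R - reps" for p
  proof -
    have "c p = \<one>" "p \<in> X" using p R_X by (auto simp: c_def shape_family_def regular_primes_def)
    then show ?thesis using b(2) H_carrier[OF b(1)] by force
  qed
  ultimately show ?thesis using b(1) by (auto simp: H'_def)
qed

lemma same_shape_refl: "a \<in> H \<Longrightarrow> same_shape a a"
  using H_carrier U_one E_X' by (simp add: same_shape_def)

lemma system_H': "system_of_length_sets (submon Q H) = system_of_length_sets (submon Q H')"
proof (intro equalityI subsetI)
  fix L assume "L \<in> system_of_length_sets (submon Q H)"
  then obtain a where a: "a \<in> H" "L = length_set (submon Q H) a" by (auto simp: system_of_length_sets_def)
  obtain b where b: "b \<in> H'" "same_shape a b" using exists_same_shape[OF a(1)] by blast
  then show "L \<in> system_of_length_sets (submon Q H')"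
    using length_set_H'[OF b(2) a(1) b(1)] a(2) by (auto simp: system_of_length_sets_def)
next
  fix L assume "L \<in> system_of_length_sets (submon Q H')"
  then obtain b where b: "b \<in> H'" "L = length_set (submon Q H') b" by (auto simp: system_of_length_sets_def)
  have "length_set (submon Q H) b = length_set (submon Q H') b"
    by (rule length_set_H'[OF same_shape_refl[OF H'_H[OF b(1)]] H'_H[OF b(1)] b(1)])
  then show "L \<in> system_of_length_sets (submon Q H)" using b H'_H[OF b(1)] by (auto simp: system_of_length_sets_def)
qed

abbreviation chosen where "chosen \<equiv> E \<union> reps"

lemma finite_chosen: "finite chosen" using finite_conductor_primes finite_reps by simp

lemma chosen_X: "p \<in> chosen \<Longrightarrow> p \<in> X" using reps_R R_X E_X' by auto

lemma H'_unitI: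
  assumes a: "a \<in> H'" and w: "\<And>p. p \<in> chosen \<Longrightarrow> w p a = 0"
  shows "inv a \<in> H'"
proof -
  have "inv a \<in> D p" if p: "p \<in> X" for p
  proof (cases "p \<in> chosen")
    case True
    then have "a \<in> U p" using U_iff_w[OF p H_D[OF p H'_H[OF a]]] w by blast
    then show ?thesis by (simp add: U_def)
  next
    case False
    then have "p \<in> R - reps" using X_cases[OF p] by blast
    then show ?thesis using a by (simp add: H'_def U_def)
  qed
  then have "inv a \<in> H" using H'_carrier[OF a] by (intro H_memI) auto
  then show ?thesis using H'_inv[OF a] by simp
qed

lemma w_H': "a \<in> H' \<Longrightarrow> p \<in> X \<Longrightarrow> 0 \<le> w p a" using w_D H_D H'_H by blast

lemma length_set_H'_nonempty:
  assumes "a \<in> H'"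
  shows "length_set (submon Q H') a \<noteq> {}"
proof -
  interpret H': comm_monoid_cancel "submon Q H'" by (rule H'M)
  define sz where "sz = (\<lambda>a. \<Sum>p\<in>chosen. nat (w p a))"
  have unit: "a \<in> Units (submon Q H')" if a: "a \<in> H'" "sz a = 0" for a
  proof -
    have "w p a = 0" if p: "p \<in> chosen" for p
    proof -
      have "nat (w p a) = 0" using a(2) p finite_chosen unfolding sz_def by (simp only: sum_eq_0_iff)
      then show ?thesis using w_H'[OF a(1) chosen_X[OF p]] by simp
    qed
    then show ?thesis using H'_unitI[OF a(1)] a(1) by (simp add: Units_submon[OF submonoid_H'])
  qed
  show ?thesis
  proof (rule H'.length_set_nonempty_by_size[where sz = sz])
    show "x \<in> Units (submon Q H')" if "x \<in> carrier (submon Q H')" "sz x = 0" for x using unit that by simp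
    fix x y assume xy: "x \<in> carrier (submon Q H')" "y \<in> carrier (submon Q H')" "y \<notin> Units (submon Q H')"
    then have m: "x \<in> H'" "y \<in> H'" by auto
    have "sz (x \<otimes> y) = (\<Sum>p\<in>chosen. nat (w p x) + nat (w p y))" unfolding sz_def
    proof (rule sum.cong[OF refl])
      fix p assume p: "p \<in> chosen"
      have "w p (x \<otimes> y) = w p x + w p y" using w_mult[OF chosen_X[OF p]] H'_carrier m by blast
      then show "nat (w p (x \<otimes> y)) = nat (w p x) + nat (w p y)"
        using w_H'[OF m(1) chosen_X[OF p]] w_H'[OF m(2) chosen_X[OF p]] by (simp add: nat_add_distrib)
    qed
    then have "sz (x \<otimes> y) = sz x + sz y" by (simp add: sz_def sum.distrib)
    moreover have "sz y \<noteq> 0" using unit[OF m(2)] xy(3) by blast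
    ultimately show "sz x < sz (x \<otimes>\<^bsub>submon Q H'\<^esub> y)" by simp
  qed (use assms in simp)
qed

text \<open>An element \<open>x\<close> of valuation zero at \<open>p\<close> yields an ideal class, and two such elements with the
  same class differ by a unit of the complete integral closure, up to units of the localization. There
  are finitely many classes, and finitely many units of the complete integral closure modulo those of
  \<open>H\<close>.\<close>

lemma finite_local_unit_classes:
  assumes p: "p \<in> E"
  shows "\<exists>(\<kappa> :: 'a \<Rightarrow> 'a set set \<times> 'a set) K. finite K \<and> (\<forall>x\<in>carrier Q. w p x = 0 \<longrightarrow> \<kappa> x \<in> K) \<and>
    (\<forall>x\<in>carrier Q. \<forall>y\<in>carrier Q. w p x = 0 \<longrightarrow> w p y = 0 \<longrightarrow> \<kappa> x = \<kappa> y \<longrightarrow> inv x \<otimes> y \<in> U p)"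
proof -
  have pX: "p \<in> X" using p by (rule E_X')
  interpret h: group_hom Q C "\<lambda>x. cls (single p x)"
    by (intro group_hom.intro group_hom_axioms.intro single_hom[OF pX] group_axioms C.group_axioms)
  (* A fixed local unit in each class; any other unit x of that class differs from it by some z that
     is a unit of the complete integral closure, up to units of the localization. *)
  define base where "base = (\<lambda>g. SOME x. x \<in> carrier Q \<and> w p x = 0 \<and> cls (single p x) = g)"
  let ?y = "\<lambda>x. base (cls (single p x))"
  have base: "?y x \<in> carrier Q" "w p (?y x) = 0" "cls (single p (?y x)) = cls (single p x)"
    if "x \<in> carrier Q" "w p x = 0" for x
  proof -
    have "\<exists>y. y \<in> carrier Q \<and> w p y = 0 \<and> cls (single p y) = cls (single p x)" using that by blast
    from someI_ex[OF this] show "?y x \<in> carrier Q" "w p (?y x) = 0" "cls (single p (?y x)) = cls (single p x)"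
      unfolding base_def by auto
  qed
  let ?good = "\<lambda>x z. z \<in> carrier Q \<and> z \<in> cic \<and> inv z \<in> cic \<and> inv x \<otimes> (?y x \<otimes> z) \<in> U p"
  have "\<exists>z. ?good x z" if x: "x \<in> carrier Q" "w p x = 0" for x
  proof -
    let ?u = "inv (?y x) \<otimes> x"
    have u: "?u \<in> carrier Q" "w p ?u = 0"
      using base[OF x] x by (simp_all add: w_mult[OF pX] w_inv[OF pX])
    have "cls (single p ?u) = \<one>\<^bsub>C\<^esub>"
      using base[OF x] x h.hom_mult[of "inv (?y x)" x] h.hom_inv[of "?y x"] h.hom_closed[OF x(1)] by simp
    then obtain z where z: "z \<in> carrier Q" "\<And>q. q \<in> X \<Longrightarrow> inv (single p ?u q) \<otimes> z \<in> U q"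
      using cls_one_obtains[OF single_families[OF u(1)]] by blast
    have zp: "inv ?u \<otimes> z \<in> U p" using z(2)[OF pX] by (simp add: single_def)
    have "w q z = 0" if q: "q \<in> X" for q
    proof (cases "q = p")
      case True
      then show ?thesis using w_U[OF pX zp] u z(1) by (simp add: w_mult[OF pX] w_inv[OF pX])
    next
      case False
      then have "inv \<one> \<otimes> z \<in> U q" using z(2)[OF q] by (simp add: single_def)
      then show ?thesis using w_U[OF q] z(1) by simp
    qed
    then have "z \<in> cic \<and> inv z \<in> cic" by (rule cic_Unit_w[OF z(1)])
    moreover have "inv ?u \<otimes> z = inv x \<otimes> (?y x \<otimes> z)"
      using base[OF x] x z(1) by (simp add: inv_quotient m_assoc)
    ultimately show ?thesis using z(1) zp by auto
  qed
  then have "\<exists>zf. \<forall>x. x \<in> carrier Q \<longrightarrow> w p x = 0 \<longrightarrow> ?good x (zf x)" by metis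
  then obtain zf where zf: "\<And>x. x \<in> carrier Q \<Longrightarrow> w p x = 0 \<Longrightarrow> ?good x (zf x)" by blast
  let ?G = "units_of (submon Q cic)" and ?N = "Units (submon Q H)"
  define \<kappa> where "\<kappa> = (\<lambda>x. (cls (single p x), ?N #>\<^bsub>?G\<^esub> zf x))"
  have G: "carrier ?G = {x \<in> cic. inv x \<in> cic}" by (simp add: units_of_carrier Units_submon[OF submonoid_cic])
  have N: "?N = {x \<in> H. inv x \<in> H}" by (rule Units_submon[OF submonoid_H])
  let ?K = "carrier C \<times> carrier (unit_quotient Q cic H)"
  have "\<kappa> x \<in> ?K" if x: "x \<in> carrier Q" "w p x = 0" for x
  proof -
    have "zf x \<in> carrier ?G" using zf[OF x] G by simp
    then show ?thesis using cls_carrier[OF single_families[OF x(1)]]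
      by (simp add: \<kappa>_def unit_quotient_def carrier_FactGroup)
  qed
  moreover have "inv x \<otimes> y \<in> U p"
    if x: "x \<in> carrier Q" "w p x = 0" and y: "y \<in> carrier Q" "w p y = 0" and e: "\<kappa> x = \<kappa> y" for x y
  proof -
    have cl: "cls (single p x) = cls (single p y)" and co: "?N #>\<^bsub>?G\<^esub> zf x = ?N #>\<^bsub>?G\<^esub> zf y"
      using e by (auto simp: \<kappa>_def)
    note zx = zf[OF x] and zy = zf[OF y]
    have "\<one> \<in> ?N" unfolding N using submonoid.one_closed[OF submonoid_H] by simp
    then have "\<one> \<otimes>\<^bsub>?G\<^esub> zf y \<in> ?N #>\<^bsub>?G\<^esub> zf y" unfolding r_coset_def by blast
    then have "zf y \<in> ?N #>\<^bsub>?G\<^esub> zf x" using co zy by (simp add: units_of_mult)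
    then obtain n where n: "n \<in> ?N" "zf y = n \<otimes> zf x" by (auto simp: r_coset_def units_of_mult)
    have nU: "n \<in> U p" and nc: "n \<in> carrier Q" using n(1) N H_D[OF pX] H_carrier by (auto simp: U_def)
    define t where "t = ?y x \<otimes> (zf x \<otimes> n)"
    have tc: "t \<in> carrier Q" using base[OF x] zx nc by (simp add: t_def)
    have "inv x \<otimes> t = (inv x \<otimes> (?y x \<otimes> zf x)) \<otimes> n" using base[OF x] zx nc x by (simp add: t_def m_assoc)
    then have 1: "inv x \<otimes> t \<in> U p" using U_mult[OF pX _ nU] zx by simp
    have "inv y \<otimes> (?y x \<otimes> (n \<otimes> zf x)) \<in> U p" using zy cl n(2) by simp
    then have "inv y \<otimes> t \<in> U p" using zx nc by (simp add: t_def m_comm)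
    then have "inv (inv y \<otimes> t) \<in> U p" by (rule U_inv[OF pX])
    then have 2: "inv t \<otimes> y \<in> U p" using tc y by (simp add: inv_quotient)
    show ?thesis using U_mult[OF pX 1 2] inv_chain[OF x(1) tc y(1)] by simp
  qed
  moreover have "finite ?K" using finite_C finite_unit_quotient by simp
  ultimately show ?thesis by (intro exI[of _ \<kappa>] exI[of _ ?K]) blast
qed

text \<open>By Dickson's lemma with the valuations as coordinates and the residues of the valuations and
  the local unit classes as colours, an infinite set of atoms of \<open>H'\<close> would contain two that divide
  each other.\<close>

lemma finitely_many_atoms_H':
  "\<exists>W. finite W \<and> W \<subseteq> carrier (submon Q H') \<and> (\<forall>u\<in>W. irreducible (submon Q H') u) \<and>
    (\<forall>a\<in>carrier (submon Q H'). irreducible (submon Q H') a \<longrightarrow> (\<exists>u\<in>W. \<exists>e\<in>Units (submon Q H'). a = u \<otimes> e))"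
proof -
  interpret H': comm_monoid_cancel "submon Q H'" by (rule H'M)
  define V where "V = {x \<in> H'. inv x \<in> H'}"
  have V: "Units (submon Q H') = V" unfolding V_def by (rule Units_submon[OF submonoid_H'])
  have Vm: "x \<otimes> y \<in> V" if "x \<in> V" "y \<in> V" for x y
    using that submonoid.m_closed[OF submonoid_H'] H'_carrier by (simp add: V_def inv_mult')
  have Vi: "inv x \<in> V" if "x \<in> V" for x using that H'_carrier by (simp add: V_def)
  have V1: "\<one> \<in> V" using submonoid.one_closed[OF submonoid_H'] by (simp add: V_def)
  define A where "A = {a \<in> H'. irreducible (submon Q H') a}"
  have Ac: "a \<in> carrier Q" if "a \<in> A" for a using that H'_carrier by (simp add: A_def)
  define k where "k = (\<lambda>a. {b \<in> A. inv a \<otimes> b \<in> V})"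
  have keq: "k a = k b" if ab: "a \<in> A" "b \<in> A" "inv a \<otimes> b \<in> V" for a b
  proof -
    have iv: "inv b \<otimes> a \<in> V" using Vi[OF ab(3)] Ac ab by (simp add: inv_quotient)
    have "inv a \<otimes> c \<in> V \<longleftrightarrow> inv b \<otimes> c \<in> V" if c: "c \<in> A" for c
      using Vm[OF ab(3), of "inv b \<otimes> c"] Vm[OF iv, of "inv a \<otimes> c"]
        inv_chain[of a b c] inv_chain[of b a c] Ac ab c by auto
    then show ?thesis by (auto simp: k_def)
  qed
  have "\<forall>p\<in>E. \<exists>z :: ('a \<Rightarrow> 'a set set \<times> 'a set) \<times> ('a set set \<times> 'a set) set. finite (snd z) \<and>
    (\<forall>x\<in>carrier Q. w p x = 0 \<longrightarrow> fst z x \<in> snd z) \<and>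
    (\<forall>x\<in>carrier Q. \<forall>y\<in>carrier Q. w p x = 0 \<longrightarrow> w p y = 0 \<longrightarrow> fst z x = fst z y \<longrightarrow> inv x \<otimes> y \<in> U p)"
  proof
    fix p assume "p \<in> E"
    from finite_local_unit_classes[OF this] show "\<exists>z :: ('a \<Rightarrow> 'a set set \<times> 'a set) \<times> ('a set set \<times> 'a set) set. finite (snd z) \<and>
    (\<forall>x\<in>carrier Q. w p x = 0 \<longrightarrow> fst z x \<in> snd z) \<and>
    (\<forall>x\<in>carrier Q. \<forall>y\<in>carrier Q. w p x = 0 \<longrightarrow> w p y = 0 \<longrightarrow> fst z x = fst z y \<longrightarrow> inv x \<otimes> y \<in> U p)"
    proof (elim exE)
      fix \<kappa> :: "'a \<Rightarrow> 'a set set \<times> 'a set" and K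
      assume "finite K \<and> (\<forall>x\<in>carrier Q. w p x = 0 \<longrightarrow> \<kappa> x \<in> K) \<and>
        (\<forall>x\<in>carrier Q. \<forall>y\<in>carrier Q. w p x = 0 \<longrightarrow> w p y = 0 \<longrightarrow> \<kappa> x = \<kappa> y \<longrightarrow> inv x \<otimes> y \<in> U p)"
      then show ?thesis by (intro exI[of _ "(\<kappa>, K)"]) simp
    qed
  qed
  from bchoice[OF this]
  obtain z :: "'a set \<Rightarrow> ('a \<Rightarrow> 'a set set \<times> 'a set) \<times> ('a set set \<times> 'a set) set" where z: "\<forall>p\<in>E. finite (snd (z p)) \<and>
    (\<forall>x\<in>carrier Q. w p x = 0 \<longrightarrow> fst (z p) x \<in> snd (z p)) \<and>
    (\<forall>x\<in>carrier Q. \<forall>y\<in>carrier Q. w p x = 0 \<longrightarrow> w p y = 0 \<longrightarrow> fst (z p) x = fst (z p) y \<longrightarrow> inv x \<otimes> y \<in> U p)"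
    by blast
  define up where "up = (\<lambda>p a. a \<otimes> inv (\<pi> p [^] w p a))"
  have up: "up p a \<in> carrier Q" "w p (up p a) = 0" if "p \<in> X" "a \<in> carrier Q" for p a
    using that \<pi>_carrier[OF that(1)] w_int_pow[OF that(1) \<pi>_carrier[OF that(1)]] w_\<pi>[OF that(1)]
    by (auto simp: up_def w_mult w_inv)
  have "finite (k ` A)"
  proof (rule ccontr)
    assume "infinite (k ` A)"
    then obtain f :: "nat \<Rightarrow> 'a set" where f: "inj f" "range f \<subseteq> k ` A"
      using infinite_countable_subset by blast
    have "\<exists>a. a \<in> A \<and> k a = f n" for n
    proof -
      have "f n \<in> k ` A" using f(2) by (rule subsetD) (rule rangeI)
      then show ?thesis by auto
    qed
    then have "\<forall>n. \<exists>a. a \<in> A \<and> k a = f n" by blast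
    from choice[OF this] obtain s where s: "\<forall>n. s n \<in> A \<and> k (s n) = f n" by blast
    have sH: "s n \<in> H'" "s n \<in> carrier Q" for n using s Ac by (auto simp: A_def)
    (* Equal residues make a positive difference of valuations at least \<alpha> p; for equal valuations
       the unit class decides. *)
    define col where "col = (\<lambda>n. restrict (\<lambda>p. (nat (w p (s n)) mod \<alpha> p, fst (z p) (up p (s n)))) E)"
    have \<alpha>0: "0 < \<alpha> p" if "p \<in> X" for p using primary_valuations.\<alpha>_pos[OF pv[OF that]] .
    have "range col \<subseteq> PiE E (\<lambda>p. {..<\<alpha> p} \<times> snd (z p))"
    proof (rule image_subsetI)
      fix n
      show "col n \<in> PiE E (\<lambda>p. {..<\<alpha> p} \<times> snd (z p))"
      proof (rule PiE_I)
        fix p assume p: "p \<in> E"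
        have "fst (z p) (up p (s n)) \<in> snd (z p)" using z p up[OF E_X'[OF p] sH(2)] by blast
        then show "col n p \<in> {..<\<alpha> p} \<times> snd (z p)" using p \<alpha>0[OF E_X'[OF p]] by (simp add: col_def)
      qed (simp add: col_def)
    qed
    moreover have "finite (PiE E (\<lambda>p. {..<\<alpha> p} \<times> snd (z p)))"
      using z by (intro finite_PiE finite_conductor_primes) auto
    ultimately have fc: "finite (range col)" by (rule finite_subset)
    obtain i j where ij: "i < j" "col i = col j" "\<forall>p\<in>chosen. nat (w p (s i)) \<le> nat (w p (s j))"
      using dickson_coloured[OF finite_chosen fc, of "\<lambda>n p. nat (w p (s n))"] by blast
    have le: "w p (s i) \<le> w p (s j)" if p: "p \<in> chosen" for p
    proof -
      have "nat (w p (s i)) \<le> nat (w p (s j))" using ij(3) p by blast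
      then show ?thesis using w_H'[OF sH(1) chosen_X[OF p], of j] by linarith
    qed
    let ?t = "inv (s i) \<otimes> s j"
    have wt: "w p ?t = w p (s j) - w p (s i)" if "p \<in> X" for p
      using sH by (simp add: w_mult[OF that] w_inv[OF that])
    have tE: "?t \<in> D p" if p: "p \<in> E" for p
    proof -
      have pX: "p \<in> X" using p by (rule E_X')
      have "col i p = col j p" using ij(2) by simp
      then have c: "nat (w p (s i)) mod \<alpha> p = nat (w p (s j)) mod \<alpha> p"
        "fst (z p) (up p (s i)) = fst (z p) (up p (s j))" using p by (auto simp: col_def)
      show ?thesis
      proof (cases "w p (s i) = w p (s j)")
        case True
        have "inv (up p (s i)) \<otimes> up p (s j) \<in> U p" using z p c(2) up[OF pX sH(2)] by blast
        moreover have "inv (up p (s i)) \<otimes> up p (s j) = ?t"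
        proof -
          let ?q = "inv (\<pi> p [^] w p (s j))"
          have q: "?q \<in> carrier Q" using \<pi>_carrier[OF pX] by simp
          have "inv (s i \<otimes> ?q) \<otimes> (s j \<otimes> ?q) = (inv ?q \<otimes> ?q) \<otimes> ?t"
            using sH q by (simp add: inv_mult' m_ac del: l_inv r_inv inv_inv)
          then show ?thesis using True sH q by (simp add: up_def)
        qed
        ultimately show ?thesis using U_D by simp
      next
        case False
        then have lt: "nat (w p (s i)) < nat (w p (s j))"
          using le[of p] p w_H'[OF sH(1) pX, of i] by simp
        have "\<alpha> p dvd nat (w p (s j)) - nat (w p (s i))" using c(1) lt by (metis mod_eq_dvd_iff_nat less_imp_le)
        then have "\<alpha> p \<le> nat (w p (s j)) - nat (w p (s i))" using lt by (intro dvd_imp_le) auto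
        then have "int (\<alpha> p) \<le> w p ?t" using wt[OF pX] lt w_H'[OF sH(1) pX, of i] by linarith
        then show ?thesis using D_large[OF pX] sH by simp
      qed
    qed
    have tnr: "?t \<in> U p" if p: "p \<in> R - reps" for p
    proof -
      have pX: "p \<in> X" using p R_X by blast
      have "s i \<in> U p" "s j \<in> U p" using sH(1) p by (auto simp: H'_def)
      then show ?thesis using U_mult[OF pX U_inv[OF pX]] by blast
    qed
    have "?t \<in> D p" if p: "p \<in> X" for p
    proof (cases "p \<in> E")
      case False
      then have pR: "p \<in> R" using X_cases[OF p] by blast
      show ?thesis
      proof (cases "p \<in> reps")
        case True
        then show ?thesis using regular_D_iff[OF pR, of ?t] wt[OF p] le[of p] sH by simp
      next
        case False
        then show ?thesis using tnr pR U_D by blast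
      qed
    qed (rule tE)
    then have "?t \<in> H" using sH by (intro H_memI) auto
    then have tH: "?t \<in> H'" using tnr by (simp add: H'_def)
    have "s j = s i \<otimes> ?t" using sH by (simp add: cancel_inv)
    then have "s i \<in> V \<or> ?t \<in> V"
      using s[rule_format, of j] H'.irreducible_iff_split[of "s j"] sH tH V by (auto simp: A_def)
    moreover have "s i \<notin> V" using s[rule_format, of i] V by (auto simp: A_def irreducible_def)
    ultimately have "k (s i) = k (s j)" using keq s by blast
    then have "f i = f j" using s by simp
    then show False using f(1) ij(1) by (simp add: inj_eq)
  qed
  define W where "W = (\<lambda>K. SOME a. a \<in> A \<and> k a = K) ` (k ` A)"
  have W: "u \<in> A" if u: "u \<in> W" for u
  proof -
    obtain a where "a \<in> A" "u = (SOME b. b \<in> A \<and> k b = k a)" using u by (auto simp: W_def)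
    then show ?thesis using someI[of "\<lambda>b. b \<in> A \<and> k b = k a" a] by simp
  qed
  have cover: "\<exists>u\<in>W. \<exists>e\<in>V. a = u \<otimes> e" if a: "a \<in> A" for a
  proof -
    let ?u = "SOME b. b \<in> A \<and> k b = k a"
    have u: "?u \<in> A \<and> k ?u = k a" by (rule someI[of _ a]) (use a in simp)
    have "a \<in> k a" using a V1 Ac by (simp add: k_def)
    then have "inv ?u \<otimes> a \<in> V" using u by (auto simp: k_def)
    moreover have "a = ?u \<otimes> (inv ?u \<otimes> a)" using u a Ac by (simp add: cancel_inv)
    moreover have "?u \<in> W" using a by (auto simp: W_def)
    ultimately show ?thesis by blast
  qed
  show ?thesis
  proof (intro exI[of _ W] conjI ballI impI)
    show "finite W" unfolding W_def using \<open>finite (k ` A)\<close> by (rule finite_imageI)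
    show "W \<subseteq> carrier (submon Q H')"
    proof
      fix u assume "u \<in> W"
      then show "u \<in> carrier (submon Q H')" using W[of u] by (simp add: A_def)
    qed
    show "irreducible (submon Q H') u" if "u \<in> W" for u using W[OF that] by (simp add: A_def)
    fix a assume "a \<in> carrier (submon Q H')" "irreducible (submon Q H') a"
    then have "a \<in> A" by (simp add: A_def)
    then show "\<exists>u\<in>W. \<exists>e\<in>Units (submon Q H'). a = u \<otimes> e" unfolding V by (rule cover)
  qed
qed

theorem accepted_elasticity_H: "accepted_elasticity (submon Q H)"
proof -
  interpret H': comm_monoid_cancel "submon Q H'" by (rule H'M)
  interpret HM: comm_monoid_cancel "submon Q H" by (rule HM)
  obtain W where W: "finite W" "W \<subseteq> carrier (submon Q H')" "\<forall>u\<in>W. irreducible (submon Q H') u"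
    "\<forall>a\<in>carrier (submon Q H'). irreducible (submon Q H') a \<longrightarrow> (\<exists>u\<in>W. \<exists>e\<in>Units (submon Q H'). a = u \<otimes> e)"
    using finitely_many_atoms_H' by blast
  have "accepted_elasticity (submon Q H')"
  proof (rule H'.accepted_elasticity_of_finitely_many_atoms[OF _ W(1,2)])
    show "length_set (submon Q H') a \<noteq> {}" if "a \<in> carrier (submon Q H')" for a
      using length_set_H'_nonempty that by simp
    show "irreducible (submon Q H') u" if "u \<in> W" for u using W(3) that by blast
    show "\<exists>u\<in>W. \<exists>e\<in>Units (submon Q H'). a = u \<otimes>\<^bsub>submon Q H'\<^esub> e"
      if "a \<in> carrier (submon Q H')" "irreducible (submon Q H') a" for a using W(4) that by simp
  qed
  then have acc: "elasticity (submon Q H') < \<infinity>" "\<exists>L\<in>system_of_length_sets (submon Q H'). set_elasticity L = elasticity (submon Q H')"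
    by (auto simp: accepted_elasticity_def)
  have "atomic_monoid (submon Q H)" unfolding HM.atomic_monoid_iff
  proof
    fix a assume "a \<in> carrier (submon Q H)"
    then have a: "a \<in> H" by simp
    obtain b where b: "b \<in> H'" "same_shape a b" using exists_same_shape[OF a] by blast
    show "length_set (submon Q H) a \<noteq> {}" using length_set_H'[OF b(2) a b(1)] length_set_H'_nonempty[OF b(1)] by simp
  qed
  then show ?thesis
    using acc elasticity_eq_of_system_eq[OF system_H'] system_H' by (simp add: accepted_elasticity_def)
qed

abbreviation Z where "Z \<equiv> zero_sum_monoid C G0"

text \<open>The zero-sum sequence lists the classes of the regular primes dividing \<open>b\<close>, and \<open>b\<close> is a unit
  at all other places.\<close>

definition zero_sum_shape :: "'a set set multiset \<Rightarrow> 'a \<Rightarrow> bool" where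
  "zero_sum_shape S b \<longleftrightarrow> (\<forall>p\<in>E. b \<in> U p) \<and> (\<forall>g\<in>G0. deg g (\<lambda>_. b) = int (count S g))"

lemma cls_eq_mset_product:
  assumes "c \<in> families" "\<And>p. p \<in> E \<Longrightarrow> c p \<in> U p" "set_mset S \<subseteq> G0" "\<And>g. g \<in> G0 \<Longrightarrow> deg g c = int (count S g)"
  shows "cls c = mset_product C S"
proof -
  have "cls c = (\<Otimes>\<^bsub>C\<^esub>g\<in>G0. g [^]\<^bsub>C\<^esub> deg g c)" by (rule cls_eq_prod[OF finite_G0 assms(1,2)])
  also have "\<dots> = (\<Otimes>\<^bsub>C\<^esub>g\<in>G0. g [^]\<^bsub>C\<^esub> count S g)"
  proof (rule C.finprod_cong'[OF refl])
    show "(\<lambda>g. g [^]\<^bsub>C\<^esub> count S g) \<in> G0 \<rightarrow> carrier C" using G0_carrier by auto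
    show "g [^]\<^bsub>C\<^esub> deg g c = g [^]\<^bsub>C\<^esub> count S g" if "g \<in> G0" for g
      unfolding assms(4)[OF that] by (rule int_pow_int)
  qed
  also have "\<dots> = mset_product C S" by (rule C.mset_product_eq[OF finite_G0 G0_carrier assms(3), symmetric])
  finally show ?thesis .
qed

text \<open>The condition on the sum of the sequence says that the ideal built from the representatives is
  principal.\<close>

lemma zero_sum_family:
  assumes S: "S \<in> carrier Z"
  defines "c \<equiv> shape_family (\<lambda>_. \<one>) (count S)"
  shows "c \<in> integral" "cls c = \<one>\<^bsub>C\<^esub>" "\<And>p. p \<in> E \<Longrightarrow> c p = \<one>" "\<And>g. g \<in> G0 \<Longrightarrow> deg g c = int (count S g)"
proof -
  have one: "p \<in> E \<Longrightarrow> \<one> \<in> D p" for p using D_one[OF E_X'] .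
  show c: "c \<in> integral" "\<And>g. g \<in> G0 \<Longrightarrow> deg g c = int (count S g)"
    using shape_family[where e = "\<lambda>_. \<one>" and n = "count S", OF one] by (simp_all add: c_def)
  show e: "\<And>p. p \<in> E \<Longrightarrow> c p = \<one>" by (simp add: c_def shape_family_def)
  have S': "set_mset S \<subseteq> G0" "mset_product C S = \<one>\<^bsub>C\<^esub>" using S by (auto simp: zero_sum_monoid_simps)
  have "cls c = mset_product C S"
    by (rule cls_eq_mset_product[OF integral_families[OF c(1)] _ S'(1) c(2)]) (use e U_one[OF E_X'] in simp)
  then show "cls c = \<one>\<^bsub>C\<^esub>" using S'(2) by simp
qed

lemma zero_sum_shape_exists:
  assumes "S \<in> carrier Z"
  shows "\<exists>b\<in>H. zero_sum_shape S b"
proof -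
  note c = zero_sum_family[OF assms]
  obtain b where b: "b \<in> H" "\<forall>p\<in>X. inv (shape_family (\<lambda>_. \<one>) (count S) p) \<otimes> b \<in> U p"
    "\<forall>g. deg g (\<lambda>_. b) = deg g (shape_family (\<lambda>_. \<one>) (count S))" using realize[OF c(1,2)] by blast
  have "b \<in> U p" if "p \<in> E" for p
    using b(2)[rule_format, OF E_X'[OF that]] c(3)[OF that] H_carrier[OF b(1)] by simp
  then have "zero_sum_shape S b" using b(3) c(4) by (simp add: zero_sum_shape_def)
  then show ?thesis using b(1) by blast
qed

lemma length_set_zero_sum:
  assumes S: "S \<in> carrier Z" and b: "b \<in> H" "zero_sum_shape S b"
  shows "length_set Z S = length_set (submon Q H) b"
proof (rule length_set_transfer[where R = zero_sum_shape, OF C.comm_monoid_cancel_zero_sum[OF finite_G0 G0_carrier] HM b(2) S])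
  show "b \<in> carrier (submon Q H)" using b by simp
next
  fix S b assume h: "zero_sum_shape S b" "S \<in> carrier Z" "b \<in> carrier (submon Q H)"
  have "{#} \<in> carrier Z" by (simp add: zero_sum_monoid_simps mset_product_def)
  then have "S \<in> Units Z \<longleftrightarrow> S = {#}" using Units_zero_sum by blast
  also have "\<dots> \<longleftrightarrow> (\<forall>g\<in>G0. count S g = 0)"
    using h(2) by (auto simp: zero_sum_monoid_simps intro: multiset_eqI) (metis count_eq_zero_iff empty_iff multiset_nonemptyE subsetD)
  also have "\<dots> \<longleftrightarrow> b \<in> Units (submon Q H)"
    using h unit_iff_shape[of b] by (auto simp: zero_sum_shape_def Units_submon[OF submonoid_H])
  finally show "S \<in> Units Z \<longleftrightarrow> b \<in> Units (submon Q H)" .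
next
  fix S b b1 b2 assume h: "zero_sum_shape S b" "S \<in> carrier Z" "b1 \<in> carrier (submon Q H)"
    "b2 \<in> carrier (submon Q H)" "b = b1 \<otimes>\<^bsub>submon Q H\<^esub> b2"
  then have m: "b1 \<in> H" "b2 \<in> H" "b = b1 \<otimes> b2" by auto
  define T where "T = (\<lambda>c. \<Sum>g\<in>G0. replicate_mset (nat (deg g (\<lambda>_. c))) g)"
  have cT: "count (T c) g = (if g \<in> G0 then nat (deg g (\<lambda>_. c)) else 0)" for c g
    using finite_G0 by (simp add: T_def count_sum)
  have sT: "set_mset (T c) \<subseteq> G0" for c using cT[of c] by (metis count_eq_zero_iff subsetI)
  have U: "b1 \<in> U p" "b2 \<in> U p" if p: "p \<in> E" for p
    using U_factor[OF E_X'[OF p] H_D[OF E_X'[OF p] m(1)] H_D[OF E_X'[OF p] m(2)]] h(1) m(3) p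
    by (auto simp: zero_sum_shape_def)
  have sh: "zero_sum_shape (T c) c" if "c \<in> H" "\<And>p. p \<in> E \<Longrightarrow> c \<in> U p" for c
    using that cT deg_const_nonneg by (simp add: zero_sum_shape_def)
  have car: "T c \<in> carrier Z" if c: "c \<in> H" "\<And>p. p \<in> E \<Longrightarrow> c \<in> U p" for c
  proof -
    have "cls (\<lambda>_. c) = mset_product C (T c)"
      by (rule cls_eq_mset_product[OF integral_families[OF const_integral[OF c(1)]] c(2) sT])
        (use cT deg_const_nonneg[OF c(1)] in simp_all)
    then show ?thesis using cls_const[OF H_carrier[OF c(1)]] sT by (simp add: zero_sum_monoid_simps)
  qed
  have "S = T b1 + T b2"
  proof (rule multiset_eqI)
    fix g
    show "count S g = count (T b1 + T b2) g"
    proof (cases "g \<in> G0")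
      case True
      then have "int (count S g) = deg g (\<lambda>_. b1) + deg g (\<lambda>_. b2)"
        using h(1) m(3) deg_const_mult[OF m(1,2)] by (simp add: zero_sum_shape_def)
      then show ?thesis using True cT deg_const_nonneg[OF m(1), of g] deg_const_nonneg[OF m(2), of g] by simp
    next
      case False
      then have "count S g = 0" using h(2) by (auto simp: zero_sum_monoid_simps count_eq_zero_iff)
      then show ?thesis using False cT by simp
    qed
  qed
  then show "\<exists>S1\<in>carrier Z. \<exists>S2\<in>carrier Z. S = S1 \<otimes>\<^bsub>Z\<^esub> S2 \<and> zero_sum_shape S1 b1 \<and> zero_sum_shape S2 b2"
    using car sh m U unfolding zero_sum_monoid_simps(2) by blast
next
  fix S b S1 S2 assume h: "zero_sum_shape S b" "b \<in> carrier (submon Q H)" "S1 \<in> carrier Z"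
    "S2 \<in> carrier Z" "S = S1 \<otimes>\<^bsub>Z\<^esub> S2"
  have bH: "b \<in> H" using h(2) by simp
  note c = zero_sum_family[OF h(3)]
  let ?c = "shape_family (\<lambda>_. \<one>) (count S1)"
  have dg: "deg g (\<lambda>_. b) = int (count S1 g) + int (count S2 g)" if "g \<in> G0" for g
    using h(1,5) that by (simp add: zero_sum_shape_def zero_sum_monoid_simps(2))
  have "\<exists>b1\<in>H. \<exists>b2\<in>H. b = b1 \<otimes> b2 \<and> (\<forall>p\<in>E. inv (?c p) \<otimes> b1 \<in> U p) \<and> (\<forall>g\<in>G0. deg g (\<lambda>_. b1) = deg g ?c)"
  proof (rule split_by_shape[OF finite_G0 bH c(1,2)])
    show "inv (?c p) \<otimes> b \<in> D p" if "p \<in> E" for p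
      using c(3)[OF that] H_carrier[OF bH] H_D[OF E_X'[OF that] bH] by simp
    show "deg g ?c \<le> deg g (\<lambda>_. b)" if "g \<in> G0" for g using dg[OF that] c(4)[OF that] by simp
  qed
  then obtain b1 b2 where b: "b1 \<in> H" "b2 \<in> H" "b = b1 \<otimes> b2" "\<forall>p\<in>E. inv (?c p) \<otimes> b1 \<in> U p"
    "\<forall>g\<in>G0. deg g (\<lambda>_. b1) = deg g ?c" by blast
  have U: "b1 \<in> U p" "b2 \<in> U p" if p: "p \<in> E" for p
    using U_factor[OF E_X'[OF p] H_D[OF E_X'[OF p] b(1)] H_D[OF E_X'[OF p] b(2)]] h(1) b(3) p
    by (auto simp: zero_sum_shape_def)
  have "zero_sum_shape S1 b1" using U b(5) c(4) by (simp add: zero_sum_shape_def)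
  moreover have "zero_sum_shape S2 b2"
    using U b(5) c(4) dg deg_const_mult[OF b(1,2)] b(3) by (simp add: zero_sum_shape_def)
  ultimately show "\<exists>b1\<in>carrier (submon Q H). \<exists>b2\<in>carrier (submon Q H).
      b = b1 \<otimes>\<^bsub>submon Q H\<^esub> b2 \<and> zero_sum_shape S1 b1 \<and> zero_sum_shape S2 b2" using b by auto
qed

theorem Delta_rho_zero_sum_subset:
  assumes "elasticity (submon Q H) = elasticity Z"
  shows "Delta_rho Z \<subseteq> Delta_rho (submon Q H)"
proof -
  have "L \<in> system_of_length_sets (submon Q H)" if L: "L \<in> system_of_length_sets Z" for L
  proof -
    obtain S where S: "S \<in> carrier Z" "L = length_set Z S" using L by (auto simp: system_of_length_sets_def)
    obtain b where "b \<in> H" "zero_sum_shape S b" using zero_sum_shape_exists[OF S(1)] by blast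
    then show ?thesis using length_set_zero_sum[OF S(1)] S(2) by (auto simp: system_of_length_sets_def)
  qed
  then show ?thesis unfolding Delta_rho_def assms by blast
qed

end

theorem theorem4p4:
  fixes Q :: "('a, 'b) monoid_scheme" and H :: "'a set"
  assumes "is_quotient_group Q H"
    and "v_noetherian Q H"
    and "weakly_Krull Q H"
    and "conductor Q H \<noteq> {}" and "conductor Q H \<subset> H"
    and "\<forall>p \<in> minimal_primes Q H. finitely_primary Q (loc Q H p)"
  shows
    "(elasticity (v_invertible_ideals Q H) < \<infinity> \<longleftrightarrow>
        bij_betw (\<lambda>P. P \<inter> H)
          (minimal_primes Q (complete_integral_closure Q H)) (minimal_primes Q H))
     \<and>
     (bij_betw (\<lambda>P. P \<inter> H)
          (minimal_primes Q (complete_integral_closure Q H)) (minimal_primes Q H)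
        \<and> (\<forall>p \<in> conductor_primes Q H. torsion_group (unit_quotient Q (loc_cic Q H p) (loc Q H p)))
        \<longrightarrow> accepted_elasticity (v_invertible_ideals Q H))
     \<and>
     (accepted_elasticity (v_invertible_ideals Q H) \<longrightarrow>
        {Gcd ((\<lambda>p. min_distance (submon Q (loc Q H p))) ` I) | I.
            I \<noteq> {} \<and> I \<subseteq> extremal_primes Q H}
          = Delta_rho_star (v_invertible_ideals Q H)
        \<and> Delta_rho_star (v_invertible_ideals Q H) \<subseteq> Delta_rho (v_invertible_ideals Q H)
        \<and> Delta_rho (v_invertible_ideals Q H)
          \<subseteq> {d. d > 0 \<and> (\<exists>d' \<in> Delta_rho_star (v_invertible_ideals Q H). d dvd d')})
     \<and>
     (bij_betw (\<lambda>P. P \<inter> H)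
          (minimal_primes Q (complete_integral_closure Q H)) (minimal_primes Q H)
        \<and> finite (carrier (v_class_group Q H))
        \<and> finite (carrier (unit_quotient Q (complete_integral_closure Q H) H))
        \<longrightarrow> accepted_elasticity (submon Q H)
          \<and> (elasticity (submon Q H)
                = elasticity (zero_sum_monoid (v_class_group Q H) (regular_prime_classes Q H))
              \<longrightarrow> Delta_rho (zero_sum_monoid (v_class_group Q H) (regular_prime_classes Q H))
                  \<subseteq> Delta_rho (submon Q H)))"
proof -
  have "comm_group Q" using assms(1) by (simp add: is_quotient_group_def)
  then have wm: "weakly_Krull_monoid Q H"
    using assms(1,3,6) by (intro weakly_Krull_monoid.intro weakly_Krull_monoid_axioms.intro) auto
  obtain P v \<alpha> where fam: "weakly_Krull_family Q H (minimal_primes Q H) (loc Q H) P v \<alpha>"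
    using weakly_Krull_monoid.exists_valuations[OF wm] by blast
  have wv: "weakly_Krull_valuations Q H P v \<alpha>"
    using wm fam assms(4,5) by (intro weakly_Krull_valuations.intro weakly_Krull_valuations_axioms.intro)
  interpret V: weakly_Krull_valuations Q H P v \<alpha> by (rule wv)
  let ?M = "v_invertible_ideals Q H"
  let ?bij = "bij_betw (\<lambda>P. P \<inter> H) (minimal_primes Q (complete_integral_closure Q H)) (minimal_primes Q H)"
  have rank: "?bij \<longleftrightarrow> (\<forall>p\<in>minimal_primes Q H. \<exists>r. P p = {r})" by (rule V.contraction_bij_iff_rank_one)
  have 1: "elasticity ?M < \<infinity> \<longleftrightarrow> ?bij" unfolding rank by (rule V.finite_elasticity_M_iff)
  have 2: "accepted_elasticity ?M"
    if b: ?bij and t: "\<forall>p \<in> conductor_primes Q H. torsion_group (unit_quotient Q (loc_cic Q H p) (loc Q H p))"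
  proof (rule V.accepted_elasticity_M)
    fix p assume p: "p \<in> conductor_primes Q H"
    show "accepted_elasticity (submon Q (loc Q H p))"
      by (rule V.torsion_accepted_local[OF _ p]) (use b t p rank in auto)
  qed
  have 3: "{Gcd ((\<lambda>p. min_distance (submon Q (loc Q H p))) ` I) | I. I \<noteq> {} \<and> I \<subseteq> extremal_primes Q H}
          = Delta_rho_star ?M \<and> Delta_rho_star ?M \<subseteq> Delta_rho ?M
        \<and> Delta_rho ?M \<subseteq> {d. d > 0 \<and> (\<exists>d' \<in> Delta_rho_star ?M. d dvd d')}"
    if acc: "accepted_elasticity ?M"
  proof (rule comm_monoid_cancel.accepted_elasticity_obtains[OF V.MM acc])
    fix \<rho> assume \<rho>: "1 \<le> \<rho>" "elasticity ?M = ennreal \<rho>"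
      "\<And>I. I \<in> carrier ?M \<Longrightarrow> ratio_bounded \<rho> (length_set ?M I)"
    have "Delta_rho ?M \<subseteq> {d. d > 0 \<and> (\<exists>d' \<in> Delta_rho_star ?M. d dvd d')}"
    proof
      fix d assume d: "d \<in> Delta_rho ?M"
      then have "0 < d" by (simp add: Delta_rho_def)
      then show "d \<in> {d. d > 0 \<and> (\<exists>d' \<in> Delta_rho_star ?M. d dvd d')}"
        using V.Delta_rho_M_divides[OF \<rho> d] by blast
    qed
    then show ?thesis
      using V.Delta_rho_star_M[OF \<rho>] V.Delta_rho_star_subset_Delta_rho[OF \<rho>]
      unfolding V.extremal_primes_eq by blast
  qed
  have 4: "accepted_elasticity (submon Q H)
      \<and> (elasticity (submon Q H) = elasticity (zero_sum_monoid (v_class_group Q H) (regular_prime_classes Q H))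
        \<longrightarrow> Delta_rho (zero_sum_monoid (v_class_group Q H) (regular_prime_classes Q H)) \<subseteq> Delta_rho (submon Q H))"
    if b: ?bij and fc: "finite (carrier (v_class_group Q H))"
      and fu: "finite (carrier (unit_quotient Q (complete_integral_closure Q H) H))"
  proof -
    have "\<forall>p\<in>minimal_primes Q H. \<exists>r. P p = {r}" using b rank by blast
    from bchoice[OF this] obtain \<pi> where \<pi>: "\<forall>p\<in>minimal_primes Q H. P p = {\<pi> p}" by blast
    have "rank_one_weakly_Krull Q H P v \<alpha> \<pi>"
      by (intro rank_one_weakly_Krull.intro rank_one_weakly_Krull_axioms.intro wv) (use \<pi> in blast)
    then have "finite_class_group Q H P v \<alpha> \<pi>"
      by (intro finite_class_group.intro finite_class_group_axioms.intro fc fu)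
    then interpret F: finite_class_group Q H P v \<alpha> \<pi> .
    show ?thesis using F.accepted_elasticity_H F.Delta_rho_zero_sum_subset unfolding F.G0_def by blast
  qed
  show ?thesis using 1 2 3 4 by blast
qed

end
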